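(* Let $P\subseteq\mathbb{R}^d$ be a full-dimensional rational convex polytope. Let $X_P$ denote the associated normal projective toric variety and $D_P$ the associated torus invariant $\mathbb{Q}$-Weil divisor. Then $$\#(nP\cap\mathbb{Z}^d)=\chi\bigl(X_P,\mathcal{O}_{X_P}(\lfloor nD_P\rfloor)\bigr)$$ and $$\#(\operatorname{int}(nP)\cap\mathbb{Z}^d)=\chi\bigl(X_P,\mathcal{O}_{X_P}(\lceil nD_P\rceil+K_{X_P})\bigr)$$ for all $n\in\mathbb{N}$.
   Context: $\mathbb{N}$ denotes the positive integers; varieties are over $\mathbb{C}$; $\operatorname{int}$ denotes the interior in $\mathbb{R}^d$; $\chi$ is the Euler characteristic of coherent sheaf cohomology. A rational convex polytope is the convex hull of finitely many points of $\mathbb{Q}^d$. Let $\Sigma_P$ be the (outer) normal fan of $P$, $\Sigma_P(1)$ its set of rays, $u_\rho\in\mathbb{Z}^d$ the primitive generator of the ray $\rho$, and $b_\rho=\max_{x\in P}\langle x,u_\rho\rangle\in\mathbb{Q}$, so that $P=\{x\in\mathbb{R}^d\mid\langle x,u_\rho\rangle\le b_\rho\ \forall\rho\in\Sigma_P(1)\}$. $X_P$ is the normal projective toric variety of the fan $\Sigma_P$, $D_\rho$ is the torus invariant prime divisor of the ray $\rho$, and $D_P=\sum_\rho b_\rho D_\rho$. The canonical divisor is $K_{X_P}=-\sum_\rho D_\rho$ up to linear equivalence. For a $\mathbb{Q}$-Weil divisor $D=\sum_\rho a_\rho D_\rho$ put $\lfloor D\rfloor=\sum_\rho\lfloor a_\rho\rfloor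 D_\rho$ and $\lceil D\rceil=\sum_\rho\lceil a_\rho\rceil D_\rho$. For a Weil divisor $D$, $\mathcal{O}_{X_P}(D)$ is the associated divisorial (rank one reflexive) sheaf. *)

theory Defs
  imports
    "HOL-Analysis.Analysis"
    "HOL-Library.Poly_Mapping"
    "HOL-Library.Function_Algebras"
    "HOL-Computational_Algebra.Fraction_Field"
    "HOL-Algebra.Ideal"
begin

section \<open>The character lattice and the function field of the torus\<close>

text \<open>
  A copy \<open>M\<close> of \<open>\<int>\<^sup>d\<close>. The only reason for introducing a new type is that the library
  proves the group algebra of \<open>M\<close> (finitely supported functions with the convolution product)
  to be an integral domain only when \<open>M\<close> is a linearly ordered group, whereas the order on
  \<^typ>\<open>int ^ 'd\<close> is the componentwise one. The order chosen here (pulled back from the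
  lexicographic order on finitely supported integer sequences) plays no role in any definition.
\<close>

typedef (overloaded) 'd character = "UNIV :: (int ^ 'd) set"
  morphisms exponent Character by simp

setup_lifting type_definition_character

instantiation character :: (finite) ab_group_add
begin
lift_definition zero_character :: "'a character" is 0 .
lift_definition plus_character :: "'a character \<Rightarrow> 'a character \<Rightarrow> 'a character" is "(+)" .
lift_definition minus_character :: "'a character \<Rightarrow> 'a character \<Rightarrow> 'a character" is "(-)" .
lift_definition uminus_character :: "'a character \<Rightarrow> 'a character" is uminus .
instance by (standard; transfer; simp)
end

definition character_sequence :: "'d::finite character \<Rightarrow> (nat \<Rightarrow>\<^sub>0 int)" where
  "character_sequence m =
     (\<Sum>i\<in>UNIV. Poly_Mapping.single (to_nat_on (UNIV :: 'd set) i) (exponent m $ i))"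

lemma character_sequence_add:
  "character_sequence (m + n) = character_sequence m + character_sequence n"
  by (simp add: character_sequence_def plus_character.rep_eq single_add sum.distrib)

lemma lookup_character_sequence:
  "Poly_Mapping.lookup (character_sequence m) (to_nat_on (UNIV :: 'd::finite set) j) = exponent m $ (j :: 'd)"
proof -
  have "inj_on (to_nat_on (UNIV :: 'd set)) UNIV"
    by (simp add: countable_finite inj_on_to_nat_on)
  then have eq: "to_nat_on (UNIV :: 'd set) i = to_nat_on UNIV j \<longleftrightarrow> i = j" for i
    by (auto dest: injD)
  show ?thesis
    by (simp add: character_sequence_def lookup_sum lookup_single eq when_def)
qed

lemma character_sequence_inject:
  "character_sequence m = character_sequence n \<longleftrightarrow> m = n"
  by (metis exponent_inject lookup_character_sequence vec_eq_iff)

instantiation character :: (finite) linordered_ab_group_add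
begin
definition less_eq_character :: "'a character \<Rightarrow> 'a character \<Rightarrow> bool" where
  "m \<le> n \<longleftrightarrow> character_sequence m \<le> character_sequence n"
definition less_character :: "'a character \<Rightarrow> 'a character \<Rightarrow> bool" where
  "m < n \<longleftrightarrow> character_sequence m < character_sequence n"
instance
proof
  fix a b c :: "'a character"
  show "a < b \<longleftrightarrow> a \<le> b \<and> \<not> b \<le> a"
    by (auto simp: less_eq_character_def less_character_def)
  show "a \<le> a"
    by (simp add: less_eq_character_def)
  show "a \<le> c" if "a \<le> b" "b \<le> c"
    using that by (auto simp: less_eq_character_def)
  show "a = b" if "a \<le> b" "b \<le> a"
    using that by (auto simp: less_eq_character_def simp flip: character_sequence_inject)
  show "c + a \<le> c + b" if "a \<le> b"
    using that by (auto simp: less_eq_character_def character_sequence_add)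
  show "a \<le> b \<or> b \<le> a"
    by (auto simp: less_eq_character_def)
qed
end

type_synonym 'd laurent = "'d character \<Rightarrow>\<^sub>0 complex"
type_synonym 'd ratfun = "'d laurent fract"

definition embed_laurent :: "'d::finite laurent \<Rightarrow> 'd ratfun" where
  "embed_laurent f = Fraction_Field.Fract f 1"

definition scale_ratfun :: "complex \<Rightarrow> 'd::finite ratfun \<Rightarrow> 'd ratfun" where
  "scale_ratfun c f = embed_laurent (Poly_Mapping.single 0 c) * f"


section \<open>Local rings in a field\<close>

text \<open>Subrings of a field, given by their carrier sets, as rings in the sense of HOL-Algebra.\<close>

definition ring_on :: "'k::field set \<Rightarrow> 'k ring" where
  "ring_on A = \<lparr>carrier = A, monoid.mult = (*), one = 1, ring.zero = 0, add = (+)\<rparr>"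

definition spec :: "'k::field set \<Rightarrow> 'k set set" where
  "spec A = {p. primeideal p (ring_on A)}"

definition localization :: "'k::field set \<Rightarrow> 'k set \<Rightarrow> 'k set" where
  "localization A p = {a / s |a s. a \<in> A \<and> s \<in> A - p}"

definition krull_dim_one :: "'k::field set \<Rightarrow> bool" where
  "krull_dim_one R \<longleftrightarrow>
     (\<exists>p\<in>spec R. \<exists>q\<in>spec R. p \<subset> q) \<and>
     \<not> (\<exists>p\<in>spec R. \<exists>q\<in>spec R. \<exists>r\<in>spec R. p \<subset> q \<and> q \<subset> r)"

definition units_on :: "'k::field set \<Rightarrow> 'k set" where
  "units_on R = {u \<in> R. u \<noteq> 0 \<and> inverse u \<in> R}"

text \<open>
  The valuation of a discrete valuation ring \<open>R\<close> with quotient field \<^typ>\<open>'k\<close>: here \<open>t\<close> is a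
  uniformizer, i.e. a generator of the maximal ideal \<open>R - R\<^sup>\<times>\<close>. To be used for \<open>f \<noteq> 0\<close> only.
\<close>

definition valuation :: "'k::field set \<Rightarrow> 'k \<Rightarrow> int" where
  "valuation R f =
     (THE k. \<exists>t u. R - units_on R = {t * r |r. r \<in> R} \<and> u \<in> units_on R \<and> f = u * t powi k)"


section \<open>The toric variety of a fan\<close>

definition real_vec :: "int ^ 'd \<Rightarrow> real ^ 'd" where
  "real_vec m = (\<chi> i. real_of_int (m $ i))"

definition integer_lattice :: "(real ^ 'd) set" where
  "integer_lattice = range real_vec"

definition pairing :: "'d::finite character \<Rightarrow> real ^ 'd \<Rightarrow> real" where
  "pairing m u = real_vec (exponent m) \<bullet> u"

text \<open>The coordinate ring \<open>\<complex>[\<sigma>\<^sup>\<or> \<inter> M]\<close> of the affine toric variety \<open>U\<^sub>\<sigma>\<close>, inside the function field.\<close>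

definition affine_ring :: "(real ^ 'd::finite) set \<Rightarrow> 'd ratfun set" where
  "affine_ring \<sigma> = embed_laurent ` {f. \<forall>m\<in>Poly_Mapping.keys f. \<forall>u\<in>\<sigma>. 0 \<le> pairing m u}"

text \<open>
  The toric variety \<open>X\<^sub>\<Sigma>\<close> is an integral separated scheme with function field \<^typ>\<open>'d ratfun\<close>, so
  that a point is determined by its local ring, viewed as a subring of the function field.
  We take these local rings as the points. This performs the gluing of the affine schemes
  \<open>U\<^sub>\<sigma> = Spec \<complex>[\<sigma>\<^sup>\<or> \<inter> M]\<close>: by separatedness, a point of \<open>U\<^sub>\<sigma>\<close> and a point of \<open>U\<^sub>\<tau>\<close> have the same
  local ring if and only if they come from the same point of \<open>U\<^bsub>\<sigma> \<inter> \<tau>\<^esub>\<close>. The sets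
  \<open>basic_open \<sigma> f\<close> are the principal open subsets of \<open>U\<^sub>\<sigma>\<close>; together they form a basis
  of the Zariski topology of \<open>X\<^sub>\<Sigma>\<close>.
\<close>

definition basic_open :: "(real ^ 'd::finite) set \<Rightarrow> 'd ratfun \<Rightarrow> 'd ratfun set set" where
  "basic_open \<sigma> f = {localization (affine_ring \<sigma>) p |p. p \<in> spec (affine_ring \<sigma>) \<and> f \<notin> p}"

definition toric_variety :: "(real ^ 'd::finite) set set \<Rightarrow> 'd ratfun set topology" where
  "toric_variety \<Sigma> = topology_generated_by {basic_open \<sigma> f |\<sigma> f. \<sigma> \<in> \<Sigma> \<and> f \<in> affine_ring \<sigma>}"

text \<open>A prime divisor is identified with its generic point, a point of codimension one.\<close>

definition prime_divisors :: "(real ^ 'd::finite) set set \<Rightarrow> 'd ratfun set set" where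
  "prime_divisors \<Sigma> = {R \<in> topspace (toric_variety \<Sigma>). krull_dim_one R}"

definition rays :: "(real ^ 'd::finite) set set \<Rightarrow> (real ^ 'd) set set" where
  "rays \<Sigma> = {\<rho> \<in> \<Sigma>. dim \<rho> = 1}"

definition primitive_generator :: "(real ^ 'd::finite) set \<Rightarrow> int ^ 'd" where
  "primitive_generator \<rho> =
     (THE u. Gcd (range (\<lambda>i. u $ i)) = 1 \<and> \<rho> = {t *\<^sub>R real_vec u |t. 0 \<le> t})"

text \<open>
  The divisor \<open>D\<^sub>\<rho>\<close> is the closure of the torus orbit \<open>O(\<rho>)\<close>, which is the closed subscheme of
  \<open>U\<^sub>\<rho>\<close> defined by the kernel of \<open>\<complex>[\<rho>\<^sup>\<or> \<inter> M] \<rightarrow> \<complex>[\<rho>\<^sup>\<bottom> \<inter> M]\<close>; the latter map sends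
  the characters outside \<open>\<rho>\<^sup>\<bottom>\<close> to zero.
\<close>

definition orbit_ideal :: "(real ^ 'd::finite) set \<Rightarrow> 'd ratfun set" where
  "orbit_ideal \<rho> = embed_laurent `
     {f. \<forall>m\<in>Poly_Mapping.keys f. (\<forall>u\<in>\<rho>. 0 \<le> pairing m u) \<and> (\<exists>u\<in>\<rho>. pairing m u \<noteq> 0)}"

definition ray_divisor :: "(real ^ 'd::finite) set \<Rightarrow> 'd ratfun set" where
  "ray_divisor \<rho> = localization (affine_ring \<rho>) (orbit_ideal \<rho>)"

text \<open>
  Weil divisors and \<open>\<rat>\<close>-Weil divisors are represented by their coefficient functions;
  only the values at prime divisors matter.
\<close>

definition toric_divisor ::
    "(real ^ 'd::finite) set set \<Rightarrow> ((real ^ 'd) set \<Rightarrow> 'a::comm_ring_1) \<Rightarrow> 'd ratfun set \<Rightarrow> 'a" where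
  "toric_divisor \<Sigma> a = (\<lambda>Z. \<Sum>\<rho>\<in>rays \<Sigma>. a \<rho> * of_bool (Z = ray_divisor \<rho>))"

definition linearly_equivalent ::
    "(real ^ 'd::finite) set set \<Rightarrow> ('d ratfun set \<Rightarrow> int) \<Rightarrow> ('d ratfun set \<Rightarrow> int) \<Rightarrow> bool" where
  "linearly_equivalent \<Sigma> D E \<longleftrightarrow>
     (\<exists>g. g \<noteq> 0 \<and> (\<forall>Z\<in>prime_divisors \<Sigma>. D Z = E Z + valuation Z g))"

definition canonical_divisor ::
    "(real ^ 'd::finite) set set \<Rightarrow> ('d ratfun set \<Rightarrow> int) \<Rightarrow> bool" where
  "canonical_divisor \<Sigma> K \<longleftrightarrow> linearly_equivalent \<Sigma> K (toric_divisor \<Sigma> (\<lambda>\<rho>. - 1))"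

text \<open>
  The sections over \<open>U\<close> of \<open>\<O>(D)\<close>, that is, zero and the rational functions \<open>f\<close> such that
  \<open>div f + D\<close> is effective on \<open>U\<close>. All restriction maps between nonempty open sets are
  inclusions.
\<close>

definition divisorial_sheaf ::
    "(real ^ 'd::finite) set set \<Rightarrow> ('d ratfun set \<Rightarrow> int) \<Rightarrow> 'd ratfun set set \<Rightarrow> 'd ratfun set" where
  "divisorial_sheaf \<Sigma> D U =
     {f. f = 0 \<or> U \<noteq> {} \<and> (\<forall>Z\<in>prime_divisors \<Sigma> \<inter> U. 0 \<le> valuation Z f + D Z)}"


section \<open>Cohomology and the Euler characteristic\<close>

text \<open>
  Cohomology in the sense of Serre, i.e. the direct limit of the Cech cohomology groups over all
  open coverings. As usual (Godement) it suffices to use coverings \<open>(V\<^sub>x)\<close> indexed by the points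
  with \<open>x \<in> V\<^sub>x\<close>, refinement being pointwise inclusion. Let \<open>F\<close> be a subsheaf of a constant sheaf
  on an irreducible space. Then all restriction maps between nonempty open sets are inclusions,
  and so are the refinement maps on cochains. The direct limit of the Cech complexes is therefore
  a union: a \<open>q\<close>-cochain of the limit is a family indexed by \<open>(q + 1)\<close>-tuples of points that
  is a cochain for some covering. Since direct limits are exact, the cohomology of this complex
  is the limit of the Cech cohomology groups. Outside the tuples of the right length, cochains
  are normalized to be zero.
\<close>

definition cech_cochains ::
    "'p topology \<Rightarrow> ('p set \<Rightarrow> 'k::field set) \<Rightarrow> nat \<Rightarrow> ('p list \<Rightarrow> 'k) set" where
  "cech_cochains X F q = {c.
     (\<forall>xs. \<not> (length xs = Suc q \<and> set xs \<subseteq> topspace X) \<longrightarrow> c xs = 0) \<and>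
     (\<exists>V. (\<forall>x\<in>topspace X. openin X (V x) \<and> x \<in> V x) \<and>
          (\<forall>xs. length xs = Suc q \<and> set xs \<subseteq> topspace X \<longrightarrow> c xs \<in> F (\<Inter>x\<in>set xs. V x)))}"

definition cech_differential ::
    "'p topology \<Rightarrow> nat \<Rightarrow> ('p list \<Rightarrow> 'k::field) \<Rightarrow> 'p list \<Rightarrow> 'k" where
  "cech_differential X q c = (\<lambda>xs.
     if length xs = Suc (Suc q) \<and> set xs \<subseteq> topspace X
     then \<Sum>j\<le>Suc q. (- 1) ^ j * c (take j xs @ drop (Suc j) xs) else 0)"

definition cech_cocycles ::
    "'p topology \<Rightarrow> ('p set \<Rightarrow> 'k::field set) \<Rightarrow> nat \<Rightarrow> ('p list \<Rightarrow> 'k) set" where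
  "cech_cocycles X F q = {c \<in> cech_cochains X F q. cech_differential X q c = 0}"

definition cech_coboundaries ::
    "'p topology \<Rightarrow> ('p set \<Rightarrow> 'k::field set) \<Rightarrow> nat \<Rightarrow> ('p list \<Rightarrow> 'k) set" where
  "cech_coboundaries X F q =
     (case q of 0 \<Rightarrow> {0} | Suc r \<Rightarrow> cech_differential X r ` cech_cochains X F r)"

text \<open>
  The dimension of the quotient space \<open>Z / B\<close>, as the number of elements of a set of
  representatives of a basis (zero if the quotient is infinite-dimensional).
\<close>

definition basis_modulo ::
    "('c::field \<Rightarrow> 'v::ab_group_add \<Rightarrow> 'v) \<Rightarrow> 'v set \<Rightarrow> 'v set \<Rightarrow> 'v set \<Rightarrow> bool" where
  "basis_modulo smul B Z S \<longleftrightarrow>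
     S \<subseteq> Z \<and> module.span smul (B \<union> S) = Z \<and>
     (\<forall>s\<in>S. s \<notin> module.span smul (B \<union> (S - {s})))"

definition quotient_dim ::
    "('c::field \<Rightarrow> 'v::ab_group_add \<Rightarrow> 'v) \<Rightarrow> 'v set \<Rightarrow> 'v set \<Rightarrow> nat" where
  "quotient_dim smul Z B = card (SOME S. basis_modulo smul B Z S)"

definition cohomology_dim ::
    "('c::field \<Rightarrow> 'k::field \<Rightarrow> 'k) \<Rightarrow> 'p topology \<Rightarrow> ('p set \<Rightarrow> 'k set) \<Rightarrow> nat \<Rightarrow> nat" where
  "cohomology_dim smul X F q =
     quotient_dim (\<lambda>a c xs. smul a (c xs)) (cech_cocycles X F q) (cech_coboundaries X F q)"

definition euler_characteristic ::
    "('c::field \<Rightarrow> 'k::field \<Rightarrow> 'k) \<Rightarrow> 'p topology \<Rightarrow> ('p set \<Rightarrow> 'k set) \<Rightarrow> int" where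
  "euler_characteristic smul X F =
     (\<Sum>q | cohomology_dim smul X F q \<noteq> 0. (- 1) ^ q * int (cohomology_dim smul X F q))"

lemma embed_laurent_add: "embed_laurent (f + g) = embed_laurent f + embed_laurent g"
  by (simp add: embed_laurent_def)

lemma embed_laurent_mult: "embed_laurent (f * g) = embed_laurent f * embed_laurent g"
  by (simp add: embed_laurent_def)

lemma embed_laurent_one: "embed_laurent 1 = 1"
  by (simp add: embed_laurent_def One_fract_def)

lemma vector_space_scale_ratfun:
  "vector_space (scale_ratfun :: complex \<Rightarrow> 'd::finite ratfun \<Rightarrow> 'd ratfun)"
proof
  fix a b :: complex and x y :: "'d ratfun"
  show "scale_ratfun a (x + y) = scale_ratfun a x + scale_ratfun a y"
    by (simp add: scale_ratfun_def distrib_left)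
  show "scale_ratfun (a + b) x = scale_ratfun a x + scale_ratfun b x"
    by (simp add: scale_ratfun_def single_add embed_laurent_add distrib_right)
  show "scale_ratfun a (scale_ratfun b x) = scale_ratfun (a * b) x"
    by (simp add: scale_ratfun_def mult.assoc flip: embed_laurent_mult)
      (simp add: embed_laurent_mult mult_single flip: mult.assoc)
  show "scale_ratfun 1 x = x"
    by (simp add: scale_ratfun_def embed_laurent_one)
qed

lemma vector_space_scale_cochains:
  "vector_space (\<lambda>a (c :: 'p list \<Rightarrow> 'd::finite ratfun) xs. scale_ratfun a (c xs))"
proof -
  interpret vector_space "scale_ratfun :: complex \<Rightarrow> 'd ratfun \<Rightarrow> 'd ratfun"
    by (rule vector_space_scale_ratfun)
  show ?thesis
    by standard (simp_all add: fun_eq_iff scale_right_distrib scale_left_distrib)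
qed


section \<open>Rational polytopes\<close>

definition rational_polytope :: "(real ^ 'd::finite) set \<Rightarrow> bool" where
  "rational_polytope P \<longleftrightarrow>
     (\<exists>V. finite V \<and> (\<forall>v\<in>V. \<forall>i. v $ i \<in> \<rat>) \<and> P = convex hull V)"

text \<open>
  The outer normal cone of a face \<open>F\<close> consists of the functionals that attain their maximum over
  \<open>P\<close> at all points of \<open>F\<close>.
\<close>

definition normal_cone :: "(real ^ 'd::finite) set \<Rightarrow> (real ^ 'd) set \<Rightarrow> (real ^ 'd) set" where
  "normal_cone P F = {u. \<forall>x\<in>F. \<forall>y\<in>P. y \<bullet> u \<le> x \<bullet> u}"

definition normal_fan :: "(real ^ 'd::finite) set \<Rightarrow> (real ^ 'd) set set" where
  "normal_fan P = {normal_cone P F |F. F face_of P \<and> F \<noteq> {}}"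

definition support_number :: "(real ^ 'd::finite) set \<Rightarrow> (real ^ 'd) set \<Rightarrow> real" where
  "support_number P \<rho> = (SUP x\<in>P. x \<bullet> real_vec (primitive_generator \<rho>))"

definition polytope_divisor :: "(real ^ 'd::finite) set \<Rightarrow> 'd ratfun set \<Rightarrow> real" where
  "polytope_divisor P = toric_divisor (normal_fan P) (support_number P)"

abbreviation polytope_variety :: "(real ^ 'd::finite) set \<Rightarrow> 'd ratfun set topology" where
  "polytope_variety P \<equiv> toric_variety (normal_fan P)"

abbreviation chi_divisor ::
    "(real ^ 'd::finite) set \<Rightarrow> ('d ratfun set \<Rightarrow> int) \<Rightarrow> int" where
  "chi_divisor P D \<equiv>
     euler_characteristic scale_ratfun (polytope_variety P) (divisorial_sheaf (normal_fan P) D)"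

end

theory Submission
  imports Defs
begin

text \<open>
  For both divisors all higher cohomology vanishes, and the global sections have a basis of characters
  that are in bijection with the lattice points in question.

  All prime divisors are discrete valuations of the function field: the rays of the fan give monomial
  valuations, and the coordinate ring of the torus is an intersection of localizations of the Euclidean
  rings of Laurent polynomials in one variable over the field of rational functions in the other
  variables. Hence every chart has the finite character of a Krull domain, its points of codimension
  one are exactly these valuations, and sections over principal open sets are obtained by inverting a
  function. Partitions of unity then make the Cech complex exact on every intersection of charts, and a
  double complex reduces the cohomology to the covering by the charts at the vertices of \<open>P\<close>.

  That complex is graded by the characters. In the degree of a character \<open>m\<close> it is the relative cochain complex
  of a simplex modulo the sets of vertices that lie in a common facet of \<open>n P\<close> that is visible
  (respectively weakly visible) from \<open>- m\<close>. Dually these are the sets of maximal cones that meet in a point of a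
  convex set of functionals, so that the subcomplex is the nerve of a covering of a convex set by convex cones.
\<close>

section \<open>Discrete valuations and localizations\<close>

text \<open>The divisorial sheaves are in general not invertible and the fan need not be simplicial,
  so vanishing cannot be read off from ampleness; the only access to a section is through its values
  at valuations. Sheaf-theoretic steps therefore rest on two facts: a rational function has finitely
  many poles, and a function that is positive at these poles has a power that cancels them. The
  second obstacle is that cohomology is a limit over all coverings indexed by points. Comparing it
  with the finite covering by charts requires that refinement maps agree up to homotopy, which the
  prism operator provides. The two divisors are treated alike: subtracting 1 from a rounded-up
  coefficient turns strict visibility of a facet into weak visibility, and each kind of visibility
  is governed by a convex set of functionals. Normals are outer while regularity means
  nonnegativity, so the character \<open>m\<close> is a global section exactly if \<open>- m\<close>
  lies in \<open>n P\<close> (respectively in its interior); this is the origin of all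
  signs.\<close>

definition discrete_valuation :: "('k::field \<Rightarrow> int) \<Rightarrow> bool" where
  "discrete_valuation v \<longleftrightarrow>
     (\<forall>f g. f \<noteq> 0 \<longrightarrow> g \<noteq> 0 \<longrightarrow> v (f * g) = v f + v g) \<and>
     (\<forall>f g. f \<noteq> 0 \<longrightarrow> g \<noteq> 0 \<longrightarrow> f + g \<noteq> 0 \<longrightarrow> min (v f) (v g) \<le> v (f + g)) \<and>
     (\<exists>t. t \<noteq> 0 \<and> v t = 1)"

text \<open>Zero belongs to the ring by the guard \<open>f \<noteq> 0\<close>; the integer
  \<open>v 0\<close> carries no information, as the integers have no infinite value.\<close>

definition val_ring :: "('k::field \<Rightarrow> int) \<Rightarrow> 'k set" where
  "val_ring v = {f. f \<noteq> 0 \<longrightarrow> 0 \<le> v f}"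

definition val_ideal :: "('k::field \<Rightarrow> int) \<Rightarrow> 'k set" where
  "val_ideal v = {f. f \<noteq> 0 \<longrightarrow> 0 < v f}"

definition subring_on :: "'k::field set \<Rightarrow> bool" where
  "subring_on A \<longleftrightarrow> 0 \<in> A \<and> 1 \<in> A \<and> (\<forall>a\<in>A. - a \<in> A) \<and>
     (\<forall>a\<in>A. \<forall>b\<in>A. a + b \<in> A \<and> a * b \<in> A)"

lemma subring_onD:
  assumes "subring_on A"
  shows "0 \<in> A" "1 \<in> A" "a \<in> A \<Longrightarrow> - a \<in> A"
    "a \<in> A \<Longrightarrow> b \<in> A \<Longrightarrow> a + b \<in> A" "a \<in> A \<Longrightarrow> b \<in> A \<Longrightarrow> a * b \<in> A"
    "a \<in> A \<Longrightarrow> b \<in> A \<Longrightarrow> a - b \<in> A" "a \<in> A \<Longrightarrow> a ^ n \<in> A"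
proof -
  show *: "0 \<in> A" "1 \<in> A" "a \<in> A \<Longrightarrow> - a \<in> A"
    "a \<in> A \<Longrightarrow> b \<in> A \<Longrightarrow> a + b \<in> A" "a \<in> A \<Longrightarrow> b \<in> A \<Longrightarrow> a * b \<in> A" for a b
    using assms by (auto simp: subring_on_def)
  show "a \<in> A \<Longrightarrow> b \<in> A \<Longrightarrow> a - b \<in> A"
    using *(3)[of b] *(4)[of a "- b"] by simp
  show "a \<in> A \<Longrightarrow> a ^ n \<in> A"
    by (induction n) (auto intro: *)
qed

lemma subring_on_sum:
  assumes "subring_on A" "\<And>i. i \<in> I \<Longrightarrow> f i \<in> A"
  shows "sum f I \<in> A"
  using assms(2) by (induction I rule: infinite_finite_induct) (auto intro: subring_onD[OF assms(1)])

lemma cring_ring_on: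
  assumes "subring_on A"
  shows "cring (ring_on A)"
proof -
  have "\<exists>y\<in>A. y + x = 0" if "x \<in> A" for x
    using that by (intro bexI[of _ "- x"]) (auto intro: subring_onD[OF assms])
  then show ?thesis
    by (intro cringI abelian_groupI comm_monoidI)
      (auto simp: ring_on_def algebra_simps intro: subring_onD[OF assms])
qed

text \<open>Unfolds the notion of prime ideal from HOL-Algebra once; afterwards prime ideals are
  handled only through their elements in the ambient field.\<close>

lemma spec_iff:
  assumes "subring_on A"
  shows "p \<in> spec A \<longleftrightarrow> p \<subseteq> A \<and> 0 \<in> p \<and> 1 \<notin> p \<and> (\<forall>a\<in>p. \<forall>b\<in>p. a + b \<in> p) \<and>
    (\<forall>a\<in>A. \<forall>b\<in>p. a * b \<in> p) \<and> (\<forall>a\<in>A. \<forall>b\<in>A. a * b \<in> p \<longrightarrow> a \<in> p \<or> b \<in> p)"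
    (is "_ \<longleftrightarrow> ?R")
proof
  interpret cring "ring_on A" by (rule cring_ring_on[OF assms])
  have [simp]: "carrier (ring_on A) = A" "add (ring_on A) = (+)" "monoid.mult (ring_on A) = (*)"
     "ring.zero (ring_on A) = 0" "monoid.one (ring_on A) = 1"
    by (auto simp: ring_on_def)
  {
    assume "p \<in> spec A"
    then interpret p: primeideal p "ring_on A" by (simp add: spec_def)
    have "1 \<notin> p"
    proof
      assume "1 \<in> p"
      then have "p = A"
        using p.one_imp_carrier by simp
      then show False
        using p.I_notcarr by simp
    qed
    moreover have "p \<subseteq> A" using p.a_subset by simp
    moreover have "0 \<in> p" using p.zero_closed by simp
    moreover have "\<forall>a\<in>p. \<forall>b\<in>p. a + b \<in> p"
      using p.a_closed by simp
    moreover have "\<forall>a\<in>A. \<forall>b\<in>p. a * b \<in> p"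
      using p.I_l_closed by simp
    moreover have "\<forall>a\<in>A. \<forall>b\<in>A. a * b \<in> p \<longrightarrow> a \<in> p \<or> b \<in> p"
      using p.I_prime by simp
    ultimately show ?R by (intro conjI)
  }
  {
    assume R: ?R
    have minus: "- a \<in> p" if "a \<in> p" for a
    proof -
      have "(-1) * a \<in> p"
        using that R subring_onD[OF assms] by blast
      then show ?thesis by simp
    qed
    have inv: "inv\<^bsub>add_monoid (ring_on A)\<^esub> a = - a" if "a \<in> A" for a
      using add.inv_equality[of "- a" a] that subring_onD[OF assms] by (simp add: a_inv_def)
    have sub: "p \<subseteq> A" and zero: "0 \<in> p" and one: "1 \<notin> p" and add: "\<And>a b. a \<in> p \<Longrightarrow> b \<in> p \<Longrightarrow> a + b \<in> p"
      and mult: "\<And>a b. a \<in> A \<Longrightarrow> b \<in> p \<Longrightarrow> a * b \<in> p"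
      and prime: "\<And>a b. a \<in> A \<Longrightarrow> b \<in> A \<Longrightarrow> a * b \<in> p \<Longrightarrow> a \<in> p \<or> b \<in> p"
      using R by simp_all
    have "ideal p (ring_on A)"
    proof (rule idealI)
      show "ring (ring_on A)" by (rule ring_axioms)
      show "subgroup p (add_monoid (ring_on A))"
      proof (rule subgroup.intro)
        show "inv\<^bsub>add_monoid (ring_on A)\<^esub> a \<in> p" if "a \<in> p" for a
          using minus[OF that] inv[of a] that sub by auto
      qed (use sub zero add in \<open>simp_all\<close>)
    next
      fix a x assume "a \<in> p" "x \<in> carrier (ring_on A)"
      then have "x * a \<in> p" using mult by simp
      then show "x \<otimes>\<^bsub>ring_on A\<^esub> a \<in> p" "a \<otimes>\<^bsub>ring_on A\<^esub> x \<in> p"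
        by (simp_all add: mult.commute)
    qed
    moreover have "cring (ring_on A)" by (rule cring_ring_on[OF assms])
    moreover have "carrier (ring_on A) \<noteq> p"
      using one subring_onD(2)[OF assms] by auto
    ultimately have "primeideal p (ring_on A)"
      by (rule primeidealI) (use prime in simp)
    then show "p \<in> spec A" by (simp add: spec_def)
  }
qed

lemma specD:
  assumes "subring_on A" "p \<in> spec A"
  shows "p \<subseteq> A" "0 \<in> p" "1 \<notin> p" "a \<in> p \<Longrightarrow> b \<in> p \<Longrightarrow> a + b \<in> p"
    "a \<in> A \<Longrightarrow> b \<in> p \<Longrightarrow> a * b \<in> p" "a \<in> A \<Longrightarrow> b \<in> A \<Longrightarrow> a * b \<in> p \<Longrightarrow> a \<in> p \<or> b \<in> p"
  using assms(2) unfolding spec_iff[OF assms(1)] by blast+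

section \<open>Valuation rings and their prime ideals\<close>

context
  fixes v :: "'k::field \<Rightarrow> int"
  assumes dv: "discrete_valuation v"
begin

lemma val_mult: "f \<noteq> 0 \<Longrightarrow> g \<noteq> 0 \<Longrightarrow> v (f * g) = v f + v g"
  using dv by (simp add: discrete_valuation_def)

lemma val_add: "f \<noteq> 0 \<Longrightarrow> g \<noteq> 0 \<Longrightarrow> f + g \<noteq> 0 \<Longrightarrow> min (v f) (v g) \<le> v (f + g)"
  using dv by (simp add: discrete_valuation_def)

lemma val_one: "v 1 = 0"
  using val_mult[of 1 1] by simp

lemma val_inverse: "f \<noteq> 0 \<Longrightarrow> v (inverse f) = - v f"
  using val_mult[of f "inverse f"] val_one by simp

lemma val_divide: "f \<noteq> 0 \<Longrightarrow> g \<noteq> 0 \<Longrightarrow> v (f / g) = v f - v g"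
  by (simp add: divide_inverse val_mult val_inverse)

lemma val_minus: "v (- f) = v f"
proof (cases "f = 0")
  case False
  have "v (- 1) + v (- 1) = 0"
    using val_mult[of "- 1" "- 1"] val_one by simp
  then show ?thesis
    using val_mult[of "- 1" f] False by simp
qed auto

lemma val_power: "f \<noteq> 0 \<Longrightarrow> v (f ^ n) = int n * v f"
  by (induction n) (simp_all add: val_one val_mult algebra_simps)

lemma val_power_int: "f \<noteq> 0 \<Longrightarrow> v (f powi k) = k * v f"
  by (cases k rule: int_cases2) (simp_all add: power_int_minus val_inverse val_power)

lemma subring_val_ring: "subring_on (val_ring v)"
  unfolding subring_on_def
proof (intro conjI ballI)
  fix a b assume *: "a \<in> val_ring v" "b \<in> val_ring v"
  show "a + b \<in> val_ring v"
    using * val_add[of a b] by (cases "a = 0"; cases "b = 0") (auto simp: val_ring_def)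
  show "a * b \<in> val_ring v"
    using * val_mult[of a b] by (auto simp: val_ring_def)
qed (auto simp: val_ring_def val_one val_minus)

lemma units_on_val_ring: "units_on (val_ring v) = {u. u \<noteq> 0 \<and> v u = 0}"
  by (auto simp: units_on_def val_ring_def val_inverse)

lemma val_ring_diff_units: "val_ring v - units_on (val_ring v) = val_ideal v"
  unfolding units_on_val_ring by (auto simp: val_ring_def val_ideal_def)

lemma exists_uniformizer: obtains t where "t \<noteq> 0" "v t = 1"
  using dv by (auto simp: discrete_valuation_def)

lemma val_ideal_eq: "val_ideal v = {t * r |r. r \<in> val_ring v}" if "t \<noteq> 0" "v t = 1"
proof (intro equalityI subsetI)
  fix f assume "f \<in> val_ideal v"
  then have "f = t * (f / t)" "f / t \<in> val_ring v"
    using that by (auto simp: val_ideal_def val_ring_def val_divide)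
  then show "f \<in> {t * r |r. r \<in> val_ring v}" by blast
qed (use that in \<open>auto simp: val_ideal_def val_ring_def val_mult\<close>)

text \<open>Every generator of the maximal ideal has value 1, so the exponent in
  \<open>f = u * t powi k\<close> does not depend on the generator. This ties the definite
  description in \<open>valuation\<close> to \<open>v\<close>.\<close>

lemma valuation_val_ring:
  assumes "f \<noteq> 0"
  shows "valuation (val_ring v) f = v f"
  unfolding valuation_def val_ring_diff_units
  unfolding units_on_val_ring
proof (rule the_equality)
  obtain t where t: "t \<noteq> 0" "v t = 1" by (rule exists_uniformizer)
  show "\<exists>t u. val_ideal v = {t * r |r. r \<in> val_ring v} \<and> u \<in> {u. u \<noteq> 0 \<and> v u = 0} \<and> f = u * t powi v f"
    using t assms
    by (intro exI[of _ t] exI[of _ "f / t powi v f"])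
      (auto simp: val_ideal_eq[OF t] val_divide val_power_int)
next
  fix k assume "\<exists>t u. val_ideal v = {t * r |r. r \<in> val_ring v} \<and>
    u \<in> {u. u \<noteq> 0 \<and> v u = 0} \<and> f = u * t powi k"
  then obtain t u where t: "val_ideal v = {t * r |r. r \<in> val_ring v}"
    and u: "u \<noteq> 0" "v u = 0" "f = u * t powi k" by auto
  obtain s where s: "s \<noteq> 0" "v s = 1" by (rule exists_uniformizer)
  have "s \<in> val_ideal v" using s by (simp add: val_ideal_def)
  then obtain r where r: "s = t * r" "r \<in> val_ring v" using t by auto
  have "1 \<in> val_ring v" by (simp add: val_ring_def val_one)
  \<comment> \<open>As \<open>t = t * 1\<close> lies in the ideal, its value is at least 1; the
    element \<open>s\<close> of value 1 is a multiple of \<open>t\<close>, so the value is exactly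
    1.\<close>
  then have "t \<in> val_ideal v" using t by force
  with r s have "v t = 1"
    by (auto simp: val_ideal_def val_ring_def val_mult)
  moreover have "t \<noteq> 0" using r s by auto
  ultimately show "k = v f"
    using u by (simp add: val_mult val_power_int)
qed

text \<open>If a prime contains \<open>a\<close> of value \<open>n\<close>, then for every
  \<open>f\<close> of positive value the quotient \<open>f ^ Suc n / a\<close> is integral. A power
  of \<open>f\<close>, hence \<open>f\<close> itself, lies in the prime.\<close>

lemma spec_val_ring: "spec (val_ring v) = {{0}, val_ideal v}"
proof (intro equalityI subsetI)
  fix p assume p: "p \<in> {{0}, val_ideal v}"
  then show "p \<in> spec (val_ring v)"
    unfolding spec_iff[OF subring_val_ring]
  proof (elim insertE emptyE)
    assume p: "p = val_ideal v"
    have "a + b \<in> val_ideal v" if "a \<in> val_ideal v" "b \<in> val_ideal v" for a b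
      using that val_add[of a b] by (cases "a = 0"; cases "b = 0") (auto simp: val_ideal_def)
    then show "p \<subseteq> val_ring v \<and> 0 \<in> p \<and> 1 \<notin> p \<and> (\<forall>a\<in>p. \<forall>b\<in>p. a + b \<in> p) \<and>
      (\<forall>a\<in>val_ring v. \<forall>b\<in>p. a * b \<in> p) \<and>
      (\<forall>a\<in>val_ring v. \<forall>b\<in>val_ring v. a * b \<in> p \<longrightarrow> a \<in> p \<or> b \<in> p)"
      unfolding p by (auto simp: val_ring_def val_ideal_def val_one val_mult)
  qed (auto simp: val_ring_def)
next
  fix p assume "p \<in> spec (val_ring v)"
  note p = specD[OF subring_val_ring this]
  have "val_ideal v \<subseteq> p" if ne: "p \<noteq> {0}"
  proof
    obtain a where a: "a \<in> p" "a \<noteq> 0" using ne p(2) by auto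
    fix f assume f: "f \<in> val_ideal v"
    show "f \<in> p"
    proof (cases "f = 0")
      case False
      define n where "n = nat (v a)"
      have pow: "g \<in> p" if "g ^ n \<in> p" "g \<in> val_ring v" for g n
        using that(1)
      proof (induction n)
        case (Suc n)
        then show ?case
          using p(6)[of g "g ^ n"] that(2) subring_onD(7)[OF subring_val_ring] by auto
      qed (use p(3) in auto)
      have "0 < v f" using f False by (simp add: val_ideal_def)
      have "v a \<le> int (Suc n) * 1" by (simp add: n_def)
      also have "\<dots> \<le> int (Suc n) * v f"
        using \<open>0 < v f\<close> by (intro mult_left_mono) auto
      finally have "v a \<le> int (Suc n) * v f" .
      then have "f ^ Suc n / a \<in> val_ring v"
        using a False by (simp add: val_ring_def val_divide val_mult val_power algebra_simps)
      then have "f ^ Suc n / a * a \<in> p" using a p(5) by blast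
      then have "f ^ Suc n \<in> p" using a by simp
      moreover have "f \<in> val_ring v" using f by (auto simp: val_ideal_def val_ring_def)
      ultimately show ?thesis by (rule pow)
    qed (use p(2) in simp)
  qed
  moreover have "p \<subseteq> val_ideal v"
  proof
    fix f assume f: "f \<in> p"
    show "f \<in> val_ideal v"
    proof (rule ccontr)
      assume "f \<notin> val_ideal v"
      then have "f \<noteq> 0" "v f = 0" using f p(1) by (auto simp: val_ideal_def val_ring_def)
      then have "inverse f * f \<in> p"
        using f p(5)[of "inverse f" f] by (auto simp: val_ring_def val_inverse)
      then show False using p(3) \<open>f \<noteq> 0\<close> by simp
    qed
  qed
  ultimately show "p \<in> {{0}, val_ideal v}" by blast
qed

lemma krull_dim_one_val_ring: "krull_dim_one (val_ring v)"
proof -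
  obtain t where t: "t \<noteq> 0" "v t = 1" by (rule exists_uniformizer)
  have "t \<in> val_ideal v" "0 \<in> val_ideal v" using t by (simp_all add: val_ideal_def)
  then have less: "{0} \<subset> val_ideal v" using t(1) by blast
  then have "\<not> (p \<subset> q \<and> q \<subset> r)"
    if "p \<in> {{0}, val_ideal v}" "q \<in> {{0}, val_ideal v}" "r \<in> {{0}, val_ideal v}" for p q r
    using that less by (metis insert_iff empty_iff less_asym less_irrefl)
  moreover have "\<exists>p\<in>{{0}, val_ideal v}. \<exists>q\<in>{{0}, val_ideal v}. p \<subset> q"
    using less by blast
  ultimately show ?thesis
    unfolding krull_dim_one_def spec_val_ring by metis
qed

end

section \<open>Affine schemes with local rings in the function field as points\<close>

definition points :: "'k::field set \<Rightarrow> 'k set set" where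
  "points A = localization A ` spec A"

context
  fixes A p :: "'k::field set"
  assumes A: "subring_on A" and p: "p \<in> spec A"
begin

lemma localizationI: "a \<in> A \<Longrightarrow> s \<in> A \<Longrightarrow> s \<notin> p \<Longrightarrow> a / s \<in> localization A p"
  by (auto simp: localization_def)

lemma not_in_prime_nonzero: "s \<notin> p \<Longrightarrow> s \<noteq> 0"
  using specD(2)[OF A p] by auto

lemma subset_localization: "A \<subseteq> localization A p"
  using localizationI[of _ 1] specD(3)[OF A p] subring_onD(2)[OF A] by auto

lemma not_in_prime_mult: "s \<in> A \<Longrightarrow> t \<in> A \<Longrightarrow> s \<notin> p \<Longrightarrow> t \<notin> p \<Longrightarrow> s * t \<notin> p"
  using specD(6)[OF A p] by blast

lemma subring_localization: "subring_on (localization A p)"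
  unfolding subring_on_def
proof (intro conjI ballI)
  fix x y assume "x \<in> localization A p" "y \<in> localization A p"
  then obtain a s b t where *: "x = a / s" "y = b / t" "a \<in> A" "b \<in> A" "s \<in> A - p" "t \<in> A - p"
    by (auto simp: localization_def)
  then have "s \<noteq> 0" "t \<noteq> 0" using not_in_prime_nonzero by auto
  with * have "x + y = (a * t + b * s) / (s * t)" "x * y = (a * b) / (s * t)"
    by (auto simp: field_simps)
  then show "x + y \<in> localization A p" "x * y \<in> localization A p"
    using * not_in_prime_mult by (auto intro!: localizationI subring_onD[OF A])
next
  fix x assume "x \<in> localization A p"
  then obtain a s where *: "x = a / s" "a \<in> A" "s \<in> A - p" by (auto simp: localization_def)
  then have "- x = (- a) / s" by simp
  also have "\<dots> \<in> localization A p"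
    using * by (intro localizationI subring_onD[OF A]) auto
  finally show "- x \<in> localization A p" .
qed (use subset_localization subring_onD[OF A] in auto)

lemma unit_localization_iff:
  assumes "a \<in> A" "s \<in> A" "s \<notin> p"
  shows "a / s \<in> units_on (localization A p) \<longleftrightarrow> a \<notin> p"
proof
  assume "a \<notin> p"
  then show "a / s \<in> units_on (localization A p)"
    using assms not_in_prime_nonzero localizationI[of s a] localizationI[of a s]
    by (auto simp: units_on_def)
next
  assume "a / s \<in> units_on (localization A p)"
  then obtain b t where *: "s / a = b / t" "b \<in> A" "t \<in> A - p" "a \<noteq> 0"
    by (auto simp: units_on_def localization_def)
  then have "s * t = b * a" using not_in_prime_nonzero by (auto simp: field_simps)
  then show "a \<notin> p"
    using not_in_prime_mult[of s t] specD(5)[OF A p, of b a] * assms by auto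
qed

lemma unit_localization_iff': "a \<in> A \<Longrightarrow> a \<in> units_on (localization A p) \<longleftrightarrow> a \<notin> p"
  using unit_localization_iff[of a 1] specD(3)[OF A p] subring_onD(2)[OF A] by simp

text \<open>A prime is recovered from its local ring, so a point given as a subring of the field
  carries the same information as the prime ideal.\<close>

lemma prime_eq_nonunits: "p = A - units_on (localization A p)"
  using unit_localization_iff' specD(1)[OF A p] by auto

end

lemma pointsE:
  assumes "R \<in> points A"
  obtains p where "p \<in> spec A" "R = localization A p"
  using assms by (auto simp: points_def)

lemma subring_point:
  assumes "subring_on A" "R \<in> points A"
  shows "subring_on R" "A \<subseteq> R"
  using assms by (auto elim!: pointsE intro: subring_localization dest: subset_localization)

lemma units_onD: "u \<in> units_on R \<Longrightarrow> u \<in> R" "u \<in> units_on R \<Longrightarrow> u \<noteq> 0"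
  "u \<in> units_on R \<Longrightarrow> inverse u \<in> R"
  by (auto simp: units_on_def)

lemma units_on_mult_iff:
  assumes "subring_on R" "a \<in> R" "b \<in> R"
  shows "a * b \<in> units_on R \<longleftrightarrow> a \<in> units_on R \<and> b \<in> units_on R"
proof
  assume ab: "a * b \<in> units_on R"
  then have nz: "a \<noteq> 0" "b \<noteq> 0" by (auto simp: units_on_def)
  then have eq: "inverse a = b * inverse (a * b)" "inverse b = a * inverse (a * b)"
    by (simp_all add: field_simps)
  have "inverse (a * b) \<in> R" using ab unfolding units_on_def by blast
  then have "inverse a \<in> R" "inverse b \<in> R"
    unfolding eq using assms(2,3) subring_onD(5)[OF assms(1)] by blast+
  then show "a \<in> units_on R \<and> b \<in> units_on R"
    using assms(2,3) nz by (simp add: units_on_def)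
qed (use assms in \<open>auto simp: units_on_def subring_onD(5)\<close>)

lemma units_on_inverse: "a \<in> units_on R \<Longrightarrow> inverse a \<in> units_on R"
  by (auto simp: units_on_def)

lemma units_on_one: "subring_on R \<Longrightarrow> 1 \<in> units_on R"
  by (simp add: units_on_def subring_onD)

lemma units_on_power:
  assumes "subring_on R" "a \<in> units_on R"
  shows "a ^ n \<in> units_on R"
  using assms subring_onD(7)[OF assms(1), of "inverse a" n]
  by (auto simp: units_on_def power_inverse subring_onD(7))

lemma nonunits_add:
  assumes A: "subring_on A" and R: "R \<in> points A"
    and x: "x \<in> R" "x \<notin> units_on R" and y: "y \<in> R" "y \<notin> units_on R"
  shows "x + y \<notin> units_on R"
proof -
  obtain p where p: "p \<in> spec A" and R': "R = localization A p" using R by (rule pointsE)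
  obtain a s b t where *: "x = a / s" "y = b / t" "a \<in> A" "b \<in> A" "s \<in> A" "t \<in> A" "s \<notin> p" "t \<notin> p"
    using x(1) y(1) by (auto simp: R' localization_def)
  then have "s \<noteq> 0" "t \<noteq> 0" using not_in_prime_nonzero[OF A p] by auto
  with * have eq: "x + y = (t * a + s * b) / (s * t)" by (auto simp: field_simps)
  have "a \<in> p" "b \<in> p"
    using x(2) y(2) * unit_localization_iff[OF A p] by (auto simp: R')
  then have "t * a + s * b \<in> p"
    using * specD[OF A p] by auto
  moreover have "s * t \<in> A" "s * t \<notin> p" "t * a + s * b \<in> A"
    using * not_in_prime_mult[OF A p] by (simp_all add: subring_onD[OF A])
  ultimately show ?thesis
    unfolding eq R' using unit_localization_iff[OF A p] by blast
qed

text \<open>The nonunits of the local ring \<open>R\<close> form its maximal ideal, whose trace on a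
  subring of \<open>R\<close> is prime. In this way a point of one affine scheme yields a prime
  ideal of another ring.\<close>

lemma contraction_in_spec:
  assumes A: "subring_on A" and R: "R \<in> points A" and A': "subring_on A'" "A' \<subseteq> R"
  shows "A' - units_on R \<in> spec A'"
proof -
  have R': "subring_on R" using subring_point[OF A R] by simp
  have "0 \<notin> units_on R" "1 \<in> units_on R"
    using units_on_one[OF R'] by (auto simp: units_on_def)
  moreover have "a + b \<notin> units_on R" if "a \<in> A'" "b \<in> A'" "a \<notin> units_on R" "b \<notin> units_on R" for a b
    using nonunits_add[OF A R] that A' by auto
  moreover have "a * b \<in> units_on R \<longleftrightarrow> a \<in> units_on R \<and> b \<in> units_on R" if "a \<in> A'" "b \<in> A'" for a b
    using units_on_mult_iff[OF R'] that A' by blast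
  ultimately show ?thesis
    unfolding spec_iff[OF A'(1)] using subring_onD[OF A'(1)] by auto
qed

lemma point_eq_localization:
  assumes A: "subring_on A" and R: "R \<in> points A"
  shows "R = localization A (A - units_on R)"
  using R prime_eq_nonunits[OF A] by (auto elim!: pointsE)

text \<open>A fraction over \<open>A\<close> is rewritten as a fraction over \<open>A'\<close> by
  clearing numerator and denominator with elements that are units at \<open>R\<close>. This is the
  algebra behind the gluing of charts.\<close>

lemma points_change_ring:
  assumes A: "subring_on A" and R: "R \<in> points A" and A': "subring_on A'" "A' \<subseteq> R"
    and clear: "\<And>a. a \<in> A \<Longrightarrow> \<exists>t\<in>A' \<inter> units_on R. a * t \<in> A'"
  shows "R \<in> points A'"
proof -
  define q where "q = A' - units_on R"
  have q: "q \<in> spec A'" unfolding q_def by (rule contraction_in_spec[OF A R A'])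
  have R': "subring_on R" "A \<subseteq> R" using subring_point[OF A R] by auto
  obtain p where p: "p \<in> spec A" and R_eq: "R = localization A p" using R by (rule pointsE)
  have "R = localization A' q"
  proof (intro equalityI subsetI)
    fix x assume "x \<in> R"
    then obtain a s where as: "a \<in> A" "s \<in> A" "s \<in> units_on R" "x = a / s"
      using p R_eq prime_eq_nonunits[OF A p] by (auto simp: localization_def)
    obtain t where t: "t \<in> A'" "t \<in> units_on R" "a * t \<in> A'" using clear[OF as(1)] by auto
    obtain u where u: "u \<in> A'" "u \<in> units_on R" "s * u \<in> A'" using clear[OF as(2)] by auto
    have "x = (a * t * u) / (s * u * t)"
      using as t u by (auto simp: units_on_def field_simps)
    moreover have "s * u * t \<in> units_on R"
      using as t u A' R' by (metis units_on_mult_iff subring_onD(5) subsetD)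
    moreover have "a * t * u \<in> A'" "s * u * t \<in> A'"
      using t u subring_onD(5)[OF A'(1)] by auto
    ultimately show "x \<in> localization A' q"
      unfolding localization_def q_def by blast
  next
    fix x assume "x \<in> localization A' q"
    then obtain a s where "x = a * inverse s" "a \<in> A'" "s \<in> units_on R"
      by (auto simp: localization_def q_def divide_inverse)
    then show "x \<in> R"
      using A' subring_onD(5)[OF R'(1), of a "inverse s"] by (auto simp: units_on_def)
  qed
  then show ?thesis using q by (auto simp: points_def)
qed

text \<open>The Krull domain argument. A nonzero prime \<open>p\<close> contains the center on
  \<open>A\<close> of some defining valuation: otherwise elements of the centers outside
  \<open>p\<close> multiply to an element outside \<open>p\<close> that is divisible by a given
  nonzero element of \<open>p\<close>. In dimension one this center must be all of
  \<open>p\<close>.\<close>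

lemma krull_dim_one_localization:
  assumes A: "subring_on A"
    and dv: "\<And>v. v \<in> V \<Longrightarrow> discrete_valuation v"
    and A_eq: "A = {f. \<forall>v\<in>V. f \<in> val_ring v}"
    and fin: "\<And>f. f \<noteq> 0 \<Longrightarrow> finite {v \<in> V. v f \<noteq> 0}"
    and pts: "\<And>v. v \<in> V \<Longrightarrow> val_ring v \<in> points A"
    and R: "R \<in> points A" "krull_dim_one R"
  shows "\<exists>v\<in>V. R = val_ring v"
proof -
  obtain p where p: "p \<in> spec A" and R_eq: "R = localization A p" using R(1) by (rule pointsE)
  note pD = specD[OF A p]
  have subR: "subring_on R" "A \<subseteq> R" using subring_point[OF A R(1)] by auto
  \<comment> \<open>If \<open>p\<close> were zero, then \<open>R\<close> would be a field, against
    the strict chain of primes that dimension one provides.\<close>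
  obtain a where a: "a \<in> p" "a \<noteq> 0"
  proof (cases "p = {0}")
    case True
    obtain q q' where q: "q \<in> spec R" "q' \<in> spec R" "q \<subset> q'"
      using R(2) by (auto simp: krull_dim_one_def)
    then obtain x where x: "x \<in> q'" "x \<notin> q" by auto
    then have "x \<in> R" "x \<noteq> 0" using specD(1,2)[OF subR(1)] q by auto
    then obtain b s where "x = b / s" "b \<in> A" "s \<in> A" "s \<notin> p" "b \<notin> p"
      unfolding R_eq localization_def using True by auto
    then have "x \<in> units_on R" using unit_localization_iff[OF A p] by (simp add: R_eq)
    then have "inverse x * x \<in> q'"
      using specD(5)[OF subR(1) q(2), of "inverse x" x] x(1) by (simp add: units_on_def)
    then show ?thesis using specD(3)[OF subR(1) q(2)] \<open>x \<noteq> 0\<close> by simp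
  next
    case False
    then have "\<exists>a\<in>p. a \<noteq> 0" using pD(2) by blast
    then show ?thesis using that by blast
  qed
  have nonneg: "f \<in> A \<Longrightarrow> f \<noteq> 0 \<Longrightarrow> v \<in> V \<Longrightarrow> 0 \<le> v f" for f v
    unfolding A_eq by (auto simp: val_ring_def)
  obtain v where v: "v \<in> V" "A \<inter> val_ideal v \<subseteq> p"
  proof (rule ccontr)
    assume no: "\<not> thesis"
    then have "\<forall>v\<in>V. \<exists>s. s \<in> A \<and> s \<in> val_ideal v \<and> s \<notin> p" using that by blast
    then obtain s where s: "\<And>v. v \<in> V \<Longrightarrow> s v \<in> A" "\<And>v. v \<in> V \<Longrightarrow> s v \<in> val_ideal v"
      "\<And>v. v \<in> V \<Longrightarrow> s v \<notin> p" by metis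
    have s0: "v \<in> V \<Longrightarrow> s v \<noteq> 0" for v using s(3) pD(2) by metis
    define W where "W = {v \<in> V. v a \<noteq> 0}"
    \<comment> \<open>Each factor has positive value at its own \<open>v\<close>, so
      \<open>t\<close> has value at least \<open>v a\<close> at each of the finitely many
      \<open>v\<close> with \<open>v a \<noteq> 0\<close>. Hence \<open>t / a\<close> is integral at
      every valuation.\<close>
    define t where "t = (\<Prod>v\<in>W. s v ^ nat (v a))"
    have W: "finite W" "W \<subseteq> V" using fin[OF a(2)] by (auto simp: W_def)
    have pow: "g ^ n \<notin> p" if "g \<in> A" "g \<notin> p" for g n
      using that pD(3) not_in_prime_mult[OF A p] subring_onD(7)[OF A] by (induction n) auto
    have tA: "U \<subseteq> W \<Longrightarrow> (\<Prod>v\<in>U. s v ^ nat (v a)) \<in> A \<and> (\<Prod>v\<in>U. s v ^ nat (v a)) \<notin> p" for U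
    proof (induction U rule: infinite_finite_induct)
      case (insert x U)
      then have "x \<in> V" using W by auto
      then show ?case
        using insert s pow not_in_prime_mult[OF A p] by (simp add: subring_onD[OF A])
    qed (use subring_onD[OF A] pD in auto)
    have "t / a \<in> A"
    proof -
      have "t / a \<in> val_ring v" if v: "v \<in> V" for v
      proof -
        have t0: "t \<noteq> 0" using W s0 unfolding t_def by (auto simp: subset_iff)
        have "v a \<le> v t"
        proof (cases "v \<in> W")
          case True
          define r where "r = (\<Prod>w\<in>W - {v}. s w ^ nat (w a))"
          have t: "t = s v ^ nat (v a) * r"
            unfolding t_def r_def using prod.remove[OF W(1) True] by simp
          have "r \<in> A" "r \<noteq> 0" using tA[of "W - {v}"] t t0 by (auto simp: r_def)
          then have r: "0 \<le> v r" using nonneg v by blast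
          have "0 < v (s v)" using s(2)[OF v] s0[OF v] by (simp add: val_ideal_def)
          moreover have "0 \<le> v a" using nonneg a pD(1) v by blast
          ultimately have "v a \<le> int (nat (v a)) * v (s v)"
            by (simp add: mult_le_cancel_left1)
          then show ?thesis
            using r \<open>r \<noteq> 0\<close> s0[OF v] by (simp add: t val_mult[OF dv[OF v]] val_power[OF dv[OF v]])
        next
          case False
          then show ?thesis using v nonneg[of t v] tA[of W] t0 by (auto simp: t_def W_def)
        qed
        then show ?thesis using t0 a by (simp add: val_ring_def val_divide[OF dv[OF v]])
      qed
      then show ?thesis unfolding A_eq by blast
    qed
    then have "t / a * a \<in> p" using a pD(5) by blast
    then show False using tA[of W] a by (simp add: t_def)
  qed
  define q where "q = A - units_on (val_ring v)"
  note dv = dv[OF v(1)]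
  have q: "q \<in> spec A" and v_eq: "val_ring v = localization A q"
    using contraction_in_spec[OF A pts[OF v(1)] A] subring_point(2)[OF A pts[OF v(1)]]
      point_eq_localization[OF A pts[OF v(1)]] by (auto simp: q_def)
  have qp: "q \<subseteq> p"
    using v(2) subring_point(2)[OF A pts[OF v(1)]] val_ring_diff_units[OF dv] by (auto simp: q_def)
  show ?thesis
  proof (cases "q = p")
    case False
    \<comment> \<open>\<open>e r\<close> is the extension of the prime \<open>r\<close> to
      \<open>R\<close>. Since it meets \<open>A\<close> exactly in \<open>r\<close>, strict
      inclusions between primes survive.\<close>
    define e where "e r = R - units_on (localization A r)" for r
    have loc_mono: "localization A r' \<subseteq> localization A r" if "r \<subseteq> r'" for r r'
      using that by (auto simp: localization_def)
    have e: "e r \<in> spec R" if "r \<in> spec A" "r \<subseteq> p" for r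
      unfolding e_def using that subR loc_mono[OF that(2)]
      by (intro contraction_in_spec[OF A, of "localization A r"]) (auto simp: points_def R_eq)
    have eA: "e r \<inter> A = r" if "r \<in> spec A" for r
      using prime_eq_nonunits[OF A that] subR by (auto simp: e_def)
    have e_mono: "e r \<subseteq> e r'" if "r \<subseteq> r'" for r r'
      using loc_mono[OF that] by (auto simp: e_def units_on_def)
    have zero: "{0} \<in> spec A"
      unfolding spec_iff[OF A] using subring_onD[OF A] by auto
    \<comment> \<open>The numerator of a uniformizer lies in \<open>q\<close>, so \<open>q\<close>
      is nonzero and the chain \<open>{0}\<close>, \<open>q\<close>, \<open>p\<close> is
      strict.\<close>
    obtain t where t: "t \<noteq> 0" "v t = 1" by (rule exists_uniformizer[OF dv])
    then have "t \<in> localization A q" by (simp add: v_eq[symmetric] val_ring_def)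
    then obtain b c where bc: "t = b / c" "b \<in> A" "c \<in> A" "c \<notin> q"
      by (auto simp: localization_def)
    have "b \<in> q"
      using unit_localization_iff[OF A q bc(2,3,4)] t by (auto simp: bc(1)[symmetric] v_eq[symmetric] units_on_val_ring[OF dv])
    then have "q \<noteq> {0}" using bc t by auto
    then have "{0} \<subset> q" using specD(2)[OF A q] by auto
    then have "e {0} \<subset> e q" "e q \<subset> e p"
      using e_mono[of "{0}" q] e_mono[OF qp] eA[OF q] eA[OF p] eA[OF zero] False qp by blast+
    moreover have "e {0} \<in> spec R" "e q \<in> spec R" "e p \<in> spec R"
      using e zero q p qp pD(2) by auto
    ultimately have False using R(2) unfolding krull_dim_one_def by blast
    then show ?thesis ..
  qed (use v v_eq R_eq in auto)
qed

text \<open>Quasi-compactness of the spectrum: if the ideal generated by the \<open>g j\<close> were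
  proper, a maximal proper ideal above it, obtained from Zorn's lemma, would be a prime containing
  all \<open>g j\<close>.\<close>

lemma partition_of_unity:
  assumes A: "subring_on A" and g: "\<And>j. j \<in> J \<Longrightarrow> g j \<in> A"
    and cover: "\<And>p. p \<in> spec A \<Longrightarrow> \<exists>j\<in>J. g j \<notin> p"
  shows "\<exists>K h. finite K \<and> K \<subseteq> J \<and> (\<forall>j\<in>K. h j \<in> A) \<and> (\<Sum>j\<in>K. h j * g j) = 1"
proof (rule ccontr)
  assume no: "\<not> ?thesis"
  define proper where "proper I \<longleftrightarrow> I \<subseteq> A \<and> 0 \<in> I \<and> 1 \<notin> I \<and> (\<forall>a\<in>I. \<forall>b\<in>I. a + b \<in> I) \<and>
    (\<forall>a\<in>A. \<forall>b\<in>I. a * b \<in> I)" for I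
  define I where "I = {\<Sum>j\<in>K. h j * g j |K h. finite K \<and> K \<subseteq> J \<and> (\<forall>j\<in>K. h j \<in> A)}"
  note A' = subring_onD[OF A]
  have I: "proper I"
    unfolding proper_def
  proof (intro conjI ballI)
    show "I \<subseteq> A" using g by (auto simp: I_def intro!: subring_on_sum[OF A] A')
    show "0 \<in> I" unfolding I_def by (auto intro!: exI[of _ "{}"])
    show "1 \<notin> I"
    proof
      assume "1 \<in> I"
      then obtain K h where "1 = (\<Sum>j\<in>K. h j * g j)" "finite K" "K \<subseteq> J" "\<forall>j\<in>K. h j \<in> A"
        unfolding I_def by blast
      with no show False by metis
    qed
  next
    fix a b assume "a \<in> I" "b \<in> I"
    then obtain K h K' h' where *: "a = (\<Sum>j\<in>K. h j * g j)" "b = (\<Sum>j\<in>K'. h' j * g j)"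
      "finite K" "finite K'" "K \<subseteq> J" "K' \<subseteq> J" "\<forall>j\<in>K. h j \<in> A" "\<forall>j\<in>K'. h' j \<in> A"
      by (auto simp: I_def)
    define k where "k j = (if j \<in> K then h j else 0) + (if j \<in> K' then h' j else 0)" for j
    have "(\<Sum>j\<in>K \<union> K'. k j * g j) =
        (\<Sum>j\<in>K \<union> K'. if j \<in> K then h j * g j else 0) + (\<Sum>j\<in>K \<union> K'. if j \<in> K' then h' j * g j else 0)"
      by (simp add: k_def distrib_right sum.distrib if_distrib[of "\<lambda>x. x * _"] cong: if_cong)
    also have "\<dots> = a + b"
      using * by (simp add: sum.If_cases Int_absorb1 Int_absorb2)
    finally have "a + b = (\<Sum>j\<in>K \<union> K'. k j * g j)" by simp
    moreover have "\<forall>j\<in>K \<union> K'. k j \<in> A"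
      using * A' by (auto simp: k_def)
    ultimately show "a + b \<in> I"
      unfolding I_def using * by (intro CollectI exI[of _ "K \<union> K'"] exI[of _ k]) simp
  next
    fix a b assume "a \<in> A" "b \<in> I"
    then obtain K h where *: "b = (\<Sum>j\<in>K. h j * g j)" "finite K" "K \<subseteq> J" "\<forall>j\<in>K. h j \<in> A"
      by (auto simp: I_def)
    then have "a * b = (\<Sum>j\<in>K. (a * h j) * g j)" "\<forall>j\<in>K. a * h j \<in> A"
      using \<open>a \<in> A\<close> A' by (auto simp: sum_distrib_left mult.assoc)
    then show "a * b \<in> I"
      unfolding I_def using * by (intro CollectI exI[of _ K] exI[of _ "\<lambda>j. a * h j"]) simp
  qed
  have "\<exists>M\<in>{M. proper M \<and> I \<subseteq> M}. \<forall>X\<in>{M. proper M \<and> I \<subseteq> M}. M \<subseteq> X \<longrightarrow> X = M"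
  proof (rule subset_Zorn_nonempty)
    fix C assume C: "C \<noteq> {}" "subset.chain {M. proper M \<and> I \<subseteq> M} C"
    then have mem: "M \<in> C \<Longrightarrow> proper M" "M \<in> C \<Longrightarrow> I \<subseteq> M" for M
      by (auto simp: subset_chain_def)
    have lin: "M \<in> C \<Longrightarrow> N \<in> C \<Longrightarrow> M \<subseteq> N \<or> N \<subseteq> M" for M N
      using C(2) by (auto simp: subset_chain_def)
    have c1: "a + b \<in> \<Union>C" if ab: "a \<in> \<Union>C" "b \<in> \<Union>C" for a b
    proof -
      obtain M N where "M \<in> C" "N \<in> C" "a \<in> M" "b \<in> N" using ab by auto
      then obtain X where X: "X \<in> C" "a \<in> X" "b \<in> X" using lin by blast
      then have "a + b \<in> X" using mem(1) unfolding proper_def by metis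
      then show ?thesis using X by blast
    qed
    have c2: "a * b \<in> \<Union>C" if "a \<in> A" "b \<in> \<Union>C" for a b
      using that mem(1) unfolding proper_def by blast
    obtain X where X: "X \<in> C" using C(1) by blast
    have c3: "M \<subseteq> A" "0 \<in> M" "1 \<notin> M" if "M \<in> C" for M
      using mem(1)[OF that] unfolding proper_def by simp_all
    have c4: "\<Union>C \<subseteq> A" "1 \<notin> \<Union>C" by (rule Union_least, erule c3(1)) (simp add: c3(3))
    have c5: "0 \<in> \<Union>C" "I \<subseteq> \<Union>C" using UnionI[OF X c3(2)[OF X]] Union_upper[OF X] mem(2)[OF X] by (simp, blast)
    show "\<Union>C \<in> {M. proper M \<and> I \<subseteq> M}"
      unfolding proper_def by (intro CollectI conjI ballI c1 c2 c4 c5)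
  qed (use I in auto)
  then obtain M where M: "proper M" "I \<subseteq> M"
    and max': "\<forall>X\<in>{M. proper M \<and> I \<subseteq> M}. M \<subseteq> X \<longrightarrow> X = M" by auto
  have max: "X = M" if "proper X" "M \<subseteq> X" for X
    using that M(2) bspec[OF max', of X] by simp
  have MD: "M \<subseteq> A" "0 \<in> M" "1 \<notin> M" "\<And>a b. a \<in> M \<Longrightarrow> b \<in> M \<Longrightarrow> a + b \<in> M"
    "\<And>a b. a \<in> A \<Longrightarrow> b \<in> M \<Longrightarrow> a * b \<in> M"
    using M(1) by (auto simp: proper_def)
  \<comment> \<open>By maximality of \<open>M\<close>, an element outside \<open>M\<close> becomes
    invertible modulo \<open>M\<close>; the product of two such representations of 1 shows that
    \<open>M\<close> is prime.\<close>
  have unit: "\<exists>m\<in>M. \<exists>x\<in>A. m + x * a = 1" if a: "a \<in> A" "a \<notin> M" for a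
  proof (rule ccontr)
    assume no1: "\<not> ?thesis"
    define N where "N = {m + x * a |m x. m \<in> M \<and> x \<in> A}"
    have "proper N"
      unfolding proper_def
    proof (intro conjI ballI)
      show "N \<subseteq> A" using MD(1) a A' by (auto simp: N_def)
      show "0 \<in> N" unfolding N_def using MD(2) A'(1) by (intro CollectI exI[of _ 0]) auto
      show "1 \<notin> N"
      proof
        assume "1 \<in> N"
        then obtain m x where "1 = m + x * a" "m \<in> M" "x \<in> A" unfolding N_def by blast
        with no1 show False by metis
      qed
    next
      fix x y assume "x \<in> N" "y \<in> N"
      then obtain m b m' b' where *: "x = m + b * a" "y = m' + b' * a" "m \<in> M" "m' \<in> M" "b \<in> A" "b' \<in> A"
        by (auto simp: N_def)
      then have "x + y = (m + m') + (b + b') * a" by (simp add: algebra_simps)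
      then show "x + y \<in> N" unfolding N_def using * MD(4) A'(4) by blast
    next
      fix x y assume "x \<in> A" "y \<in> N"
      then obtain m b where *: "y = m + b * a" "m \<in> M" "b \<in> A" "x \<in> A" by (auto simp: N_def)
      then have "x * y = x * m + (x * b) * a" by (simp add: algebra_simps)
      then show "x * y \<in> N" unfolding N_def using * MD(5) A'(5) by blast
    qed
    moreover have "M \<subseteq> N"
    proof
      fix m assume "m \<in> M"
      then have "m = m + 0 * a" "m \<in> M" "0 \<in> A" using A' by auto
      then show "m \<in> N" unfolding N_def by blast
    qed
    ultimately have "N = M" by (rule max)
    moreover have "a = 0 + 1 * a" by simp
    then have "a \<in> N" unfolding N_def using MD(2) A'(2) by blast
    ultimately show False using a by simp
  qed
  have "M \<in> spec A"
    unfolding spec_iff[OF A]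
  proof (intro conjI ballI impI)
    fix a b assume ab: "a \<in> A" "b \<in> A" "a * b \<in> M"
    show "a \<in> M \<or> b \<in> M"
    proof (rule ccontr)
      assume "\<not> ?thesis"
      then obtain m x m' y where *: "m \<in> M" "x \<in> A" "m + x * a = 1" "m' \<in> M" "y \<in> A" "m' + y * b = 1"
        using unit[OF ab(1)] unit[OF ab(2)] by blast
      have "1 = (m + x * a) * (m' + y * b)" using * by simp
      also have "\<dots> = (m' + y * b) * m + ((x * a) * m' + (x * y) * (a * b))" by (simp add: algebra_simps)
      also have "\<dots> \<in> M"
        using * MD ab A' by (metis subsetD)
      finally show False using MD(3) by simp
    qed
  qed (use MD in auto)
  then obtain j where j: "j \<in> J" "g j \<notin> M" using cover by blast
  have "g j \<in> I"
    unfolding I_def using j A'(2) by (intro CollectI exI[of _ "{j}"] exI[of _ "\<lambda>_. 1"]) auto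
  then show False using M(2) j by auto
qed

text \<open>Replacing functions by powers does not change the primes that contain them, so the
  powers still generate the unit ideal. Coefficients outside the chosen subset are filled with
  0.\<close>

lemma partition_of_unity_power:
  assumes A: "subring_on A" and K: "finite K" "\<And>j. j \<in> K \<Longrightarrow> g j \<in> A" "\<And>j. j \<in> K \<Longrightarrow> h j \<in> A"
    and unit: "(\<Sum>j\<in>K. h j * g j) = 1"
  shows "\<exists>h'. (\<forall>j\<in>K. h' j \<in> A) \<and> (\<Sum>j\<in>K. h' j * g j ^ N) = 1"
proof -
  have "\<exists>L h'. finite L \<and> L \<subseteq> K \<and> (\<forall>j\<in>L. h' j \<in> A) \<and> (\<Sum>j\<in>L. h' j * g j ^ N) = 1"
  proof (rule partition_of_unity[OF A])
    fix p assume p: "p \<in> spec A"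
    note pD = specD[OF A p]
    have "\<exists>j\<in>K. g j \<notin> p"
    proof (rule ccontr)
      assume *: "\<not> ?thesis"
      have "(\<Sum>j\<in>L. h j * g j) \<in> p" if "L \<subseteq> K" for L
        using finite_subset[OF that K(1)] that
        by (induction L rule: finite_induct) (use pD * K in auto)
      from this[of K] show False using unit pD(3) by simp
    qed
    then obtain j where j: "j \<in> K" "g j \<notin> p" ..
    have "g j ^ N \<notin> p"
      using j pD not_in_prime_mult[OF A p] subring_onD(7)[OF A] K(2) by (induction N) auto
    then show "\<exists>j\<in>K. g j ^ N \<notin> p" using j by blast
  qed (use K subring_onD[OF A] in auto)
  then obtain L h' where L: "finite L" "L \<subseteq> K" "\<forall>j\<in>L. h' j \<in> A" "(\<Sum>j\<in>L. h' j * g j ^ N) = 1" by auto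
  have "(\<Sum>j\<in>K. (if j \<in> L then h' j else 0) * g j ^ N) = (\<Sum>j\<in>L. h' j * g j ^ N)"
    by (rule sum.mono_neutral_cong_right) (use L K in auto)
  then show ?thesis
    using L subring_onD(1)[OF A] by (intro exI[of _ "\<lambda>j. if j \<in> L then h' j else 0"]) auto
qed

section \<open>Monomial valuations on the function field of the torus\<close>

lemma embed_laurent_zero [simp]: "embed_laurent 0 = 0"
  by (simp add: embed_laurent_def Zero_fract_def)

lemma embed_laurent_inject [simp]: "embed_laurent f = embed_laurent g \<longleftrightarrow> f = g"
  by (simp add: embed_laurent_def eq_fract)

lemma embed_laurent_eq_0 [simp]: "embed_laurent f = 0 \<longleftrightarrow> f = 0"
  using embed_laurent_inject[of f 0] by simp

lemma embed_laurent_uminus: "embed_laurent (- f) = - embed_laurent f"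
  by (simp add: embed_laurent_def)

lemma embed_laurent_diff: "embed_laurent (f - g) = embed_laurent f - embed_laurent g"
  by (simp add: embed_laurent_def)

lemma embed_laurent_sum: "embed_laurent (sum f I) = (\<Sum>i\<in>I. embed_laurent (f i))"
  by (induction I rule: infinite_finite_induct) (simp_all add: embed_laurent_add)

lemma ratfun_quotient:
  fixes f :: "'d::finite ratfun"
  obtains a b where "b \<noteq> 0" "f = embed_laurent a / embed_laurent b"
  by (cases f) (metis embed_laurent_def divide_fract mult_1 mult_1_right zero_neq_one)

lemma subring_range_embed: "subring_on (range (embed_laurent :: 'd::finite laurent \<Rightarrow> _))"
  unfolding subring_on_def
proof (intro conjI ballI)
  fix x y assume "x \<in> range (embed_laurent :: 'd laurent \<Rightarrow> _)" "y \<in> range (embed_laurent :: 'd laurent \<Rightarrow> _)"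
  then show "x + y \<in> range (embed_laurent :: 'd laurent \<Rightarrow> _)" "x * y \<in> range (embed_laurent :: 'd laurent \<Rightarrow> _)"
    by (auto simp flip: embed_laurent_add embed_laurent_mult)
next
  show "0 \<in> range (embed_laurent :: 'd laurent \<Rightarrow> _)" "1 \<in> range (embed_laurent :: 'd laurent \<Rightarrow> _)"
    by (metis embed_laurent_zero rangeI) (metis embed_laurent_one rangeI)
qed (auto simp flip: embed_laurent_uminus)

definition monom :: "'d::finite character \<Rightarrow> 'd ratfun" where
  "monom m = embed_laurent (Poly_Mapping.single m 1)"

lemma monom_add: "monom (m + n) = monom m * monom n"
  by (simp add: monom_def mult_single flip: embed_laurent_mult)

lemma monom_zero: "monom 0 = 1"
  by (simp add: monom_def embed_laurent_one)

lemma monom_nonzero [simp]: "monom m \<noteq> 0"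
  by (simp add: monom_def flip: keys_eq_empty)

lemma inverse_monom: "inverse (monom m) = monom (- m)"
  using monom_add[of m "- m"] by (simp add: monom_zero inverse_unique)

section \<open>Splitting Laurent polynomials by their exponents\<close>

lift_definition part :: "('a \<Rightarrow> bool) \<Rightarrow> ('a \<Rightarrow>\<^sub>0 'b::zero) \<Rightarrow> 'a \<Rightarrow>\<^sub>0 'b" is
  "\<lambda>Q f k. if Q k then f k else 0"
  by (rule finite_subset) auto

lemma lookup_part: "Poly_Mapping.lookup (part Q a) k = (if Q k then Poly_Mapping.lookup a k else 0)"
  by transfer simp

lemma keys_part: "Poly_Mapping.keys (part Q a) = {k \<in> Poly_Mapping.keys a. Q k}"
  by (auto simp: in_keys_iff lookup_part split: if_splits)

lemma keys_diff_part:
  fixes a :: "'a \<Rightarrow>\<^sub>0 'b::ab_group_add"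
  shows "Poly_Mapping.keys (a - part Q a) = {k \<in> Poly_Mapping.keys a. \<not> Q k}"
  by (auto simp: in_keys_iff lookup_part lookup_minus split: if_splits)

lemma keys_mult_obtain:
  assumes "k \<in> Poly_Mapping.keys (a * b)"
  obtains m n where "m \<in> Poly_Mapping.keys a" "n \<in> Poly_Mapping.keys b" "k = m + n"
  using assms keys_mult[of a b] by blast

lemma keys_add_obtain:
  "k \<in> Poly_Mapping.keys (a + b) \<Longrightarrow> k \<in> Poly_Mapping.keys a \<or> k \<in> Poly_Mapping.keys b"
  using Poly_Mapping.keys_add[of a b] by blast

lemma keys_diff_obtain:
  fixes a b :: "'a \<Rightarrow>\<^sub>0 'b::ab_group_add"
  shows "k \<in> Poly_Mapping.keys (a - b) \<Longrightarrow> k \<in> Poly_Mapping.keys a \<or> k \<in> Poly_Mapping.keys b"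
  by (auto simp: in_keys_iff lookup_minus)

text \<open>The least weight of an exponent. For the zero polynomial this is the minimum of the
  empty set, whence the nonvanishing assumptions below.\<close>

definition low :: "('d character \<Rightarrow> int) \<Rightarrow> 'd::finite laurent \<Rightarrow> int" where
  "low w a = Min (w ` Poly_Mapping.keys a)"

lemma low_le: "m \<in> Poly_Mapping.keys a \<Longrightarrow> low w a \<le> w m"
  by (simp add: low_def)

lemma low_obtain:
  assumes "a \<noteq> 0"
  obtains m where "m \<in> Poly_Mapping.keys a" "w m = low w a"
proof -
  have "Min (w ` Poly_Mapping.keys a) \<in> w ` Poly_Mapping.keys a"
    using assms by (intro Min_in) auto
  then show ?thesis using that by (auto simp: low_def)
qed

lemma low_ge: "a \<noteq> 0 \<Longrightarrow> (\<And>m. m \<in> Poly_Mapping.keys a \<Longrightarrow> c \<le> w m) \<Longrightarrow> c \<le> low w a"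
  by (metis low_obtain)

lemma low_single: "c \<noteq> 0 \<Longrightarrow> low w (Poly_Mapping.single m c) = w m"
  by (simp add: low_def)

lemma low_add: "a + b \<noteq> 0 \<Longrightarrow> min (low w a) (low w b) \<le> low w (a + b)"
  by (rule low_ge) (auto dest!: keys_add_obtain simp: min_le_iff_disj intro: low_le)

text \<open>The parts \<open>a0\<close> and \<open>b0\<close> of lowest weight have a nonzero
  product, since the group algebra is a domain. A key of \<open>a0 * b0\<close> cannot be cancelled,
  because all remaining products have larger weight.\<close>

lemma low_mult:
  assumes w: "\<And>m n. w (m + n) = w m + w n" and ab: "a \<noteq> 0" "b \<noteq> 0"
  shows "low w (a * b) = low w a + low w b"
proof (rule antisym)
  show "low w a + low w b \<le> low w (a * b)"
  proof (rule low_ge)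
    fix k assume "k \<in> Poly_Mapping.keys (a * b)"
    then show "low w a + low w b \<le> w k"
      by (rule keys_mult_obtain) (simp add: w add_mono low_le)
  qed (use ab in simp)
  define a0 b0 where "a0 = part (\<lambda>m. w m = low w a) a" and "b0 = part (\<lambda>m. w m = low w b) b"
  define a1 b1 where "a1 = a - a0" and "b1 = b - b0"
  have part0: "part (\<lambda>m. w m = low w c) c \<noteq> 0" if c: "c \<noteq> 0" for c :: "'a laurent"
  proof -
    obtain m where "m \<in> Poly_Mapping.keys c" "w m = low w c" using low_obtain[OF c] by blast
    then have "m \<in> Poly_Mapping.keys (part (\<lambda>m. w m = low w c) c)" by (simp add: keys_part)
    then show ?thesis by force
  qed
  have "a0 \<noteq> 0" "b0 \<noteq> 0"
    unfolding a0_def b0_def by (intro part0 ab)+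
  then have "a0 * b0 \<noteq> 0" by simp
  then obtain k where k: "k \<in> Poly_Mapping.keys (a0 * b0)" by (metis all_not_in_conv keys_eq_empty)
  then have wk: "w k = low w a + low w b"
    by (rule keys_mult_obtain) (auto simp: a0_def b0_def keys_part w)
  have a1: "low w a < w m" if "m \<in> Poly_Mapping.keys a1" for m
    using that low_le[of m a w] by (auto simp: a1_def a0_def keys_diff_part less_le)
  have b1: "low w b < w m" if "m \<in> Poly_Mapping.keys b1" for m
    using that low_le[of m b w] by (auto simp: b1_def b0_def keys_diff_part less_le)
  have "k \<notin> Poly_Mapping.keys (a0 * b1 + a1 * b)"
  proof
    assume "k \<in> Poly_Mapping.keys (a0 * b1 + a1 * b)"
    from keys_add_obtain[OF this]
    consider "k \<in> Poly_Mapping.keys (a0 * b1)" | "k \<in> Poly_Mapping.keys (a1 * b)" by blast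
    then show False
    proof cases
      case 1
      then obtain m n where "m \<in> Poly_Mapping.keys a0" "n \<in> Poly_Mapping.keys b1" "k = m + n"
        by (rule keys_mult_obtain)
      then show False using wk b1[of n] by (auto simp: a0_def keys_part w)
    next
      case 2
      then obtain m n where "m \<in> Poly_Mapping.keys a1" "n \<in> Poly_Mapping.keys b" "k = m + n"
        by (rule keys_mult_obtain)
      then show False using wk a1[of m] low_le[of n b w] by (auto simp: w)
    qed
  qed
  moreover have "a * b = a0 * b0 + (a0 * b1 + a1 * b)"
    by (simp add: a1_def b1_def algebra_simps)
  ultimately have "k \<in> Poly_Mapping.keys (a * b)"
    using k by (simp add: in_keys_iff lookup_add)
  then show "low w (a * b) \<le> low w a + low w b"
    using low_le[of k "a * b" w] wk by simp
qed

definition monomial_valuation :: "('d::finite character \<Rightarrow> int) \<Rightarrow> 'd ratfun \<Rightarrow> int" where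
  "monomial_valuation w f =
     (THE k. \<exists>a b. a \<noteq> 0 \<and> b \<noteq> 0 \<and> f = embed_laurent a / embed_laurent b \<and> k = low w a - low w b)"

context
  fixes w :: "'d::finite character \<Rightarrow> int"
  assumes w: "\<And>m n. w (m + n) = w m + w n"
begin

lemma monomial_valuation_quotient:
  assumes "a \<noteq> 0" "b \<noteq> 0"
  shows "monomial_valuation w (embed_laurent a / embed_laurent b) = low w a - low w b"
  unfolding monomial_valuation_def
proof (rule the_equality)
  fix k assume "\<exists>a' b'. a' \<noteq> 0 \<and> b' \<noteq> 0 \<and> embed_laurent a / embed_laurent b = embed_laurent a' / embed_laurent b' \<and>
    k = low w a' - low w b'"
  then obtain a' b' where *: "a' \<noteq> 0" "b' \<noteq> 0" "k = low w a' - low w b'"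
    "embed_laurent a / embed_laurent b = embed_laurent a' / embed_laurent b'" by blast
  then have "embed_laurent (a * b') = embed_laurent (a' * b)"
    using assms by (simp add: embed_laurent_mult field_simps)
  then have "low w (a * b') = low w (a' * b)" by simp
  then show "k = low w a - low w b"
    using * assms by (simp add: low_mult[OF w])
qed (use assms in blast)

lemma monomial_valuation_embed:
  assumes "a \<noteq> 0"
  shows "monomial_valuation w (embed_laurent a) = low w a"
proof -
  have "w 0 = 0" using w[of 0 0] by simp
  then have "low w 1 = 0" using low_single[of 1 w 0] by simp
  then show ?thesis
    using monomial_valuation_quotient[OF assms, of 1] by (simp add: embed_laurent_one)
qed

lemma monomial_valuation_monom: "monomial_valuation w (monom m) = w m"
  by (simp add: monom_def monomial_valuation_embed low_single flip: keys_eq_empty)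

lemma monomial_valuation_mult:
  assumes "f \<noteq> 0" "g \<noteq> 0"
  shows "monomial_valuation w (f * g) = monomial_valuation w f + monomial_valuation w g"
proof -
  obtain a b where f: "b \<noteq> 0" "f = embed_laurent a / embed_laurent b" by (rule ratfun_quotient)
  obtain c d where g: "d \<noteq> 0" "g = embed_laurent c / embed_laurent d" by (rule ratfun_quotient)
  have "f * g = embed_laurent (a * c) / embed_laurent (b * d)"
    by (simp add: f g embed_laurent_mult)
  then show ?thesis
    using assms f g by (simp add: monomial_valuation_quotient low_mult[OF w])
qed

lemma monomial_valuation_add:
  assumes "f \<noteq> 0" "g \<noteq> 0" "f + g \<noteq> 0"
  shows "min (monomial_valuation w f) (monomial_valuation w g) \<le> monomial_valuation w (f + g)"
proof -
  obtain a b where f: "b \<noteq> 0" "f = embed_laurent a / embed_laurent b" by (rule ratfun_quotient)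
  obtain c d where g: "d \<noteq> 0" "g = embed_laurent c / embed_laurent d" by (rule ratfun_quotient)
  have eq: "f + g = embed_laurent (a * d + c * b) / embed_laurent (b * d)"
    using f g by (simp add: embed_laurent_mult embed_laurent_add field_simps)
  then have "a * d + c * b \<noteq> 0" using assms(3) by auto
  moreover have "a \<noteq> 0" "c \<noteq> 0" using f g assms by auto
  ultimately show ?thesis
    using f g low_add[of "a * d" "c * b" w] unfolding eq
    by (simp add: monomial_valuation_quotient low_mult[OF w])
qed

lemma discrete_monomial_valuation:
  assumes "w m = 1"
  shows "discrete_valuation (monomial_valuation w)"
  unfolding discrete_valuation_def
  using monomial_valuation_mult monomial_valuation_add monomial_valuation_monom[of m] assms
  by (metis monom_nonzero)

end

section \<open>The coordinate ring of the torus as an intersection of discrete valuation rings\<close>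

subsection \<open>Pseudo-division in one variable\<close>

definition ex :: "'d \<Rightarrow> 'd::finite character \<Rightarrow> int" where
  "ex i m = exponent m $ i"

lemma ex_add: "ex i (m + n) = ex i m + ex i n"
  by (simp add: ex_def plus_character.rep_eq)

lemma ex_zero: "ex i 0 = 0"
  by (simp add: ex_def zero_character.rep_eq)

lemma character_eq_iff: "m = n \<longleftrightarrow> (\<forall>i. ex i m = ex i n)"
  by (simp add: ex_def vec_eq_iff flip: exponent_inject)

definition axis_character :: "'d \<Rightarrow> int \<Rightarrow> 'd::finite character" where
  "axis_character i k = Character (axis i k)"

lemma ex_axis: "ex j (axis_character i k) = (if j = i then k else 0)"
  by (simp add: ex_def axis_character_def Character_inverse axis_def)

definition free :: "'d \<Rightarrow> 'd::finite laurent \<Rightarrow> bool" where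
  "free i a \<longleftrightarrow> (\<forall>m\<in>Poly_Mapping.keys a. ex i m = 0)"

lemma free_mult: "free i a \<Longrightarrow> free i b \<Longrightarrow> free i (a * b)"
  by (auto simp: free_def ex_add elim!: keys_mult_obtain)

lemma free_one: "free i 1"
  by (simp add: free_def ex_zero)

text \<open>Top degree minus bottom degree in the variable \<open>i\<close>. Powers of the variable
  are units, so this difference, rather than the degree, is the Euclidean function for Laurent
  polynomials.\<close>

definition width :: "'d \<Rightarrow> 'd::finite laurent \<Rightarrow> int" where
  "width i a = - low (\<lambda>m. - ex i m) a - low (ex i) a"

lemma low_uminus_ex_mult: "a \<noteq> 0 \<Longrightarrow> b \<noteq> 0 \<Longrightarrow>
  low (\<lambda>m. - ex i m) (a * b) = low (\<lambda>m. - ex i m) a + low (\<lambda>m. - ex i m) b"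
  by (rule low_mult) (auto simp: ex_add)

lemma width_mult: "a \<noteq> 0 \<Longrightarrow> b \<noteq> 0 \<Longrightarrow> width i (a * b) = width i a + width i b"
  by (simp add: width_def low_uminus_ex_mult low_mult ex_add)

lemma width_nonneg:
  assumes "a \<noteq> 0"
  shows "0 \<le> width i a"
proof -
  obtain m where m: "m \<in> Poly_Mapping.keys a" "ex i m = low (ex i) a"
    using low_obtain[OF assms] by blast
  then show ?thesis using low_le[OF m(1), of "\<lambda>m. - ex i m"] by (simp add: width_def)
qed

lemma width_free:
  assumes "free i a" "a \<noteq> 0"
  shows "width i a = 0"
proof -
  obtain m where m: "m \<in> Poly_Mapping.keys a" "ex i m = low (ex i) a"
    using low_obtain[OF assms(2)] by blast
  obtain n where n: "n \<in> Poly_Mapping.keys a" "- ex i n = low (\<lambda>m. - ex i m) a"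
    using low_obtain[OF assms(2), of "\<lambda>m. - ex i m"] by blast
  show ?thesis using m n assms(1) by (simp add: width_def free_def flip: m(2) n(2))
qed

lemma width_le:
  assumes "a \<noteq> 0" "\<And>m. m \<in> Poly_Mapping.keys a \<Longrightarrow> l \<le> ex i m \<and> ex i m \<le> k"
  shows "width i a \<le> k - l"
proof -
  have "l \<le> low (ex i) a" "- k \<le> low (\<lambda>m. - ex i m) a"
    using assms by (auto intro!: low_ge)
  then show ?thesis by (simp add: width_def)
qed

text \<open>Cross-multiplication with leading terms: \<open>c\<close> is the leading coefficient of
  \<open>b\<close>, and \<open>q\<close> is the leading term of \<open>a\<close> times the power
  \<open>- l\<close> of the variable. The top degree cancels, while
  \<open>width i b \<le> width i a\<close> prevents the bottom degree from dropping.\<close>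

lemma reduction_step:
  fixes a b :: "'d::finite laurent"
  assumes ab: "a \<noteq> 0" "b \<noteq> 0" "width i b \<le> width i a"
  shows "\<exists>c q. c \<noteq> 0 \<and> free i c \<and> (\<forall>j. free j b \<longrightarrow> free j c) \<and>
    (c * a - q * b = 0 \<or> width i (c * a - q * b) < width i a)"
proof -
  define k l where "k = - low (\<lambda>m. - ex i m) a" and "l = - low (\<lambda>m. - ex i m) b"
  define s where "s = Poly_Mapping.single (axis_character i (- l)) (1::complex)"
  define a0 b0 where "a0 = part (\<lambda>m. ex i m = k) a" and "b0 = part (\<lambda>m. ex i m = l) b"
  define a1 b1 where "a1 = a - a0" and "b1 = b - b0"
  define c q where "c = b0 * s" and "q = a0 * s"
  have top: "ex i m \<le> k" if "m \<in> Poly_Mapping.keys a" for m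
    using low_le[OF that, of "\<lambda>m. - ex i m"] by (simp add: k_def)
  have topb: "ex i m \<le> l" if "m \<in> Poly_Mapping.keys b" for m
    using low_le[OF that, of "\<lambda>m. - ex i m"] by (simp add: l_def)
  have s: "Poly_Mapping.keys s = {axis_character i (- l)}" by (simp add: s_def)
  obtain m where "m \<in> Poly_Mapping.keys b" "- ex i m = low (\<lambda>m. - ex i m) b"
    using low_obtain[OF ab(2), of "\<lambda>m. - ex i m"] by blast
  then have "m \<in> Poly_Mapping.keys b0" by (simp add: b0_def l_def keys_part flip: minus_equation_iff)
  then have "b0 \<noteq> 0" by force
  moreover have "s \<noteq> 0" using s by (metis insert_not_empty keys_zero)
  ultimately have "c \<noteq> 0" by (simp add: c_def)
  moreover have c0: "ex i m = 0" if "m \<in> Poly_Mapping.keys c" for m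
    using that unfolding c_def
    by (rule keys_mult_obtain) (auto simp: b0_def keys_part s ex_add ex_axis)
  moreover have "free j c" if "free j b" for j
  proof (cases "j = i")
    case False
    then show ?thesis
      using that unfolding c_def free_def
      by (auto simp: b0_def keys_part s ex_add ex_axis elim!: keys_mult_obtain)
  qed (use c0 in \<open>simp add: free_def\<close>)
  moreover have "width i (c * a - q * b) < width i a" if ne: "c * a - q * b \<noteq> 0"
  proof -
    have eq: "c * a - q * b = c * a1 - q * b1"
      by (simp add: c_def q_def a1_def b1_def algebra_simps)
    have "low (ex i) a \<le> ex i m \<and> ex i m \<le> k - 1" if "m \<in> Poly_Mapping.keys (c * a1 - q * b1)" for m
      using keys_diff_obtain[OF that]
    proof
      assume "m \<in> Poly_Mapping.keys (c * a1)"
      then obtain x y where xy: "x \<in> Poly_Mapping.keys c" "y \<in> Poly_Mapping.keys a1" "m = x + y"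
        by (rule keys_mult_obtain)
      then have "y \<in> Poly_Mapping.keys a" "ex i y \<noteq> k" by (auto simp: a1_def a0_def keys_diff_part)
      then show ?thesis
        using xy c0[of x] top[of y] low_le[of y a "ex i"] by (simp add: ex_add)
    next
      assume "m \<in> Poly_Mapping.keys (q * b1)"
      then obtain x y where xy: "x \<in> Poly_Mapping.keys q" "y \<in> Poly_Mapping.keys b1" "m = x + y"
        by (rule keys_mult_obtain)
      then have "y \<in> Poly_Mapping.keys b" "ex i y \<noteq> l" by (auto simp: b1_def b0_def keys_diff_part)
      moreover have "ex i x = k - l"
        using xy(1) unfolding q_def
        by (rule keys_mult_obtain) (auto simp: a0_def keys_part s ex_add ex_axis)
      ultimately show ?thesis
        using xy topb[of y] low_le[of y b "ex i"] ab(3) by (simp add: ex_add width_def k_def l_def)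
    qed
    then have "width i (c * a1 - q * b1) \<le> k - 1 - low (ex i) a"
      using ne unfolding eq by (intro width_le) auto
    then show ?thesis unfolding eq by (simp add: width_def k_def)
  qed
  ultimately show ?thesis unfolding free_def by blast
qed

text \<open>Euclidean division over the rational functions in the other variables, with denominators
  cleared by \<open>c\<close>. That \<open>c\<close> misses every variable missing in
  \<open>b\<close> permits the induction over the variables in
  \<open>Inter_univariate_ring\<close>.\<close>

lemma pseudo_division:
  fixes a b :: "'d::finite laurent"
  assumes b: "b \<noteq> 0"
  shows "\<exists>c q r. c \<noteq> 0 \<and> free i c \<and> (\<forall>j. free j b \<longrightarrow> free j c) \<and>
    c * a = q * b + r \<and> (r = 0 \<or> width i r < width i b)"
proof (induction "nat (width i a)" arbitrary: a rule: less_induct)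
  case less
  show ?case
  proof (cases "a = 0 \<or> width i a < width i b")
    case True
    then show ?thesis
      by (intro exI[of _ 1] exI[of _ 0] exI[of _ a]) (auto simp: free_one)
  next
    case False
    then obtain c q where c: "c \<noteq> 0" "free i c" "\<forall>j. free j b \<longrightarrow> free j c"
      and less_w: "c * a - q * b = 0 \<or> width i (c * a - q * b) < width i a"
      using reduction_step[of a b i] b by auto
    show ?thesis
    proof (cases "c * a - q * b = 0")
      case True
      then show ?thesis
        using c by (intro exI[of _ c] exI[of _ q] exI[of _ 0]) simp
    next
      case ne: False
      then have "nat (width i (c * a - q * b)) < nat (width i a)"
        using less_w width_nonneg[OF ne, of i] by linarith
      from less[OF this] obtain d p r where d: "d \<noteq> 0" "free i d" "\<forall>j. free j b \<longrightarrow> free j d"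
        "d * (c * a - q * b) = p * b + r" "r = 0 \<or> width i r < width i b" by blast
      then have "(d * c) * a = (p + d * q) * b + r" by (simp add: algebra_simps)
      then show ?thesis
        using c d by (intro exI[of _ "d * c"] exI[of _ "p + d * q"] exI[of _ r]) (auto intro: free_mult)
    qed
  qed
qed

subsection \<open>The valuations of a Euclidean ring\<close>

text \<open>A Euclidean domain inside its quotient field. The norm is additive on the nonzero
  elements of the whole field, so norm 0 in \<open>B\<close> characterizes the units and a proper
  factor has strictly smaller norm.\<close>

locale euclidean_subring =
  fixes B :: "'k::field set" and N :: "'k \<Rightarrow> int"
  assumes subring: "subring_on B"
    and quotient: "\<And>f. \<exists>a\<in>B. \<exists>b\<in>B. b \<noteq> 0 \<and> f = a / b"
    and N_mult: "\<And>f g. f \<noteq> 0 \<Longrightarrow> g \<noteq> 0 \<Longrightarrow> N (f * g) = N f + N g"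
    and N_nonneg: "\<And>f. f \<in> B \<Longrightarrow> f \<noteq> 0 \<Longrightarrow> 0 \<le> N f"
    and N_unit: "\<And>f. f \<in> B \<Longrightarrow> f \<noteq> 0 \<Longrightarrow> N f = 0 \<Longrightarrow> inverse f \<in> B"
    and division: "\<And>a b. a \<in> B \<Longrightarrow> b \<in> B \<Longrightarrow> b \<noteq> 0 \<Longrightarrow> \<exists>q\<in>B. a - q * b = 0 \<or> N (a - q * b) < N b"
begin

lemmas B = subring_onD[OF subring]

definition irr :: "'k \<Rightarrow> bool" where
  "irr \<pi> \<longleftrightarrow> \<pi> \<in> B \<and> \<pi> \<noteq> 0 \<and> 0 < N \<pi> \<and> (\<forall>a\<in>B. \<forall>b\<in>B. \<pi> = a * b \<longrightarrow> N a = 0 \<or> N b = 0)"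

definition multiples :: "'k \<Rightarrow> 'k set" where
  "multiples \<pi> = {\<pi> * b |b. b \<in> B}"

lemma multiplesI: "b \<in> B \<Longrightarrow> \<pi> * b \<in> multiples \<pi>"
  by (auto simp: multiples_def)

lemma multiplesE:
  assumes "f \<in> multiples \<pi>"
  obtains b where "b \<in> B" "f = \<pi> * b"
  using assms by (auto simp: multiples_def)

lemma zero_in_multiples: "0 \<in> multiples \<pi>"
  using multiplesI[OF B(1), of \<pi>] by simp

lemma multiples_absorb: "f \<in> multiples \<pi> \<Longrightarrow> b \<in> B \<Longrightarrow> f * b \<in> multiples \<pi>"
  by (metis multiplesE multiplesI B(5) mult.assoc)

text \<open>A nonzero element of least norm divides all others, as a remainder would have smaller
  norm. Closure under \<open>x - q * y\<close> is the ideal property in the form in which division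
  produces it.\<close>

lemma generator:
  assumes S: "g \<in> S" "g \<noteq> 0" "S \<subseteq> B"
    and closed: "\<And>x y q. x \<in> S \<Longrightarrow> y \<in> S \<Longrightarrow> q \<in> B \<Longrightarrow> x - q * y \<in> S"
  obtains c where "c \<in> S" "c \<noteq> 0" "\<And>x. x \<in> S \<Longrightarrow> x \<in> multiples c"
proof -
  define c where "c = (ARG_MIN (\<lambda>x. nat (N x)) x. x \<in> S \<and> x \<noteq> 0)"
  have c: "c \<in> S \<and> c \<noteq> 0" and min: "\<And>x. x \<in> S \<and> x \<noteq> 0 \<Longrightarrow> nat (N c) \<le> nat (N x)"
    using arg_min_nat_lemma[of "\<lambda>x. x \<in> S \<and> x \<noteq> 0" g "\<lambda>x. nat (N x)"] S by (auto simp: c_def)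
  have "x \<in> multiples c" if x: "x \<in> S" for x
  proof -
    have xB: "x \<in> B" and cB: "c \<in> B" using x c S by auto
    obtain q where q: "q \<in> B" "x - q * c = 0 \<or> N (x - q * c) < N c"
      using division[OF xB cB] c by blast
    have "x - q * c = 0"
    proof (rule ccontr)
      assume ne: "x - q * c \<noteq> 0"
      have mem: "x - q * c \<in> S" using closed x c q by blast
      then have "nat (N c) \<le> nat (N (x - q * c))" using min ne by blast
      moreover have "0 \<le> N (x - q * c)" using mem ne S by (intro N_nonneg) auto
      ultimately show False using q ne by linarith
    qed
    then have "x = c * q" by (simp add: mult.commute)
    then show ?thesis using q multiplesI by blast
  qed
  then show ?thesis using that c by blast
qed

lemma irr_dvd:
  assumes "f \<in> B" "f \<noteq> 0" "0 < N f"
  shows "\<exists>\<pi>. irr \<pi> \<and> f \<in> multiples \<pi>"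
  using assms
proof (induction "nat (N f)" arbitrary: f rule: less_induct)
  case less
  show ?case
  proof (cases "irr f")
    case True
    then show ?thesis using multiplesI[OF B(2), of f] by auto
  next
    case False
    then obtain a b where ab: "a \<in> B" "b \<in> B" "f = a * b" "N a \<noteq> 0" "N b \<noteq> 0"
      using less.prems by (auto simp: irr_def)
    then have ne: "a \<noteq> 0" "b \<noteq> 0" using less.prems by auto
    then have pos: "0 < N a" "0 < N b" using ab N_nonneg by (metis order_le_less)+
    then have "nat (N a) < nat (N f)" using ab ne by (simp add: N_mult)
    then obtain \<pi> where "irr \<pi>" "a \<in> multiples \<pi>" using less.hyps[of a] ab ne pos by blast
    then show ?thesis using ab multiples_absorb by blast
  qed
qed

context
  fixes \<pi> :: 'k
  assumes irr: "irr \<pi>"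
begin

lemma irr_facts: "\<pi> \<in> B" "\<pi> \<noteq> 0" "0 < N \<pi>"
  using irr by (auto simp: irr_def)

text \<open>The ideal generated by \<open>\<pi>\<close> and \<open>b\<close> is principal, with
  generator \<open>g\<close>. If \<open>g\<close> is not a unit, irreducibility makes it an
  associate of \<open>\<pi>\<close>, so \<open>\<pi>\<close> divides \<open>b\<close>; if it is a
  unit, a Bezout identity multiplied by \<open>a\<close> shows that \<open>\<pi>\<close> divides
  \<open>a\<close>.\<close>

lemma irr_prime:
  assumes ab: "a \<in> B" "b \<in> B" "a * b \<in> multiples \<pi>"
  shows "a \<in> multiples \<pi> \<or> b \<in> multiples \<pi>"
proof (rule disjCI)
  assume nb: "b \<notin> multiples \<pi>"
  define S where "S = {u * \<pi> + t * b |u t. u \<in> B \<and> t \<in> B}"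
  have "\<pi> = 1 * \<pi> + 0 * b" "b = 0 * \<pi> + 1 * b" by simp_all
  then have S: "\<pi> \<in> S" "b \<in> S"
    unfolding S_def using B(1,2) by blast+
  have sub: "S \<subseteq> B" using irr_facts ab B by (auto simp: S_def)
  have closed: "x - q * y \<in> S" if xy: "x \<in> S" "y \<in> S" and q: "q \<in> B" for x y q
  proof -
    obtain u t u' t' where *: "x = u * \<pi> + t * b" "y = u' * \<pi> + t' * b" "u \<in> B" "t \<in> B" "u' \<in> B" "t' \<in> B"
      using xy by (auto simp: S_def)
    then have "x - q * y = (u - q * u') * \<pi> + (t - q * t') * b" by (simp add: algebra_simps)
    moreover have "u - q * u' \<in> B" "t - q * t' \<in> B" using * B q by auto
    ultimately show ?thesis unfolding S_def by blast
  qed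
  obtain g where g: "g \<in> S" "g \<noteq> 0" "\<And>x. x \<in> S \<Longrightarrow> x \<in> multiples g"
    using generator[OF S(1) irr_facts(2) sub closed] by blast
  obtain q where q: "q \<in> B" "\<pi> = g * q" using g(3)[OF S(1)] by (rule multiplesE)
  obtain r where r: "r \<in> B" "b = g * r" using g(3)[OF S(2)] by (rule multiplesE)
  have gB: "g \<in> B" using g sub by auto
  have "N g = 0"
  proof (rule ccontr)
    assume "N g \<noteq> 0"
    then have "N q = 0" using irr q gB unfolding irr_def by blast
    moreover have "q \<noteq> 0" using q irr_facts by auto
    ultimately have "inverse q \<in> B" using N_unit q by blast
    moreover have "b = \<pi> * (inverse q * r)" using q r \<open>q \<noteq> 0\<close> by simp
    ultimately show False using nb multiplesI B(5) r by metis
  qed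
  then have inv: "inverse g \<in> B" using N_unit gB g by blast
  obtain u t where ut: "g = u * \<pi> + t * b" "u \<in> B" "t \<in> B" using g(1) by (auto simp: S_def)
  obtain x where x: "x \<in> B" "a * b = \<pi> * x" using ab(3) by (rule multiplesE)
  have "a = inverse g * (g * a)" using g by simp
  also have "\<dots> = inverse g * (u * a * \<pi> + t * (a * b))" by (subst ut(1)) (simp add: algebra_simps)
  also have "\<dots> = \<pi> * (inverse g * (u * a + t * x))" by (simp add: x algebra_simps)
  finally show "a \<in> multiples \<pi>"
    using multiplesI inv ut x ab B by metis
qed

lemma factor_out:
  assumes "f \<in> B" "f \<noteq> 0"
  shows "\<exists>k b. b \<in> B \<and> b \<notin> multiples \<pi> \<and> f = \<pi> ^ k * b"
  using assms
proof (induction "nat (N f)" arbitrary: f rule: less_induct)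
  case less
  show ?case
  proof (cases "f \<in> multiples \<pi>")
    case True
    then obtain g where g: "g \<in> B" "f = \<pi> * g" by (rule multiplesE)
    then have "g \<noteq> 0" using less by auto
    then have "nat (N g) < nat (N f)"
      using g irr_facts N_nonneg[of g] by (simp add: N_mult)
    then obtain k b where "b \<in> B \<and> b \<notin> multiples \<pi> \<and> g = \<pi> ^ k * b" using less.hyps g \<open>g \<noteq> 0\<close> by blast
    then show ?thesis using g by (intro exI[of _ "Suc k"] exI[of _ b]) (simp add: mult.assoc)
  next
    case False
    then show ?thesis using less by (intro exI[of _ 0] exI[of _ f]) simp
  qed
qed

definition order :: "'k \<Rightarrow> int" where
  "order f = (THE k. \<exists>a b. a \<in> B - multiples \<pi> \<and> b \<in> B - multiples \<pi> \<and> f = \<pi> powi k * (a / b))"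

lemma not_multiple_mult: "a \<in> B - multiples \<pi> \<Longrightarrow> b \<in> B - multiples \<pi> \<Longrightarrow> a * b \<in> B - multiples \<pi>"
  using irr_prime B(5) by blast

lemma not_multiple_nonzero: "a \<in> B - multiples \<pi> \<Longrightarrow> a \<noteq> 0"
  using zero_in_multiples by auto

lemma one_not_multiple: "1 \<in> B - multiples \<pi>"
proof -
  have "1 \<notin> multiples \<pi>"
  proof
    assume "1 \<in> multiples \<pi>"
    then obtain b where b: "b \<in> B" "1 = \<pi> * b" by (rule multiplesE)
    then have "b \<noteq> 0" by auto
    have "N 1 = 0" using N_mult[of 1 1] by simp
    then have "N \<pi> + N b = 0" using b N_mult[of \<pi> b] \<open>b \<noteq> 0\<close> irr_facts by simp
    then show False using N_nonneg[OF b(1)] \<open>b \<noteq> 0\<close> irr_facts by simp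
  qed
  then show ?thesis using B(2) by simp
qed

lemma order_eq:
  assumes ab: "a \<in> B - multiples \<pi>" "b \<in> B - multiples \<pi>"
  shows "order (\<pi> powi k * (a / b)) = k"
  unfolding order_def
proof (rule the_equality)
  have *: False if "a \<in> B - multiples \<pi>" "b \<in> B - multiples \<pi>" "c \<in> B - multiples \<pi>" "d \<in> B - multiples \<pi>"
    "\<pi> powi k * (a / b) = \<pi> powi l * (c / d)" "l < k" for a b c d k l
  proof -
    define n where "n = nat (k - l) - 1"
    have "k = l + 1 + int n" using that(6) by (simp add: n_def)
    then have "\<pi> powi k = \<pi> powi l * (\<pi> * \<pi> ^ n)"
      using irr_facts by (simp add: power_int_add mult.assoc)
    then have "\<pi> powi l * (\<pi> * \<pi> ^ n * a / b) = \<pi> powi l * (c / d)" using that by (simp add: mult.assoc)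
    then have "\<pi> * \<pi> ^ n * a / b = c / d"
      using irr_facts(2) by (metis mult_left_cancel power_int_not_zero)
    then have "c * b = \<pi> * (\<pi> ^ n * (a * d))"
      using not_multiple_nonzero[OF that(2)] not_multiple_nonzero[OF that(4)] by (simp add: field_simps)
    moreover have "\<pi> ^ n * (a * d) \<in> B" using that irr_facts B by auto
    ultimately show False using not_multiple_mult[OF that(3) that(2)] multiplesI by auto
  qed
  fix l assume "\<exists>c d. c \<in> B - multiples \<pi> \<and> d \<in> B - multiples \<pi> \<and> \<pi> powi k * (a / b) = \<pi> powi l * (c / d)"
  then obtain c d where "c \<in> B - multiples \<pi>" "d \<in> B - multiples \<pi>" "\<pi> powi k * (a / b) = \<pi> powi l * (c / d)" by blast
  then show "l = k"
    using *[OF ab, of c d k l] *[of c d a b l k] ab by (metis linorder_neqE_linordered_idom)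
qed (use ab in blast)

lemma order_form:
  assumes "f \<noteq> 0"
  obtains k a b where "a \<in> B - multiples \<pi>" "b \<in> B - multiples \<pi>" "f = \<pi> powi k * (a / b)" "order f = k"
proof -
  obtain a b where ab: "a \<in> B" "b \<in> B" "b \<noteq> 0" "f = a / b" using quotient by blast
  then have "a \<noteq> 0" using assms by auto
  obtain k c where c: "c \<in> B" "c \<notin> multiples \<pi>" "a = \<pi> ^ k * c" using factor_out ab \<open>a \<noteq> 0\<close> by blast
  obtain l d where d: "d \<in> B" "d \<notin> multiples \<pi>" "b = \<pi> ^ l * d" using factor_out ab by blast
  have "f = \<pi> powi (int k - int l) * (c / d)"
    using ab(4) c(3) d(3) irr_facts by (simp add: power_int_diff)
  moreover from this have "order f = int k - int l" using order_eq c d by simp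
  ultimately show ?thesis using that c d by blast
qed

lemma order_mult:
  assumes "f \<noteq> 0" "g \<noteq> 0"
  shows "order (f * g) = order f + order g"
proof -
  obtain k a b where f: "a \<in> B - multiples \<pi>" "b \<in> B - multiples \<pi>" "f = \<pi> powi k * (a / b)" "order f = k"
    using order_form[OF assms(1)] by blast
  obtain l c d where g: "c \<in> B - multiples \<pi>" "d \<in> B - multiples \<pi>" "g = \<pi> powi l * (c / d)" "order g = l"
    using order_form[OF assms(2)] by blast
  have eq: "f * g = \<pi> powi (k + l) * ((a * c) / (b * d))"
    using f(3) g(3) irr_facts by (simp add: power_int_add)
  show ?thesis
    unfolding eq f(4) g(4) by (rule order_eq[OF not_multiple_mult[OF f(1) g(1)] not_multiple_mult[OF f(2) g(2)]])
qed

lemma order_one: "order 1 = 0"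
  using order_eq[OF one_not_multiple one_not_multiple, of 0] by simp

lemma order_nonneg:
  assumes "f \<in> B" "f \<noteq> 0"
  shows "0 \<le> order f"
proof -
  obtain k b where "b \<in> B" "b \<notin> multiples \<pi>" "f = \<pi> ^ k * b" using factor_out[OF assms] by blast
  then show ?thesis using order_eq[of b 1 "int k"] one_not_multiple by simp
qed

lemma order_not_multiple: "b \<in> B - multiples \<pi> \<Longrightarrow> order b = 0"
  using order_eq[of b 1 0] one_not_multiple by simp

lemma order_generator: "order \<pi> = 1"
  using order_eq[of 1 1 1] one_not_multiple by simp

lemma order_add:
  assumes "f \<noteq> 0" "g \<noteq> 0" "f + g \<noteq> 0"
  shows "min (order f) (order g) \<le> order (f + g)"
proof -
  have *: "order f \<le> order (f + g)" if le: "order f \<le> order g" and nz: "f \<noteq> 0" "g \<noteq> 0" "f + g \<noteq> 0" for f g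
  proof -
    obtain k a b where f: "a \<in> B - multiples \<pi>" "b \<in> B - multiples \<pi>" "f = \<pi> powi k * (a / b)" "order f = k"
      using order_form[OF nz(1)] by blast
    obtain l c d where g: "c \<in> B - multiples \<pi>" "d \<in> B - multiples \<pi>" "g = \<pi> powi l * (c / d)" "order g = l"
      using order_form[OF nz(2)] by blast
    define n where "n = nat (l - k)"
    have l: "l = k + int n" using le f g by (simp add: n_def)
    note bd = not_multiple_mult[OF f(2) g(2)]
    define e where "e = a * d + \<pi> ^ n * (c * b)"
    have eq: "f + g = \<pi> powi k * (e / (b * d))"
      using f(3) g(3) irr_facts not_multiple_nonzero[OF f(2)] not_multiple_nonzero[OF g(2)]
      by (simp add: l e_def power_int_add field_simps)
    have "e \<in> B" using f g irr_facts B by (auto simp: e_def)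
    moreover have "e \<noteq> 0" using eq nz by auto
    ultimately have "0 \<le> order e" by (rule order_nonneg)
    moreover have "f + g = (\<pi> powi k * (1 / (b * d))) * e" using eq by simp
    then have "order (f + g) = order (\<pi> powi k * (1 / (b * d))) + order e"
      using order_mult[of "\<pi> powi k * (1 / (b * d))" e] \<open>e \<noteq> 0\<close> irr_facts not_multiple_nonzero[OF bd] by simp
    ultimately show ?thesis using order_eq[OF one_not_multiple bd, of k] f by simp
  qed
  show ?thesis
    using *[OF _ assms] *[of g f] assms by (cases "order f \<le> order g") (auto simp: add.commute)
qed

lemma discrete_order: "discrete_valuation order"
  unfolding discrete_valuation_def
  using order_mult order_add order_generator irr_facts(2) by blast

lemma order_localization:
  assumes "f \<noteq> 0" "0 \<le> order f"
  shows "\<exists>a\<in>B. \<exists>s\<in>B - multiples \<pi>. f = a / s"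
proof -
  obtain k a b where f: "a \<in> B - multiples \<pi>" "b \<in> B - multiples \<pi>" "f = \<pi> powi k * (a / b)" "order f = k"
    using order_form[OF assms(1)] by blast
  then have "f = (\<pi> ^ nat k * a) / b" using assms(2) by (simp add: power_int_def)
  moreover have "\<pi> ^ nat k * a \<in> B" using f irr_facts B by auto
  ultimately show ?thesis using f by blast
qed

text \<open>At 0 the definite description has no solution, so the value is the same default for
  every irreducible element. This lets \<open>order_cong\<close> be an equality of
  functions.\<close>

lemma order_zero: "order 0 = (THE k. False)"
proof -
  have "\<not> (\<exists>a b. a \<in> B - multiples \<pi> \<and> b \<in> B - multiples \<pi> \<and> 0 = \<pi> powi k * (a / b))" for k
    using not_multiple_nonzero irr_facts by (metis divide_eq_0_iff mult_eq_0_iff power_int_not_zero)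
  then show ?thesis unfolding order_def by (intro arg_cong[where f = The] ext) blast
qed

end

text \<open>Associated irreducibles have the same valuation ring, and \<open>valuation\<close>
  recovers the order function from that ring. Thus \<open>orders\<close> does not count associates
  separately, which the finiteness of zeros and poles depends on.\<close>

lemma order_cong:
  assumes "irr \<pi>" "irr \<rho>" "multiples \<pi> = multiples \<rho>"
  shows "order \<pi> = order \<rho>"
proof
  have ring: "val_ring (order \<pi>) = {a / s |a s. a \<in> B \<and> s \<in> B - multiples \<pi>}" if \<pi>: "irr \<pi>" for \<pi>
  proof (intro equalityI subsetI)
    fix f assume f: "f \<in> val_ring (order \<pi>)"
    show "f \<in> {a / s |a s. a \<in> B \<and> s \<in> B - multiples \<pi>}"
    proof (cases "f = 0")
      case True
      then have "f = 0 / 1" by simp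
      then show ?thesis using one_not_multiple[OF \<pi>] B(1) by blast
    qed (use f order_localization[OF \<pi>, of f] in \<open>auto simp: val_ring_def\<close>)
  next
    fix f assume "f \<in> {a / s |a s. a \<in> B \<and> s \<in> B - multiples \<pi>}"
    then obtain a s where *: "f = a / s" "a \<in> B" "s \<in> B - multiples \<pi>" by auto
    then show "f \<in> val_ring (order \<pi>)"
      using order_nonneg[OF \<pi>, of a] order_not_multiple[OF \<pi>, of s] not_multiple_nonzero[OF \<pi>, of s]
        val_divide[OF discrete_order[OF \<pi>]]
      by (auto simp: val_ring_def)
  qed
  fix f
  show "order \<pi> f = order \<rho> f"
  proof (cases "f = 0")
    case False
    then show ?thesis
      using valuation_val_ring[OF discrete_order[OF assms(1)] False]
        valuation_val_ring[OF discrete_order[OF assms(2)] False] ring assms by simp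
  qed (use order_zero assms in simp)
qed

definition orders :: "('k \<Rightarrow> int) set" where
  "orders = order ` {\<pi>. irr \<pi>}"

text \<open>The denominators of \<open>f\<close> form a principal ideal, proper since
  \<open>f\<close> is not in \<open>B\<close>. At an irreducible divisor of its generator
  \<open>f\<close> has a pole, because every denominator of \<open>f\<close> is a multiple of that
  divisor.\<close>

lemma orders_separate:
  assumes "f \<notin> B"
  shows "\<exists>v\<in>orders. v f < 0"
proof -
  define S where "S = {c \<in> B. c * f \<in> B}"
  obtain a b where ab: "a \<in> B" "b \<in> B" "b \<noteq> 0" "f = a / b" using quotient by blast
  then have "b \<in> S" by (simp add: S_def)
  moreover have "x - q * y \<in> S" if "x \<in> S" "y \<in> S" "q \<in> B" for x y q
  proof -
    have "(x - q * y) * f = x * f - q * (y * f)" by (simp add: algebra_simps)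
    then show ?thesis using that B by (auto simp: S_def)
  qed
  moreover have "S \<subseteq> B" by (auto simp: S_def)
  ultimately obtain c where c: "c \<in> S" "c \<noteq> 0" "\<And>x. x \<in> S \<Longrightarrow> x \<in> multiples c"
    using generator[of b S] ab(3) by blast
  have "N c \<noteq> 0"
  proof
    assume "N c = 0"
    then have "inverse c \<in> B" using N_unit c by (auto simp: S_def)
    then have "inverse c * (c * f) \<in> B" using c B by (auto simp: S_def)
    moreover have "inverse c * (c * f) = f" using c(2) by (simp flip: mult.assoc)
    ultimately show False using assms by metis
  qed
  then have "0 < N c" using N_nonneg c by (force simp: S_def order.order_iff_strict)
  then obtain \<pi> where \<pi>: "irr \<pi>" "c \<in> multiples \<pi>" using irr_dvd[of c] c by (auto simp: S_def)
  have "f \<noteq> 0" using assms B by auto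
  have "order \<pi> f < 0"
  proof (rule ccontr)
    assume "\<not> ?thesis"
    then obtain a s where as: "a \<in> B" "s \<in> B - multiples \<pi>" "f = a / s"
      using order_localization[OF \<pi>(1) \<open>f \<noteq> 0\<close>] by force
    then have "s \<in> S" using not_multiple_nonzero[OF \<pi>(1) as(2)] by (simp add: S_def)
    then obtain q where "q \<in> B" "s = c * q" using c(3) multiplesE by blast
    then show False using as multiples_absorb[OF \<pi>(2)] by blast
  qed
  then show ?thesis using \<pi> by (auto simp: orders_def)
qed

text \<open>Factorization by induction on the norm: a unit has order 0 everywhere, an irreducible
  element has nonzero order only at its own class of associates, and supports of products are
  contained in unions.\<close>

lemma finite_orders:
  assumes "f \<noteq> 0"
  shows "finite {v \<in> orders. v f \<noteq> 0}"
proof -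
  have inB: "finite {v \<in> orders. v f \<noteq> 0}" if "f \<in> B" "f \<noteq> 0" for f
    using that
  proof (induction "nat (N f)" arbitrary: f rule: less_induct)
    case less
    consider "N f = 0" | "irr f" | a b where "a \<in> B" "b \<in> B" "f = a * b" "N a \<noteq> 0" "N b \<noteq> 0"
      using less.prems N_nonneg[of f] by (force simp: irr_def)
    then show ?case
    proof cases
      case 1
      then have inv: "inverse f \<in> B" using N_unit less by blast
      have "order \<pi> f = 0" if \<pi>: "irr \<pi>" for \<pi>
        using order_nonneg[OF \<pi> less.prems] order_nonneg[OF \<pi> inv] less.prems
          val_inverse[OF discrete_order[OF \<pi>], of f] by simp
      then have "{v \<in> orders. v f \<noteq> 0} \<subseteq> {}" by (auto simp: orders_def)
      then show ?thesis by (rule finite_subset) simp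
    next
      case 2
      have "order \<pi> = order f" if \<pi>: "irr \<pi>" and ne: "order \<pi> f \<noteq> 0" for \<pi>
      proof -
        have "f \<in> multiples \<pi>" using order_not_multiple[OF \<pi>, of f] less.prems ne by blast
        then obtain u where u: "u \<in> B" "f = \<pi> * u" by (rule multiplesE)
        then have "u \<noteq> 0" using less.prems by auto
        have "N u = 0" using 2 u irr_facts[OF \<pi>] unfolding irr_def by fastforce
        then have inv: "inverse u \<in> B" using N_unit u \<open>u \<noteq> 0\<close> by blast
        have "multiples \<pi> = multiples f"
        proof (intro equalityI subsetI)
          fix x assume "x \<in> multiples \<pi>"
          then obtain b where "b \<in> B" "x = \<pi> * b" by (rule multiplesE)
          then have "x = f * (inverse u * b)" "inverse u * b \<in> B"
            using u \<open>u \<noteq> 0\<close> inv B by auto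
          then show "x \<in> multiples f" using multiplesI by blast
        next
          fix x assume "x \<in> multiples f"
          then obtain b where "b \<in> B" "x = f * b" by (rule multiplesE)
          then have "x = \<pi> * (u * b)" "u * b \<in> B" using u B by (auto simp: mult.assoc)
          then show "x \<in> multiples \<pi>" using multiplesI by blast
        qed
        then show ?thesis using order_cong \<pi> 2 by blast
      qed
      then have "{v \<in> orders. v f \<noteq> 0} \<subseteq> {order f}" by (auto simp: orders_def)
      then show ?thesis using finite_subset by blast
    next
      case (3 a b)
      then have ne: "a \<noteq> 0" "b \<noteq> 0" using less.prems by auto
      then have "0 < N a" "0 < N b" using 3 N_nonneg by (metis order_le_less)+
      then have "nat (N a) < nat (N f)" "nat (N b) < nat (N f)" using 3 ne by (simp_all add: N_mult)
      then have "finite ({v \<in> orders. v a \<noteq> 0} \<union> {v \<in> orders. v b \<noteq> 0})" using less.hyps 3 ne by blast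
      moreover have "order \<pi> f = order \<pi> a + order \<pi> b" if "irr \<pi>" for \<pi>
        using order_mult[OF that ne] 3 by simp
      then have "{v \<in> orders. v f \<noteq> 0} \<subseteq> {v \<in> orders. v a \<noteq> 0} \<union> {v \<in> orders. v b \<noteq> 0}"
        by (auto simp: orders_def)
      ultimately show ?thesis by (rule finite_subset[rotated])
    qed
  qed
  obtain a b where ab: "a \<in> B" "b \<in> B" "b \<noteq> 0" "f = a / b" using quotient by blast
  then have ne: "a \<noteq> 0" using assms by auto
  have "order \<pi> f = order \<pi> a - order \<pi> b" if "irr \<pi>" for \<pi>
    using val_divide[OF discrete_order[OF that] ne ab(3)] ab by simp
  then have "{v \<in> orders. v f \<noteq> 0} \<subseteq> {v \<in> orders. v a \<noteq> 0} \<union> {v \<in> orders. v b \<noteq> 0}"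
    by (auto simp: orders_def)
  then show ?thesis using inB[of a] inB[of b] ab ne finite_subset by blast
qed

lemma orders_discrete: "v \<in> orders \<Longrightarrow> discrete_valuation v"
  using discrete_order by (auto simp: orders_def)

lemma orders_nonneg: "v \<in> orders \<Longrightarrow> f \<in> B \<Longrightarrow> f \<noteq> 0 \<Longrightarrow> 0 \<le> v f"
  using order_nonneg by (auto simp: orders_def)

lemma orders_localization:
  assumes "v \<in> orders" "f \<in> val_ring v"
  shows "\<exists>a\<in>B. \<exists>s\<in>B. s \<noteq> 0 \<and> v s = 0 \<and> f = a / s"
proof -
  obtain \<pi> where \<pi>: "irr \<pi>" "v = order \<pi>" using assms(1) by (auto simp: orders_def)
  show ?thesis
  proof (cases "f = 0")
    case True
    then have "0 \<in> B \<and> 1 \<in> B \<and> v 1 = 0 \<and> f = 0 / 1" using \<pi> order_one B by auto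
    then show ?thesis by (metis zero_neq_one)
  next
    case False
    then obtain a s where "a \<in> B" "s \<in> B - multiples \<pi>" "f = a / s"
      using order_localization[OF \<pi>(1)] assms(2) \<pi>(2) by (force simp: val_ring_def)
    then show ?thesis
      using \<pi> order_not_multiple[of \<pi> s] not_multiple_nonzero[of \<pi> s] by auto
  qed
qed

end

subsection \<open>The torus\<close>

text \<open>Laurent polynomials in the variable \<open>i\<close> over the field of rational functions in the others.\<close>

definition univariate_ring :: "'d \<Rightarrow> 'd::finite ratfun set" where
  "univariate_ring i =
     {f. \<exists>s. s \<noteq> 0 \<and> free i s \<and> embed_laurent s * f \<in> range embed_laurent}"

definition ratfun_width :: "'d \<Rightarrow> 'd::finite ratfun \<Rightarrow> int" where
  "ratfun_width i f = - monomial_valuation (\<lambda>m. - ex i m) f - monomial_valuation (ex i) f"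

lemma ratfun_width_mult:
  "f \<noteq> 0 \<Longrightarrow> g \<noteq> 0 \<Longrightarrow> ratfun_width i (f * g) = ratfun_width i f + ratfun_width i g"
  by (simp add: ratfun_width_def monomial_valuation_mult ex_add)

lemma ratfun_width_embed: "a \<noteq> 0 \<Longrightarrow> ratfun_width i (embed_laurent a) = width i a"
  by (simp add: ratfun_width_def width_def monomial_valuation_embed ex_add)

lemma ratfun_width_fraction:
  assumes "s \<noteq> 0" "free i s" "f \<noteq> 0" "embed_laurent s * f = embed_laurent a"
  shows "ratfun_width i f = width i a" "a \<noteq> 0"
proof -
  show "a \<noteq> 0" using assms by (metis embed_laurent_eq_0 mult_eq_0_iff)
  then show "ratfun_width i f = width i a"
    using assms ratfun_width_mult[of "embed_laurent s" f i] ratfun_width_embed[of s i]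
      ratfun_width_embed[of a i] width_free[of i s] by simp
qed

lemma univariate_ringI:
  "s \<noteq> 0 \<Longrightarrow> free i s \<Longrightarrow> embed_laurent s * f = embed_laurent a \<Longrightarrow> f \<in> univariate_ring i"
  unfolding univariate_ring_def by blast

lemma univariate_ringE:
  assumes "f \<in> univariate_ring i"
  obtains s a where "s \<noteq> 0" "free i s" "embed_laurent s * f = embed_laurent a"
  using assms unfolding univariate_ring_def by blast

lemma embed_in_univariate_ring: "embed_laurent a \<in> univariate_ring i"
  using univariate_ringI[of 1 i "embed_laurent a" a] by (simp add: free_one embed_laurent_one)

text \<open>The norm is the width, extended to the field by monomial valuations. Multipliers free of
  the variable have width 0, so clearing denominators changes no norm and pseudo-division becomes
  true division.\<close>

lemma euclidean_univariate_ring: "euclidean_subring (univariate_ring i) (ratfun_width i)"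
proof
  show "subring_on (univariate_ring i)"
    unfolding subring_on_def
  proof (intro conjI ballI)
    show "0 \<in> univariate_ring i" "1 \<in> univariate_ring i"
      by (metis embed_in_univariate_ring embed_laurent_zero)
        (metis embed_in_univariate_ring embed_laurent_one)
  next
    fix f assume "f \<in> univariate_ring i"
    then obtain s a where "s \<noteq> 0" "free i s" "embed_laurent s * f = embed_laurent a" by (rule univariate_ringE)
    then show "- f \<in> univariate_ring i"
      by (intro univariate_ringI[of s i "- f" "- a"]) (simp_all add: embed_laurent_uminus)
  next
    fix f g assume "f \<in> univariate_ring i" "g \<in> univariate_ring i"
    then obtain s a t b where *: "s \<noteq> 0" "free i s" "embed_laurent s * f = embed_laurent a"
       "t \<noteq> 0" "free i t" "embed_laurent t * g = embed_laurent b" by (metis univariate_ringE)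
    have "embed_laurent (s * t) * (f + g) = embed_laurent (t * a + s * b)"
      "embed_laurent (s * t) * (f * g) = embed_laurent (a * b)"
      by (simp_all add: embed_laurent_mult embed_laurent_add algebra_simps flip: *(3,6))
    then show "f + g \<in> univariate_ring i" "f * g \<in> univariate_ring i"
      using * by (auto intro!: univariate_ringI[of "s * t"] free_mult)
  qed
next
  fix f :: "'a ratfun"
  obtain a b where "b \<noteq> 0" "f = embed_laurent a / embed_laurent b" by (rule ratfun_quotient)
  then show "\<exists>a\<in>univariate_ring i. \<exists>b\<in>univariate_ring i. b \<noteq> 0 \<and> f = a / b"
    using embed_in_univariate_ring by (intro bexI[of _ "embed_laurent a"] bexI[of _ "embed_laurent b"]) auto
next
  fix f g :: "'a ratfun" assume "f \<noteq> 0" "g \<noteq> 0"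
  then show "ratfun_width i (f * g) = ratfun_width i f + ratfun_width i g" by (rule ratfun_width_mult)
next
  fix f assume f: "f \<in> univariate_ring i" "f \<noteq> 0"
  obtain s a where sa: "s \<noteq> 0" "free i s" "embed_laurent s * f = embed_laurent a" using f(1) by (rule univariate_ringE)
  note w = ratfun_width_fraction[OF sa(1,2) f(2) sa(3)]
  show "0 \<le> ratfun_width i f" using w width_nonneg by metis
  assume "ratfun_width i f = 0"
  then have "width i a = 0" using w by simp
  define k where "k = low (ex i) a"
  have k: "ex i m = k" if "m \<in> Poly_Mapping.keys a" for m
    using low_le[OF that, of "ex i"] low_le[OF that, of "\<lambda>m. - ex i m"] \<open>width i a = 0\<close>
    by (simp add: width_def k_def)
  \<comment> \<open>Width 0 means that a single power of the variable occurs; shifting by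
    \<open>- k\<close> makes the numerator free of the variable, hence an admissible denominator of
    the inverse.\<close>
  define c where "c = Poly_Mapping.single (axis_character i (- k)) (1::complex)"
  have c: "Poly_Mapping.keys c = {axis_character i (- k)}" by (simp add: c_def)
  have "free i (c * a)"
    by (auto simp: free_def ex_add ex_axis c k elim!: keys_mult_obtain)
  moreover have "c * a \<noteq> 0" using c w(2) by (metis insert_not_empty keys_zero mult_eq_0_iff)
  moreover have "embed_laurent (c * a) * inverse f = embed_laurent (c * s)"
    using f(2) by (simp add: embed_laurent_mult mult.assoc flip: sa(3))
  ultimately show "inverse f \<in> univariate_ring i" by (intro univariate_ringI)
next
  fix f g assume f: "f \<in> univariate_ring i" and g: "g \<in> univariate_ring i" "g \<noteq> 0"
  obtain s a where sa: "s \<noteq> 0" "free i s" "embed_laurent s * f = embed_laurent a" using f by (rule univariate_ringE)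
  obtain t b where tb: "t \<noteq> 0" "free i t" "embed_laurent t * g = embed_laurent b" using g(1) by (rule univariate_ringE)
  note w = ratfun_width_fraction[OF tb(1,2) g(2) tb(3)]
  obtain c q r where c: "c \<noteq> 0" "free i c" "c * a = q * b + r" "r = 0 \<or> width i r < width i b"
    using pseudo_division[OF w(2), of i a] by blast
  \<comment> \<open>The pseudo-quotient \<open>q\<close> belongs to the cleared polynomials
    \<open>a\<close> and \<open>b\<close>; the factors \<open>t\<close> and \<open>c * s\<close>
    convert it into a quotient of \<open>f\<close> by \<open>g\<close>.\<close>
  define Q where "Q = embed_laurent (q * t) / embed_laurent (c * s)"
  have Q: "embed_laurent (c * s) * Q = embed_laurent (q * t)" using c sa by (simp add: Q_def)
  have "Q \<in> univariate_ring i" using c sa Q by (intro univariate_ringI[of "c * s"]) (auto intro: free_mult)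
  have "embed_laurent (c * s) * (f - Q * g) = embed_laurent c * (embed_laurent s * f) - embed_laurent (c * s) * Q * g"
    by (simp add: embed_laurent_mult algebra_simps)
  also have "\<dots> = embed_laurent (c * a) - embed_laurent (q * b)"
    unfolding Q sa(3) by (simp add: embed_laurent_mult mult.assoc flip: tb(3))
  also have "\<dots> = embed_laurent r" unfolding c(3) by (simp add: embed_laurent_add)
  finally have r: "embed_laurent (c * s) * (f - Q * g) = embed_laurent r" .
  have "f - Q * g = 0 \<or> ratfun_width i (f - Q * g) < ratfun_width i g"
  proof (rule disjCI)
    assume "\<not> ratfun_width i (f - Q * g) < ratfun_width i g"
    moreover have "ratfun_width i (f - Q * g) < ratfun_width i g" if ne: "f - Q * g \<noteq> 0"
      using ratfun_width_fraction[OF _ free_mult[OF c(2) sa(2)] ne r] c sa w by auto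
    ultimately show "f - Q * g = 0" by blast
  qed
  then show "\<exists>q\<in>univariate_ring i. f - q * g = 0 \<or> ratfun_width i (f - q * g) < ratfun_width i g"
    using \<open>Q \<in> univariate_ring i\<close> by blast
qed

text \<open>
  If \<open>s\<close> is a denominator of \<open>f\<close> without the variables in \<open>S\<close> and \<open>t\<close> one without the variable \<open>j\<close>,
  then pseudo-division of \<open>s * f\<close> by \<open>s\<close> in the variable \<open>j\<close> must leave no remainder,
  because multiplication by \<open>t\<close> does not change widths.
\<close>

lemma Inter_univariate_ring:
  assumes f: "\<And>i. f \<in> univariate_ring i"
  shows "f \<in> range embed_laurent"
proof -
  have "\<exists>s a. s \<noteq> 0 \<and> (\<forall>i\<in>S. free i s) \<and> embed_laurent s * f = embed_laurent a" for S :: "'a set"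
    using finite[of S]
  proof (induction S rule: finite_induct)
    case empty
    obtain a b where ab: "b \<noteq> 0" "f = embed_laurent a / embed_laurent b" by (rule ratfun_quotient)
    then have "embed_laurent b * f = embed_laurent a" by simp
    then show ?case using ab(1) by blast
  next
    case (insert j S)
    then obtain s g where s: "s \<noteq> 0" "\<forall>i\<in>S. free i s" "embed_laurent s * f = embed_laurent g" by blast
    obtain t h where t: "t \<noteq> 0" "free j t" "embed_laurent t * f = embed_laurent h" using f[of j] by (rule univariate_ringE)
    obtain c q r where c: "c \<noteq> 0" "free j c" "\<And>i. free i s \<Longrightarrow> free i c" "c * g = q * s + r"
      and r: "r = 0 \<or> width j r < width j s"
      using pseudo_division[OF s(1), of j g] by blast
    have "embed_laurent (t * g) = embed_laurent (s * h)"
      by (simp add: embed_laurent_mult mult_ac flip: s(3) t(3))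
    then have tg: "t * g = s * h" by simp
    have "c * (t * g) = t * (c * g)" by (simp add: mult_ac)
    then have "t * r = c * (t * g) - t * q * s" unfolding c(4) by (simp add: algebra_simps)
    then have tr: "t * r = s * (c * h - t * q)" unfolding tg by (simp add: algebra_simps)
    have "r = 0"
    proof (rule ccontr)
      assume "r \<noteq> 0"
      then have "s * (c * h - t * q) \<noteq> 0" using tr t by (metis mult_eq_0_iff)
      then have "width j s \<le> width j (t * r)"
        unfolding tr using width_nonneg[of "c * h - t * q" j] by (simp add: width_mult)
      then show False using r \<open>r \<noteq> 0\<close> t width_free[OF t(2,1)] by (simp add: width_mult)
    qed
    have "embed_laurent s * (embed_laurent c * f) = embed_laurent c * (embed_laurent s * f)"
      by (simp add: mult_ac)
    also have "\<dots> = embed_laurent s * embed_laurent q"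
      unfolding s(3) using c(4) \<open>r = 0\<close> by (simp add: mult_ac flip: embed_laurent_mult)
    finally have "embed_laurent c * f = embed_laurent q" using s(1) by simp
    then show ?case using c s by blast
  qed
  from this[of UNIV] obtain s a where s: "s \<noteq> 0" "\<And>i. free i s" "embed_laurent s * f = embed_laurent a" by blast
  obtain m where m: "m \<in> Poly_Mapping.keys s" using s(1) by (metis all_not_in_conv keys_eq_empty)
  \<comment> \<open>A denominator free of all variables is supported at the trivial character, hence
    is a nonzero constant.\<close>
  have "k = 0" if "k \<in> Poly_Mapping.keys s" for k
    using s(2) that by (auto simp: free_def character_eq_iff ex_zero)
  then have "s = Poly_Mapping.single 0 (Poly_Mapping.lookup s 0)"
    by (intro poly_mapping_eqI) (auto simp: lookup_single when_def in_keys_iff)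
  then obtain z where z: "s = Poly_Mapping.single 0 z" by blast
  then have "z \<noteq> 0" using s(1) by auto
  then have "Poly_Mapping.single 0 (inverse z) * s = 1" by (simp add: z mult_single)
  then have "embed_laurent (Poly_Mapping.single 0 (inverse z)) * (embed_laurent s * f) = f"
    by (simp add: embed_laurent_one flip: mult.assoc embed_laurent_mult)
  then have "f = embed_laurent (Poly_Mapping.single 0 (inverse z) * a)"
    unfolding s(3) by (simp add: embed_laurent_mult)
  then show ?thesis by blast
qed

definition torus_valuations :: "('d::finite ratfun \<Rightarrow> int) set" where
  "torus_valuations = (\<Union>i. euclidean_subring.orders (univariate_ring i) (ratfun_width i))"

lemma torus_valuationsE:
  assumes "v \<in> torus_valuations"
  obtains i where "v \<in> euclidean_subring.orders (univariate_ring i) (ratfun_width i)"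
  using assms by (auto simp: torus_valuations_def)

lemma discrete_torus_valuation: "v \<in> torus_valuations \<Longrightarrow> discrete_valuation v"
  by (erule torus_valuationsE) (rule euclidean_subring.orders_discrete[OF euclidean_univariate_ring])

lemma torus_valuation_nonneg: "v \<in> torus_valuations \<Longrightarrow> a \<noteq> 0 \<Longrightarrow> 0 \<le> v (embed_laurent a)"
  by (erule torus_valuationsE)
    (auto intro: euclidean_subring.orders_nonneg[OF euclidean_univariate_ring] embed_in_univariate_ring)

lemma torus_valuation_monom: "v \<in> torus_valuations \<Longrightarrow> v (monom m) = 0"
  using torus_valuation_nonneg[of v "Poly_Mapping.single m 1"] torus_valuation_nonneg[of v "Poly_Mapping.single (- m) 1"]
    val_inverse[OF discrete_torus_valuation, of v "monom m"]
  by (simp add: inverse_monom flip: monom_def keys_eq_empty)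

lemma torus_valuations_separate: "f \<notin> range embed_laurent \<Longrightarrow> \<exists>v\<in>torus_valuations. v f < 0"
  using Inter_univariate_ring[of f] euclidean_subring.orders_separate[OF euclidean_univariate_ring, of f]
  unfolding torus_valuations_def by blast

lemma finite_torus_valuations:
  assumes "f \<noteq> 0"
  shows "finite {v \<in> torus_valuations. v f \<noteq> 0}"
proof -
  have "{v \<in> torus_valuations. v f \<noteq> 0} =
      (\<Union>i. {v \<in> euclidean_subring.orders (univariate_ring i) (ratfun_width i). v f \<noteq> 0})"
    by (auto simp: torus_valuations_def)
  then show ?thesis
    using euclidean_subring.finite_orders[OF euclidean_univariate_ring assms] by simp
qed

text \<open>Polynomials free of the variable \<open>i\<close> are units of the univariate ring and
  have value 0. Hence its local ring at \<open>v\<close> is already a localization of the Laurent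
  polynomial ring.\<close>

lemma torus_valuation_localization:
  assumes v: "v \<in> torus_valuations" and f: "f \<in> val_ring v"
  shows "\<exists>a s. s \<noteq> 0 \<and> v (embed_laurent s) = 0 \<and> f = embed_laurent a / embed_laurent s"
proof -
  obtain i where i: "v \<in> euclidean_subring.orders (univariate_ring i) (ratfun_width i)" using v by (rule torus_valuationsE)
  note dv = discrete_torus_valuation[OF v]
  interpret euclidean_subring "univariate_ring i" "ratfun_width i" by (rule euclidean_univariate_ring)
  obtain x y where xy: "x \<in> univariate_ring i" "y \<in> univariate_ring i" "y \<noteq> 0" "v y = 0" "f = x / y"
    using orders_localization[OF i f] by blast
  obtain s a where sa: "s \<noteq> 0" "free i s" "embed_laurent s * x = embed_laurent a" using xy(1) by (rule univariate_ringE)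
  obtain t b where tb: "t \<noteq> 0" "free i t" "embed_laurent t * y = embed_laurent b" using xy(2) by (rule univariate_ringE)
  have unit: "v (embed_laurent c) = 0" if c: "c \<noteq> 0" "free i c" for c
  proof -
    have "embed_laurent c \<in> univariate_ring i" by (rule embed_in_univariate_ring)
    moreover have "inverse (embed_laurent c) \<in> univariate_ring i"
      using c by (intro univariate_ringI[of c i _ 1]) (auto simp: embed_laurent_one)
    ultimately show ?thesis
      using orders_nonneg[OF i, of "embed_laurent c"] orders_nonneg[OF i, of "inverse (embed_laurent c)"]
        val_inverse[OF dv, of "embed_laurent c"] c by simp
  qed
  have "b \<noteq> 0" using tb xy(3) by (metis embed_laurent_eq_0 mult_eq_0_iff)
  have "v (embed_laurent b) = 0"
    using unit[OF tb(1,2)] xy(3,4) tb(1) by (simp add: val_mult[OF dv] flip: tb(3))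
  then have "v (embed_laurent (s * b)) = 0"
    using unit[OF sa(1,2)] sa(1) \<open>b \<noteq> 0\<close> by (simp add: val_mult[OF dv] embed_laurent_mult)
  moreover have "f = embed_laurent (t * a) / embed_laurent (s * b)"
    using sa(1) tb(1) xy(3) unfolding xy(5)
    by (simp add: embed_laurent_mult flip: sa(3) tb(3))
  ultimately show ?thesis
    using sa \<open>b \<noteq> 0\<close> by (metis mult_eq_0_iff)
qed

section \<open>The normal fan of a full-dimensional rational polytope\<close>

lemma bezout_Gcd:
  fixes f :: "'i \<Rightarrow> int"
  assumes "finite I"
  shows "\<exists>c. (\<Sum>i\<in>I. c i * f i) = Gcd (f ` I)"
  using assms
proof (induction I rule: finite_induct)
  case (insert j I)
  then obtain c where c: "(\<Sum>i\<in>I. c i * f i) = Gcd (f ` I)" by blast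
  obtain x y where "x * f j + y * Gcd (f ` I) = gcd (f j) (Gcd (f ` I))"
    using bezout_int by blast
  moreover have "(\<Sum>i\<in>I. (if i = j then x else y * c i) * f i) = y * (\<Sum>i\<in>I. c i * f i)"
    unfolding sum_distrib_left using insert by (intro sum.cong) auto
  ultimately show ?case
    using insert c by (intro exI[of _ "\<lambda>i. if i = j then x else y * c i"]) simp
qed simp

lemma inner_real_vec: "real_vec u \<bullet> real_vec w = real_of_int (\<Sum>i\<in>UNIV. u $ i * w $ i)"
  by (simp add: real_vec_def inner_vec_def)

lemma real_vec_eq_0 [simp]: "real_vec u = 0 \<longleftrightarrow> u = 0"
  by (simp add: real_vec_def vec_eq_iff)

definition rational_vec :: "real ^ 'd \<Rightarrow> bool" where
  "rational_vec x \<longleftrightarrow> (\<forall>i. x $ i \<in> \<rat>)"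

lemma rational_vec_diff: "rational_vec x \<Longrightarrow> rational_vec y \<Longrightarrow> rational_vec (x - y)"
  by (simp add: rational_vec_def)

lemma rational_vec_integer_multiple:
  fixes x :: "real ^ 'd::finite"
  assumes "rational_vec x"
  shows "\<exists>k m. k > 0 \<and> real_vec m = real k *\<^sub>R x"
proof -
  have "\<exists>n z. n > 0 \<and> x $ i = of_int z / real n" for i
    using assms unfolding rational_vec_def by (metis Rats_cases' of_int_of_nat_eq zero_less_imp_eq_int of_nat_0_less_iff)
  then obtain n z where nz: "\<And>i. n i > 0" "\<And>i. x $ i = of_int (z i) / real (n i)" by metis
  define k where "k = (\<Prod>i\<in>UNIV. n i)"
  have "real k * x $ i = of_int (z i * int (\<Prod>j\<in>UNIV - {i}. n j))" for i
  proof -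
    have "k = n i * (\<Prod>j\<in>UNIV - {i}. n j)" unfolding k_def by (rule prod.remove) auto
    then show ?thesis using nz[of i] by simp
  qed
  then have "real_vec (\<chi> i. z i * int (\<Prod>j\<in>UNIV - {i}. n j)) = real k *\<^sub>R x"
    by (simp add: real_vec_def vec_eq_iff)
  moreover have "k > 0" using nz by (simp add: k_def prod_pos)
  ultimately show ?thesis by blast
qed

text \<open>Apply a \<open>\<rat>\<close>-linear functional \<open>\<real> \<rightarrow> \<rat>\<close> to a real solution of a rational linear system.\<close>

lemma rational_solution:
  fixes u :: "real ^ 'd::finite"
  assumes "u \<noteq> 0" "\<And>a. a \<in> S \<Longrightarrow> rational_vec a" "\<And>a. a \<in> S \<Longrightarrow> a \<bullet> u = 0"
  shows "\<exists>z. z \<noteq> 0 \<and> rational_vec z \<and> (\<forall>a\<in>S. a \<bullet> z = 0)"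
proof -
  interpret Q: vector_space "\<lambda>(r::rat) (x::real). of_rat r * x"
    by standard (auto simp: of_rat_add of_rat_mult algebra_simps)
  obtain i where i: "u $ i \<noteq> 0" using assms(1) by (auto simp: vec_eq_iff)
  have ind: "Q.independent {u $ i}" using i by simp
  \<comment> \<open>A rational basis of the reals containing the nonzero coordinate
    \<open>u $ i\<close>. The coefficient functional \<open>l\<close> of this basis vector takes the
    value 1 there, which keeps \<open>z\<close> nonzero.\<close>
  define b where "b = Q.extend_basis {u $ i}"
  have b: "Q.independent b" "u $ i \<in> b" "\<And>x. x \<in> Q.span b"
    using Q.independent_extend_basis[OF ind] Q.extend_basis_superset[OF ind] Q.span_extend_basis[OF ind]
    by (auto simp: b_def)
  define l where "l x = Q.representation b x (u $ i)" for x
  have add: "l (x + y) = l x + l y" for x y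
    by (simp add: l_def Q.representation_add[OF b(1) b(3) b(3)])
  have scale: "l (of_rat r * x) = r * l x" for r x
    by (simp add: l_def Q.representation_scale[OF b(1) b(3)])
  have l0: "l 0 = 0" using add[of 0 0] by simp
  have sum: "l (\<Sum>j\<in>J. f j) = (\<Sum>j\<in>J. l (f j))" for f :: "'d \<Rightarrow> real" and J
    by (induction J rule: infinite_finite_induct) (simp_all add: l0 add)
  define z where "z = (\<chi> j. real_of_rat (l (u $ j)))"
  have "l (u $ i) = 1" by (simp add: l_def Q.representation_basis[OF b(1,2)])
  then have "z $ i = 1" by (simp add: z_def)
  then have "z \<noteq> 0" by (metis zero_index zero_neq_one)
  moreover have "rational_vec z" by (simp add: rational_vec_def z_def)
  moreover have "a \<bullet> z = 0" if a: "a \<in> S" for a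
  proof -
    have "\<exists>r. a $ j = of_rat r" for j
      using assms(2)[OF a] by (metis rational_vec_def Rats_cases)
    then obtain r where r: "\<And>j. a $ j = of_rat (r j)" by metis
    have "0 = l (a \<bullet> u)" using assms(3)[OF a] l0 by simp
    also have "\<dots> = (\<Sum>j\<in>UNIV. r j * l (u $ j))"
      by (simp add: inner_vec_def sum r scale)
    finally have "of_rat 0 = real_of_rat (\<Sum>j\<in>UNIV. r j * l (u $ j))" by simp
    then show ?thesis by (simp add: inner_vec_def z_def r of_rat_sum of_rat_mult)
  qed
  ultimately show ?thesis by blast
qed

lemma primitive_multiple:
  fixes z :: "real ^ 'd::finite"
  assumes "z \<noteq> 0" "rational_vec z"
  shows "\<exists>w t. Gcd (range (\<lambda>i. w $ i)) = 1 \<and> t > 0 \<and> z = t *\<^sub>R real_vec w"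
proof -
  obtain k m where m: "k > 0" "real_vec m = real k *\<^sub>R z" using rational_vec_integer_multiple[OF assms(2)] by blast
  define g where "g = Gcd (range (\<lambda>i. m $ i))"
  have "real_vec m \<noteq> 0" using m assms(1) by simp
  then have "m \<noteq> 0" by simp
  then obtain i where "m $ i \<noteq> 0" by (auto simp: vec_eq_iff)
  then have "g > 0" unfolding g_def by (auto simp: order.strict_iff_order)
  define w where "w = (\<chi> i. m $ i div g)"
  have gw: "m $ i = g * w $ i" for i
    unfolding w_def g_def by (simp add: Gcd_dvd)
  have "g = g * Gcd (range (\<lambda>i. w $ i))"
  proof -
    have "range (\<lambda>i. m $ i) = (*) g ` range (\<lambda>i. w $ i)" by (simp add: gw image_image)
    then have "g = normalize (g * Gcd (range (\<lambda>i. w $ i)))" unfolding g_def[symmetric] using Gcd_mult g_def by metis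
    then show ?thesis using \<open>g > 0\<close> by (simp add: abs_mult)
  qed
  then have "Gcd (range (\<lambda>i. w $ i)) = 1" using \<open>g > 0\<close> by simp
  have gz: "real_vec m = real_of_int g *\<^sub>R real_vec w"
    by (simp add: real_vec_def vec_eq_iff gw)
  have "z = (1 / real k) *\<^sub>R (real k *\<^sub>R z)" using m(1) by simp
  also have "\<dots> = (1 / real k) *\<^sub>R (real_of_int g *\<^sub>R real_vec w)" unfolding m(2)[symmetric] gz ..
  finally have "z = (real_of_int g / real k) *\<^sub>R real_vec w" by simp
  with \<open>Gcd (range (\<lambda>i. w $ i)) = 1\<close> show ?thesis
    using \<open>g > 0\<close> m(1) by (intro exI[of _ w] exI[of _ "real_of_int g / real k"]) simp
qed

text \<open>Bezout identities for \<open>w\<close> and \<open>u\<close> show that both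
  \<open>t\<close> and its inverse are integers; being positive, \<open>t\<close> is 1.\<close>

lemma primitive_positive_multiple_eq:
  fixes u w :: "int ^ 'd::finite"
  assumes u: "Gcd (range (\<lambda>i. u $ i)) = 1" and w: "Gcd (range (\<lambda>i. w $ i)) = 1"
    and t: "t > 0" "real_vec u = t *\<^sub>R real_vec w"
  shows "u = w"
proof -
  have comp: "real_of_int (u $ i) = t * real_of_int (w $ i)" for i
    using arg_cong[OF t(2), of "\<lambda>x. x $ i"] by (simp add: real_vec_def)
  obtain c where c: "(\<Sum>i\<in>UNIV. c i * w $ i) = 1" using bezout_Gcd[of UNIV "\<lambda>i. w $ i"] w by auto
  obtain d where d: "(\<Sum>i\<in>UNIV. d i * u $ i) = 1" using bezout_Gcd[of UNIV "\<lambda>i. u $ i"] u by auto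
  have "t * real_of_int (\<Sum>i\<in>UNIV. c i * w $ i) = real_of_int (\<Sum>i\<in>UNIV. c i * u $ i)"
    by (simp add: sum_distrib_left comp mult_ac)
  then have T: "t = real_of_int (\<Sum>i\<in>UNIV. c i * u $ i)" (is "_ = real_of_int ?T") using c by simp
  have "real_of_int (\<Sum>i\<in>UNIV. d i * u $ i) = t * real_of_int (\<Sum>i\<in>UNIV. d i * w $ i)"
    by (simp add: sum_distrib_left comp mult_ac)
  then have "1 = t * real_of_int (\<Sum>i\<in>UNIV. d i * w $ i)" (is "_ = _ * real_of_int ?D") using d by simp
  then have "real_of_int (?T * ?D) = real_of_int 1" unfolding T by simp
  then have "?T * ?D = 1" by (simp only: of_int_eq_iff)
  then have "?T = 1" using t(1) T by (auto simp: zmult_eq_1_iff)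
  then show ?thesis using comp T by (simp add: vec_eq_iff)
qed

locale full_polytope =
  fixes P :: "(real ^ 'd::finite) set"
  assumes rational: "rational_polytope P" and full: "aff_dim P = int CARD('d)"
begin

text \<open>Normal cones are indexed by points instead of faces. For a point of \<open>P\<close>
  this is the normal cone of the smallest face through it, so that cones can be compared by moving
  between points.\<close>

definition cone_at :: "real ^ 'd \<Rightarrow> (real ^ 'd) set" where
  "cone_at x = {u. \<forall>y\<in>P. y \<bullet> u \<le> x \<bullet> u}"

definition verts :: "(real ^ 'd) set" where
  "verts = {v. v extreme_point_of P}"

abbreviation \<Sigma> :: "(real ^ 'd) set set" where "\<Sigma> \<equiv> normal_fan P"
abbreviation gen :: "(real ^ 'd) set \<Rightarrow> real ^ 'd" where "gen \<rho> \<equiv> real_vec (primitive_generator \<rho>)"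

lemma verts: "finite verts" "convex hull verts = P" "verts \<subseteq> P" "\<And>v. v \<in> verts \<Longrightarrow> rational_vec v"
  and polytope: "polytope P" "compact P" "convex P" "P \<noteq> {}"
proof -
  obtain V where V: "finite V" "\<forall>v\<in>V. \<forall>i. v $ i \<in> \<rat>" "P = convex hull V"
    using rational by (auto simp: rational_polytope_def)
  show "polytope P" "compact P" "convex P"
    using V by (auto simp: polytope_def finite_imp_compact_convex_hull)
  then show "convex hull verts = P" unfolding verts_def by (intro Krein_Milman_Minkowski[symmetric])
  have sub: "verts \<subseteq> V"
  proof
    fix x assume "x \<in> verts"
    then have "x extreme_point_of P" by (simp add: verts_def)
    then show "x \<in> V" using extreme_point_of_convex_hull[of x V] V(3) by metis
  qed
  then show "finite verts" "\<And>v. v \<in> verts \<Longrightarrow> rational_vec v"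
    using V finite_subset by (auto simp: rational_vec_def)
  show "verts \<subseteq> P" by (auto simp: verts_def extreme_point_of_def)
  show "P \<noteq> {}"
  proof
    assume "P = {}"
    then have "- 1 = int CARD('d)" using full by simp
    then show False by simp
  qed
qed

lemma interior_nonempty: "interior P \<noteq> {}"
proof -
  have "affine hull P = UNIV" using full aff_dim_eq_full[of P] by simp
  then have "rel_interior P = interior P" by (rule rel_interior_interior)
  moreover have "rel_interior P \<noteq> {}" using polytope by (simp add: rel_interior_eq_empty)
  ultimately show ?thesis by simp
qed

lemma interior_less:
  assumes "x \<in> interior P" "u \<in> cone_at y" "u \<noteq> 0"
  shows "x \<bullet> u < y \<bullet> u"
proof -
  obtain e where e: "e > 0" "cball x e \<subseteq> P" using assms(1) mem_interior_cball by blast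
  have "x + (e / norm u) *\<^sub>R u \<in> cball x e" using e assms(3) by (simp add: dist_norm)
  then have "(x + (e / norm u) *\<^sub>R u) \<bullet> u \<le> y \<bullet> u" using e assms(2) by (auto simp: cone_at_def)
  moreover have "0 < (e / norm u) * (u \<bullet> u)" using e assms(3) by simp
  ultimately show ?thesis by (simp add: inner_add_left)
qed

text \<open>A functional attains its maximum over \<open>P\<close> at the barycentre of
  \<open>S\<close> exactly if it does so at every point of \<open>S\<close>, since the mean of
  nonnegative defects vanishes only if each defect does. Thus faces, and intersections of cones, are
  represented by points of \<open>P\<close>.\<close>

lemma cone_at_convex_hull:
  assumes S: "finite S" "S \<noteq> {}" "S \<subseteq> P"
  defines "x \<equiv> (1 / real (card S)) *\<^sub>R \<Sum>S"
  shows "x \<in> convex hull S" "cone_at x = normal_cone P (convex hull S)"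
    "cone_at x = (\<Inter>s\<in>S. cone_at s)"
proof -
  have card: "card S > 0" using S by (simp add: card_gt_0_iff)
  have x_sum: "x = (\<Sum>s\<in>S. (1 / real (card S)) *\<^sub>R s)" by (simp add: x_def scaleR_sum_right)
  show x: "x \<in> convex hull S"
    unfolding x_sum using card S
    by (intro convex_sum convex_convex_hull) (auto simp: hull_inc)
  have eq: "s \<bullet> u = x \<bullet> u" if u: "u \<in> cone_at x" and s: "s \<in> S" for u s
  proof -
    have "(\<Sum>s\<in>S. x \<bullet> u - s \<bullet> u) = real (card S) * (x \<bullet> u) - (\<Sum>S) \<bullet> u"
      by (simp add: sum_subtractf inner_sum_left)
    also have "\<dots> = 0" using card by (simp add: x_def)
    finally have "(\<Sum>s\<in>S. x \<bullet> u - s \<bullet> u) = 0" .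
    moreover have "\<forall>s\<in>S. 0 \<le> x \<bullet> u - s \<bullet> u" using u S by (auto simp: cone_at_def)
    ultimately show ?thesis using s S by (simp add: sum_nonneg_eq_0_iff)
  qed
  have hull: "z \<bullet> u = x \<bullet> u" if u: "u \<in> cone_at x" and z: "z \<in> convex hull S" for u z
  proof -
    have "convex hull S \<subseteq> {z. u \<bullet> z = x \<bullet> u}"
      
    proof (rule hull_minimal)
      show "S \<subseteq> {z. u \<bullet> z = x \<bullet> u}" using eq[OF u] by (auto simp: inner_commute[of u])
    qed (rule convex_hyperplane)
    then show ?thesis using z by (auto simp: inner_commute)
  qed
  show "cone_at x = normal_cone P (convex hull S)"
  proof (intro equalityI subsetI)
    fix u assume u: "u \<in> cone_at x"
    have "y \<bullet> u \<le> z \<bullet> u" if "z \<in> convex hull S" "y \<in> P" for y z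
      unfolding hull[OF u that(1)] using u that(2) by (simp add: cone_at_def)
    then show "u \<in> normal_cone P (convex hull S)" by (simp add: normal_cone_def)
  qed (use x in \<open>simp add: normal_cone_def cone_at_def\<close>)
  show "cone_at x = (\<Inter>s\<in>S. cone_at s)"
  proof (intro equalityI subsetI)
    fix u assume "u \<in> cone_at x"
    then have "u \<in> cone_at s" if "s \<in> S" for s
      using \<open>u \<in> cone_at x\<close> by (simp add: cone_at_def eq[OF \<open>u \<in> cone_at x\<close> that])
    then show "u \<in> (\<Inter>s\<in>S. cone_at s)" by blast
  next
    fix u assume u: "u \<in> (\<Inter>s\<in>S. cone_at s)"
    show "u \<in> cone_at x"
      unfolding cone_at_def
    proof (intro CollectI ballI)
      fix y assume "y \<in> P"
      then have "(\<Sum>s\<in>S. y \<bullet> u) \<le> (\<Sum>s\<in>S. s \<bullet> u)" using u by (intro sum_mono) (auto simp: cone_at_def)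
      then have "real (card S) * (y \<bullet> u) \<le> (\<Sum>S) \<bullet> u" by (simp add: inner_sum_left)
      then show "y \<bullet> u \<le> x \<bullet> u" using card by (simp add: x_def field_simps)
    qed
  qed
qed

lemma rational_average:
  assumes "finite S" "S \<noteq> {}" "\<And>s. s \<in> S \<Longrightarrow> rational_vec s"
  shows "rational_vec ((1 / real (card S)) *\<^sub>R \<Sum>S)"
  using assms by (auto simp: rational_vec_def sum_component intro!: Rats_divide Rats_sum)

lemma fan_cone:
  assumes "\<sigma> \<in> \<Sigma>"
  obtains x where "x \<in> P" "rational_vec x" "\<sigma> = cone_at x"
proof -
  obtain F where F: "F face_of P" "F \<noteq> {}" "\<sigma> = normal_cone P F" using assms by (auto simp: normal_fan_def)
  obtain S where S: "S \<subseteq> verts" "F = convex hull S"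
    using F(1) face_of_convex_hull_subset[of verts F] verts(1,2) by (metis finite_imp_compact)
  then have S': "finite S" "S \<noteq> {}" "S \<subseteq> P" using F(2) verts(1,3) finite_subset by auto
  note x = cone_at_convex_hull[OF S']
  show ?thesis
  proof (rule that)
    show "(1 / real (card S)) *\<^sub>R \<Sum>S \<in> P"
      using x(1) S F(1) face_of_imp_subset by blast
    show "rational_vec ((1 / real (card S)) *\<^sub>R \<Sum>S)"
      using rational_average[OF S'(1,2)] S(1) verts(4) by blast
  qed (use x S F in simp)
qed

lemma vert_cone_in_fan: "v \<in> verts \<Longrightarrow> cone_at v \<in> \<Sigma>"
  unfolding normal_fan_def normal_cone_def cone_at_def verts_def
  by (intro CollectI exI[of _ "{v}"]) (simp add: face_of_singleton)

lemma finite_fan: "finite \<Sigma>"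
proof -
  have "\<Sigma> \<subseteq> normal_cone P ` {F. F face_of P}" by (auto simp: normal_fan_def)
  then show ?thesis using finite_polytope_faces[OF polytope(1)] finite_surj by blast
qed

lemma finite_rays: "finite (rays \<Sigma>)"
  using finite_fan by (simp add: rays_def)

lemma cone_at_verts: "cone_at x = {u. \<forall>w\<in>verts. w \<bullet> u \<le> x \<bullet> u}"
proof (intro equalityI subsetI)
  fix u assume u: "u \<in> {u. \<forall>w\<in>verts. w \<bullet> u \<le> x \<bullet> u}"
  have "P \<subseteq> {y. u \<bullet> y \<le> x \<bullet> u}"
    
  proof -
    have "convex hull verts \<subseteq> {y. u \<bullet> y \<le> x \<bullet> u}"
    proof (rule hull_minimal)
      show "verts \<subseteq> {y. u \<bullet> y \<le> x \<bullet> u}" using u by (auto simp: inner_commute[of u])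
    qed (rule convex_halfspace_le)
    then show ?thesis using verts(2) by simp
  qed
  then show "u \<in> cone_at x" by (auto simp: cone_at_def inner_commute)
qed (use verts in \<open>auto simp: cone_at_def\<close>)

lemma maximal_vert:
  obtains v where "v \<in> verts" "u \<in> cone_at v"
proof -
  have "verts \<noteq> {}" using verts polytope by auto
  then have "Max ((\<lambda>w. w \<bullet> u) ` verts) \<in> (\<lambda>w. w \<bullet> u) ` verts" using verts by (intro Max_in) auto
  then obtain v where v: "v \<in> verts" "v \<bullet> u = Max ((\<lambda>w. w \<bullet> u) ` verts)" by auto
  have "w \<bullet> u \<le> v \<bullet> u" if "w \<in> verts" for w unfolding v(2) using that verts by simp
  then have "u \<in> cone_at v" unfolding cone_at_verts by simp
  then show ?thesis using that v by blast
qed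

text \<open>In a convex combination equal to \<open>x\<close>, a functional maximal at
  \<open>x\<close> is maximal at every vertex of positive weight. Hence each cone of the fan lies in
  the cone of a vertex.\<close>

lemma vert_of_point:
  assumes "x \<in> P"
  obtains v where "v \<in> verts" "cone_at x \<subseteq> cone_at v"
proof -
  have "x \<in> convex hull verts" using assms by (simp add: verts(2))
  then obtain c where c: "\<forall>w\<in>verts. 0 \<le> c w" "sum c verts = 1" "(\<Sum>w\<in>verts. c w *\<^sub>R w) = x"
    unfolding convex_hull_finite[OF verts(1)] by blast
  obtain v where v: "v \<in> verts" "c v > 0"
  proof (rule ccontr)
    assume "\<not> thesis"
    then have "\<forall>w\<in>verts. \<not> c w > 0" using that by blast
    then have "\<forall>w\<in>verts. c w = 0" using c(1) by force
    then show False using c(2) by simp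
  qed
  have "u \<in> cone_at v" if u: "u \<in> cone_at x" for u
  proof -
    have "(\<Sum>w\<in>verts. c w * (x \<bullet> u - w \<bullet> u)) = (\<Sum>w\<in>verts. c w) * (x \<bullet> u) - (\<Sum>w\<in>verts. c w *\<^sub>R w) \<bullet> u"
      by (simp add: right_diff_distrib sum_subtractf sum_distrib_right inner_sum_left)
    also have "\<dots> = 0" unfolding c(2,3) by simp
    finally have s: "(\<Sum>w\<in>verts. c w * (x \<bullet> u - w \<bullet> u)) = 0" .
    have "\<forall>w\<in>verts. 0 \<le> c w * (x \<bullet> u - w \<bullet> u)"
      using c(1) u verts(3) by (auto simp: cone_at_def)
    then have "c v * (x \<bullet> u - v \<bullet> u) = 0" 
      using sum_nonneg_eq_0_iff[OF verts(1), of "\<lambda>w. c w * (x \<bullet> u - w \<bullet> u)"] s v by blast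
    then show ?thesis using v u by (auto simp: cone_at_def)
  qed
  then show ?thesis using that v by blast
qed

text \<open>The line spanned by the ray is the solution space of a rational linear system, given by
  the vertices on which \<open>u\<close> is maximal. So it contains a rational, hence a primitive
  integral vector; an interior point of \<open>P\<close> rules out the opposite direction.\<close>

lemma ray_primitive_generator:
  assumes "\<rho> \<in> rays \<Sigma>"
  shows "Gcd (range (\<lambda>i. primitive_generator \<rho> $ i)) = 1" "\<rho> = {t *\<^sub>R gen \<rho> |t. 0 \<le> t}"
proof -
  have \<rho>: "\<rho> \<in> \<Sigma>" "dim \<rho> = 1" using assms by (auto simp: rays_def)
  obtain x where x: "x \<in> P" "rational_vec x" "\<rho> = cone_at x" using fan_cone[OF \<rho>(1)] .
  have "\<not> \<rho> \<subseteq> {0}" using \<rho>(2) by (metis dim_eq_0 zero_neq_one)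
  then obtain u where u: "u \<in> \<rho>" "u \<noteq> 0" by auto
  have "span {u} = span \<rho>"
  proof (rule dim_eq_span)
    show "dim {u} \<ge> dim \<rho>" using \<rho>(2) u dim_insert[of u "{}"] by simp
  qed (use u in simp)
  then have line: "w \<in> \<rho> \<Longrightarrow> \<exists>c. w = c *\<^sub>R u" for w
    using span_base[of w \<rho>] by (auto simp: span_singleton)
  define S where "S = {a. \<exists>w\<in>verts. w \<bullet> u = x \<bullet> u \<and> a = x - w}"
  have line': "\<exists>c. z = c *\<^sub>R u" if z: "\<forall>a\<in>S. a \<bullet> z = 0" for z
  proof -
    \<comment> \<open>So small that \<open>u + e *\<^sub>R z\<close> keeps the inequalities that are
      strict at \<open>u\<close>. The inserted 1 covers the case of no such inequality, and the
      summand 1 keeps denominators positive.\<close>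
    define e where "e = Min (insert 1 ((\<lambda>w. (x \<bullet> u - w \<bullet> u) / (1 + \<bar>(x - w) \<bullet> z\<bar>)) ` {w \<in> verts. w \<bullet> u < x \<bullet> u}))"
    have "e > 0" unfolding e_def using verts(1) by (subst Min_gr_iff) auto
    have "u + e *\<^sub>R z \<in> cone_at x"
      unfolding cone_at_verts
    proof (intro CollectI ballI)
      fix w assume w: "w \<in> verts"
      have "w \<bullet> u \<le> x \<bullet> u" using u(1) w verts(3) x(3) by (auto simp: cone_at_def)
      then consider "w \<bullet> u = x \<bullet> u" | "w \<bullet> u < x \<bullet> u" by linarith
      then have "0 \<le> (x - w) \<bullet> (u + e *\<^sub>R z)"
      proof cases
        case 1
        then have "(x - w) \<bullet> z = 0" using z w by (auto simp: S_def)
        then show ?thesis using 1 by (simp add: inner_add_right inner_diff_left)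
      next
        case 2
        then have "e \<le> (x \<bullet> u - w \<bullet> u) / (1 + \<bar>(x - w) \<bullet> z\<bar>)"
          unfolding e_def using w verts(1) by (intro Min_le) auto
        then have "e * (1 + \<bar>(x - w) \<bullet> z\<bar>) \<le> x \<bullet> u - w \<bullet> u" by (simp add: pos_le_divide_eq)
        moreover have "- (e * ((x - w) \<bullet> z)) \<le> e * \<bar>(x - w) \<bullet> z\<bar>"
          using \<open>e > 0\<close> by (metis abs_ge_minus_self mult_le_cancel_left_pos mult_minus_right)
        moreover have "(x - w) \<bullet> (u + e *\<^sub>R z) = (x \<bullet> u - w \<bullet> u) + e * ((x - w) \<bullet> z)"
          by (simp add: inner_add_right inner_diff_left)
        ultimately show ?thesis using \<open>e > 0\<close> by (simp add: distrib_left)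
      qed
      then show "w \<bullet> (u + e *\<^sub>R z) \<le> x \<bullet> (u + e *\<^sub>R z)" by (simp add: inner_diff_left)
    qed
    then obtain c where "u + e *\<^sub>R z = c *\<^sub>R u" using line x(3) by blast
    then have "e *\<^sub>R z = (c - 1) *\<^sub>R u" by (simp add: algebra_simps)
    moreover have "z = (1 / e) *\<^sub>R (e *\<^sub>R z)" using \<open>e > 0\<close> by simp
    ultimately have "z = (1 / e) *\<^sub>R ((c - 1) *\<^sub>R u)" by metis
    then have "z = ((c - 1) / e) *\<^sub>R u" by simp
    then show ?thesis by blast
  qed
  have "\<exists>z. z \<noteq> 0 \<and> rational_vec z \<and> (\<forall>a\<in>S. a \<bullet> z = 0)"
  proof (rule rational_solution[OF u(2)])
    show "rational_vec a" if "a \<in> S" for a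
      using that x(2) verts(4) by (auto simp: S_def intro: rational_vec_diff)
    show "a \<bullet> u = 0" if "a \<in> S" for a
      using that by (auto simp: S_def inner_diff_left)
  qed
  then obtain z where z: "z \<noteq> 0" "rational_vec z" "\<forall>a\<in>S. a \<bullet> z = 0" by blast
  then obtain c where c: "z = c *\<^sub>R u" using line' by blast
  \<comment> \<open>The rational solution may point against \<open>u\<close>; this choice makes it a
    positive multiple of \<open>u\<close>.\<close>
  define z' where "z' = (if c > 0 then z else - z)"
  have z': "z' \<noteq> 0" "rational_vec z'" "z' = \<bar>c\<bar> *\<^sub>R u" "c \<noteq> 0"
    using z(1,2) c by (auto simp: z'_def rational_vec_def)
  obtain w t where w: "Gcd (range (\<lambda>i. w $ i)) = 1" "t > 0" "z' = t *\<^sub>R real_vec w"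
    using primitive_multiple[OF z'(1,2)] by blast
  have uw: "u = (t / \<bar>c\<bar>) *\<^sub>R real_vec w"
  proof -
    have "u = (1 / \<bar>c\<bar>) *\<^sub>R z'" using z'(3,4) by simp
    then show ?thesis unfolding w(3) by simp
  qed
  define r where "r = t / \<bar>c\<bar>"
  have r: "r > 0" "u = r *\<^sub>R real_vec w" using w z'(4) uw by (auto simp: r_def)
  have \<rho>_eq: "\<rho> = {t *\<^sub>R real_vec w |t. 0 \<le> t}"
  proof (intro equalityI subsetI)
    fix y assume y: "y \<in> \<rho>"
    then obtain d where d: "y = d *\<^sub>R u" using line by blast
    have "0 \<le> d"
    proof -
      obtain x0 where x0: "x0 \<in> interior P" using interior_nonempty by blast
      then have "x0 \<bullet> u < x \<bullet> u" using interior_less u x(3) by blast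
      moreover have "x0 \<bullet> y \<le> x \<bullet> y" using y x(3) x0 interior_subset by (auto simp: cone_at_def)
      then have "d * (x0 \<bullet> u) \<le> d * (x \<bullet> u)" by (simp add: d)
      ultimately show ?thesis by (metis mult_le_cancel_left not_le)
    qed
    then show "y \<in> {t *\<^sub>R real_vec w |t. 0 \<le> t}" using d r by (auto intro!: exI[of _ "d * r"])
  next
    fix y assume "y \<in> {t *\<^sub>R real_vec w |t. 0 \<le> t}"
    then obtain s where "0 \<le> s" "y = s *\<^sub>R real_vec w" by blast
    then have y: "y = (s / r) *\<^sub>R u" "0 \<le> s / r" using r by auto
    show "y \<in> \<rho>"
      unfolding x(3) cone_at_def
    proof (intro CollectI ballI)
      fix p assume "p \<in> P"
      then have "p \<bullet> u \<le> x \<bullet> u" using u(1) x(3) by (auto simp: cone_at_def)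
      then show "p \<bullet> y \<le> x \<bullet> y" unfolding y(1) inner_scaleR_right using y(2) by (rule mult_left_mono)
    qed
  qed
  have "primitive_generator \<rho> = w"
    unfolding primitive_generator_def
  proof (rule the_equality)
    fix w' assume w': "Gcd (range (\<lambda>i. w' $ i)) = 1 \<and> \<rho> = {t *\<^sub>R real_vec w' |t. 0 \<le> t}"
    have "real_vec w' = 1 *\<^sub>R real_vec w'" by simp
    then have "real_vec w' \<in> \<rho>" using w' zero_le_one by blast
    then obtain s where s: "real_vec w' = s *\<^sub>R real_vec w" "0 \<le> s" unfolding \<rho>_eq by blast
    have "w' \<noteq> 0"
    proof
      assume "w' = 0"
      then have "Gcd (range (\<lambda>i. w' $ i)) = 0" by (auto simp: Gcd_0_iff)
      then show False using w' by simp
    qed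
    then have "s \<noteq> 0" using s(1) by auto
    then show "w' = w" using primitive_positive_multiple_eq[of w' w s] s w' w by auto
  qed (use w \<rho>_eq in blast)
  then show "Gcd (range (\<lambda>i. primitive_generator \<rho> $ i)) = 1" "\<rho> = {t *\<^sub>R gen \<rho> |t. 0 \<le> t}"
    using w \<rho>_eq by auto
qed

lemma gen_in_ray: "\<rho> \<in> rays \<Sigma> \<Longrightarrow> gen \<rho> \<in> \<rho>"
  using ray_primitive_generator(2)[of \<rho>] by (metis (mono_tags, lifting) mem_Collect_eq scaleR_one zero_le_one)

lemma gen_nonzero:
  assumes "\<rho> \<in> rays \<Sigma>"
  shows "gen \<rho> \<noteq> 0"
proof
  assume "gen \<rho> = 0"
  then have "primitive_generator \<rho> = 0" by simp
  then have "Gcd (range (\<lambda>i. primitive_generator \<rho> $ i)) = 0" by simp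
  then show False using ray_primitive_generator(1)[OF assms] by simp
qed

lemma gen_inject:
  assumes \<rho>: "\<rho> \<in> rays \<Sigma>" "\<rho>' \<in> rays \<Sigma>" and eq: "primitive_generator \<rho> = primitive_generator \<rho>'"
  shows "\<rho> = \<rho>'"
proof -
  have "\<rho> = {t *\<^sub>R gen \<rho> |t. 0 \<le> t}" by (rule ray_primitive_generator(2)[OF \<rho>(1)])
  also have "\<dots> = {t *\<^sub>R gen \<rho>' |t. 0 \<le> t}" unfolding eq ..
  also have "\<dots> = \<rho>'" by (rule ray_primitive_generator(2)[OF \<rho>(2), symmetric])
  finally show ?thesis .
qed

lemma support_number_eq:
  assumes "gen \<rho> \<in> cone_at x" "x \<in> P"
  shows "support_number P \<rho> = x \<bullet> gen \<rho>"
  unfolding support_number_def using assms by (intro cSup_eq_maximum) (auto simp: cone_at_def)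

lemma ray_point:
  assumes "\<rho> \<in> rays \<Sigma>"
  obtains x where "x \<in> P" "rational_vec x" "\<rho> = cone_at x" "gen \<rho> \<in> cone_at x"
  using fan_cone[of \<rho>] assms gen_in_ray[OF assms] by (auto simp: rays_def)

lemma le_support_number: "\<rho> \<in> rays \<Sigma> \<Longrightarrow> y \<in> P \<Longrightarrow> y \<bullet> gen \<rho> \<le> support_number P \<rho>"
  by (erule ray_point) (auto simp: support_number_eq cone_at_def)

lemma gen_in_cone_iff:
  "\<rho> \<in> rays \<Sigma> \<Longrightarrow> x \<in> P \<Longrightarrow> gen \<rho> \<in> cone_at x \<longleftrightarrow> x \<bullet> gen \<rho> = support_number P \<rho>"
  using support_number_eq[of \<rho> x] le_support_number[of \<rho>] by (auto simp: cone_at_def)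

text \<open>By dimension the affine hull of a facet is the whole hyperplane. A functional maximal on
  the facet is constant there, so its component orthogonal to \<open>a\<close> vanishes, and an
  interior point fixes the sign.\<close>

lemma facet_cone:
  assumes h: "P \<subseteq> {x. a \<bullet> x \<le> b}" "a \<noteq> 0" and C: "C facet_of P" "C = P \<inter> {x. a \<bullet> x = b}"
  shows "normal_cone P C = {t *\<^sub>R a |t. 0 \<le> t}" "normal_cone P C \<in> rays \<Sigma>"
proof -
  have face: "C face_of P" "C \<noteq> {}" "aff_dim C = int CARD('d) - 1"
    using C(1) full by (auto simp: facet_of_def)
  obtain c where c: "c \<in> C" using face by auto
  have hyper: "affine hull C = {x. a \<bullet> x = b}"
  proof (rule affine_dim_equal)
    show "affine hull C \<subseteq> {x. a \<bullet> x = b}"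
      using C(2) by (intro hull_minimal affine_hyperplane) auto
    show "aff_dim (affine hull C) = aff_dim {x. a \<bullet> x = b}"
      using face(3) h(2) by (simp add: aff_dim_hyperplane)
  qed (use face affine_hyperplane in auto)
  have "u \<in> {t *\<^sub>R a |t. 0 \<le> t}" if u: "u \<in> normal_cone P C" for u
  proof -
    have const: "x \<bullet> u = c \<bullet> u" if "x \<in> C" for x
      using u that c C(2) by (intro antisym) (auto simp: normal_cone_def)
    have "affine hull C \<subseteq> {x. u \<bullet> x = c \<bullet> u}"
      using const by (intro hull_minimal affine_hyperplane) (auto simp: inner_commute[of u])
    then have *: "u \<bullet> x = c \<bullet> u" if "a \<bullet> x = b" for x using that hyper by auto
    define t where "t = (u \<bullet> a) / (a \<bullet> a)"
    define z where "z = u - t *\<^sub>R a"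
    have az: "a \<bullet> z = 0" using h(2) by (simp add: z_def t_def inner_diff_right inner_commute)
    have "a \<bullet> (c + z) = b" using c C(2) az by (simp add: inner_add_right)
    then have "u \<bullet> z = 0" using *[of "c + z"] by (simp add: inner_add_right inner_commute)
    then have "z \<bullet> z = 0" using az by (simp add: z_def inner_diff_left)
    then have ut: "u = t *\<^sub>R a" by (simp add: z_def)
    obtain x0 where x0: "x0 \<in> interior P" using interior_nonempty by blast
    have cP: "c \<in> P" "c \<bullet> a = b" using c C(2) by (auto simp: inner_commute)
    then have "a \<in> cone_at c" using h(1) by (auto simp: cone_at_def inner_commute)
    then have less: "x0 \<bullet> a < c \<bullet> a" using interior_less[OF x0 _ h(2)] by blast
    have "x0 \<bullet> u \<le> c \<bullet> u"
      using u c x0 interior_subset by (auto simp: normal_cone_def)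
    then have "t * (x0 \<bullet> a) \<le> t * (c \<bullet> a)" by (simp add: ut)
    then have "0 \<le> t" using less by (metis mult_le_cancel_left not_le)
    then show ?thesis using ut by blast
  qed
  moreover have "t *\<^sub>R a \<in> normal_cone P C" if "0 \<le> t" for t
    using that h(1) C(2) by (auto simp: normal_cone_def inner_commute[of _ a] intro!: mult_left_mono)
  ultimately show eq: "normal_cone P C = {t *\<^sub>R a |t. 0 \<le> t}" by blast
  have "dim {t *\<^sub>R a |t. 0 \<le> t} = dim {a}"
  proof (rule antisym)
    have "{t *\<^sub>R a |t. 0 \<le> t} \<subseteq> span {a}" by (auto intro: span_scale span_base)
    then show "dim {t *\<^sub>R a |t. 0 \<le> t} \<le> dim {a}" using dim_subset[of _ "span {a}"] by (simp add: dim_span)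
    have "a = 1 *\<^sub>R a" by simp
    then have "a \<in> {t *\<^sub>R a |t. 0 \<le> t}" using zero_le_one by blast
    then show "dim {a} \<le> dim {t *\<^sub>R a |t. 0 \<le> t}" by (intro dim_subset) blast
  qed
  also have "dim {a} = 1" using h(2) dim_insert[of a "{}"] by simp
  finally show "normal_cone P C \<in> rays \<Sigma>"
    unfolding rays_def eq[symmetric] using face by (auto simp: normal_fan_def)
qed

text \<open>Each half-space in an irredundant description of \<open>P\<close> defines a facet, whose
  normal cone is a ray. So the inequalities of the rays already cut out \<open>P\<close>.\<close>

lemma mem_polytope_iff: "y \<in> P \<longleftrightarrow> (\<forall>\<rho>\<in>rays \<Sigma>. y \<bullet> gen \<rho> \<le> support_number P \<rho>)"
proof
  assume y: "\<forall>\<rho>\<in>rays \<Sigma>. y \<bullet> gen \<rho> \<le> support_number P \<rho>"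
  have "polyhedron P" using polytope by (simp add: polytope_imp_polyhedron)
  then obtain F where F: "finite F" "P = affine hull P \<inter> \<Inter>F"
    "\<forall>h\<in>F. \<exists>a b. a \<noteq> 0 \<and> h = {x. a \<bullet> x \<le> b}" "\<forall>F'\<subset>F. P \<subset> affine hull P \<inter> \<Inter>F'"
    unfolding polyhedron_Int_affine_minimal by blast
  then obtain a b where ab: "\<And>h. h \<in> F \<Longrightarrow> a h \<noteq> 0 \<and> h = {x. a h \<bullet> x \<le> b h}" by metis
  have "affine hull P = UNIV" using full aff_dim_eq_full[of P] by simp
  then have P_eq: "P = \<Inter>F" using F(2) by simp
  have "y \<in> h" if h: "h \<in> F" for h
  proof -
    define C where "C = P \<inter> {x. a h \<bullet> x = b h}"
    have facet: "C facet_of P"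
      using facet_of_polyhedron_explicit[OF F(1,2) ab, of C] F(4) h by (auto simp: C_def)
    have sub: "P \<subseteq> {x. a h \<bullet> x \<le> b h}" using P_eq ab[OF h] h by blast
    have a0: "a h \<noteq> 0" using ab[OF h] by simp
    define \<rho> where "\<rho> = normal_cone P C"
    have \<rho>: "\<rho> = {t *\<^sub>R a h |t. 0 \<le> t}" "\<rho> \<in> rays \<Sigma>"
      unfolding \<rho>_def by (rule facet_cone[OF sub a0 facet C_def])+
    obtain t where t: "gen \<rho> = t *\<^sub>R a h" "0 \<le> t" using gen_in_ray[OF \<rho>(2)] unfolding \<rho>(1) by blast
    then have "t > 0" using gen_nonzero[OF \<rho>(2)] by (auto simp: order.order_iff_strict)
    obtain c where c: "c \<in> C" using facet by (auto simp: facet_of_def)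
    have "\<rho> \<subseteq> cone_at c" using c by (auto simp: \<rho>_def normal_cone_def cone_at_def)
    then have "support_number P \<rho> = c \<bullet> gen \<rho>"
      using gen_in_ray[OF \<rho>(2)] c by (intro support_number_eq) (auto simp: C_def)
    then have "y \<bullet> gen \<rho> \<le> c \<bullet> gen \<rho>" using y \<rho>(2) by auto
    then have "t * (y \<bullet> a h) \<le> t * (c \<bullet> a h)" unfolding t(1) by simp
    then have "y \<bullet> a h \<le> c \<bullet> a h" using \<open>t > 0\<close> by simp
    moreover have "c \<bullet> a h = b h" using c by (simp add: C_def inner_commute)
    ultimately have "a h \<bullet> y \<le> b h" by (simp add: inner_commute)
    then show ?thesis using ab[OF h] by blast
  qed
  then show "y \<in> P" unfolding P_eq by blast
qed (use le_support_number in blast)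

lemma mem_interior_iff: "y \<in> interior P \<longleftrightarrow> (\<forall>\<rho>\<in>rays \<Sigma>. y \<bullet> gen \<rho> < support_number P \<rho>)"
proof
  assume y: "y \<in> interior P"
  show "\<forall>\<rho>\<in>rays \<Sigma>. y \<bullet> gen \<rho> < support_number P \<rho>"
  proof
    fix \<rho> assume \<rho>: "\<rho> \<in> rays \<Sigma>"
    then obtain x where "x \<in> P" "gen \<rho> \<in> cone_at x" by (rule ray_point)
    then show "y \<bullet> gen \<rho> < support_number P \<rho>"
      using interior_less[OF y _ gen_nonzero[OF \<rho>]] support_number_eq by metis
  qed
next
  assume y: "\<forall>\<rho>\<in>rays \<Sigma>. y \<bullet> gen \<rho> < support_number P \<rho>"
  define U where "U = (\<Inter>\<rho>\<in>rays \<Sigma>. {z. gen \<rho> \<bullet> z < support_number P \<rho>})"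
  have "open U" unfolding U_def using finite_rays by (intro open_INT open_halfspace_lt ballI) auto
  moreover have "U \<subseteq> P"
    unfolding U_def using mem_polytope_iff by (force simp: inner_commute intro: less_imp_le)
  moreover have "y \<in> U" using y by (simp add: U_def inner_commute)
  ultimately show "y \<in> interior P" using interior_maximal by blast
qed

text \<open>Nonnegativity on the generators of the rays suffices for a small step from
  \<open>x\<close> along \<open>- m\<close> to stay in \<open>P\<close>, since the other
  inequalities have slack; such a step gives nonnegativity on the whole cone. This expresses,
  dually, that the cone is generated by its rays.\<close>

lemma dual_cone_iff:
  assumes x: "x \<in> P"
  shows "(\<forall>u\<in>cone_at x. 0 \<le> m \<bullet> u) \<longleftrightarrow> (\<forall>\<rho>\<in>rays \<Sigma>. gen \<rho> \<in> cone_at x \<longrightarrow> 0 \<le> m \<bullet> gen \<rho>)"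
    and "(\<forall>u\<in>cone_at x. 0 \<le> m \<bullet> u) \<longleftrightarrow> (\<exists>e>0. x - e *\<^sub>R m \<in> P)"
proof -
  have 23: "\<exists>e>0. x - e *\<^sub>R m \<in> P" if m: "\<forall>\<rho>\<in>rays \<Sigma>. gen \<rho> \<in> cone_at x \<longrightarrow> 0 \<le> m \<bullet> gen \<rho>"
  proof -
    define R where "R = {\<rho> \<in> rays \<Sigma>. x \<bullet> gen \<rho> < support_number P \<rho>}"
    \<comment> \<open>The step is bounded by the slack of the facets not containing
      \<open>x\<close>; on the others the sign of \<open>m\<close> alone suffices.\<close>
    define e where "e = Min (insert 1 ((\<lambda>\<rho>. (support_number P \<rho> - x \<bullet> gen \<rho>) / (1 + \<bar>m \<bullet> gen \<rho>\<bar>)) ` R))"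
    have "finite R" using finite_rays by (simp add: R_def)
    then have "e > 0" unfolding e_def by (subst Min_gr_iff) (auto simp: R_def)
    have "(x - e *\<^sub>R m) \<bullet> gen \<rho> \<le> support_number P \<rho>" if \<rho>: "\<rho> \<in> rays \<Sigma>" for \<rho>
    proof (cases "\<rho> \<in> R")
      case True
      then have "e \<le> (support_number P \<rho> - x \<bullet> gen \<rho>) / (1 + \<bar>m \<bullet> gen \<rho>\<bar>)"
        unfolding e_def using \<open>finite R\<close> by (intro Min_le) auto
      then have "e * (1 + \<bar>m \<bullet> gen \<rho>\<bar>) \<le> support_number P \<rho> - x \<bullet> gen \<rho>" by (simp add: pos_le_divide_eq)
      moreover have "- (e * (m \<bullet> gen \<rho>)) \<le> e * \<bar>m \<bullet> gen \<rho>\<bar>"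
        using \<open>e > 0\<close> by (metis abs_ge_minus_self mult_le_cancel_left_pos mult_minus_right)
      ultimately show ?thesis using \<open>e > 0\<close> by (simp add: inner_diff_left distrib_left)
    next
      case False
      then have "x \<bullet> gen \<rho> = support_number P \<rho>" using le_support_number[OF \<rho> x] \<rho> by (auto simp: R_def)
      then have "0 \<le> m \<bullet> gen \<rho>" using m gen_in_cone_iff[OF \<rho> x] \<rho> by blast
      then show ?thesis using \<open>e > 0\<close> \<open>x \<bullet> gen \<rho> = _\<close> by (simp add: inner_diff_left)
    qed
    then have "x - e *\<^sub>R m \<in> P" by (simp add: mem_polytope_iff)
    then show ?thesis using \<open>e > 0\<close> by blast
  qed
  have 31: "\<forall>u\<in>cone_at x. 0 \<le> m \<bullet> u" if e: "\<exists>e>0. x - e *\<^sub>R m \<in> P"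
  proof
    fix u assume "u \<in> cone_at x"
    obtain e where e: "e > 0" "x - e *\<^sub>R m \<in> P" using e by blast
    then have "(x - e *\<^sub>R m) \<bullet> u \<le> x \<bullet> u" using \<open>u \<in> cone_at x\<close> by (auto simp: cone_at_def)
    then have "0 \<le> e * (m \<bullet> u)" by (simp add: inner_diff_left)
    then show "0 \<le> m \<bullet> u" using e by (simp add: zero_le_mult_iff)
  qed
  show "(\<forall>u\<in>cone_at x. 0 \<le> m \<bullet> u) \<longleftrightarrow> (\<forall>\<rho>\<in>rays \<Sigma>. gen \<rho> \<in> cone_at x \<longrightarrow> 0 \<le> m \<bullet> gen \<rho>)"
    "(\<forall>u\<in>cone_at x. 0 \<le> m \<bullet> u) \<longleftrightarrow> (\<exists>e>0. x - e *\<^sub>R m \<in> P)"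
    using 23 31 by blast+
qed

text \<open>
  The obstruction to a character being a section near \<open>S\<close>, seen from the point \<open>x\<close>: a facet that
  contains \<open>S\<close> and is visible (weakly visible, in the second lemma) from \<open>x\<close>. Being described by a convex
  set of functionals, it has no cohomology.
\<close>

lemma visible_facet_iff:
  assumes S: "finite S" "S \<subseteq> verts"
  shows "(\<exists>\<rho>\<in>rays \<Sigma>. (\<forall>s\<in>S. gen \<rho> \<in> cone_at s) \<and> support_number P \<rho> < x \<bullet> gen \<rho>) \<longleftrightarrow>
    (\<exists>u\<in>{u. \<forall>w\<in>verts. w \<bullet> u < x \<bullet> u}. \<forall>s\<in>S. u \<in> cone_at s)"
proof
  assume "\<exists>\<rho>\<in>rays \<Sigma>. (\<forall>s\<in>S. gen \<rho> \<in> cone_at s) \<and> support_number P \<rho> < x \<bullet> gen \<rho>"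
  then obtain \<rho> where \<rho>: "\<rho> \<in> rays \<Sigma>" "\<forall>s\<in>S. gen \<rho> \<in> cone_at s" "support_number P \<rho> < x \<bullet> gen \<rho>" by blast
  then have "w \<bullet> gen \<rho> < x \<bullet> gen \<rho>" if "w \<in> verts" for w
    using le_support_number[OF \<rho>(1), of w] that verts(3) by force
  then show "\<exists>u\<in>{u. \<forall>w\<in>verts. w \<bullet> u < x \<bullet> u}. \<forall>s\<in>S. u \<in> cone_at s"
    using \<rho>(2) by (intro bexI[of _ "gen \<rho>"]) auto
next
  assume "\<exists>u\<in>{u. \<forall>w\<in>verts. w \<bullet> u < x \<bullet> u}. \<forall>s\<in>S. u \<in> cone_at s"
  then obtain u where u: "\<forall>w\<in>verts. w \<bullet> u < x \<bullet> u" "\<forall>s\<in>S. u \<in> cone_at s" by blast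
  \<comment> \<open>Adding a maximizing vertex makes the barycentre \<open>z\<close> a maximum point
    of \<open>u\<close>, even for empty \<open>S\<close>. As \<open>v\<close> has a smaller value
    than \<open>x\<close>, the vector \<open>z - x\<close> is negative at \<open>u\<close>, hence at
    the generator of some ray of the cone at \<open>z\<close>.\<close>
  obtain v where v: "v \<in> verts" "u \<in> cone_at v" by (rule maximal_vert)
  have S': "finite (insert v S)" "insert v S \<noteq> {}" "insert v S \<subseteq> P" using S v verts(3) by auto
  obtain z where z: "z \<in> P" "cone_at z = (\<Inter>s\<in>insert v S. cone_at s)"
    using cone_at_convex_hull[OF S'] hull_minimal[where S = convex, OF S'(3) polytope(3)] by blast
  have uz: "u \<in> cone_at z" using z u v by auto
  then have "v \<bullet> u = z \<bullet> u" using v z verts(3) by (intro antisym) (auto simp: cone_at_def)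
  then have "(z - x) \<bullet> u < 0" using u(1) v(1) by (auto simp: inner_diff_left)
  then have "\<not> (\<forall>u\<in>cone_at z. 0 \<le> (z - x) \<bullet> u)" using uz by (meson not_le)
  then obtain \<rho> where \<rho>: "\<rho> \<in> rays \<Sigma>" "gen \<rho> \<in> cone_at z" "(z - x) \<bullet> gen \<rho> < 0"
    unfolding dual_cone_iff(1)[OF z(1)] by (meson not_le)
  then have "support_number P \<rho> < x \<bullet> gen \<rho>"
    using support_number_eq[OF \<rho>(2) z(1)] by (simp add: inner_diff_left)
  then show "\<exists>\<rho>\<in>rays \<Sigma>. (\<forall>s\<in>S. gen \<rho> \<in> cone_at s) \<and> support_number P \<rho> < x \<bullet> gen \<rho>"
    using \<rho> z(2) by blast
qed

lemma weakly_visible_facet_iff: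
  assumes S: "finite S" "S \<subseteq> verts" and x0: "x0 \<in> interior P"
  shows "(\<exists>\<rho>\<in>rays \<Sigma>. (\<forall>s\<in>S. gen \<rho> \<in> cone_at s) \<and> support_number P \<rho> \<le> x \<bullet> gen \<rho>) \<longleftrightarrow>
    (\<exists>u\<in>{u. (\<forall>w\<in>verts. w \<bullet> u \<le> x \<bullet> u) \<and> x0 \<bullet> u < x \<bullet> u}. \<forall>s\<in>S. u \<in> cone_at s)"
proof
  assume "\<exists>\<rho>\<in>rays \<Sigma>. (\<forall>s\<in>S. gen \<rho> \<in> cone_at s) \<and> support_number P \<rho> \<le> x \<bullet> gen \<rho>"
  then obtain \<rho> where \<rho>: "\<rho> \<in> rays \<Sigma>" "\<forall>s\<in>S. gen \<rho> \<in> cone_at s" "support_number P \<rho> \<le> x \<bullet> gen \<rho>" by blast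
  then have "w \<bullet> gen \<rho> \<le> x \<bullet> gen \<rho>" if "w \<in> verts" for w
    using le_support_number[OF \<rho>(1), of w] that verts(3) by force
  moreover have "x0 \<bullet> gen \<rho> < x \<bullet> gen \<rho>"
    using x0 \<rho>(1,3) mem_interior_iff by force
  ultimately show "\<exists>u\<in>{u. (\<forall>w\<in>verts. w \<bullet> u \<le> x \<bullet> u) \<and> x0 \<bullet> u < x \<bullet> u}. \<forall>s\<in>S. u \<in> cone_at s"
    using \<rho>(2) by (intro bexI[of _ "gen \<rho>"]) auto
next
  assume "\<exists>u\<in>{u. (\<forall>w\<in>verts. w \<bullet> u \<le> x \<bullet> u) \<and> x0 \<bullet> u < x \<bullet> u}. \<forall>s\<in>S. u \<in> cone_at s"
  then obtain u where u: "\<forall>w\<in>verts. w \<bullet> u \<le> x \<bullet> u" "x0 \<bullet> u < x \<bullet> u" "\<forall>s\<in>S. u \<in> cone_at s" by blast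
  show "\<exists>\<rho>\<in>rays \<Sigma>. (\<forall>s\<in>S. gen \<rho> \<in> cone_at s) \<and> support_number P \<rho> \<le> x \<bullet> gen \<rho>"
  proof (rule ccontr)
    assume no: "\<not> ?thesis"
    define R where "R = {\<rho> \<in> rays \<Sigma>. \<forall>s\<in>S. gen \<rho> \<in> cone_at s}"
    \<comment> \<open>Pushing \<open>x\<close> slightly away from the interior point
      \<open>x0\<close> makes the weak inequalities for \<open>u\<close> strict. The bound
      \<open>d\<close> is chosen so that no facet through \<open>S\<close> becomes strictly visible,
      against the strict version of the claim.\<close>
    define d where "d = Min (insert 1 ((\<lambda>\<rho>. (support_number P \<rho> - x \<bullet> gen \<rho>) / (1 + \<bar>(x - x0) \<bullet> gen \<rho>\<bar>)) ` R))"
    have R: "finite R" "\<And>\<rho>. \<rho> \<in> R \<Longrightarrow> x \<bullet> gen \<rho> < support_number P \<rho>"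
      using finite_rays no by (force simp: R_def)+
    have "d > 0" unfolding d_def using R by (subst Min_gr_iff) auto
    define x' where "x' = x + d *\<^sub>R (x - x0)"
    have "\<forall>w\<in>verts. w \<bullet> u < x' \<bullet> u"
    proof
      fix w assume "w \<in> verts"
      then have "w \<bullet> u \<le> x \<bullet> u" using u by blast
      also have "\<dots> < x' \<bullet> u"
        using \<open>d > 0\<close> u(2) by (simp add: x'_def inner_add_left inner_diff_left)
      finally show "w \<bullet> u < x' \<bullet> u" .
    qed
    then obtain \<rho> where \<rho>: "\<rho> \<in> rays \<Sigma>" "\<forall>s\<in>S. gen \<rho> \<in> cone_at s" "support_number P \<rho> < x' \<bullet> gen \<rho>"
      using visible_facet_iff[OF S, of x'] u(3) by blast
    then have "\<rho> \<in> R" by (simp add: R_def)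
    then have "d \<le> (support_number P \<rho> - x \<bullet> gen \<rho>) / (1 + \<bar>(x - x0) \<bullet> gen \<rho>\<bar>)"
      unfolding d_def using R(1) by (intro Min_le) auto
    then have "d * (1 + \<bar>(x - x0) \<bullet> gen \<rho>\<bar>) \<le> support_number P \<rho> - x \<bullet> gen \<rho>" by (simp add: pos_le_divide_eq)
    moreover have "d * ((x - x0) \<bullet> gen \<rho>) \<le> d * \<bar>(x - x0) \<bullet> gen \<rho>\<bar>"
      using \<open>d > 0\<close> by (intro mult_left_mono) auto
    ultimately have "x' \<bullet> gen \<rho> \<le> support_number P \<rho>"
      using \<open>d > 0\<close> unfolding x'_def inner_add_left inner_scaleR_left distrib_left mult_1_right by linarith
    then show False using \<rho>(3) by simp
  qed
qed

end

section \<open>The affine charts\<close>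

lemma pairing_add: "pairing (m + n) u = pairing m u + pairing n u"
  by (simp add: pairing_def real_vec_def inner_vec_def plus_character.rep_eq sum.distrib distrib_right)

lemma pairing_zero [simp]: "pairing 0 u = 0"
  by (simp add: pairing_def real_vec_def inner_vec_def zero_character.rep_eq)

lemma embed_mem_affine_ring:
  "embed_laurent f \<in> affine_ring \<sigma> \<longleftrightarrow> (\<forall>m\<in>Poly_Mapping.keys f. \<forall>u\<in>\<sigma>. 0 \<le> pairing m u)"
  by (auto simp: affine_ring_def)

lemma affine_ringE:
  assumes "a \<in> affine_ring \<sigma>"
  obtains f where "a = embed_laurent f" "\<forall>m\<in>Poly_Mapping.keys f. \<forall>u\<in>\<sigma>. 0 \<le> pairing m u"
  using assms by (auto simp: affine_ring_def)

lemma affine_ring_subset: "affine_ring \<sigma> \<subseteq> range embed_laurent"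
  by (auto simp: affine_ring_def)

lemma monom_mem_affine_ring: "monom m \<in> affine_ring \<sigma> \<longleftrightarrow> (\<forall>u\<in>\<sigma>. 0 \<le> pairing m u)"
  by (simp add: monom_def embed_mem_affine_ring)

lemma subring_affine_ring: "subring_on (affine_ring \<sigma>)"
  unfolding subring_on_def
proof (intro conjI ballI)
  show "0 \<in> affine_ring \<sigma>" using embed_mem_affine_ring[of 0 \<sigma>] by simp
  show "1 \<in> affine_ring \<sigma>" using monom_mem_affine_ring[of 0 \<sigma>] by (simp add: monom_zero)
next
  fix a b assume a: "a \<in> affine_ring \<sigma>" and b: "b \<in> affine_ring \<sigma>"
  obtain f where f: "a = embed_laurent f" "\<forall>m\<in>Poly_Mapping.keys f. \<forall>u\<in>\<sigma>. 0 \<le> pairing m u"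
    using a by (rule affine_ringE)
  obtain g where g: "b = embed_laurent g" "\<forall>m\<in>Poly_Mapping.keys g. \<forall>u\<in>\<sigma>. 0 \<le> pairing m u"
    using b by (rule affine_ringE)
  note fg = f(1) g(1) f(2) g(2)
  show "a + b \<in> affine_ring \<sigma>"
    unfolding fg(1,2) embed_laurent_add[symmetric] embed_mem_affine_ring
  proof (intro ballI)
    fix m u assume m: "m \<in> Poly_Mapping.keys (f + g)" and u: "u \<in> \<sigma>"
    show "0 \<le> pairing m u" using keys_add_obtain[OF m] fg(3,4) u by blast
  qed
  show "a * b \<in> affine_ring \<sigma>"
    unfolding fg(1,2) embed_laurent_mult[symmetric] embed_mem_affine_ring
  proof (intro ballI)
    fix m u assume m: "m \<in> Poly_Mapping.keys (f * g)" and u: "u \<in> \<sigma>"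
    then obtain k l where "k \<in> Poly_Mapping.keys f" "l \<in> Poly_Mapping.keys g" "m = k + l" by (rule_tac keys_mult_obtain)
    then show "0 \<le> pairing m u" using fg(3,4) u by (simp add: pairing_add)
  qed
next
  fix a assume "a \<in> affine_ring \<sigma>"
  then obtain f where f: "a = embed_laurent f"
    "\<And>m u. m \<in> Poly_Mapping.keys f \<Longrightarrow> u \<in> \<sigma> \<Longrightarrow> 0 \<le> pairing m u"
    by (metis affine_ringE)
  then show "- a \<in> affine_ring \<sigma>"
    unfolding f embed_laurent_uminus[symmetric] embed_mem_affine_ring by (auto simp: in_keys_iff)
qed

lemma basic_open_eq:
  assumes "f \<in> affine_ring \<sigma>"
  shows "basic_open \<sigma> f = {R \<in> points (affine_ring \<sigma>). f \<in> units_on R}"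
proof -
  have "f \<in> units_on (localization (affine_ring \<sigma>) p) \<longleftrightarrow> f \<notin> p" if "p \<in> spec (affine_ring \<sigma>)" for p
    using unit_localization_iff'[OF subring_affine_ring that assms] .
  then show ?thesis by (auto simp: basic_open_def points_def)
qed

lemma basic_open_one: "basic_open \<sigma> 1 = points (affine_ring \<sigma>)"
proof -
  have "1 \<in> units_on R" if "R \<in> points (affine_ring \<sigma>)" for R
    using units_on_one subring_point[OF subring_affine_ring that] by blast
  then show ?thesis using basic_open_eq[OF subring_onD(2)[OF subring_affine_ring]] by blast
qed

lemma monom_power: "monom m ^ n = monom (\<Sum>_<n. m)"
  by (induction n) (simp_all add: monom_zero monom_add)

lemma pairing_sum: "pairing (\<Sum>i\<in>I. f i) u = (\<Sum>i\<in>I. pairing (f i) u)"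
  by (induction I rule: infinite_finite_induct) (simp_all add: pairing_add)

context full_polytope
begin

section \<open>Change of charts by characters\<close>

abbreviation chart :: "real ^ 'd \<Rightarrow> 'd ratfun set" where
  "chart x \<equiv> affine_ring (cone_at x)"

text \<open>The character points from \<open>x\<close> to \<open>y\<close>. Its monomial is regular
  on the chart at \<open>y\<close>, and inverting it there yields the overlap with the chart at
  \<open>x\<close>.\<close>

definition shift :: "real ^ 'd \<Rightarrow> real ^ 'd \<Rightarrow> 'd character \<Rightarrow> bool" where
  "shift x y m \<longleftrightarrow> x \<in> P \<and> y \<in> P \<and> (\<exists>k>0. real_vec (exponent m) = k *\<^sub>R (y - x))"

lemma shift_exists:
  assumes "x \<in> P" "y \<in> P" "rational_vec x" "rational_vec y"
  obtains m where "shift x y m" "shift y x (- m)"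
proof -
  obtain k w where kw: "k > 0" "real_vec w = real k *\<^sub>R (y - x)"
    using rational_vec_integer_multiple[OF rational_vec_diff[OF assms(4,3)]] by blast
  have "real_vec (exponent (- Character w)) = real k *\<^sub>R (x - y)"
    using kw(2) by (simp add: uminus_character.rep_eq Character_inverse real_vec_def vec_eq_iff algebra_simps)
  then have "shift y x (- Character w)"
    unfolding shift_def using kw(1) assms by (intro conjI exI[of _ "real k"]) auto
  moreover have "shift x y (Character w)"
    unfolding shift_def using kw assms by (intro conjI exI[of _ "real k"]) (auto simp: Character_inverse)
  ultimately show ?thesis using that by blast
qed

lemma shift_pairing:
  assumes "shift x y m" "u \<in> cone_at y"
  shows "0 \<le> pairing m u"
  using assms by (auto simp: shift_def pairing_def cone_at_def inner_diff_left)

lemma shift_mem_chart: "shift x y m \<Longrightarrow> monom m \<in> chart y"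
  by (simp add: monom_mem_affine_ring shift_pairing)

text \<open>Evaluate \<open>u\<close> at the points \<open>x - e n\<close> and \<open>y\<close> of
  \<open>P\<close>: maximality at \<open>y\<close> bounds the pairing of \<open>n\<close> from below
  by a multiple of that of \<open>m\<close>. This gives the threshold
  \<open>1 / (e * k)\<close>.\<close>

lemma shift_dual:
  assumes m: "shift x y m" and n: "\<And>u. u \<in> cone_at x \<Longrightarrow> 0 \<le> pairing n u"
  shows "\<exists>N. \<forall>r\<ge>N. \<forall>u\<in>cone_at y. 0 \<le> pairing n u + real r * pairing m u"
proof -
  obtain k where k: "k > 0" "real_vec (exponent m) = k *\<^sub>R (y - x)" and xy: "x \<in> P" "y \<in> P"
    using m by (auto simp: shift_def)
  have "\<forall>u\<in>cone_at x. 0 \<le> real_vec (exponent n) \<bullet> u" using n by (simp add: pairing_def)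
  then obtain e where e: "e > 0" "x - e *\<^sub>R real_vec (exponent n) \<in> P"
    using dual_cone_iff(2)[OF xy(1)] by blast
  obtain N where N: "real N \<ge> 1 / (e * k)" using real_arch_simple by blast
  show ?thesis
  proof (intro exI allI impI ballI)
    fix r u assume r: "N \<le> r" and u: "u \<in> cone_at y"
    have "(x - e *\<^sub>R real_vec (exponent n)) \<bullet> u \<le> y \<bullet> u" using e u by (auto simp: cone_at_def)
    then have "0 \<le> e * pairing n u + (y - x) \<bullet> u" by (simp add: pairing_def inner_diff_left)
    then have "0 \<le> (e * pairing n u + (y - x) \<bullet> u) / e" using e(1) by simp
    also have "\<dots> = pairing n u + (1 / (e * k)) * pairing m u"
      using e(1) k(1) by (simp add: pairing_def k(2) add_divide_distrib)
    finally have 1: "0 \<le> pairing n u + (1 / (e * k)) * pairing m u" .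
    have "1 / (e * k) \<le> real r" using N r by linarith
    then have "(1 / (e * k)) * pairing m u \<le> real r * pairing m u"
      by (rule mult_right_mono) (rule shift_pairing[OF m u])
    then show "0 \<le> pairing n u + real r * pairing m u" using 1 by linarith
  qed
qed

text \<open>A function regular on the chart at \<open>x\<close> acquires on the chart at
  \<open>y\<close> only poles that a power of one monomial removes. All larger exponents are
  allowed, so that several functions can be cleared at once.\<close>

lemma shift_clear:
  assumes m: "shift x y m" and a: "a \<in> chart x"
  shows "\<exists>N. \<forall>r\<ge>N. a * monom m ^ r \<in> chart y"
proof -
  obtain f where f: "a = embed_laurent f"
    "\<And>n u. n \<in> Poly_Mapping.keys f \<Longrightarrow> u \<in> cone_at x \<Longrightarrow> 0 \<le> pairing n u"
    using a by (metis affine_ringE)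
  have "\<forall>n\<in>Poly_Mapping.keys f. \<exists>N. \<forall>r\<ge>N. \<forall>u\<in>cone_at y. 0 \<le> pairing n u + real r * pairing m u"
    using shift_dual[OF m] f(2) by blast
  then obtain N where N: "\<And>n r u. n \<in> Poly_Mapping.keys f \<Longrightarrow> N n \<le> r \<Longrightarrow> u \<in> cone_at y \<Longrightarrow>
      0 \<le> pairing n u + real r * pairing m u" by metis
  define M where "M = Max (insert 0 (N ` Poly_Mapping.keys f))"
  have M: "N n \<le> M" if "n \<in> Poly_Mapping.keys f" for n
    using that by (simp add: M_def)
  show ?thesis
  proof (intro exI allI impI)
    fix r assume r: "M \<le> r"
    define s where "s = (\<Sum>_<r. m)"
    have s: "monom m ^ r = embed_laurent (Poly_Mapping.single s 1)"
      unfolding s_def by (subst monom_power) (simp add: monom_def)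
    have ps: "pairing s u = real r * pairing m u" for u by (simp add: s_def pairing_sum)
    show "a * monom m ^ r \<in> chart y"
      unfolding f(1) s embed_laurent_mult[symmetric] embed_mem_affine_ring
    proof (intro ballI)
      fix k u assume k: "k \<in> Poly_Mapping.keys (f * Poly_Mapping.single s 1)" and u: "u \<in> cone_at y"
      from k obtain n l where n: "n \<in> Poly_Mapping.keys f" "l \<in> Poly_Mapping.keys (Poly_Mapping.single s (1::complex))" "k = n + l"
        by (rule keys_mult_obtain)
      then have "k = n + s" by simp
      then show "0 \<le> pairing k u" using N[OF n(1) _ u] M[OF n(1)] r by (simp add: pairing_add ps)
    qed
  qed
qed

lemma monom_unit:
  assumes "subring_on R" "monom m \<in> R" "monom (- m) \<in> R"
  shows "monom m \<in> units_on R" "monom (- m) \<in> units_on R"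
  using assms inverse_monom[of m] inverse_monom[of "- m"] by (auto simp: units_on_def)

lemma chart_change:
  assumes m: "shift x y m" "shift y x (- m)" and R: "R \<in> points (chart y)" and unit: "monom m \<in> units_on R"
  shows "R \<in> points (chart x)"
proof (rule points_change_ring[OF subring_affine_ring R subring_affine_ring])
  note sub = subring_point[OF subring_affine_ring R]
  have unit': "monom (- m) \<in> units_on R" using units_on_inverse[OF unit] by (simp add: inverse_monom)
  show "chart x \<subseteq> R"
  proof
    fix a assume "a \<in> chart x"
    then obtain N where "a * monom m ^ N \<in> chart y" using shift_clear[OF m(1)] by blast
    then have "a * monom m ^ N * monom (- m) ^ N \<in> R"
      using sub unit' subring_onD(5,7)[OF sub(1)] by (meson subsetD units_onD(1))
    moreover have "monom m ^ N * monom (- m) ^ N = 1"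
      by (simp flip: power_mult_distrib monom_add add: monom_zero)
    ultimately show "a \<in> R" by (simp add: mult.assoc)
  qed
  show "\<exists>t\<in>chart x \<inter> units_on R. a * t \<in> chart x" if a: "a \<in> chart y" for a
  proof -
    obtain N where "a * monom (- m) ^ N \<in> chart x" using shift_clear[OF m(2) a] by blast
    moreover have "monom (- m) ^ N \<in> chart x"
      using shift_mem_chart[OF m(2)] subring_onD(7)[OF subring_affine_ring] by blast
    moreover have "monom (- m) ^ N \<in> units_on R" using units_on_power[OF sub(1) unit'] .
    ultimately show ?thesis by blast
  qed
qed

text \<open>Separatedness in terms of local rings: a point of the chart at \<open>y\<close> lies in
  the chart at \<open>x\<close> exactly on a principal open set, as both \<open>m\<close> and
  \<open>- m\<close> are regular on one of the charts.\<close>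

lemma chart_overlap:
  assumes m: "shift x y m" "shift y x (- m)" and R: "R \<in> points (chart y)"
  shows "R \<in> points (chart x) \<longleftrightarrow> monom m \<in> units_on R"
proof
  assume Rx: "R \<in> points (chart x)"
  note sub = subring_point[OF subring_affine_ring R]
  have "monom m \<in> R" using shift_mem_chart[OF m(1)] sub by blast
  moreover have "monom (- m) \<in> R" using shift_mem_chart[OF m(2)] subring_point[OF subring_affine_ring Rx] by blast
  ultimately show "monom m \<in> units_on R" using monom_unit sub by blast
qed (rule chart_change[OF m R])

lemma points_chart_mono:
  assumes xy: "x \<in> P" "y \<in> P" "rational_vec x" "rational_vec y" and sub: "cone_at x \<subseteq> cone_at y"
  shows "points (chart x) \<subseteq> points (chart y)"
proof
  fix R assume R: "R \<in> points (chart x)"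
  obtain m where m: "shift y x m" "shift x y (- m)" using shift_exists[OF xy(2,1,4,3)] .
  note subR = subring_point[OF subring_affine_ring R]
  have "monom m \<in> R" using shift_mem_chart[OF m(1)] subR by blast
  moreover have "monom (- m) \<in> chart x"
    using shift_pairing[OF m(2)] sub by (auto simp: monom_mem_affine_ring)
  ultimately have "monom m \<in> units_on R" using monom_unit subR by blast
  then show "R \<in> points (chart y)" by (rule chart_change[OF m R])
qed

lemma verts_rational: "v \<in> verts \<Longrightarrow> v \<in> P" "v \<in> verts \<Longrightarrow> rational_vec v"
  using verts by auto

section \<open>Points and open sets of the toric variety\<close>

abbreviation X :: "'d ratfun set topology" where "X \<equiv> polytope_variety P"

lemma topspace_X: "topspace X = (\<Union>v\<in>verts. points (chart v))"
proof (intro equalityI subsetI)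
  fix R assume "R \<in> topspace X"
  then obtain \<sigma> f where \<sigma>: "\<sigma> \<in> \<Sigma>" "f \<in> affine_ring \<sigma>" "R \<in> basic_open \<sigma> f"
    by (auto simp: toric_variety_def)
  obtain x where x: "x \<in> P" "rational_vec x" "\<sigma> = cone_at x" using fan_cone[OF \<sigma>(1)] .
  obtain v where v: "v \<in> verts" "cone_at x \<subseteq> cone_at v" using vert_of_point[OF x(1)] .
  have "R \<in> points (chart x)" using \<sigma> x basic_open_eq by auto
  then show "R \<in> (\<Union>v\<in>verts. points (chart v))"
    using points_chart_mono[of x v] x v verts_rational by blast
next
  fix R assume "R \<in> (\<Union>v\<in>verts. points (chart v))"
  then obtain v where v: "v \<in> verts" "R \<in> points (chart v)" by blast
  then have "R \<in> basic_open (cone_at v) 1" by (simp add: basic_open_one)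
  then show "R \<in> topspace X"
    using vert_cone_in_fan[OF v(1)] subring_onD(2)[OF subring_affine_ring, of "cone_at v"]
    unfolding toric_variety_def topology_generated_by_topspace by blast
qed

definition principal :: "real ^ 'd \<Rightarrow> 'd ratfun \<Rightarrow> 'd ratfun set set" where
  "principal x f = {R \<in> points (chart x). f \<in> units_on R}"

lemma openin_principal:
  assumes "v \<in> verts" "g \<in> chart v"
  shows "openin X (principal v g)"
  unfolding toric_variety_def
proof (rule topology_generated_by_Basis)
  show "principal v g \<in> {basic_open \<sigma> f |\<sigma> f. \<sigma> \<in> \<Sigma> \<and> f \<in> affine_ring \<sigma>}"
    using basic_open_eq[OF assms(2), folded principal_def] vert_cone_in_fan[OF assms(1)] assms(2)
    by blast
qed

lemma principal_Int: "f \<in> chart x \<Longrightarrow> g \<in> chart x \<Longrightarrow> principal x f \<inter> principal x g = principal x (f * g)"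
  using units_on_mult_iff subring_point[OF subring_affine_ring] unfolding principal_def by blast

text \<open>The factor \<open>monom m\<close> of \<open>g\<close> cuts out the overlap; on the
  overlap \<open>f\<close> and \<open>f * monom m ^ N\<close> differ by a unit.\<close>

lemma principal_Int_chart:
  assumes xy: "x \<in> P" "y \<in> P" "rational_vec x" "rational_vec y" and f: "f \<in> chart x"
  shows "\<exists>g\<in>chart y. principal x f \<inter> points (chart y) = principal y g"
proof -
  obtain m where m: "shift x y m" "shift y x (- m)" using shift_exists[OF xy] .
  obtain N where N: "f * monom m ^ N \<in> chart y" using shift_clear[OF m(1) f] by blast
  define g where "g = monom m * (f * monom m ^ N)"
  have mem: "monom m \<in> chart y" using shift_mem_chart[OF m(1)] .
  have "R \<in> principal x f \<longleftrightarrow> g \<in> units_on R" if R: "R \<in> points (chart y)" for R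
  proof -
    note sub = subring_point[OF subring_affine_ring R]
    have "g \<in> units_on R \<longleftrightarrow> monom m \<in> units_on R \<and> f * monom m ^ N \<in> units_on R"
      unfolding g_def using units_on_mult_iff[OF sub(1)] N mem sub(2) by blast
    also have "\<dots> \<longleftrightarrow> monom m \<in> units_on R \<and> f \<in> units_on R"
    proof (rule conj_cong[OF refl])
      assume "monom m \<in> units_on R"
      then have "monom m ^ N \<in> units_on R" "R \<in> points (chart x)"
        using units_on_power[OF sub(1)] chart_change[OF m R] by blast+
      moreover from this have "f \<in> R" using subring_point[OF subring_affine_ring] f by blast
      ultimately show "f * monom m ^ N \<in> units_on R \<longleftrightarrow> f \<in> units_on R"
        using units_on_mult_iff[OF sub(1)] units_onD(1) by blast
    qed
    also have "\<dots> \<longleftrightarrow> R \<in> principal x f" using chart_overlap[OF m R] by (auto simp: principal_def)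
    finally show ?thesis by blast
  qed
  moreover have "g \<in> chart y" unfolding g_def using mem N subring_onD(5)[OF subring_affine_ring] by blast
  ultimately show ?thesis by (intro bexI[of _ g]) (auto simp: principal_def)
qed

text \<open>Near a point the principal sets of a single chart form a base: they are closed under
  intersection, and basic open sets of other charts restrict to principal ones.\<close>

lemma open_contains_principal:
  assumes "openin X V" "R \<in> V" "R \<in> points (chart v)" "v \<in> verts"
  shows "\<exists>g\<in>chart v. R \<in> principal v g \<and> principal v g \<subseteq> V"
proof -
  have "generate_topology_on {basic_open \<sigma> f |\<sigma> f. \<sigma> \<in> \<Sigma> \<and> f \<in> affine_ring \<sigma>} V"
    using assms(1) by (simp add: toric_variety_def openin_topology_generated_by_iff)
  then show ?thesis
    using assms(2)
  proof (induction rule: generate_topology_on.induct)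
    case (Int a b)
    then obtain f g where "f \<in> chart v" "g \<in> chart v" "R \<in> principal v f \<inter> principal v g"
      "principal v f \<subseteq> a" "principal v g \<subseteq> b" by blast
    then show ?case
      using principal_Int[of f v g] subring_onD(5)[OF subring_affine_ring, of f "cone_at v" g] by blast
  next
    case (Basis s)
    then obtain \<sigma> f where \<sigma>: "s = basic_open \<sigma> f" "\<sigma> \<in> \<Sigma>" "f \<in> affine_ring \<sigma>" by blast
    obtain x where x: "x \<in> P" "rational_vec x" "\<sigma> = cone_at x" using fan_cone[OF \<sigma>(2)] .
    have s: "s = principal x f" using \<sigma> x basic_open_eq[of f \<sigma>] by (simp add: principal_def)
    obtain g where "g \<in> chart v" "principal x f \<inter> points (chart v) = principal v g"
      using principal_Int_chart[OF x(1) _ x(2)] verts_rational[OF assms(4)] \<sigma> x by blast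
    then show ?case using Basis.prems assms(3) s by blast
  qed blast+
qed

end

section \<open>The prime divisors\<close>

lemma val_ring_in_points:
  assumes dv: "discrete_valuation v" and A: "subring_on A" "A \<subseteq> val_ring v"
    and frac: "\<And>f. f \<in> val_ring v \<Longrightarrow> \<exists>a\<in>A. \<exists>s\<in>A. s \<noteq> 0 \<and> v s = 0 \<and> f = a / s"
  shows "val_ring v \<in> points A" "val_ring v = localization A (A \<inter> val_ideal v)"
proof -
  have prime: "A \<inter> val_ideal v \<in> spec A"
  proof -
    have mem: "val_ideal v \<in> spec (val_ring v)" by (simp add: spec_val_ring[OF dv])
    note m = specD[OF subring_val_ring[OF dv] mem]
    have m6: "a \<in> val_ideal v \<or> b \<in> val_ideal v" if "a \<in> A" "b \<in> A" "a * b \<in> val_ideal v" for a b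
      using m(6) that A(2) by blast
    show ?thesis
      unfolding spec_iff[OF A(1)]
    proof (intro conjI ballI impI)
      fix a b assume "a \<in> A" "b \<in> A" "a * b \<in> A \<inter> val_ideal v"
      then show "a \<in> A \<inter> val_ideal v \<or> b \<in> A \<inter> val_ideal v" using m6 by blast
    next
      fix a b assume "a \<in> A" "b \<in> A \<inter> val_ideal v"
      then show "a * b \<in> A \<inter> val_ideal v" using m(5) A subring_onD(5)[OF A(1)] by blast
    next
      fix a b assume "a \<in> A \<inter> val_ideal v" "b \<in> A \<inter> val_ideal v"
      then show "a + b \<in> A \<inter> val_ideal v" using m(4) subring_onD(4)[OF A(1)] by blast
    qed (use m(2,3) subring_onD(1)[OF A(1)] in auto)
  qed
  show eq: "val_ring v = localization A (A \<inter> val_ideal v)"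
  proof (intro equalityI subsetI)
    fix f assume "f \<in> val_ring v"
    then obtain a s where as: "a \<in> A" "s \<in> A" "s \<noteq> 0" "v s = 0" "f = a / s" using frac by blast
    then have "s \<in> A - A \<inter> val_ideal v" by (simp add: val_ideal_def)
    then show "f \<in> localization A (A \<inter> val_ideal v)" unfolding localization_def using as by blast
  next
    fix f assume "f \<in> localization A (A \<inter> val_ideal v)"
    then obtain a s where as: "a \<in> A" "s \<in> A" "s \<notin> val_ideal v" "f = a / s" unfolding localization_def by blast
    then have s: "s \<noteq> 0" "v s \<le> 0" by (auto simp: val_ideal_def)
    have "a \<in> val_ring v" using as A by blast
    then show "f \<in> val_ring v" using s as(4) val_divide[OF dv, of a s] by (auto simp: val_ring_def)
  qed
  show "val_ring v \<in> points A" using prime eq by (auto simp: points_def)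
qed

definition weight :: "int ^ 'd \<Rightarrow> 'd::finite character \<Rightarrow> int" where
  "weight w m = (\<Sum>i\<in>UNIV. ex i m * w $ i)"

lemma weight_add: "weight w (m + n) = weight w m + weight w n"
  by (simp add: weight_def ex_add distrib_right sum.distrib)

lemma pairing_real_vec: "pairing m (real_vec w) = real_of_int (weight w m)"
  by (simp add: pairing_def inner_real_vec weight_def ex_def)

lemma weight_one_exists:
  assumes "Gcd (range (\<lambda>i. w $ i)) = 1"
  obtains m where "weight w m = 1"
proof -
  obtain c where "(\<Sum>i\<in>UNIV. c i * w $ i) = 1" using bezout_Gcd[of UNIV "\<lambda>i. w $ i"] assms by auto
  then have "weight w (Character (\<chi> i. c i)) = 1" by (simp add: weight_def ex_def Character_inverse)
  then show ?thesis by (rule that)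
qed

context full_polytope
begin

section \<open>The divisors of the rays\<close>

definition ray_val :: "(real ^ 'd) set \<Rightarrow> 'd ratfun \<Rightarrow> int" where
  "ray_val \<rho> = monomial_valuation (weight (primitive_generator \<rho>))"

lemma discrete_ray_val: "\<rho> \<in> rays \<Sigma> \<Longrightarrow> discrete_valuation (ray_val \<rho>)"
  unfolding ray_val_def using weight_one_exists[OF ray_primitive_generator(1)]
  by (metis discrete_monomial_valuation weight_add)

lemma ray_val_embed: "a \<noteq> 0 \<Longrightarrow> ray_val \<rho> (embed_laurent a) = low (weight (primitive_generator \<rho>)) a"
  by (simp add: ray_val_def monomial_valuation_embed weight_add)

lemma ray_val_monom: "ray_val \<rho> (monom m) = weight (primitive_generator \<rho>) m"
  by (simp add: ray_val_def monomial_valuation_monom weight_add)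

lemma embed_in_ray_ring:
  "embed_laurent a \<in> val_ring (ray_val \<rho>) \<longleftrightarrow> (\<forall>m\<in>Poly_Mapping.keys a. 0 \<le> weight (primitive_generator \<rho>) m)"
proof (cases "a = 0")
  case True
  then show ?thesis by (simp add: val_ring_def)
next
  case False
  then show ?thesis
    using low_ge[OF False, of 0 "weight (primitive_generator \<rho>)"] low_le[of _ a "weight (primitive_generator \<rho>)"]
    by (force simp: val_ring_def ray_val_embed)
qed

lemma chart_subset_ray_ring:
  assumes "gen \<rho> \<in> cone_at x"
  shows "chart x \<subseteq> val_ring (ray_val \<rho>)"
proof
  fix a assume "a \<in> chart x"
  then obtain f where f: "a = embed_laurent f" "\<forall>m\<in>Poly_Mapping.keys f. \<forall>u\<in>cone_at x. 0 \<le> pairing m u"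
    by (rule affine_ringE)
  then have "0 \<le> pairing m (gen \<rho>)" if "m \<in> Poly_Mapping.keys f" for m using that assms by blast
  then show "a \<in> val_ring (ray_val \<rho>)" unfolding f(1) embed_in_ray_ring by (simp add: pairing_real_vec)
qed

text \<open>A quotient of Laurent polynomials is expanded twice: by a power of a monomial of value 1
  to give the denominator value 0, and by a power of a monomial of value 0 to move both parts into
  the chart at \<open>x\<close>.\<close>

lemma ray_ring_fraction:
  assumes \<rho>: "\<rho> \<in> rays \<Sigma>" and x: "x \<in> P" "rational_vec x" "gen \<rho> \<in> cone_at x"
    and f: "f \<in> val_ring (ray_val \<rho>)"
  shows "\<exists>a\<in>chart x. \<exists>s\<in>chart x. s \<noteq> 0 \<and> ray_val \<rho> s = 0 \<and> f = a / s"
proof (cases "f = 0")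
  case True
  then show ?thesis
    using subring_onD(1,2)[OF subring_affine_ring, of "cone_at x"] val_one[OF discrete_ray_val[OF \<rho>]]
    by (intro bexI[of _ 0] bexI[of _ 1]) auto
next
  case False
  note dv = discrete_ray_val[OF \<rho>]
  obtain y where y: "y \<in> P" "rational_vec y" "\<rho> = cone_at y" "gen \<rho> \<in> cone_at y" using ray_point[OF \<rho>] .
  \<comment> \<open>Both \<open>x\<close> and \<open>y\<close> maximize the generator of the ray, so
    this character has weight 0 along it.\<close>
  obtain m where m: "shift y x m" using shift_exists[OF y(1) x(1) y(2) x(2)] by blast
  then obtain k where k: "real_vec (exponent m) = k *\<^sub>R (x - y)" by (auto simp: shift_def)
  have "real_of_int (weight (primitive_generator \<rho>) m) = pairing m (gen \<rho>)" by (simp add: pairing_real_vec)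
  also have "\<dots> = 0"
    using gen_in_cone_iff[OF \<rho> x(1)] gen_in_cone_iff[OF \<rho> y(1)] x(3) y(4)
    by (simp add: pairing_def k inner_diff_left)
  finally have vm: "ray_val \<rho> (monom m) = 0" by (simp add: ray_val_monom)
  have clear: "\<exists>N. \<forall>r\<ge>N. a * monom m ^ r \<in> chart x" if a: "a \<in> range embed_laurent" "a \<in> val_ring (ray_val \<rho>)" for a
  proof -
    obtain p where p: "a = embed_laurent p" using a by blast
    have "0 \<le> pairing n u" if n: "n \<in> Poly_Mapping.keys p" and u: "u \<in> cone_at y" for n u
    proof -
      have "u \<in> \<rho>" using u y(3) by simp
      then have "u \<in> {t *\<^sub>R gen \<rho> |t. 0 \<le> t}"
        by (rule subsetD[OF equalityD1[OF ray_primitive_generator(2)[OF \<rho>]]])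
      then obtain t where t: "0 \<le> t" "u = t *\<^sub>R gen \<rho>" by blast
      have "0 \<le> pairing n (gen \<rho>)" using a(2) n unfolding p embed_in_ray_ring by (simp add: pairing_real_vec)
      then show ?thesis using t by (simp add: pairing_def)
    qed
    then have "a \<in> chart y" unfolding p embed_mem_affine_ring by blast
    then show ?thesis using shift_clear[OF m] by blast
  qed
  obtain p q where pq: "q \<noteq> 0" "f = embed_laurent p / embed_laurent q" by (rule ratfun_quotient)
  then have "p \<noteq> 0" using False by auto
  obtain \<mu> where \<mu>: "weight (primitive_generator \<rho>) \<mu> = 1" using weight_one_exists[OF ray_primitive_generator(1)[OF \<rho>]] .
  define l where "l = ray_val \<rho> (embed_laurent q)"
  \<comment> \<open>The exponent \<open>- l\<close> cancels the value \<open>l\<close> of the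
    denominator; powers of monomials of either sign remain Laurent polynomials.\<close>
  define c where "c = monom \<mu> powi (- l)"
  have c: "c \<noteq> 0" "ray_val \<rho> c = - l" "c \<in> range embed_laurent"
  proof -
    show "c \<noteq> 0" by (simp add: c_def)
    show "ray_val \<rho> c = - l" by (simp add: c_def val_power_int[OF dv] ray_val_monom \<mu>)
    have "monom n ^ j \<in> range embed_laurent" for n :: "'d character" and j
      unfolding monom_power unfolding monom_def by blast
    then show "c \<in> range embed_laurent"
      unfolding c_def power_int_def by (simp add: inverse_monom)
  qed
  define a b where "a = embed_laurent p * c" and "b = embed_laurent q * c"
  have fab: "f = a / b" using pq c by (simp add: a_def b_def)
  have b0: "b \<noteq> 0" "ray_val \<rho> b = 0"
    using c pq(1) by (simp_all add: b_def val_mult[OF dv] l_def)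
  have a0: "a \<noteq> 0" using c \<open>p \<noteq> 0\<close> by (simp add: a_def)
  have "0 \<le> ray_val \<rho> a"
    using f False b0 a0 val_divide[OF dv a0 b0(1)] by (simp add: fab val_ring_def)
  then have "a \<in> val_ring (ray_val \<rho>)" "b \<in> val_ring (ray_val \<rho>)" using b0 by (simp_all add: val_ring_def)
  moreover have "a \<in> range embed_laurent" "b \<in> range embed_laurent"
    unfolding a_def b_def by (intro subring_onD(5)[OF subring_range_embed] rangeI c(3))+
  ultimately obtain N M where "\<forall>r\<ge>N. a * monom m ^ r \<in> chart x" "\<forall>r\<ge>M. b * monom m ^ r \<in> chart x"
    using clear by metis
  then have "a * monom m ^ max N M \<in> chart x" "b * monom m ^ max N M \<in> chart x" by auto
  moreover have "ray_val \<rho> (b * monom m ^ max N M) = 0"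
    using b0 by (simp add: val_mult[OF dv] val_power[OF dv] vm)
  moreover have "f = (a * monom m ^ max N M) / (b * monom m ^ max N M)" by (simp add: fab)
  ultimately show ?thesis using b0(1) by (metis mult_eq_0_iff monom_nonzero power_not_zero)
qed

text \<open>On a ray, a character that is nonnegative and not identically zero has positive weight.
  So the orbit ideal is the center of the monomial valuation on the chart of the ray.\<close>

lemma ray_divisor_eq:
  assumes \<rho>: "\<rho> \<in> rays \<Sigma>"
  shows "ray_divisor \<rho> = val_ring (ray_val \<rho>)"
proof -
  obtain y where y: "y \<in> P" "rational_vec y" "\<rho> = cone_at y" "gen \<rho> \<in> cone_at y" using ray_point[OF \<rho>] .
  have ring: "val_ring (ray_val \<rho>) = localization (affine_ring \<rho>) (affine_ring \<rho> \<inter> val_ideal (ray_val \<rho>))"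
    using val_ring_in_points(2)[OF discrete_ray_val[OF \<rho>] subring_affine_ring chart_subset_ray_ring[OF y(4)]
        ray_ring_fraction[OF \<rho> y(1,2,4)]] y(3) by simp
  have line: "u \<in> \<rho> \<Longrightarrow> \<exists>t\<ge>0. u = t *\<^sub>R gen \<rho>" for u
    using equalityD1[OF ray_primitive_generator(2)[OF \<rho>]] by blast
  have pos: "(\<exists>u\<in>\<rho>. pairing m u \<noteq> 0) \<longleftrightarrow> weight (primitive_generator \<rho>) m \<noteq> 0" for m
  proof
    assume "\<exists>u\<in>\<rho>. pairing m u \<noteq> 0"
    then obtain t where "pairing m (t *\<^sub>R gen \<rho>) \<noteq> 0" using line by blast
    then have "pairing m (gen \<rho>) \<noteq> 0" by (simp add: pairing_def)
    then show "weight (primitive_generator \<rho>) m \<noteq> 0" by (simp add: pairing_real_vec)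
  qed (use gen_in_ray[OF \<rho>] in \<open>auto simp: pairing_real_vec intro!: bexI[of _ "gen \<rho>"]\<close>)
  have nonneg: "(\<forall>u\<in>\<rho>. 0 \<le> pairing m u) \<longleftrightarrow> 0 \<le> weight (primitive_generator \<rho>) m" for m
  proof
    assume w: "0 \<le> weight (primitive_generator \<rho>) m"
    show "\<forall>u\<in>\<rho>. 0 \<le> pairing m u"
    proof
      fix u assume "u \<in> \<rho>"
      then obtain t where t: "0 \<le> t" "u = t *\<^sub>R gen \<rho>" using line by blast
      have "0 \<le> pairing m (gen \<rho>)" using w by (simp add: pairing_real_vec)
      then show "0 \<le> pairing m u" using t by (simp add: pairing_def)
    qed
  next
    assume "\<forall>u\<in>\<rho>. 0 \<le> pairing m u"
    then have "0 \<le> pairing m (gen \<rho>)" using gen_in_ray[OF \<rho>] by blast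
    then show "0 \<le> weight (primitive_generator \<rho>) m" by (simp add: pairing_real_vec)
  qed
  have ideal: "embed_laurent f \<in> val_ideal (ray_val \<rho>) \<longleftrightarrow> (\<forall>m\<in>Poly_Mapping.keys f. 0 < weight (primitive_generator \<rho>) m)" for f
  proof (cases "f = 0")
    case False
    let ?w = "weight (primitive_generator \<rho>)"
    have "0 < low ?w f \<longleftrightarrow> (\<forall>m\<in>Poly_Mapping.keys f. 0 < ?w m)"
      using low_obtain[OF False, of ?w] low_le[of _ f ?w] by (metis less_le_trans)
    then show ?thesis using False by (simp add: val_ideal_def ray_val_embed)
  qed (simp add: val_ideal_def)
  have "orbit_ideal \<rho> = affine_ring \<rho> \<inter> val_ideal (ray_val \<rho>)"
  proof (intro equalityI subsetI)
    fix a assume "a \<in> orbit_ideal \<rho>"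
    then obtain f where "a = embed_laurent f" "\<forall>m\<in>Poly_Mapping.keys f. 0 < weight (primitive_generator \<rho>) m"
      unfolding orbit_ideal_def pos nonneg by (auto simp: order.strict_iff_order)
    then show "a \<in> affine_ring \<rho> \<inter> val_ideal (ray_val \<rho>)"
      unfolding affine_ring_def nonneg using ideal by (auto intro: less_imp_le)
  next
    fix a assume "a \<in> affine_ring \<rho> \<inter> val_ideal (ray_val \<rho>)"
    then obtain f where "a = embed_laurent f" "embed_laurent f \<in> val_ideal (ray_val \<rho>)" by (auto simp: affine_ring_def)
    then show "a \<in> orbit_ideal \<rho>"
      unfolding orbit_ideal_def pos nonneg using ideal by force
  qed
  then show ?thesis unfolding ray_divisor_def ring by simp
qed

text \<open>The barycentre \<open>y\<close> of all vertices has trivial normal cone: a functional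
  maximal there is maximal at every vertex, hence so is its negative, and an interior point excludes
  this unless it is 0. The chart at \<open>y\<close> is thus the torus, and one monomial clears all
  Laurent polynomials.\<close>

lemma clear_denominators:
  assumes x: "x \<in> P" "rational_vec x"
  shows "\<exists>m. \<forall>a. \<exists>N. \<forall>r\<ge>N. embed_laurent a * monom m ^ r \<in> chart x"
proof -
  define y where "y = (1 / real (card verts)) *\<^sub>R \<Sum>verts"
  have ne: "verts \<noteq> {}" using verts(2) polytope(4) by auto
  note avg = cone_at_convex_hull[OF verts(1) ne verts(3), folded y_def]
  have y: "y \<in> P" "rational_vec y"
    using avg(1) rational_average[OF verts(1) ne verts(4)] by (simp_all add: verts(2) y_def)
  have zero: "u = 0" if u: "u \<in> cone_at y" for u
  proof (rule ccontr)
    assume "u \<noteq> 0"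
    obtain x0 where x0: "x0 \<in> interior P" using interior_nonempty by blast
    have "- u \<in> cone_at y"
      unfolding cone_at_verts
    proof (intro CollectI ballI)
      fix w assume "w \<in> verts"
      then have "u \<in> cone_at w" using u avg(3) by blast
      then show "w \<bullet> - u \<le> y \<bullet> - u" using y(1) by (simp add: cone_at_def)
    qed
    then show False
      using interior_less[OF x0 u \<open>u \<noteq> 0\<close>] interior_less[OF x0, of "- u" y] \<open>u \<noteq> 0\<close> by simp
  qed
  obtain m where m: "shift y x m" using shift_exists[OF y(1) x(1) y(2) x(2)] by blast
  have "\<exists>N. \<forall>r\<ge>N. embed_laurent a * monom m ^ r \<in> chart x" for a
  proof -
    have "embed_laurent a \<in> chart y"
      unfolding embed_mem_affine_ring by (auto dest!: zero simp: pairing_def)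
    then show ?thesis using shift_clear[OF m] by blast
  qed
  then show ?thesis by blast
qed

lemma torus_ring_fraction:
  assumes v: "v \<in> torus_valuations" and x: "x \<in> P" "rational_vec x" and f: "f \<in> val_ring v"
  shows "\<exists>a\<in>chart x. \<exists>s\<in>chart x. s \<noteq> 0 \<and> v s = 0 \<and> f = a / s"
proof -
  note dv = discrete_torus_valuation[OF v]
  obtain m where clear: "\<And>a. \<exists>N. \<forall>r\<ge>N. embed_laurent a * monom m ^ r \<in> chart x"
    using clear_denominators[OF x] by blast
  obtain a s where as: "s \<noteq> 0" "v (embed_laurent s) = 0" "f = embed_laurent a / embed_laurent s"
    using torus_valuation_localization[OF v f] by blast
  obtain N M where "\<forall>r\<ge>N. embed_laurent a * monom m ^ r \<in> chart x" "\<forall>r\<ge>M. embed_laurent s * monom m ^ r \<in> chart x"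
    using clear by metis
  then have "embed_laurent a * monom m ^ max N M \<in> chart x" "embed_laurent s * monom m ^ max N M \<in> chart x" by auto
  moreover have "v (embed_laurent s * monom m ^ max N M) = 0"
    using as by (simp add: val_mult[OF dv] val_power[OF dv] torus_valuation_monom[OF v])
  moreover have "f = (embed_laurent a * monom m ^ max N M) / (embed_laurent s * monom m ^ max N M)" by (simp add: as(3))
  moreover have "embed_laurent s * monom m ^ max N M \<noteq> 0" using as(1) by simp
  ultimately show ?thesis by blast
qed

text \<open>The generic point: its local ring is the whole function field.\<close>

lemma UNIV_in_points:
  assumes x: "x \<in> P" "rational_vec x"
  shows "UNIV \<in> points (chart x)"
proof -
  have prime: "{0} \<in> spec (chart x)"
    unfolding spec_iff[OF subring_affine_ring] using subring_onD(1)[OF subring_affine_ring] by auto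
  obtain m where clear: "\<And>a. \<exists>N. \<forall>r\<ge>N. embed_laurent a * monom m ^ r \<in> chart x"
    using clear_denominators[OF x] by blast
  have "f \<in> localization (chart x) {0}" for f
  proof -
    obtain a s where as: "s \<noteq> 0" "f = embed_laurent a / embed_laurent s" by (rule ratfun_quotient)
    obtain N M where "\<forall>r\<ge>N. embed_laurent a * monom m ^ r \<in> chart x" "\<forall>r\<ge>M. embed_laurent s * monom m ^ r \<in> chart x"
      using clear by metis
    then have "embed_laurent a * monom m ^ max N M \<in> chart x" "embed_laurent s * monom m ^ max N M \<in> chart x - {0}"
      using as(1) by auto
    moreover have "f = (embed_laurent a * monom m ^ max N M) / (embed_laurent s * monom m ^ max N M)" by (simp add: as(2))
    ultimately show ?thesis unfolding localization_def by blast
  qed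
  then have "UNIV = localization (chart x) {0}" by blast
  then show ?thesis using prime by (auto simp: points_def)
qed

section \<open>All prime divisors of the charts and of the variety\<close>

lemma chart_subset_torus_ring: "v \<in> torus_valuations \<Longrightarrow> chart x \<subseteq> val_ring v"
  using affine_ring_subset torus_valuation_nonneg by (force simp: val_ring_def)

text \<open>The valuations of the prime divisors that meet the chart at \<open>x\<close>: those of
  the torus and those of the rays of the cone.\<close>

definition vals_at :: "real ^ 'd \<Rightarrow> ('d ratfun \<Rightarrow> int) set" where
  "vals_at x = torus_valuations \<union> ray_val ` {\<rho> \<in> rays \<Sigma>. gen \<rho> \<in> cone_at x}"

definition vals :: "('d ratfun \<Rightarrow> int) set" where
  "vals = torus_valuations \<union> ray_val ` rays \<Sigma>"

lemma vals_at_subset: "vals_at x \<subseteq> vals"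
  by (auto simp: vals_at_def vals_def)

lemma vals_discrete: "v \<in> vals \<Longrightarrow> discrete_valuation v"
  using discrete_torus_valuation discrete_ray_val by (auto simp: vals_def)

lemma finite_vals:
  assumes "f \<noteq> 0"
  shows "finite {v \<in> vals. v f \<noteq> 0}"
proof -
  have "{v \<in> vals. v f \<noteq> 0} \<subseteq> {v \<in> torus_valuations. v f \<noteq> 0} \<union> ray_val ` rays \<Sigma>"
    by (auto simp: vals_def)
  then show ?thesis using finite_torus_valuations[OF assms] finite_rays finite_subset by blast
qed

lemma vals_at_points:
  assumes x: "x \<in> P" "rational_vec x" and v: "v \<in> vals_at x"
  shows "val_ring v \<in> points (chart x)"
proof -
  consider "v \<in> torus_valuations" | \<rho> where "\<rho> \<in> rays \<Sigma>" "gen \<rho> \<in> cone_at x" "v = ray_val \<rho>"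
    using v by (auto simp: vals_at_def)
  then show ?thesis
  proof cases
    case 1
    show ?thesis
      by (rule val_ring_in_points(1)[OF discrete_torus_valuation[OF 1] subring_affine_ring
          chart_subset_torus_ring[OF 1] torus_ring_fraction[OF 1 x]])
  next
    case 2
    show ?thesis
      unfolding 2(3)
      by (rule val_ring_in_points(1)[OF discrete_ray_val[OF 2(1)] subring_affine_ring
          chart_subset_ray_ring[OF 2(2)] ray_ring_fraction[OF 2(1) x 2(2)]])
  qed
qed

text \<open>Nonnegativity at the torus valuations forces a Laurent polynomial; at the rays it
  constrains each exponent separately, and \<open>dual_cone_iff\<close> passes from the rays to the
  cone.\<close>

lemma chart_eq_Inter:
  assumes x: "x \<in> P"
  shows "chart x = {f. \<forall>v\<in>vals_at x. f \<in> val_ring v}"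
proof (intro equalityI subsetI)
  fix f assume "f \<in> chart x"
  then show "f \<in> {f. \<forall>v\<in>vals_at x. f \<in> val_ring v}"
    using chart_subset_torus_ring[of _ x] chart_subset_ray_ring[of _ x] by (auto simp: vals_at_def)
next
  fix f assume f: "f \<in> {f. \<forall>v\<in>vals_at x. f \<in> val_ring v}"
  then have "f \<noteq> 0 \<Longrightarrow> v \<in> torus_valuations \<Longrightarrow> 0 \<le> v f" for v by (auto simp: vals_at_def val_ring_def)
  then have "f \<in> range embed_laurent"
    using torus_valuations_separate[of f] by (metis not_le embed_laurent_zero rangeI)
  then obtain a where a: "f = embed_laurent a" by blast
  have "\<forall>u\<in>cone_at x. 0 \<le> real_vec (exponent m) \<bullet> u" if m: "m \<in> Poly_Mapping.keys a" for m
    unfolding dual_cone_iff(1)[OF x]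
  proof (intro ballI impI)
    fix \<rho> assume \<rho>: "\<rho> \<in> rays \<Sigma>" "gen \<rho> \<in> cone_at x"
    then have "embed_laurent a \<in> val_ring (ray_val \<rho>)" using f a by (auto simp: vals_at_def)
    then have "0 \<le> pairing m (gen \<rho>)" unfolding embed_in_ray_ring using m by (simp add: pairing_real_vec)
    then show "0 \<le> real_vec (exponent m) \<bullet> gen \<rho>" by (simp add: pairing_def)
  qed
  then show "f \<in> chart x" unfolding a embed_mem_affine_ring pairing_def by blast
qed

lemma prime_divisors_chart:
  assumes x: "x \<in> P" "rational_vec x"
  shows "{R \<in> points (chart x). krull_dim_one R} = val_ring ` vals_at x"
proof (intro equalityI subsetI)
  fix R assume R: "R \<in> {R \<in> points (chart x). krull_dim_one R}"
  have "\<exists>v\<in>vals_at x. R = val_ring v"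
  proof (rule krull_dim_one_localization[OF subring_affine_ring _ chart_eq_Inter[OF x(1)]])
    show "discrete_valuation v" if "v \<in> vals_at x" for v using that vals_discrete vals_at_subset by blast
    show "finite {v \<in> vals_at x. v f \<noteq> 0}" if "f \<noteq> 0" for f
      by (rule finite_subset[OF _ finite_vals[OF that]]) (use vals_at_subset in auto)
  qed (use R vals_at_points[OF x] in auto)
  then show "R \<in> val_ring ` vals_at x" by blast
next
  fix R assume "R \<in> val_ring ` vals_at x"
  then show "R \<in> {R \<in> points (chart x). krull_dim_one R}"
    using vals_at_points[OF x] krull_dim_one_val_ring vals_discrete vals_at_subset by blast
qed

text \<open>The characters pointing from the vertices to \<open>x\<close> are regular on the chart;
  their nonnegative values along the ray say that its generator is maximal at
  \<open>x\<close>.\<close>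

lemma val_ring_ray_in_chart:
  assumes x: "x \<in> P" "rational_vec x" and \<rho>: "\<rho> \<in> rays \<Sigma>" and R: "val_ring (ray_val \<rho>) \<in> points (chart x)"
  shows "gen \<rho> \<in> cone_at x"
  unfolding cone_at_verts
proof (intro CollectI ballI)
  fix w assume w: "w \<in> verts"
  obtain m where m: "shift w x m" using shift_exists[OF verts_rational(1)[OF w] x(1) verts_rational(2)[OF w] x(2)] by blast
  then obtain k where k: "k > 0" "real_vec (exponent m) = k *\<^sub>R (x - w)" by (auto simp: shift_def)
  have "monom m \<in> val_ring (ray_val \<rho>)"
    using shift_mem_chart[OF m] subring_point(2)[OF subring_affine_ring R] by blast
  then have "0 \<le> pairing m (gen \<rho>)" by (simp add: val_ring_def ray_val_monom pairing_real_vec)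
  then have "0 \<le> k * ((x - w) \<bullet> gen \<rho>)" by (simp add: pairing_def k(2))
  then show "w \<bullet> gen \<rho> \<le> x \<bullet> gen \<rho>" using k(1) by (simp add: zero_le_mult_iff inner_diff_left)
qed

lemma val_ring_in_chart_iff:
  assumes x: "x \<in> P" "rational_vec x" and v: "v \<in> vals"
  shows "val_ring v \<in> points (chart x) \<longleftrightarrow> v \<in> vals_at x"
  using vals_at_points[OF x] val_ring_ray_in_chart[OF x] v by (auto simp: vals_def vals_at_def)

lemma prime_divisors_eq: "prime_divisors \<Sigma> = val_ring ` vals"
proof (intro equalityI subsetI)
  fix R assume "R \<in> prime_divisors \<Sigma>"
  then obtain v where v: "v \<in> verts" "R \<in> points (chart v)" "krull_dim_one R"
    unfolding prime_divisors_def topspace_X by blast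
  then have "R \<in> val_ring ` vals_at v" using prime_divisors_chart[OF verts_rational[OF v(1)]] by blast
  then show "R \<in> val_ring ` vals" using vals_at_subset by blast
next
  fix R assume "R \<in> val_ring ` vals"
  then obtain v where v: "v \<in> vals" "R = val_ring v" by blast
  have "\<exists>x\<in>verts. v \<in> vals_at x"
  proof (cases "v \<in> torus_valuations")
    case True
    have "verts \<noteq> {}" using verts(2) polytope(4) by auto
    then show ?thesis using True by (auto simp: vals_at_def)
  next
    case False
    then obtain \<rho> where \<rho>: "\<rho> \<in> rays \<Sigma>" "v = ray_val \<rho>" using v by (auto simp: vals_def)
    obtain x where "x \<in> verts" "gen \<rho> \<in> cone_at x" using maximal_vert .
    then show ?thesis using \<rho> by (auto simp: vals_at_def)
  qed
  then obtain x where x: "x \<in> verts" "v \<in> vals_at x" by blast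
  then have "R \<in> points (chart x)" using vals_at_points[OF verts_rational[OF x(1)]] v by blast
  then show "R \<in> prime_divisors \<Sigma>"
    unfolding prime_divisors_def topspace_X using x krull_dim_one_val_ring[OF vals_discrete[OF v(1)]] v by blast
qed

lemma ray_ring_inject:
  assumes "\<rho> \<in> rays \<Sigma>" "\<rho>' \<in> rays \<Sigma>" "val_ring (ray_val \<rho>) = val_ring (ray_val \<rho>')"
  shows "\<rho> = \<rho>'"
proof (rule gen_inject[OF assms(1,2)])
  have "weight (primitive_generator \<rho>) m = weight (primitive_generator \<rho>') m" for m
    using valuation_val_ring[OF discrete_ray_val[OF assms(1)], of "monom m"]
      valuation_val_ring[OF discrete_ray_val[OF assms(2)], of "monom m"] assms(3)
    by (simp add: ray_val_monom)
  from this[of "axis_character i 1" for i] show "primitive_generator \<rho> = primitive_generator \<rho>'"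
    by (simp add: weight_def ex_axis vec_eq_iff if_distrib[of "\<lambda>x. x * _"] cong: if_cong)
qed

text \<open>A torus valuation vanishes on all monomials, while a ray valuation takes the value 1 on
  one of them, since the generator is primitive.\<close>

lemma ray_ring_not_torus:
  assumes "\<rho> \<in> rays \<Sigma>" "v \<in> torus_valuations"
  shows "val_ring v \<noteq> val_ring (ray_val \<rho>)"
proof
  assume eq: "val_ring v = val_ring (ray_val \<rho>)"
  obtain m where "weight (primitive_generator \<rho>) m = 1" using weight_one_exists[OF ray_primitive_generator(1)[OF assms(1)]] .
  then show False
    using valuation_val_ring[OF discrete_ray_val[OF assms(1)], of "monom m"]
      valuation_val_ring[OF discrete_torus_valuation[OF assms(2)], of "monom m"] eq
    by (simp add: ray_val_monom torus_valuation_monom[OF assms(2)])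
qed

lemma toric_divisor_ray:
  assumes "\<rho> \<in> rays \<Sigma>"
  shows "toric_divisor \<Sigma> a (val_ring (ray_val \<rho>)) = a \<rho>"
proof -
  have "toric_divisor \<Sigma> a (val_ring (ray_val \<rho>)) = (\<Sum>\<rho>'\<in>rays \<Sigma>. if \<rho>' = \<rho> then a \<rho>' else 0)"
    unfolding toric_divisor_def
    using ray_ring_inject[OF assms] assms by (intro sum.cong) (auto simp: ray_divisor_eq)
  then show ?thesis using assms finite_rays by simp
qed

lemma toric_divisor_torus: "v \<in> torus_valuations \<Longrightarrow> toric_divisor \<Sigma> a (val_ring v) = 0"
  unfolding toric_divisor_def using ray_ring_not_torus by (intro sum.neutral) (auto simp: ray_divisor_eq)

end

section \<open>Cochain complexes of functions on tuples\<close>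

text \<open>The alternating sum over the omission of one entry. The recursion either omits the head
  or keeps it with a change of sign; it turns the complex property and the homotopy formula into
  list inductions.\<close>

primrec coboundary :: "('i list \<Rightarrow> 'k::ab_group_add) \<Rightarrow> 'i list \<Rightarrow> 'k" where
  "coboundary f [] = 0"
| "coboundary f (x # xs) = f xs - coboundary (\<lambda>ys. f (x # ys)) xs"

declare coboundary.simps(2) [simp del]

lemma coboundary_zero [simp]: "coboundary (\<lambda>_. 0) xs = 0"
  by (induction xs) (simp_all add: coboundary.simps)

lemma coboundary_add: "coboundary (\<lambda>ys. f ys + g ys) xs = coboundary f xs + coboundary g xs"
  by (induction xs arbitrary: f g) (simp_all add: coboundary.simps)

lemma coboundary_diff: "coboundary (\<lambda>ys. f ys - g ys) xs = coboundary f xs - coboundary g xs"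
  by (induction xs arbitrary: f g) (simp_all add: coboundary.simps)

lemma coboundary_hom:
  assumes "\<And>x y. h (x - y) = h x - h y"
  shows "coboundary (\<lambda>ys. h (f ys)) xs = h (coboundary f xs)"
proof -
  have "h 0 = 0" using assms[of 0 0] by simp
  then show ?thesis by (induction xs arbitrary: f) (simp_all add: coboundary.simps assms)
qed

lemma coboundary_sum: "coboundary (\<lambda>ys. \<Sum>j\<in>K. f j ys) xs = (\<Sum>j\<in>K. coboundary (f j) xs)"
  by (induction K rule: infinite_finite_induct) (simp_all add: coboundary_add)

lemma coboundary_coboundary [simp]: "coboundary (coboundary f) xs = 0"
proof (induction xs arbitrary: f)
  case (Cons x xs)
  have "coboundary (\<lambda>ys. coboundary f (x # ys)) xs =
      coboundary f xs - coboundary (coboundary (\<lambda>ys. f (x # ys))) xs"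
    by (simp add: coboundary.simps coboundary_diff)
  then show ?case by (simp add: coboundary.simps Cons)
qed simp

lemma coboundary_commute:
  "coboundary (\<lambda>s. coboundary (c s) ws) ss = coboundary (\<lambda>w. coboundary (\<lambda>s. c s w) ss) ws"
  by (induction ss arbitrary: c) (simp_all add: coboundary.simps coboundary_diff)

lemma coboundary_cong:
  assumes "\<And>ys. set ys \<subseteq> set xs \<Longrightarrow> Suc (length ys) = length xs \<Longrightarrow> f ys = g ys"
  shows "coboundary f xs = coboundary g xs"
  using assms
proof (induction xs arbitrary: f g)
  case (Cons x xs)
  have "f xs = g xs" using Cons.prems by auto
  moreover have "coboundary (\<lambda>ys. f (x # ys)) xs = coboundary (\<lambda>ys. g (x # ys)) xs"
    by (rule Cons.IH) (auto intro!: Cons.prems)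
  ultimately show ?case by (simp add: coboundary.simps)
qed simp

lemma coboundary_mem:
  assumes G: "0 \<in> G" "\<And>x y. x \<in> G \<Longrightarrow> y \<in> G \<Longrightarrow> x - y \<in> G"
    and "\<And>ys. set ys \<subseteq> set xs \<Longrightarrow> Suc (length ys) = length xs \<Longrightarrow> f ys \<in> G"
  shows "coboundary f xs \<in> G"
  using assms(3)
proof (induction xs arbitrary: f)
  case (Cons x xs)
  have "f xs \<in> G" using Cons.prems by auto
  moreover have "coboundary (\<lambda>ys. f (x # ys)) xs \<in> G"
    by (rule Cons.IH) (auto intro!: Cons.prems)
  ultimately show ?case by (simp add: coboundary.simps G)
qed (use G in simp)

lemma coboundary_map: "coboundary f (map s xs) = coboundary (\<lambda>ys. f (map s ys)) xs"
  by (induction xs arbitrary: f) (simp_all add: coboundary.simps)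

lemma coboundary_eq_sum:
  fixes f :: "'i list \<Rightarrow> 'k::comm_ring_1"
  shows "coboundary f xs = (\<Sum>j<length xs. (- 1) ^ j * f (take j xs @ drop (Suc j) xs))"
proof (induction xs arbitrary: f)
  case (Cons x xs)
  show ?case
    unfolding coboundary.simps Cons length_Cons sum.lessThan_Suc_shift
    by (simp add: sum_negf)
qed simp

text \<open>The classical prism operator: the alternating sum over \<open>j\<close> of
  \<open>f\<close> at the tuple that runs through the entries up to \<open>j\<close> and then
  through the images under \<open>s\<close> from \<open>j\<close> on.\<close>

primrec prism :: "('i \<Rightarrow> 'i) \<Rightarrow> ('i list \<Rightarrow> 'k::ab_group_add) \<Rightarrow> 'i list \<Rightarrow> 'k" where
  "prism s f [] = 0"
| "prism s f (x # xs) = f (x # s x # map s xs) - prism s (\<lambda>ys. f (x # ys)) xs"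

lemma prism_diff: "prism s (\<lambda>ys. f ys - g ys) xs = prism s f xs - prism s g xs"
  by (induction xs arbitrary: f g) simp_all

lemma prism_homotopy: "coboundary (prism s f) xs + prism s (coboundary f) xs = f (map s xs) - f xs"
proof (induction xs arbitrary: f)
  case (Cons x xs)
  let ?fx = "\<lambda>ys. f (x # ys)"
  have 1: "coboundary (prism s f) (x # xs) =
      prism s f xs - (coboundary (\<lambda>ys. f (x # s x # ys)) (map s xs) - coboundary (prism s ?fx) xs)"
    by (simp add: coboundary.simps coboundary_diff coboundary_map)
  have 2: "prism s (coboundary f) (x # xs) =
      f (s x # map s xs) - (f (x # map s xs) - coboundary (\<lambda>ys. f (x # s x # ys)) (map s xs)) -
      (prism s f xs - prism s (coboundary ?fx) xs)"
    by (simp add: coboundary.simps prism_diff)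
  have "coboundary (prism s ?fx) xs + prism s (coboundary ?fx) xs = f (x # map s xs) - f (x # xs)"
    by (rule Cons.IH)
  then show ?case unfolding 1 2 by (simp add: algebra_simps)
qed simp

lemma prism_mem:
  assumes G: "0 \<in> G" "\<And>x y. x \<in> G \<Longrightarrow> y \<in> G \<Longrightarrow> x - y \<in> G"
    and "\<And>ys. set ys \<subseteq> set xs \<union> s ` set xs \<Longrightarrow> length ys = Suc (length xs) \<Longrightarrow> f ys \<in> G"
  shows "prism s f xs \<in> G"
  using assms(3)
proof (induction xs arbitrary: f)
  case (Cons x xs)
  have "f (x # s x # map s xs) \<in> G" by (rule Cons.prems) auto
  moreover have "prism s (\<lambda>ys. f (x # ys)) xs \<in> G"
    by (rule Cons.IH) (auto intro!: Cons.prems)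
  ultimately show ?case by (simp add: G)
qed (use G in simp)

text \<open>The degree is the length of the tuple. The empty tuple in degree 0 makes this the
  augmented complex, so exactness in degrees 0 and 1 includes separation and gluing of
  sections.\<close>

definition cochains :: "'i set \<Rightarrow> ('i list \<Rightarrow> 'k::zero set) \<Rightarrow> nat \<Rightarrow> ('i list \<Rightarrow> 'k) set" where
  "cochains I G p = {c. \<forall>xs. if set xs \<subseteq> I \<and> length xs = p then c xs \<in> G xs else c xs = 0}"

definition delta :: "'i set \<Rightarrow> ('i list \<Rightarrow> 'k::ab_group_add) \<Rightarrow> 'i list \<Rightarrow> 'k" where
  "delta I c xs = (if set xs \<subseteq> I then coboundary c xs else 0)"

definition exact_at :: "'i set \<Rightarrow> ('i list \<Rightarrow> 'k::ab_group_add set) \<Rightarrow> nat \<Rightarrow> bool" where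
  "exact_at I G p \<longleftrightarrow> (\<forall>c\<in>cochains I G p. (\<forall>xs. delta I c xs = 0) \<longrightarrow>
     (case p of 0 \<Rightarrow> (\<forall>xs. c xs = 0) | Suc r \<Rightarrow> \<exists>b\<in>cochains I G r. \<forall>xs. delta I b xs = c xs))"

text \<open>Adjoining indices shrinks an intersection of open sets and enlarges its group of
  sections. Monotonicity in both directions makes the group depend on the set of indices
  only.\<close>

definition coefficient_system :: "('i list \<Rightarrow> 'k::ab_group_add set) \<Rightarrow> bool" where
  "coefficient_system G \<longleftrightarrow> (\<forall>xs. 0 \<in> G xs \<and> (\<forall>a\<in>G xs. \<forall>b\<in>G xs. a - b \<in> G xs)) \<and>
     (\<forall>xs ys. set xs \<subseteq> set ys \<longrightarrow> G xs \<subseteq> G ys)"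

lemma coefficient_systemD:
  assumes "coefficient_system G"
  shows "0 \<in> G xs" "a \<in> G xs \<Longrightarrow> b \<in> G xs \<Longrightarrow> a - b \<in> G xs" "a \<in> G xs \<Longrightarrow> b \<in> G xs \<Longrightarrow> a + b \<in> G xs"
    "set xs \<subseteq> set ys \<Longrightarrow> a \<in> G xs \<Longrightarrow> a \<in> G ys"
proof -
  show *: "0 \<in> G xs" "a \<in> G xs \<Longrightarrow> b \<in> G xs \<Longrightarrow> a - b \<in> G xs" for a b
    using assms by (auto simp: coefficient_system_def)
  show "a \<in> G xs \<Longrightarrow> b \<in> G xs \<Longrightarrow> a + b \<in> G xs" using *(2)[of a "0 - b"] *(2)[of 0 b] *(1) by simp
  show "set xs \<subseteq> set ys \<Longrightarrow> a \<in> G xs \<Longrightarrow> a \<in> G ys"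
    using assms unfolding coefficient_system_def by blast
qed

lemma coefficient_system_sum:
  assumes "coefficient_system G" "\<And>j. j \<in> K \<Longrightarrow> f j \<in> G xs"
  shows "sum f K \<in> G xs"
  using assms(2)
  by (induction K rule: infinite_finite_induct) (auto intro: coefficient_systemD[OF assms(1)])

lemma cochainsD:
  assumes "c \<in> cochains I G p"
  shows "set xs \<subseteq> I \<Longrightarrow> length xs = p \<Longrightarrow> c xs \<in> G xs" "\<not> (set xs \<subseteq> I \<and> length xs = p) \<Longrightarrow> c xs = 0"
proof -
  have "if set xs \<subseteq> I \<and> length xs = p then c xs \<in> G xs else c xs = 0"
    using assms unfolding cochains_def by blast
  then show "set xs \<subseteq> I \<Longrightarrow> length xs = p \<Longrightarrow> c xs \<in> G xs" "\<not> (set xs \<subseteq> I \<and> length xs = p) \<Longrightarrow> c xs = 0"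
    by (auto split: if_splits)
qed

lemma cochainsI:
  assumes "\<And>xs. set xs \<subseteq> I \<Longrightarrow> length xs = p \<Longrightarrow> c xs \<in> G xs" "\<And>xs. \<not> (set xs \<subseteq> I \<and> length xs = p) \<Longrightarrow> c xs = 0"
  shows "c \<in> cochains I G p"
  using assms by (simp add: cochains_def)

lemma exact_atD:
  assumes "exact_at I G p" "c \<in> cochains I G p" "\<And>xs. delta I c xs = 0"
  shows "p = 0 \<Longrightarrow> c xs = 0" "p = Suc r \<Longrightarrow> \<exists>b\<in>cochains I G r. \<forall>xs. delta I b xs = c xs"
  using assms by (auto simp: exact_at_def)

lemma delta_cochains:
  assumes G: "coefficient_system G" and c: "c \<in> cochains I G p"
  shows "delta I c \<in> cochains I G (Suc p)"
proof (rule cochainsI)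
  fix xs :: "'a list" assume xs: "set xs \<subseteq> I" "length xs = Suc p"
  have "coboundary c xs \<in> G xs"
  proof (rule coboundary_mem)
    fix ys assume ys: "set ys \<subseteq> set xs" "Suc (length ys) = length xs"
    then have "c ys \<in> G ys" using xs by (intro cochainsD(1)[OF c]) auto
    then show "c ys \<in> G xs" using coefficient_systemD(4)[OF G ys(1)] by blast
  qed (use coefficient_systemD[OF G] in auto)
  then show "delta I c xs \<in> G xs" using xs by (simp add: delta_def)
next
  fix xs :: "'a list" assume xs: "\<not> (set xs \<subseteq> I \<and> length xs = Suc p)"
  have "coboundary c xs = coboundary (\<lambda>_. 0) xs" if "length xs \<noteq> Suc p"
    by (rule coboundary_cong) (use that in \<open>auto intro!: cochainsD(2)[OF c]\<close>)
  then show "delta I c xs = 0" using xs by (auto simp: delta_def)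
qed

lemma delta_delta [simp]: "delta I (delta I c) xs = 0"
proof (cases "set xs \<subseteq> I")
  case True
  have "coboundary (delta I c) xs = coboundary (coboundary c) xs"
    by (rule coboundary_cong) (use True in \<open>auto simp: delta_def\<close>)
  then show ?thesis by (simp add: delta_def)
qed (simp add: delta_def)

lemma delta_diff: "delta I (\<lambda>ys. f ys - g ys) xs = delta I f xs - delta I g xs"
  by (simp add: delta_def coboundary_diff)

lemma delta_zero [simp]: "delta I (\<lambda>_. 0) xs = 0"
  by (simp add: delta_def)

lemma cochains_diff:
  assumes G: "coefficient_system G" and "c \<in> cochains I G p" "b \<in> cochains I G p"
  shows "(\<lambda>xs. c xs - b xs) \<in> cochains I G p"
  using cochainsD[OF assms(2)] cochainsD[OF assms(3)] coefficient_systemD(2)[OF G]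
  by (intro cochainsI) auto

text \<open>The usual contraction by a partition of unity: a cocycle is, for each fixed first index
  \<open>j\<close>, a coboundary outside the coefficient system, and the
  \<open>\<phi>\<close>-weighted sum moves back into it. The weights may depend on the cochain,
  since their exponents are chosen after its poles are known.\<close>

lemma exact_at_partition:
  fixes G :: "'i list \<Rightarrow> 'k::field set"
  assumes G: "coefficient_system G" and I: "i \<in> I"
    and part: "\<And>c. c \<in> cochains I G p \<Longrightarrow> 0 < p \<Longrightarrow> \<exists>K \<phi>. finite K \<and> K \<subseteq> I \<and> sum \<phi> K = 1 \<and>
      (\<forall>j\<in>K. \<forall>xs. set xs \<subseteq> I \<longrightarrow> Suc (length xs) = p \<longrightarrow> \<phi> j * c (j # xs) \<in> G xs)"
  shows "exact_at I G p"
  unfolding exact_at_def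
proof (intro ballI impI)
  fix c assume c: "c \<in> cochains I G p" and dc: "\<forall>xs. delta I c xs = 0"
  have dc': "coboundary c xs = 0" if "set xs \<subseteq> I" for xs
    using dc that by (metis delta_def)
  have cons: "c xs = coboundary (\<lambda>ys. c (j # ys)) xs" if "set xs \<subseteq> I" "j \<in> I" for j xs
    using dc'[of "j # xs"] that by (simp add: coboundary.simps)
  show "case p of 0 \<Rightarrow> \<forall>xs. c xs = 0 | Suc r \<Rightarrow> \<exists>b\<in>cochains I G r. \<forall>xs. delta I b xs = c xs"
  proof (cases p)
    case 0
    have "c [] = 0" using cons[of "[]" i] I by simp
    then have "c xs = 0" for xs using cochainsD(2)[OF c, of xs] 0 by (cases xs) auto
    then show ?thesis using 0 by simp
  next
    case (Suc r)
    then obtain K \<phi> where K: "finite K" "K \<subseteq> I" "sum \<phi> K = 1"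
      and mem: "\<And>j xs. j \<in> K \<Longrightarrow> set xs \<subseteq> I \<Longrightarrow> length xs = r \<Longrightarrow> \<phi> j * c (j # xs) \<in> G xs"
      using part[OF c] by auto
    define b where "b xs = (if set xs \<subseteq> I \<and> length xs = r then \<Sum>j\<in>K. \<phi> j * c (j # xs) else 0)" for xs
    have "b \<in> cochains I G r"
      unfolding b_def by (intro cochainsI) (auto intro!: coefficient_system_sum[OF G] mem)
    moreover have "delta I b xs = c xs" for xs
    proof (cases "set xs \<subseteq> I \<and> length xs = p")
      case True
      have "coboundary b xs = coboundary (\<lambda>ys. \<Sum>j\<in>K. \<phi> j * c (j # ys)) xs"
        by (rule coboundary_cong) (use True Suc in \<open>auto simp: b_def\<close>)
      also have "\<dots> = (\<Sum>j\<in>K. \<phi> j * coboundary (\<lambda>ys. c (j # ys)) xs)"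
        unfolding coboundary_sum by (intro sum.cong refl coboundary_hom) (simp add: right_diff_distrib)
      also have "\<dots> = (\<Sum>j\<in>K. \<phi> j * c xs)"
        using cons[of xs] True K by (intro sum.cong) auto
      also have "\<dots> = c xs" using K by (simp flip: sum_distrib_right)
      finally show ?thesis using True by (simp add: delta_def)
    next
      case False
      then have "delta I b xs = 0"
        using cochainsD(2)[OF delta_cochains[OF G \<open>b \<in> cochains I G r\<close>]] Suc by blast
      then show ?thesis using cochainsD(2)[OF c False] by simp
    qed
    ultimately show ?thesis using Suc by auto
  qed
qed

text \<open>If adjoining the index \<open>i\<close> never enlarges the coefficients, the single
  weight 1 at \<open>i\<close> is a partition of unity.\<close>

lemma exact_at_cone:
  fixes G :: "'i list \<Rightarrow> 'k::field set"
  assumes G: "coefficient_system G" and I: "i \<in> I"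
    and cone: "\<And>xs. set xs \<subseteq> I \<Longrightarrow> G (i # xs) \<subseteq> G xs"
  shows "exact_at I G p"
proof (rule exact_at_partition[OF G I])
  fix c assume c: "c \<in> cochains I G p" "0 < p"
  have "c (i # xs) \<in> G xs" if "set xs \<subseteq> I" "Suc (length xs) = p" for xs
    using cochainsD(1)[OF c(1), of "i # xs"] cone[OF that(1)] that I by auto
  then show "\<exists>K \<phi>. finite K \<and> K \<subseteq> I \<and> sum \<phi> K = 1 \<and>
      (\<forall>j\<in>K. \<forall>xs. set xs \<subseteq> I \<longrightarrow> Suc (length xs) = p \<longrightarrow> \<phi> j * c (j # xs) \<in> G xs)"
    using I by (intro exI[of _ "{i}"] exI[of _ "\<lambda>_. 1"]) simp
qed

subsection \<open>Double complexes\<close>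

definition cochains2 where
  "cochains2 I J G p q = {c. \<forall>ss ws. if set ss \<subseteq> I \<and> length ss = p \<and> set ws \<subseteq> J \<and> length ws = q
     then c ss ws \<in> G ss ws else c ss ws = (0::'k::ab_group_add)}"

lemma cochains2_iff:
  "c \<in> cochains2 I J G p q \<longleftrightarrow>
    (\<forall>ws. if set ws \<subseteq> J \<and> length ws = q then (\<lambda>ss. c ss ws) \<in> cochains I (\<lambda>ss. G ss ws) p else (\<forall>ss. c ss ws = 0))"
  "c \<in> cochains2 I J G p q \<longleftrightarrow>
    (\<forall>ss. if set ss \<subseteq> I \<and> length ss = p then c ss \<in> cochains J (G ss) q else (\<forall>ws. c ss ws = 0))"
  unfolding cochains2_def cochains_def by (simp_all, (smt (verit))+)

text \<open>All complexes over \<open>I\<close> are exact, and those over \<open>J\<close> are exact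
  as soon as the tuple from \<open>I\<close> is nonempty. A diagram chase transfers exactness to the
  remaining complex, that of the empty tuple.\<close>

lemma exact_at_double_complex:
  fixes G :: "'i list \<Rightarrow> 'j list \<Rightarrow> 'k::ab_group_add set"
  assumes G1: "\<And>ws. coefficient_system (\<lambda>ss. G ss ws)" and G2: "\<And>ss. coefficient_system (G ss)"
    and ex1: "\<And>ws p. set ws \<subseteq> J \<Longrightarrow> exact_at I (\<lambda>ss. G ss ws) p"
    and ex2: "\<And>ss q. set ss \<subseteq> I \<Longrightarrow> ss \<noteq> [] \<Longrightarrow> exact_at J (G ss) q"
  shows "exact_at J (G []) q"
proof -
  let ?C = "cochains2 I J G"
  define D1 where "D1 c = (\<lambda>ss ws. delta I (\<lambda>s. c s ws) ss)" for c :: "'i list \<Rightarrow> 'j list \<Rightarrow> 'k"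
  define D2 where "D2 c = (\<lambda>ss ws. delta J (c ss) ws)" for c :: "'i list \<Rightarrow> 'j list \<Rightarrow> 'k"
  have D1_C: "D1 c \<in> ?C (Suc p) q" if "c \<in> ?C p q" for c p q
    using that unfolding cochains2_iff(1) D1_def
    by (auto intro!: delta_cochains[OF G1] split: if_splits)
  have D2_C: "D2 c \<in> ?C p (Suc q)" if "c \<in> ?C p q" for c p q
    unfolding cochains2_iff(2) D2_def
  proof
    fix ss
    have c: "if set ss \<subseteq> I \<and> length ss = p then c ss \<in> cochains J (G ss) q else (\<forall>ws. c ss ws = 0)"
      using that unfolding cochains2_iff(2) by blast
    have "delta J (c ss) ws = 0" if "\<forall>ws. c ss ws = 0" for ws
    proof -
      have "c ss = (\<lambda>_. 0)" using that by (intro ext) simp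
      then show ?thesis by simp
    qed
    then show "if set ss \<subseteq> I \<and> length ss = p then (\<lambda>ws. delta J (c ss) ws) \<in> cochains J (G ss) (Suc q)
      else (\<forall>ws. delta J (c ss) ws = 0)"
      using c delta_cochains[OF G2, of "c ss" J ss q] by (auto split: if_splits)
  qed
  have comm: "D1 (D2 c) ss ws = D2 (D1 c) ss ws" for c ss ws
  proof (cases "set ss \<subseteq> I \<and> set ws \<subseteq> J")
    case True
    have "coboundary (\<lambda>s. delta J (c s) ws) ss = coboundary (\<lambda>s. coboundary (c s) ws) ss"
      using True by (simp add: delta_def)
    also have "\<dots> = coboundary (\<lambda>w. coboundary (\<lambda>s. c s w) ss) ws" by (rule coboundary_commute)
    also have "\<dots> = coboundary (\<lambda>w. delta I (\<lambda>s. c s w) ss) ws" using True by (simp add: delta_def)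
    finally show ?thesis using True by (simp add: D1_def D2_def delta_def)
  qed (auto simp: D1_def D2_def delta_def)
  have DD: "D1 (D1 c) ss ws = 0" "D2 (D2 c) ss ws = 0" for c ss ws
    by (simp_all add: D1_def D2_def)
  have Ddiff: "D1 (\<lambda>ss ws. a ss ws - b ss ws) ss ws = D1 a ss ws - D1 b ss ws"
    "D2 (\<lambda>ss ws. a ss ws - b ss ws) ss ws = D2 a ss ws - D2 b ss ws" for a b ss ws
    by (simp_all add: D1_def D2_def delta_diff)
  have C_diff: "(\<lambda>ss ws. a ss ws - b ss ws) \<in> ?C p q" if "a \<in> ?C p q" "b \<in> ?C p q" for a b p q
    using that coefficient_systemD(2)[OF G2] by (fastforce simp: cochains2_def split: if_splits)
  have E1: "\<exists>y\<in>?C p q. D1 y = x" if x: "x \<in> ?C (Suc p) q" "\<And>ss ws. D1 x ss ws = 0" for x p q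
  proof -
    have "\<exists>b. b \<in> cochains I (\<lambda>ss. G ss ws) p \<and> (\<forall>ss. delta I b ss = x ss ws)"
      if ws: "set ws \<subseteq> J" "length ws = q" for ws
    proof -
      have "(\<lambda>ss. x ss ws) \<in> cochains I (\<lambda>ss. G ss ws) (Suc p)"
        using x(1) ws unfolding cochains2_iff(1) by metis
      moreover have "delta I (\<lambda>ss. x ss ws) ss = 0" for ss using x(2) by (simp add: D1_def)
      ultimately show ?thesis using exact_atD(2)[OF ex1[OF ws(1)]] by blast
    qed
    then obtain b where b: "\<And>ws. set ws \<subseteq> J \<Longrightarrow> length ws = q \<Longrightarrow>
        b ws \<in> cochains I (\<lambda>ss. G ss ws) p \<and> (\<forall>ss. delta I (b ws) ss = x ss ws)" by metis
    define y where "y ss ws = (if set ws \<subseteq> J \<and> length ws = q then b ws ss else 0)" for ss ws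
    have "y \<in> ?C p q"
      unfolding cochains2_iff(1)
    proof
      fix ws
      show "if set ws \<subseteq> J \<and> length ws = q then (\<lambda>ss. y ss ws) \<in> cochains I (\<lambda>ss. G ss ws) p else (\<forall>ss. y ss ws = 0)"
        using b[of ws] by (cases "set ws \<subseteq> J"; cases "length ws = q") (simp_all add: y_def)
    qed
    moreover have "D1 y ss ws = x ss ws" for ss ws
    proof (cases "set ws \<subseteq> J \<and> length ws = q")
      case True
      then show ?thesis using b by (simp add: D1_def y_def)
    next
      case False
      then have "x ss ws = 0" using x(1) unfolding cochains2_iff(1) by metis
      moreover have "y ss' ws = 0" for ss' using False by (auto simp: y_def)
      ultimately show ?thesis by (simp add: D1_def)
    qed
    then have "D1 y = x" by (intro ext)
    ultimately show ?thesis by blast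
  qed
  have E1_0: "x ss ws = 0" if x: "x \<in> ?C 0 q" "\<And>ss ws. D1 x ss ws = 0" for x q ss ws
  proof (cases "set ws \<subseteq> J \<and> length ws = q")
    case True
    then have "(\<lambda>ss. x ss ws) \<in> cochains I (\<lambda>ss. G ss ws) 0" using x(1) unfolding cochains2_iff(1) by metis
    moreover have "delta I (\<lambda>ss. x ss ws) ss = 0" for ss using x(2) by (simp add: D1_def)
    ultimately show ?thesis using exact_atD(1)[OF ex1] True by blast
  qed (use x(1) in \<open>unfold cochains2_iff(1), metis\<close>)
  have E2: "\<exists>y\<in>?C (Suc p) q. D2 y = x" if x: "x \<in> ?C (Suc p) (Suc q)" "\<And>ss ws. D2 x ss ws = 0" for x p q
  proof -
    have "\<exists>b. b \<in> cochains J (G ss) q \<and> (\<forall>ws. delta J b ws = x ss ws)"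
      if ss: "set ss \<subseteq> I" "length ss = Suc p" for ss
    proof -
      have "x ss \<in> cochains J (G ss) (Suc q)"
        using x(1) ss unfolding cochains2_iff(2) by metis
      moreover have "delta J (x ss) ws = 0" for ws using x(2) by (simp add: D2_def)
      moreover have "ss \<noteq> []" using ss by auto
      ultimately show ?thesis using exact_atD(2)[OF ex2[OF ss(1)]] by blast
    qed
    then obtain b where b: "\<And>ss. set ss \<subseteq> I \<Longrightarrow> length ss = Suc p \<Longrightarrow>
        b ss \<in> cochains J (G ss) q \<and> (\<forall>ws. delta J (b ss) ws = x ss ws)" by metis
    define y where "y ss ws = (if set ss \<subseteq> I \<and> length ss = Suc p then b ss ws else 0)" for ss ws
    have "y \<in> ?C (Suc p) q"
      unfolding cochains2_iff(2)
    proof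
      fix ss
      have "y ss = b ss" if "set ss \<subseteq> I \<and> length ss = Suc p" using that by (intro ext) (simp add: y_def)
      then show "if set ss \<subseteq> I \<and> length ss = Suc p then y ss \<in> cochains J (G ss) q else (\<forall>ws. y ss ws = 0)"
        using b[of ss] by (cases "set ss \<subseteq> I"; cases "length ss = Suc p") (simp_all add: y_def)
    qed
    moreover have "D2 y ss ws = x ss ws" for ss ws
    proof (cases "set ss \<subseteq> I \<and> length ss = Suc p")
      case True
      then have "y ss = b ss" by (intro ext) (simp add: y_def)
      then show ?thesis using b True by (simp add: D2_def)
    next
      case False
      then have "x ss ws = 0" using x(1) unfolding cochains2_iff(2) by metis
      moreover have "y ss = (\<lambda>_. 0)" using False by (intro ext) (auto simp: y_def)
      ultimately show ?thesis by (simp add: D2_def)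
    qed
    then have "D2 y = x" by (intro ext)
    ultimately show ?thesis by blast
  qed
  have E2_0: "x ss ws = 0" if x: "x \<in> ?C (Suc p) 0" "\<And>ss ws. D2 x ss ws = 0" for x p ss ws
  proof (cases "set ss \<subseteq> I \<and> length ss = Suc p")
    case True
    then have "x ss \<in> cochains J (G ss) 0" using x(1) unfolding cochains2_iff(2) by metis
    moreover have "delta J (x ss) ws = 0" for ws using x(2) by (simp add: D2_def)
    moreover have "ss \<noteq> []" using True by auto
    ultimately show ?thesis using exact_atD(1)[OF ex2] True by blast
  qed (use x(1) in \<open>unfold cochains2_iff(2), metis\<close>)
  \<comment> \<open>An element killed by both differentials has a primitive for \<open>D1\<close>
    that is killed by \<open>D2\<close>. The induction over \<open>q\<close> corrects a
    \<open>D2\<close>-primitive \<open>z\<close> by an element \<open>w\<close> with the same image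
    under \<open>D1\<close>.\<close>
  have Q: "\<exists>w\<in>?C p q. D1 w = x \<and> (\<forall>ss ws. D2 w ss ws = 0)"
    if "x \<in> ?C (Suc p) q" "\<And>ss ws. D1 x ss ws = 0" "\<And>ss ws. D2 x ss ws = 0" for x p q
    using that
  proof (induction q arbitrary: x p)
    case 0
    have "x = (\<lambda>_ _. 0)" using E2_0[OF 0(1,3)] by (intro ext)
    moreover have "(\<lambda>_ _. 0) \<in> ?C p 0"
      using coefficient_systemD(1)[OF G2] by (simp add: cochains2_def)
    ultimately show ?case by (intro bexI[of _ "\<lambda>_ _. 0"]) (auto simp: D1_def D2_def)
  next
    case (Suc q)
    obtain z where z: "z \<in> ?C (Suc p) q" "D2 z = x" using E2[OF Suc.prems(1,3)] by blast
    have "D2 (D1 z) ss ws = 0" for ss ws unfolding comm[symmetric] z(2) by (rule Suc.prems)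
    then obtain w where w: "w \<in> ?C (Suc p) q" "D1 w = D1 z" "\<And>ss ws. D2 w ss ws = 0"
      using Suc.IH[OF D1_C[OF z(1)] DD(1)] by metis
    have "D1 (\<lambda>ss ws. z ss ws - w ss ws) ss ws = 0" for ss ws by (simp add: Ddiff w)
    then obtain u where u: "u \<in> ?C p q" "D1 u = (\<lambda>ss ws. z ss ws - w ss ws)"
      using E1[OF C_diff[OF z(1) w(1)]] by metis
    have "D1 (D2 u) ss ws = x ss ws" for ss ws
      unfolding comm u(2) Ddiff w(3) z(2) by simp
    then have "D1 (D2 u) = x" by (intro ext)
    then show ?case using D2_C[OF u(1)] DD(2) by blast
  qed
  have lift: "(\<lambda>ss::'i list. if ss = [] then b else (\<lambda>_. 0)) \<in> ?C 0 q" if "b \<in> cochains J (G []) q" for b q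
    unfolding cochains2_iff(2) using that by auto
  show ?thesis
    unfolding exact_at_def
  proof (intro ballI impI)
    fix c assume c: "c \<in> cochains J (G []) q" and dc: "\<forall>xs. delta J c xs = 0"
    \<comment> \<open>The cocycle \<open>c\<close> is placed at the empty tuple; its image under
      \<open>D1\<close> lives where the complexes over \<open>J\<close> are exact.\<close>
    define x :: "'i list \<Rightarrow> 'j list \<Rightarrow> 'k" where "x = (\<lambda>ss. if ss = [] then c else (\<lambda>_. 0))"
    have x: "x \<in> ?C 0 q" unfolding x_def by (rule lift[OF c])
    have dx: "D2 x ss ws = 0" for ss ws using dc by (simp add: D2_def x_def)
    have dx': "D2 (D1 x) ss ws = 0" for ss ws
    proof -
      have "D2 x = (\<lambda>_ _. 0)" using dx by (intro ext)
      then show ?thesis unfolding comm[symmetric] by (simp add: D1_def)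
    qed
    show "case q of 0 \<Rightarrow> \<forall>xs. c xs = 0 | Suc r \<Rightarrow> \<exists>b\<in>cochains J (G []) r. \<forall>xs. delta J b xs = c xs"
    proof (cases q)
      case 0
      have "D1 x ss ws = 0" for ss ws
        using E2_0[OF _ dx'] D1_C[OF x] 0 by blast
      then have "x [] xs = 0" for xs using E1_0[OF x] by blast
      then show ?thesis using 0 by (simp add: x_def)
    next
      case (Suc r)
      obtain b0 where b0: "b0 \<in> ?C (Suc 0) r" "D2 b0 = D1 x"
        using E2[OF _ dx'] D1_C[OF x] Suc by blast
      have "D2 (D1 b0) ss ws = 0" for ss ws unfolding comm[symmetric] b0(2) by (rule DD)
      then obtain w where w: "w \<in> ?C (Suc 0) r" "D1 w = D1 b0" "\<And>ss ws. D2 w ss ws = 0"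
        using Q[OF D1_C[OF b0(1)] DD(1)] by metis
      have "D1 (\<lambda>ss ws. b0 ss ws - w ss ws) ss ws = 0" for ss ws by (simp add: Ddiff w)
      then obtain y where y: "y \<in> ?C 0 r" "D1 y = (\<lambda>ss ws. b0 ss ws - w ss ws)"
        using E1[OF C_diff[OF b0(1) w(1)]] by metis
      \<comment> \<open>\<open>D1\<close> of \<open>D2 y\<close> is \<open>D2\<close> of
        \<open>b0 - w\<close>, that is, \<open>D1 x\<close>, because \<open>w\<close> is killed by
        \<open>D2\<close>. Injectivity of \<open>D1\<close> in degree 0 then identifies
        \<open>x\<close> with \<open>D2 y\<close>.\<close>
      have "D1 (\<lambda>ss ws. x ss ws - D2 y ss ws) ss ws = 0" for ss ws
        unfolding Ddiff comm y(2) b0(2) w(3) by simp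
      then have "x [] ws - D2 y [] ws = 0" for ws
        using E1_0[of "\<lambda>ss ws. x ss ws - D2 y ss ws"] C_diff[OF x] D2_C[OF y(1)] Suc by blast
      then have "delta J (y []) ws = c ws" for ws by (simp add: D2_def x_def)
      moreover have "y [] \<in> cochains J (G []) r" using y(1) unfolding cochains2_iff(2) by auto
      ultimately show ?thesis using Suc by auto
    qed
  qed
qed

subsection \<open>Coverings of convex sets by the cones of a normal fan\<close>

text \<open>
  Cutting a convex set \<open>V\<close> by the hyperplanes spanned by the walls of the cones and applying the
  Mayer-Vietoris argument reduces the claim to sets that lie in a single cone.
\<close>

definition maximizer_cone :: "'a::real_inner set \<Rightarrow> 'a \<Rightarrow> 'a set" where
  "maximizer_cone I i = {u. \<forall>w\<in>I. w \<bullet> u \<le> i \<bullet> u}"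

definition in_nerve :: "'a::real_inner set \<Rightarrow> 'a set \<Rightarrow> 'a list \<Rightarrow> bool" where
  "in_nerve I V ss \<longleftrightarrow> (\<exists>u\<in>V. \<forall>s\<in>set ss. u \<in> maximizer_cone I s)"

text \<open>Functions on tuples that vanish on the nerve of the covering of \<open>V\<close>, that
  is, the cochains of a full simplex relative to the nerve. The empty tuple belongs to the nerve
  exactly if \<open>V\<close> is nonempty, as augmentation demands.\<close>

definition relative_system :: "'a::real_inner set \<Rightarrow> 'a set \<Rightarrow> 'a list \<Rightarrow> 'k::field set" where
  "relative_system I V ss = (if in_nerve I V ss then {0} else UNIV)"

lemma coefficient_system_relative: "coefficient_system (relative_system I V)"
  unfolding coefficient_system_def
proof (intro conjI allI impI)
  fix xs ys :: "'a list" assume "set xs \<subseteq> set ys"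
  then have "in_nerve I V ys \<Longrightarrow> in_nerve I V xs" by (auto simp: in_nerve_def)
  then show "relative_system I V xs \<subseteq> relative_system I V ys" by (auto simp: relative_system_def)
qed (auto simp: relative_system_def)

lemma convex_halfspaces:
  assumes "convex V"
  shows "convex {u \<in> V. 0 \<le> h \<bullet> u}" "convex {u \<in> V. h \<bullet> u \<le> 0}" "convex {u \<in> V. h \<bullet> u = 0}"
proof -
  have "{u \<in> V. 0 \<le> h \<bullet> u} = V \<inter> {u. h \<bullet> u \<ge> 0}" "{u \<in> V. h \<bullet> u \<le> 0} = V \<inter> {u. h \<bullet> u \<le> 0}"
    "{u \<in> V. h \<bullet> u = 0} = V \<inter> {u. h \<bullet> u = 0}" by auto
  then show "convex {u \<in> V. 0 \<le> h \<bullet> u}" "convex {u \<in> V. h \<bullet> u \<le> 0}" "convex {u \<in> V. h \<bullet> u = 0}"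
    using assms by (simp_all add: convex_Int convex_halfspace_ge convex_halfspace_le convex_hyperplane)
qed

lemma convex_maximizer_cone: "convex (maximizer_cone I i)"
proof -
  have "maximizer_cone I i = (\<Inter>w\<in>I. {u. (w - i) \<bullet> u \<le> 0})"
    by (auto simp: maximizer_cone_def inner_diff_left)
  then show ?thesis by (simp add: convex_INT convex_halfspace_le)
qed

lemma convex_change_sign:
  assumes "convex C" "x \<in> C" "y \<in> C" "0 \<le> h \<bullet> x" "h \<bullet> y \<le> 0"
  shows "\<exists>z\<in>C. h \<bullet> z = 0"
proof (cases "h \<bullet> x = h \<bullet> y")
  case True
  then have "h \<bullet> x = 0" using assms by linarith
  then show ?thesis using assms by blast
next
  case False
  define t where "t = (h \<bullet> x) / (h \<bullet> x - h \<bullet> y)"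
  have pos: "h \<bullet> x - h \<bullet> y > 0" using False assms by linarith
  have t: "0 \<le> t" "t \<le> 1" using pos assms by (simp_all add: t_def)
  have "(1 - t) *\<^sub>R x + t *\<^sub>R y \<in> C" using assms t by (intro convexD) auto
  moreover have "h \<bullet> ((1 - t) *\<^sub>R x + t *\<^sub>R y) = h \<bullet> x - t * (h \<bullet> x - h \<bullet> y)"
    by (simp add: inner_add_right algebra_simps)
  then have "h \<bullet> ((1 - t) *\<^sub>R x + t *\<^sub>R y) = 0" using pos by (simp add: t_def)
  ultimately show ?thesis by blast
qed

text \<open>The points of \<open>V\<close> in all cones of a tuple form a convex set; if it meets
  both closed half-spaces, it meets the hyperplane.\<close>

lemma in_nerve_cut:
  assumes V: "convex V"
  shows "in_nerve I V ss \<longleftrightarrow> in_nerve I {u \<in> V. 0 \<le> h \<bullet> u} ss \<or> in_nerve I {u \<in> V. h \<bullet> u \<le> 0} ss"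
    and "in_nerve I {u \<in> V. 0 \<le> h \<bullet> u} ss \<Longrightarrow> in_nerve I {u \<in> V. h \<bullet> u \<le> 0} ss \<Longrightarrow>
      in_nerve I {u \<in> V. h \<bullet> u = 0} ss"
proof -
  show "in_nerve I V ss \<longleftrightarrow> in_nerve I {u \<in> V. 0 \<le> h \<bullet> u} ss \<or> in_nerve I {u \<in> V. h \<bullet> u \<le> 0} ss"
    unfolding in_nerve_def using linear[of 0 "h \<bullet> u" for u] by blast
  assume "in_nerve I {u \<in> V. 0 \<le> h \<bullet> u} ss" "in_nerve I {u \<in> V. h \<bullet> u \<le> 0} ss"
  then obtain x y where xy: "x \<in> V" "0 \<le> h \<bullet> x" "\<forall>s\<in>set ss. x \<in> maximizer_cone I s"
    "y \<in> V" "h \<bullet> y \<le> 0" "\<forall>s\<in>set ss. y \<in> maximizer_cone I s" by (auto simp: in_nerve_def)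
  define C where "C = V \<inter> (\<Inter>s\<in>set ss. maximizer_cone I s)"
  have "convex C" unfolding C_def by (intro convex_Int V convex_INT convex_maximizer_cone)
  then obtain z where "z \<in> C" "h \<bullet> z = 0" using convex_change_sign[of C x y h] xy by (auto simp: C_def)
  then show "in_nerve I {u \<in> V. h \<bullet> u = 0} ss" by (auto simp: in_nerve_def C_def)
qed

text \<open>Mayer-Vietoris: the coefficients for \<open>V\<close> are the intersection of those for
  the two halves, and the coefficients for the hyperplane section are their sum. Primitives on the
  halves differ by a cocycle on the section, whose primitive is split to correct them.\<close>

lemma exact_at_relative_cut:
  fixes V :: "'a::real_inner set"
  assumes V: "convex V"
    and pos: "\<And>p. exact_at I (relative_system I {u \<in> V. 0 \<le> h \<bullet> u} :: 'a list \<Rightarrow> 'k::field set) p"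
    and neg: "\<And>p. exact_at I (relative_system I {u \<in> V. h \<bullet> u \<le> 0} :: 'a list \<Rightarrow> 'k set) p"
    and zero: "\<And>p. exact_at I (relative_system I {u \<in> V. h \<bullet> u = 0} :: 'a list \<Rightarrow> 'k set) p"
  shows "exact_at I (relative_system I V :: 'a list \<Rightarrow> 'k set) p"
proof -
  define Gp Gn Gz where "Gp = (relative_system I {u \<in> V. 0 \<le> h \<bullet> u} :: 'a list \<Rightarrow> 'k set)"
    and "Gn = (relative_system I {u \<in> V. h \<bullet> u \<le> 0} :: 'a list \<Rightarrow> 'k set)"
    and "Gz = (relative_system I {u \<in> V. h \<bullet> u = 0} :: 'a list \<Rightarrow> 'k set)"
  define G where "G = (relative_system I V :: 'a list \<Rightarrow> 'k set)"
  have sys: "coefficient_system G" "coefficient_system Gp" "coefficient_system Gn" "coefficient_system Gz"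
    unfolding G_def Gp_def Gn_def Gz_def by (rule coefficient_system_relative)+
  have G_iff: "a \<in> G ss \<longleftrightarrow> a \<in> Gp ss \<and> a \<in> Gn ss" for a ss
    using in_nerve_cut(1)[OF V, of I ss h] by (auto simp: G_def Gp_def Gn_def relative_system_def)
  have Gz: "a \<in> Gp ss \<or> a \<in> Gn ss \<Longrightarrow> a \<in> Gz ss" for a ss
  proof -
    have "in_nerve I {u \<in> V. h \<bullet> u = 0} ss \<Longrightarrow> in_nerve I {u \<in> V. 0 \<le> h \<bullet> u} ss \<and> in_nerve I {u \<in> V. h \<bullet> u \<le> 0} ss"
      by (auto simp: in_nerve_def)
    then show "a \<in> Gp ss \<or> a \<in> Gn ss \<Longrightarrow> a \<in> Gz ss"
      by (auto simp: Gp_def Gn_def Gz_def relative_system_def split: if_splits)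
  qed
  have coch: "c \<in> cochains I G p \<longleftrightarrow> c \<in> cochains I Gp p \<and> c \<in> cochains I Gn p" for c p
    unfolding cochains_def using G_iff by (auto split: if_splits)
  have cochz: "c \<in> cochains I Gp p \<or> c \<in> cochains I Gn p \<Longrightarrow> c \<in> cochains I Gz p" for c p
    unfolding cochains_def using Gz by (auto split: if_splits)
  have "exact_at I G p"
    unfolding exact_at_def
  proof (intro ballI impI)
    fix c assume c: "c \<in> cochains I G p" and dc: "\<forall>xs. delta I c xs = 0"
    have cpn: "c \<in> cochains I Gp p" "c \<in> cochains I Gn p" using c coch by auto
    show "case p of 0 \<Rightarrow> \<forall>xs. c xs = 0 | Suc r \<Rightarrow> \<exists>b\<in>cochains I G r. \<forall>xs. delta I b xs = c xs"
    proof (cases p)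
      case 0
      then show ?thesis using exact_atD(1)[OF pos[folded Gp_def] cpn(1)] dc by simp
    next
      case (Suc r)
      obtain bp where bp: "bp \<in> cochains I Gp r" "\<forall>xs. delta I bp xs = c xs"
        using exact_atD(2)[OF pos[folded Gp_def] cpn(1) _ Suc] dc by blast
      obtain bn where bn: "bn \<in> cochains I Gn r" "\<forall>xs. delta I bn xs = c xs"
        using exact_atD(2)[OF neg[folded Gn_def] cpn(2) _ Suc] dc by blast
      define e where "e xs = bp xs - bn xs" for xs
      have e: "e \<in> cochains I Gz r"
        unfolding e_def using cochz bp(1) bn(1) by (intro cochains_diff[OF sys(4)]) auto
      have de: "delta I e xs = 0" for xs
        unfolding e_def using bp(2) bn(2) by (simp add: delta_diff)
      have "\<exists>b\<in>cochains I G r. \<forall>xs. delta I b xs = c xs"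
      proof (cases r)
        case 0
        have "e xs = 0" for xs using exact_atD(1)[OF zero[folded Gz_def] e de 0] .
        then have "bp = bn" by (intro ext) (simp add: e_def)
        then show ?thesis using bp bn coch by blast
      next
        case (Suc t)
        obtain f where f: "f \<in> cochains I Gz t" "\<forall>xs. delta I f xs = e xs"
          using exact_atD(2)[OF zero[folded Gz_def] e de Suc] by blast
        \<comment> \<open>The splitting: \<open>fp\<close> vanishes on the nerve of the positive
          half. Its difference from \<open>f\<close> vanishes on that of the negative half, since a
          tuple in both nerves lies in the nerve of the hyperplane section, where \<open>f\<close>
          is 0.\<close>
        define fp where "fp xs = (if in_nerve I {u \<in> V. 0 \<le> h \<bullet> u} xs then 0 else f xs)" for xs
        define fn where "fn xs = fp xs - f xs" for xs
        have fp: "fp \<in> cochains I Gp t"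
          using cochainsD(2)[OF f(1)] by (intro cochainsI) (auto simp: fp_def Gp_def relative_system_def)
        have fn: "fn \<in> cochains I Gn t"
        proof (rule cochainsI)
          fix xs assume xs: "set xs \<subseteq> I" "length xs = t"
          have "fn xs = 0" if "in_nerve I {u \<in> V. h \<bullet> u \<le> 0} xs"
          proof (cases "in_nerve I {u \<in> V. 0 \<le> h \<bullet> u} xs")
            case True
            then have "f xs = 0"
              using cochainsD(1)[OF f(1) xs] in_nerve_cut(2)[OF V True that]
              by (simp add: Gz_def relative_system_def)
            then show ?thesis using True by (simp add: fn_def fp_def)
          qed (simp add: fn_def fp_def)
          then show "fn xs \<in> Gn xs" by (auto simp: Gn_def relative_system_def)
        next
          fix xs assume "\<not> (set xs \<subseteq> I \<and> length xs = t)"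
          then show "fn xs = 0" using cochainsD(2)[OF f(1)] by (simp add: fn_def fp_def)
        qed
        define b where "b xs = bp xs - delta I fp xs" for xs
        have dfn: "delta I fn xs = delta I fp xs - e xs" for xs
          unfolding fn_def using f(2) by (simp add: delta_diff)
        have "b = (\<lambda>xs. bn xs - delta I fn xs)"
          unfolding b_def dfn e_def by (intro ext) simp
        moreover have "b \<in> cochains I Gp r"
          unfolding b_def using delta_cochains[OF sys(2) fp] bp(1) Suc by (intro cochains_diff[OF sys(2)]) auto
        moreover have "(\<lambda>xs. bn xs - delta I fn xs) \<in> cochains I Gn r"
          using delta_cochains[OF sys(3) fn] bn(1) Suc by (intro cochains_diff[OF sys(3)]) auto
        ultimately have "b \<in> cochains I G r" using coch by simp
        moreover have "delta I b xs = c xs" for xs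
          unfolding b_def using bp(2) by (simp add: delta_diff)
        ultimately show ?thesis by blast
      qed
      then show ?thesis using Suc by simp
    qed
  qed
  then show ?thesis by (simp add: G_def)
qed

text \<open>A difference of constant sign vanishes at a midpoint only if it vanishes at both ends,
  so averaging yields a point where all differences that do not vanish identically on
  \<open>V\<close> are nonzero. The maximizer at that point is a maximizer on all of
  \<open>V\<close>.\<close>

lemma subset_maximizer_cone:
  assumes I: "finite I" "I \<noteq> {}" and V: "convex V" "V \<noteq> {}"
    and det: "\<And>i j. i \<in> I \<Longrightarrow> j \<in> I \<Longrightarrow> (\<forall>u\<in>V. 0 \<le> (j - i) \<bullet> u) \<or> (\<forall>u\<in>V. (j - i) \<bullet> u \<le> 0)"
  shows "\<exists>i\<in>I. V \<subseteq> maximizer_cone I i"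
proof -
  define H where "H = {(i, j) \<in> I \<times> I. \<exists>u\<in>V. (j - i) \<bullet> u \<noteq> 0}"
  have "finite H"
    by (rule finite_subset[of _ "I \<times> I"]) (use I(1) in \<open>auto simp: H_def\<close>)
  obtain u0 where u0: "u0 \<in> V" using V by auto
  have "\<forall>z\<in>H. \<exists>u\<in>V. (snd z - fst z) \<bullet> u \<noteq> 0" by (auto simp: H_def)
  then obtain f where f: "\<And>z. z \<in> H \<Longrightarrow> f z \<in> V \<and> (snd z - fst z) \<bullet> f z \<noteq> 0" by metis
  have "\<exists>y\<in>V. \<forall>z\<in>S. (snd z - fst z) \<bullet> y \<noteq> 0" if "S \<subseteq> H" for S
    using finite_subset[OF that \<open>finite H\<close>] that
  proof (induction S rule: finite_induct)
    case (insert z S)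
    then obtain y where y: "y \<in> V" "\<forall>z\<in>S. (snd z - fst z) \<bullet> y \<noteq> 0" by blast
    define w where "w = (1 / 2) *\<^sub>R y + (1 / 2) *\<^sub>R f z"
    have zH: "z \<in> H" using insert by blast
    have w: "w \<in> V" unfolding w_def using V(1) y f[OF zH] by (intro convexD) auto
    have ne: "(snd z' - fst z') \<bullet> w \<noteq> 0"
      if z': "z' \<in> H" "(snd z' - fst z') \<bullet> y \<noteq> 0 \<or> (snd z' - fst z') \<bullet> f z \<noteq> 0" for z'
    proof -
      have "(snd z' - fst z') \<bullet> w = ((snd z' - fst z') \<bullet> y + (snd z' - fst z') \<bullet> f z) / 2"
        by (simp add: w_def inner_add_right)
      moreover have "(\<forall>u\<in>V. 0 \<le> (snd z' - fst z') \<bullet> u) \<or> (\<forall>u\<in>V. (snd z' - fst z') \<bullet> u \<le> 0)"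
      proof -
        obtain i j where "z' = (i, j)" "i \<in> I" "j \<in> I" using z'(1) unfolding H_def by blast
        then show ?thesis using det[of i j] by simp
      qed
      then have "0 \<le> (snd z' - fst z') \<bullet> y \<and> 0 \<le> (snd z' - fst z') \<bullet> f z \<or>
          (snd z' - fst z') \<bullet> y \<le> 0 \<and> (snd z' - fst z') \<bullet> f z \<le> 0"
        using y(1) f[OF zH] by blast
      moreover have "(a + b) / 2 \<noteq> 0" if "0 \<le> a \<and> 0 \<le> b \<or> a \<le> 0 \<and> b \<le> 0" "a \<noteq> 0 \<or> b \<noteq> 0" for a b :: real
        using that by (auto simp: add_nonneg_eq_0_iff add_nonpos_eq_0_iff)
      ultimately show ?thesis using z'(2) by metis
    qed
    have "(snd z' - fst z') \<bullet> w \<noteq> 0" if "z' \<in> insert z S" for z'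
      using that ne[of z'] y(2) f[OF zH] insert.prems by blast
    then show ?case using w by blast
  qed (use u0 in auto)
  then obtain y where y: "y \<in> V" "\<And>z. z \<in> H \<Longrightarrow> (snd z - fst z) \<bullet> y \<noteq> 0" by blast
  have "Max ((\<lambda>w. w \<bullet> y) ` I) \<in> (\<lambda>w. w \<bullet> y) ` I" using I by (intro Max_in) auto
  then obtain i where i: "i \<in> I" "i \<bullet> y = Max ((\<lambda>w. w \<bullet> y) ` I)" by auto
  have max: "w \<bullet> y \<le> i \<bullet> y" if "w \<in> I" for w unfolding i(2) using that I by simp
  have "w \<bullet> u \<le> i \<bullet> u" if w: "w \<in> I" and u: "u \<in> V" for w u
  proof (rule ccontr)
    assume "\<not> ?thesis"
    then have pos: "0 < (w - i) \<bullet> u" by (simp add: inner_diff_left)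
    then have "(i, w) \<in> H" unfolding H_def using u w i by force
    then have "(w - i) \<bullet> y \<noteq> 0" using y(2) by fastforce
    moreover have "0 \<le> (w - i) \<bullet> y" using det[OF i(1) w] pos u y(1) by force
    ultimately show False using max[OF w] by (simp add: inner_diff_left)
  qed
  then show ?thesis using i(1) by (auto simp: maximizer_cone_def)
qed

theorem exact_at_relative_system:
  fixes I :: "'a::real_inner set"
  assumes I: "finite I" "I \<noteq> {}" and V: "convex V"
  shows "exact_at I (relative_system I V :: 'a list \<Rightarrow> 'k::field set) p"
proof -
  \<comment> \<open>The differences of indices that take both strict signs on \<open>V\<close>.
    Their number is the induction measure: cutting by one of them removes it from this set on each
    piece and adds no other.\<close>
  define undet where "undet V = {h \<in> (\<lambda>(i, j). j - i) ` (I \<times> I). (\<exists>u\<in>V. h \<bullet> u < 0) \<and> (\<exists>u\<in>V. 0 < h \<bullet> u)}" for V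
  have fin: "finite (undet V)" for V using I by (simp add: undet_def)
  show ?thesis
    using V
  proof (induction "card (undet V)" arbitrary: V p rule: less_induct)
    case less
    show ?case
    proof (cases "undet V = {}")
      case True
      obtain i where i: "i \<in> I" "V \<subseteq> maximizer_cone I i"
      proof (cases "V = {}")
        case False
        have "(\<forall>u\<in>V. 0 \<le> (j - i) \<bullet> u) \<or> (\<forall>u\<in>V. (j - i) \<bullet> u \<le> 0)" if "i \<in> I" "j \<in> I" for i j
        proof -
          have "j - i \<in> (\<lambda>(i, j). j - i) ` (I \<times> I)" using that by (intro image_eqI[of _ _ "(i, j)"]) auto
          then show ?thesis using True unfolding undet_def by (metis (mono_tags, lifting) empty_iff mem_Collect_eq not_le)
        qed
        then show ?thesis using subset_maximizer_cone[OF I less.prems False] that by blast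
      qed (use I that in blast)
      show ?thesis
      proof (rule exact_at_cone[OF coefficient_system_relative i(1)])
        fix xs
        have "in_nerve I V xs \<Longrightarrow> in_nerve I V (i # xs)" using i(2) by (auto simp: in_nerve_def)
        then show "(relative_system I V (i # xs) :: 'k set) \<subseteq> relative_system I V xs"
          by (auto simp: relative_system_def)
      qed
    next
      case False
      then obtain h where h: "h \<in> undet V" by blast
      have smaller: "card (undet W) < card (undet V)"
        if "W \<subseteq> V" "(\<forall>u\<in>W. 0 \<le> h \<bullet> u) \<or> (\<forall>u\<in>W. h \<bullet> u \<le> 0)" for W
      proof (rule psubset_card_mono[OF fin])
        have "undet W \<subseteq> undet V" using that(1) unfolding undet_def by blast
        moreover have "h \<notin> undet W" using that(2) unfolding undet_def by force
        ultimately show "undet W \<subset> undet V" using h by blast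
      qed
      show ?thesis
        by (rule exact_at_relative_cut[OF less.prems, of _ h]; rule less.hyps; (rule smaller | rule convex_halfspaces[OF less.prems]); auto)
    qed
  qed
qed

section \<open>Vanishing of higher cohomology\<close>

context full_polytope
begin

lemma cone_at_eq_maximizer: "cone_at x = maximizer_cone verts x"
  unfolding cone_at_verts maximizer_cone_def ..

lemma vals_constant:
  assumes "v \<in> vals" "c \<noteq> 0"
  shows "v (embed_laurent (Poly_Mapping.single 0 c)) = 0"
proof -
  have nonneg: "0 \<le> v (embed_laurent (Poly_Mapping.single 0 c))" if "c \<noteq> 0" for c :: complex
  proof (cases "v \<in> torus_valuations")
    case True
    then show ?thesis using that by (intro torus_valuation_nonneg) (auto simp flip: keys_eq_empty)
  next
    case False
    then obtain \<rho> where "v = ray_val \<rho>" using assms(1) by (auto simp: vals_def)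
    moreover have "Poly_Mapping.single 0 c \<noteq> (0 :: 'd laurent)" using that by (simp flip: keys_eq_empty)
    ultimately show ?thesis using that
      by (simp add: ray_val_embed low_single weight_def ex_zero)
  qed
  have "embed_laurent (Poly_Mapping.single 0 c) * embed_laurent (Poly_Mapping.single 0 (inverse c)) = (1 :: 'd ratfun)"
    using assms(2) by (simp add: mult_single embed_laurent_one flip: embed_laurent_mult)
  then have "v (embed_laurent (Poly_Mapping.single 0 c)) + v (embed_laurent (Poly_Mapping.single 0 (inverse c))) = 0"
    using val_mult[OF vals_discrete[OF assms(1)]] val_one[OF vals_discrete[OF assms(1)]]
    by (metis mult_eq_0_iff zero_neq_one)
  then show ?thesis using nonneg[OF assms(2)] nonneg[of "inverse c"] assms(2) by simp
qed

end

text \<open>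
  A torus invariant divisor with coefficients \<open>a\<close>, such that for every character \<open>m\<close> there is a convex
  set \<open>V\<close> with the following property: \<open>m\<close> fails to be a section on an intersection of charts if and only if
  the corresponding cones have a common point in \<open>V\<close>.
\<close>

locale acyclic_divisor = full_polytope P for P :: "(real ^ 'd::finite) set" +
  fixes a :: "(real ^ 'd) set \<Rightarrow> int"
  assumes obstruction: "\<And>m. \<exists>V. convex V \<and> (\<forall>ss. set ss \<subseteq> verts \<longrightarrow>
    ((\<exists>\<rho>\<in>rays \<Sigma>. (\<forall>s\<in>set ss. gen \<rho> \<in> cone_at s) \<and> weight (primitive_generator \<rho>) m + a \<rho> < 0) \<longleftrightarrow>
      in_nerve verts V ss))"
begin

section \<open>Sections described by conditions on valuations\<close>

definition mult :: "('d ratfun \<Rightarrow> int) \<Rightarrow> int" where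
  "mult v = toric_divisor \<Sigma> a (val_ring v)"

lemma mult_ray: "\<rho> \<in> rays \<Sigma> \<Longrightarrow> mult (ray_val \<rho>) = a \<rho>"
  by (simp add: mult_def toric_divisor_ray)

lemma mult_torus: "v \<in> torus_valuations \<Longrightarrow> mult v = 0"
  by (simp add: mult_def toric_divisor_torus)

text \<open>Open sets are replaced by predicates on valuations: an intersection becomes a
  conjunction, and passing to the principal open set of \<open>g\<close> adds the condition that
  \<open>g\<close> has value 0.\<close>

definition sections :: "(('d ratfun \<Rightarrow> int) \<Rightarrow> bool) \<Rightarrow> 'd ratfun set" where
  "sections Q = {f. f \<noteq> 0 \<longrightarrow> (\<forall>v\<in>vals. Q v \<longrightarrow> 0 \<le> v f + mult v)}"

lemma sections_zero: "0 \<in> sections Q"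
  by (simp add: sections_def)

lemma sections_diff:
  assumes "f \<in> sections Q" "g \<in> sections Q"
  shows "f - g \<in> sections Q"
proof (cases "f = 0 \<or> g = 0 \<or> f - g = 0")
  case True
  have "- g \<in> sections Q"
    unfolding sections_def
  proof (intro CollectI impI ballI)
    fix v assume "- g \<noteq> 0" "v \<in> vals" "Q v"
    then show "0 \<le> v (- g) + mult v"
      using assms(2) val_minus[OF vals_discrete[of v], of g] by (simp add: sections_def)
  qed
  then show ?thesis using True assms sections_zero by auto
next
  case False
  have "0 \<le> v (f - g) + mult v" if v: "v \<in> vals" "Q v" for v
  proof -
    have "min (v f) (v (- g)) \<le> v (f - g)"
      using val_add[OF vals_discrete[OF v(1)], of f "- g"] False by simp
    moreover have "0 \<le> v f + mult v" "0 \<le> v g + mult v"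
      using assms False v by (auto simp: sections_def)
    ultimately show ?thesis using val_minus[OF vals_discrete[OF v(1)], of g] by linarith
  qed
  then show ?thesis by (simp add: sections_def)
qed

lemma sections_mono: "(\<And>v. v \<in> vals \<Longrightarrow> Q v \<Longrightarrow> Q' v) \<Longrightarrow> sections Q' \<subseteq> sections Q"
  by (auto simp: sections_def)

lemma sections_mult:
  assumes "f \<in> sections Q" and h: "h \<noteq> 0 \<Longrightarrow> (\<And>v. v \<in> vals \<Longrightarrow> Q v \<Longrightarrow> 0 \<le> v h)"
  shows "h * f \<in> sections Q"
  unfolding sections_def
proof (intro CollectI impI ballI)
  fix v assume ne: "h * f \<noteq> 0" and v: "v \<in> vals" "Q v"
  then have "f \<noteq> 0" "h \<noteq> 0" by auto
  then have "0 \<le> v f + mult v" "0 \<le> v h" using assms(1) h[OF _ v] v by (auto simp: sections_def)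
  then show "0 \<le> v (h * f) + mult v" using ne val_mult[OF vals_discrete[OF v(1)], of h f] by simp
qed

lemma finite_poles:
  assumes "f \<noteq> 0"
  shows "finite {v \<in> vals. v f + mult v < 0}"
proof (rule finite_subset)
  show "{v \<in> vals. v f + mult v < 0} \<subseteq> {v \<in> vals. v f \<noteq> 0} \<union> ray_val ` rays \<Sigma>"
    using mult_torus by (auto simp: vals_def)
  show "finite ({v \<in> vals. v f \<noteq> 0} \<union> ray_val ` rays \<Sigma>)" using finite_vals[OF assms] finite_rays by simp
qed

text \<open>The quasi-coherence of the sheaf: a section where \<open>g\<close> is invertible has
  only finitely many poles elsewhere, and \<open>g\<close> has value at least 1 at each of them, so
  that a power of \<open>g\<close> cancels them.\<close>

lemma sections_clear:
  assumes f: "f \<in> sections (\<lambda>v. Q v \<and> g \<noteq> 0 \<and> v g = 0)"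
    and nonneg: "g \<noteq> 0 \<Longrightarrow> (\<And>v. v \<in> vals \<Longrightarrow> Q v \<Longrightarrow> 0 \<le> v g)"
  shows "\<exists>N. \<forall>n\<ge>N. g ^ n * f \<in> sections Q"
proof (cases "f = 0 \<or> g = 0")
  case True
  have "g ^ n * f \<in> sections Q" if "1 \<le> n" for n
  proof -
    have "g ^ n * f = 0" using True that by auto
    then show ?thesis by (simp only: sections_zero)
  qed
  then show ?thesis by blast
next
  case False
  \<comment> \<open>The largest pole order relative to the divisor; as \<open>g\<close> is positive
    at the poles, its exponent need only reach this number.\<close>
  define N where "N = Max (insert 0 ((\<lambda>v. nat (- (v f + mult v))) ` {v \<in> vals. v f + mult v < 0}))"
  have fin: "finite {v \<in> vals. v f + mult v < 0}" using finite_poles False by blast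
  show ?thesis
  proof (intro exI allI impI)
    fix n assume n: "N \<le> n"
    have "0 \<le> v (g ^ n * f) + mult v" if v: "v \<in> vals" "Q v" for v
    proof (cases "v g = 0 \<or> 0 \<le> v f + mult v")
      case True
      then have "0 \<le> v f + mult v" using f v False by (auto simp: sections_def)
      moreover have "0 \<le> v g" using nonneg v False by blast
      moreover from this have "0 \<le> int n * v g" by simp
      moreover have "v (g ^ n * f) = int n * v g + v f"
        using False val_mult[OF vals_discrete[OF v(1)], of "g ^ n" f] val_power[OF vals_discrete[OF v(1)], of g n]
        by simp
      ultimately show ?thesis by linarith
    next
      case neg: False
      then have "nat (- (v f + mult v)) \<le> N"
        unfolding N_def using fin v(1) by (intro Max_ge) auto
      then have "- (v f + mult v) \<le> int n" using n by linarith
      also have "1 \<le> v g" using nonneg[OF _ v] neg False by force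
      then have "int n * 1 \<le> int n * v g" by (intro mult_left_mono) auto
      finally show ?thesis
        using False val_mult[OF vals_discrete[OF v(1)], of "g ^ n" f] val_power[OF vals_discrete[OF v(1)], of g n]
        by simp
    qed
    then show "g ^ n * f \<in> sections Q" by (simp add: sections_def)
  qed
qed

definition graded :: "(real ^ 'd) set \<Rightarrow> 'd character \<Rightarrow> bool" where
  "graded S m \<longleftrightarrow> (\<forall>\<rho>\<in>rays \<Sigma>. (\<forall>s\<in>S. gen \<rho> \<in> cone_at s) \<longrightarrow> 0 \<le> weight (primitive_generator \<rho>) m + a \<rho>)"

text \<open>All charts contain the torus, so such sections are Laurent polynomials; a ray valuation
  is a minimum over exponents, so its condition splits into conditions on single characters. For
  \<open>S = {}\<close> these are the global sections.\<close>

lemma sections_charts: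
  "sections (\<lambda>v. \<forall>s\<in>S. v \<in> vals_at s) = embed_laurent ` {f. \<forall>m\<in>Poly_Mapping.keys f. graded S m}"
proof -
  have ray_at: "ray_val \<rho> \<in> vals_at s \<longleftrightarrow> gen \<rho> \<in> cone_at s" if \<rho>: "\<rho> \<in> rays \<Sigma>" for \<rho> s
  proof
    assume "ray_val \<rho> \<in> vals_at s"
    then consider "ray_val \<rho> \<in> torus_valuations" | \<rho>' where "\<rho>' \<in> rays \<Sigma>" "gen \<rho>' \<in> cone_at s" "ray_val \<rho> = ray_val \<rho>'"
      by (auto simp: vals_at_def)
    then show "gen \<rho> \<in> cone_at s"
      using ray_ring_not_torus[OF \<rho>] ray_ring_inject[OF \<rho>] by cases auto
  qed (use \<rho> in \<open>auto simp: vals_at_def\<close>)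
  have embed: "embed_laurent f \<in> sections (\<lambda>v. \<forall>s\<in>S. v \<in> vals_at s) \<longleftrightarrow> (\<forall>m\<in>Poly_Mapping.keys f. graded S m)" for f
  proof (cases "f = 0")
    case False
    have low_iff: "0 \<le> low w f + c \<longleftrightarrow> (\<forall>m\<in>Poly_Mapping.keys f. 0 \<le> w m + c)" for w c
    proof
      assume "0 \<le> low w f + c"
      then show "\<forall>m\<in>Poly_Mapping.keys f. 0 \<le> w m + c" using low_le[of _ f w] by force
    next
      assume "\<forall>m\<in>Poly_Mapping.keys f. 0 \<le> w m + c"
      then show "0 \<le> low w f + c" using low_obtain[OF False, of w] by metis
    qed
    have "embed_laurent f \<in> sections (\<lambda>v. \<forall>s\<in>S. v \<in> vals_at s) \<longleftrightarrow>
      (\<forall>\<rho>\<in>rays \<Sigma>. (\<forall>s\<in>S. gen \<rho> \<in> cone_at s) \<longrightarrow> 0 \<le> ray_val \<rho> (embed_laurent f) + mult (ray_val \<rho>))"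
      using False torus_valuation_nonneg[of _ f] mult_torus ray_at
      unfolding sections_def vals_def by force
    also have "\<dots> \<longleftrightarrow> (\<forall>m\<in>Poly_Mapping.keys f. graded S m)"
      using False low_iff by (auto simp: graded_def ray_val_embed mult_ray)
    finally show ?thesis .
  qed (simp add: sections_zero)
  have "f \<in> range embed_laurent" if f: "f \<in> sections (\<lambda>v. \<forall>s\<in>S. v \<in> vals_at s)" for f
  proof (rule ccontr)
    assume "f \<notin> range embed_laurent"
    then obtain v where v: "v \<in> torus_valuations" "v f < 0" using torus_valuations_separate by blast
    have "f \<noteq> 0" using \<open>f \<notin> range embed_laurent\<close> by (metis embed_laurent_zero rangeI)
    then show False using f v mult_torus[OF v(1)] by (force simp: sections_def vals_def vals_at_def)
  qed
  then show ?thesis using embed by blast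
qed

text \<open>The coefficient of a fixed character turns a cochain into a cochain of the relative
  system of the convex set \<open>V m\<close>, where exactness is known.\<close>

lemma exact_at_charts: "exact_at verts (\<lambda>ss. sections (\<lambda>v. \<forall>s\<in>set ss. v \<in> vals_at s)) p"
  unfolding exact_at_def
proof (intro ballI impI)
  let ?G = "\<lambda>ss. sections (\<lambda>v. \<forall>s\<in>set ss. v \<in> vals_at s)"
  fix c assume c: "c \<in> cochains verts ?G p" and dc: "\<forall>xs. delta verts c xs = 0"
  have "\<exists>f. c xs = embed_laurent f \<and> (set xs \<subseteq> verts \<and> length xs = p \<longrightarrow> (\<forall>m\<in>Poly_Mapping.keys f. graded (set xs) m))" for xs
  proof (cases "set xs \<subseteq> verts \<and> length xs = p")
    case True
    then have "c xs \<in> ?G xs" using cochainsD(1)[OF c] by blast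
    then show ?thesis unfolding sections_charts by blast
  next
    case False
    then have "c xs = embed_laurent 0" using cochainsD(2)[OF c] by simp
    then show ?thesis using False by blast
  qed
  then obtain f where f: "\<And>xs. c xs = embed_laurent (f xs)"
    "\<And>xs m. set xs \<subseteq> verts \<Longrightarrow> length xs = p \<Longrightarrow> m \<in> Poly_Mapping.keys (f xs) \<Longrightarrow> graded (set xs) m" by metis
  obtain V where V: "\<And>m. convex (V m)" "\<And>m ss. set ss \<subseteq> verts \<Longrightarrow> in_nerve verts (V m) ss \<longleftrightarrow> \<not> graded (set ss) m"
    using obstruction unfolding graded_def by (metis not_le)
  have ne: "verts \<noteq> {}" using verts(2) polytope(4) by auto
  note ex = exact_at_relative_system[OF verts(1) ne V(1)]
  define cm where "cm m xs = Poly_Mapping.lookup (f xs) m" for m xs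
  have f0: "f xs = 0" if "\<not> (set xs \<subseteq> verts \<and> length xs = p)" for xs
    using cochainsD(2)[OF c that] f(1)[of xs] by simp
  have cm: "cm m \<in> cochains verts (relative_system verts (V m)) p" for m
  proof (rule cochainsI)
    fix xs assume xs: "set xs \<subseteq> verts" "length xs = p"
    then show "cm m xs \<in> relative_system verts (V m) xs"
      using f(2)[OF xs, of m] V(2)[OF xs(1), of m] by (auto simp: relative_system_def cm_def in_keys_iff)
  qed (simp add: cm_def f0)
  have df: "coboundary f xs = 0" if "set xs \<subseteq> verts" for xs
  proof -
    have "embed_laurent (coboundary f xs) = coboundary (\<lambda>ys. embed_laurent (f ys)) xs"
      by (rule coboundary_hom[symmetric]) (rule embed_laurent_diff)
    also have "\<dots> = coboundary c xs" by (simp add: f(1)[abs_def])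
    also have "\<dots> = 0" using dc that by (metis delta_def)
    finally show ?thesis by simp
  qed
  have dcm: "delta verts (cm m) xs = 0" for m xs
  proof (cases "set xs \<subseteq> verts")
    case True
    have "coboundary (cm m) xs = Poly_Mapping.lookup (coboundary f xs) m"
      unfolding cm_def by (rule coboundary_hom) (rule lookup_minus)
    then show ?thesis using df[OF True] by (simp add: delta_def)
  qed (simp add: delta_def)
  show "case p of 0 \<Rightarrow> \<forall>xs. c xs = 0 | Suc r \<Rightarrow> \<exists>b\<in>cochains verts ?G r. \<forall>xs. delta verts b xs = c xs"
  proof (cases p)
    case 0
    have "cm m xs = 0" for m xs using exact_atD(1)[OF ex cm dcm 0] .
    then have "f xs = 0" for xs by (intro poly_mapping_eqI) (simp add: cm_def)
    then show ?thesis using f(1) 0 by simp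
  next
    case (Suc r)
    have "\<exists>b. b \<in> cochains verts (relative_system verts (V m)) r \<and> (\<forall>xs. delta verts b xs = cm m xs)" for m
      using exact_atD(2)[OF ex cm dcm Suc] by blast
    then obtain b where b: "\<And>m. b m \<in> cochains verts (relative_system verts (V m)) r"
      "\<And>m xs. delta verts (b m) xs = cm m xs" by metis
    \<comment> \<open>Only finitely many characters occur in \<open>c\<close>, as there are finitely
      many tuples of vertices. Hence the primitives in the individual degrees add up to Laurent
      polynomials.\<close>
    define M where "M = (\<Union>xs\<in>{xs. set xs \<subseteq> verts \<and> length xs = p}. Poly_Mapping.keys (f xs))"
    have M: "finite M" unfolding M_def using finite_lists_length_eq[OF verts(1)] by simp
    have cm0: "cm m xs = 0" if "m \<notin> M" for m xs
      using that f0[of xs] unfolding M_def cm_def by (cases "set xs \<subseteq> verts \<and> length xs = p") (auto simp: in_keys_iff)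
    define h where "h xs = (\<Sum>m\<in>M. Poly_Mapping.single m (b m xs))" for xs
    have h: "Poly_Mapping.lookup (h xs) m = (if m \<in> M then b m xs else 0)" for xs m
      using M by (simp add: h_def lookup_sum lookup_single when_def)
    have "(\<lambda>xs. embed_laurent (h xs)) \<in> cochains verts ?G r"
    proof (rule cochainsI)
      fix xs assume xs: "set xs \<subseteq> verts" "length xs = r"
      have "graded (set xs) m" if "m \<in> Poly_Mapping.keys (h xs)" for m
      proof (rule ccontr)
        assume "\<not> graded (set xs) m"
        then have "b m xs = 0"
          using cochainsD(1)[OF b(1) xs, of m] V(2)[OF xs(1)] by (simp add: relative_system_def)
        then show False using that h[of xs m] by (simp add: in_keys_iff split: if_splits)
      qed
      then show "embed_laurent (h xs) \<in> ?G xs" unfolding sections_charts by blast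
    next
      fix xs assume "\<not> (set xs \<subseteq> verts \<and> length xs = r)"
      then have "b m xs = 0" for m using cochainsD(2)[OF b(1)] by blast
      then show "embed_laurent (h xs) = 0" by (simp add: h_def)
    qed
    moreover have "delta verts (\<lambda>xs. embed_laurent (h xs)) xs = c xs" for xs
    proof (cases "set xs \<subseteq> verts")
      case True
      have "coboundary h xs = f xs"
      proof (rule poly_mapping_eqI)
        fix m
        have "Poly_Mapping.lookup (coboundary h xs) m = coboundary (\<lambda>ys. Poly_Mapping.lookup (h ys) m) xs"
          by (rule coboundary_hom[symmetric]) (rule lookup_minus)
        also have "\<dots> = (if m \<in> M then coboundary (b m) xs else 0)"
          by (simp add: h)
        also have "\<dots> = Poly_Mapping.lookup (f xs) m"
          using b(2)[of m xs] cm0[of m xs] True by (simp add: delta_def cm_def)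
        finally show "Poly_Mapping.lookup (coboundary h xs) m = Poly_Mapping.lookup (f xs) m" .
      qed
      moreover have "coboundary (\<lambda>ys. embed_laurent (h ys)) xs = embed_laurent (coboundary h xs)"
        by (rule coboundary_hom) (rule embed_laurent_diff)
      ultimately show ?thesis using True f(1) by (simp add: delta_def)
    next
      case False
      then show ?thesis using cochainsD(2)[OF c] by (simp add: delta_def)
    qed
    ultimately show ?thesis using Suc by auto
  qed
qed

text \<open>The double complex of vertex charts against principal sets. A nonempty tuple of
  principal sets already lies in some vertex chart, which gives a cone; inside a chart, the
  principal sets belonging to it carry a partition of unity.\<close>

lemma exact_at_finite_cover:
  fixes J :: "'j set" and vt :: "'j \<Rightarrow> real ^ 'd" and g :: "'j \<Rightarrow> 'd ratfun"
  assumes J: "finite J" "vt ` J \<subseteq> verts" "\<And>j. j \<in> J \<Longrightarrow> g j \<in> chart (vt j)"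
    and unit: "\<And>v. v \<in> verts \<Longrightarrow> \<exists>h. (\<forall>j. h j \<in> chart v) \<and> (\<Sum>j | j \<in> J \<and> vt j = v. h j * g j) = 1"
  shows "exact_at J (\<lambda>ws. sections (\<lambda>u. \<forall>j\<in>set ws. u \<in> vals_at (vt j) \<and> g j \<noteq> 0 \<and> u (g j) = 0)) q"
proof -
  define Q where "Q ss ws u \<longleftrightarrow> (\<forall>s\<in>set ss. u \<in> vals_at s) \<and>
    (\<forall>j\<in>set ws. u \<in> vals_at (vt j) \<and> g j \<noteq> 0 \<and> u (g j) = 0)" for ss ws u
  define G where "G ss ws = sections (Q ss ws)" for ss ws
  have sys1: "coefficient_system (\<lambda>ss. G ss ws)" for ws
    unfolding coefficient_system_def G_def
    by (intro conjI allI ballI impI sections_zero sections_diff sections_mono) (auto simp: Q_def)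
  have sys2: "coefficient_system (G ss)" for ss
    unfolding coefficient_system_def G_def
    by (intro conjI allI ballI impI sections_zero sections_diff sections_mono) (auto simp: Q_def)
  have ne: "verts \<noteq> {}" using verts(2) polytope(4) by auto
  have chart_nonneg: "0 \<le> u h" if "h \<in> chart s" "s \<in> verts" "h \<noteq> 0" "u \<in> vals_at s" for h s u
  proof -
    have "h \<in> val_ring u" using that chart_eq_Inter[OF verts_rational(1)[OF that(2)]] by blast
    then show ?thesis using that(3) by (simp add: val_ring_def)
  qed
  have ex1: "exact_at verts (\<lambda>ss. G ss ws) p" if ws: "set ws \<subseteq> J" for ws p
  proof (cases ws)
    case Nil
    then show ?thesis using exact_at_charts[of p] by (simp add: G_def Q_def[abs_def])
  next
    case (Cons j ws')
    have "vt j \<in> verts" using Cons ws J(2) by auto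
    then show ?thesis
    proof (rule exact_at_cone[OF sys1])
      fix xs show "G (vt j # xs) ws \<subseteq> G xs ws"
        unfolding G_def by (rule sections_mono) (use Cons in \<open>auto simp: Q_def\<close>)
    qed
  qed
  have ex2: "exact_at J (G ss) p" if ss: "set ss \<subseteq> verts" "ss \<noteq> []" for ss p
  proof -
    define v where "v = hd ss"
    have v: "v \<in> verts" "v \<in> set ss" using ss by (auto simp: v_def)
    obtain h where h: "\<forall>j. h j \<in> chart v" "(\<Sum>j | j \<in> J \<and> vt j = v. h j * g j) = 1" using unit[OF v(1)] by blast
    define K where "K = {j \<in> J. vt j = v}"
    have sumK: "(\<Sum>j\<in>K. h j * g j) = 1" using h(2) by (simp add: K_def)
    then have "K \<noteq> {}" by auto
    then have K: "finite K" "K \<subseteq> J" "K \<noteq> {}" using J(1) by (auto simp: K_def)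
    have gK: "g j \<in> chart v" if "j \<in> K" for j using that J(3) by (auto simp: K_def)
    obtain i where i: "i \<in> J" using K by blast
    show ?thesis
    proof (rule exact_at_partition[OF sys2 i])
      fix c assume c: "c \<in> cochains J (G ss) p" and p: "0 < p"
      \<comment> \<open>The finitely many values of \<open>c\<close> to be cleared; one exponent
        \<open>M\<close> serves all of them, and the partition of unity is rebuilt for the powers of
        this exponent.\<close>
      define L where "L = K \<times> {xs. set xs \<subseteq> J \<and> length xs = p - 1}"
      have L: "finite L" unfolding L_def using K(1) finite_lists_length_eq[OF J(1)] by simp
      have "\<exists>N. \<forall>n\<ge>N. g (fst z) ^ n * c (fst z # snd z) \<in> G ss (snd z)" if z: "z \<in> L" for z
      proof -
        obtain j xs where jxs: "z = (j, xs)" "j \<in> K" "set xs \<subseteq> J" "length xs = p - 1" using z by (auto simp: L_def)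
        have "c (j # xs) \<in> G ss (j # xs)" using jxs K p by (intro cochainsD(1)[OF c]) auto
        moreover have "sections (Q ss (j # xs)) \<subseteq> sections (\<lambda>u. Q ss xs u \<and> g j \<noteq> 0 \<and> u (g j) = 0)"
          using jxs(2) v by (intro sections_mono) (auto simp: Q_def K_def)
        ultimately have "c (j # xs) \<in> sections (\<lambda>u. Q ss xs u \<and> g j \<noteq> 0 \<and> u (g j) = 0)"
          unfolding G_def by blast
        moreover have "0 \<le> u (g j)" if "g j \<noteq> 0" "u \<in> vals" "Q ss xs u" for u
          using chart_nonneg[OF gK[OF jxs(2)] v(1) that(1)] that(3) v(2) by (auto simp: Q_def)
        ultimately show ?thesis unfolding G_def jxs(1) fst_conv snd_conv by (rule sections_clear)
      qed
      then obtain N where N: "\<And>z n. z \<in> L \<Longrightarrow> N z \<le> n \<Longrightarrow> g (fst z) ^ n * c (fst z # snd z) \<in> G ss (snd z)"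
        by metis
      define M where "M = Max (insert 0 (N ` L))"
      obtain h' where h': "\<forall>j\<in>K. h' j \<in> chart v" "(\<Sum>j\<in>K. h' j * g j ^ M) = 1"
        using partition_of_unity_power[OF subring_affine_ring K(1) gK _ sumK, of M] h(1) by blast
      have "h' j * g j ^ M * c (j # xs) \<in> G ss xs" if j: "j \<in> K" and xs: "set xs \<subseteq> J" "Suc (length xs) = p" for j xs
      proof -
        have z: "(j, xs) \<in> L" using j xs by (auto simp: L_def)
        then have "N (j, xs) \<le> M" using L by (simp add: M_def)
        then have "g j ^ M * c (j # xs) \<in> G ss xs" using N[OF z] by simp
        then have "h' j * (g j ^ M * c (j # xs)) \<in> G ss xs"
          unfolding G_def
        proof (rule sections_mult)
          fix u assume "h' j \<noteq> 0" "u \<in> vals" "Q ss xs u"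
          then show "0 \<le> u (h' j)" using chart_nonneg[OF _ v(1)] h'(1) j v(2) by (auto simp: Q_def)
        qed
        then show ?thesis by (simp add: mult.assoc)
      qed
      then show "\<exists>K \<phi>. finite K \<and> K \<subseteq> J \<and> sum \<phi> K = 1 \<and>
          (\<forall>j\<in>K. \<forall>xs. set xs \<subseteq> J \<longrightarrow> Suc (length xs) = p \<longrightarrow> \<phi> j * c (j # xs) \<in> G ss xs)"
        using K h'(2) by (intro exI[of _ K] exI[of _ "\<lambda>j. h' j * g j ^ M"]) auto
    qed
  qed
  have "exact_at J (G []) q" by (rule exact_at_double_complex[OF sys1 sys2 ex1 ex2])
  then show ?thesis by (simp add: G_def[abs_def] Q_def[abs_def])
qed

end

section \<open>The Euler characteristic\<close>

lemma spec_sum: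
  assumes "subring_on A" "p \<in> spec A" "\<And>j. j \<in> K \<Longrightarrow> f j \<in> p"
  shows "sum f K \<in> p"
  using assms(3)
  by (induction K rule: infinite_finite_induct) (auto intro: specD(2,4)[OF assms(1,2)])

lemma cech_differential_eq:
  fixes c :: "'p list \<Rightarrow> 'k::field"
  shows "cech_differential X q c xs =
    (if length xs = Suc (Suc q) \<and> set xs \<subseteq> topspace X then coboundary c xs else 0)"
  unfolding cech_differential_def coboundary_eq_sum lessThan_Suc_atMost[symmetric] by auto

text \<open>The dimension rests on an arbitrary choice, so every admissible set of representatives
  is shown to be empty: its members would already lie in the span.\<close>

lemma quotient_dim_self:
  assumes "vector_space smul" "module.subspace smul Z"
  shows "quotient_dim smul Z Z = 0"
proof -
  interpret vector_space smul by fact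
  have "span (Z \<union> {}) = Z" using assms(2) by (simp add: span_eq_iff)
  then have "basis_modulo smul Z Z {}" unfolding basis_modulo_def by simp
  then have S: "basis_modulo smul Z Z (SOME S. basis_modulo smul Z Z S)" by (rule someI)
  have "S = {}" if "basis_modulo smul Z Z S" for S
  proof -
    have "s \<in> span (Z \<union> (S - {s}))" if "s \<in> S" for s
      using that \<open>basis_modulo smul Z Z S\<close> by (intro span_base) (auto simp: basis_modulo_def)
    then show ?thesis using that by (auto simp: basis_modulo_def)
  qed
  from this[OF S] show ?thesis by (simp add: quotient_dim_def)
qed

lemma quotient_dim_basis:
  assumes "vector_space smul" and B: "\<not> module.dependent smul B" "module.span smul B = Z"
  shows "quotient_dim smul Z {0} = card B"
proof -
  interpret vector_space smul by fact
  have span0: "span (insert 0 T) = span T" for T by (simp add: span_insert_0)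
  have iff: "basis_modulo smul {0} Z S \<longleftrightarrow> independent S \<and> span S = Z" for S
    unfolding basis_modulo_def dependent_def using span_superset[of S] by (auto simp: span0)
  then have "basis_modulo smul {0} Z (SOME S. basis_modulo smul {0} Z S)" using B by (metis someI)
  then have "independent (SOME S. basis_modulo smul {0} Z S)" "span (SOME S. basis_modulo smul {0} Z S) = span B"
    using iff B by auto
  then have "dim B = card (SOME S. basis_modulo smul {0} Z S)" by (metis dim_eq_card)
  moreover have "dim B = card B" using B(1) by (metis dim_eq_card)
  ultimately show ?thesis by (simp add: quotient_dim_def)
qed

lemma scale_ratfun_eq: "scale_ratfun k f = embed_laurent (Poly_Mapping.single 0 k) * f"
  by (simp add: scale_ratfun_def)

lemma single_0_mult: "Poly_Mapping.single 0 k * Poly_Mapping.single m (1::complex) = Poly_Mapping.single (m :: 'd::finite character) k"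
  by (simp add: mult_single)

context full_polytope
begin

lemma UNIV_in_topspace: "UNIV \<in> topspace X"
proof -
  have "verts \<noteq> {}" using verts(2) polytope(4) by auto
  then show ?thesis unfolding topspace_X using UNIV_in_points verts_rational by blast
qed

text \<open>Irreducibility: every nonempty open set contains the generic point. Hence intersections
  of members of a covering are nonempty, and the convention for sections over the empty set does not
  intervene.\<close>

lemma UNIV_in_open:
  assumes "openin X U" "R \<in> U"
  shows "UNIV \<in> U"
proof -
  have "R \<in> topspace X" using assms openin_subset by blast
  then obtain v where v: "v \<in> verts" "R \<in> points (chart v)" unfolding topspace_X by blast
  obtain g where g: "g \<in> chart v" "R \<in> principal v g" "principal v g \<subseteq> U"
    using open_contains_principal[OF assms v(2,1)] by blast
  then have "g \<noteq> 0" using units_onD(2) by (auto simp: principal_def)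
  then have "UNIV \<in> principal v g"
    using UNIV_in_points[OF verts_rational[OF v(1)]] by (simp add: principal_def units_on_def)
  then show ?thesis using g by blast
qed

end

text \<open>Multiplication by \<open>\<gamma>\<close> turns a linearly equivalent divisor into the torus invariant one.\<close>

locale acyclic_sheaf = acyclic_divisor +
  fixes \<gamma> :: "'a ratfun" and F :: "'a ratfun set set \<Rightarrow> 'a ratfun set"
  assumes \<gamma>: "\<gamma> \<noteq> 0"
    and F: "\<And>U. U \<noteq> {} \<Longrightarrow> F U = {f. \<gamma> * f \<in> sections (\<lambda>v. val_ring v \<in> U)}"
begin

definition cover :: "('a ratfun set \<Rightarrow> 'a ratfun set set) \<Rightarrow> bool" where
  "cover V \<longleftrightarrow> (\<forall>x\<in>topspace X. openin X (V x) \<and> x \<in> V x)"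

lemma cover_UNIV: "cover V \<Longrightarrow> set xs \<subseteq> topspace X \<Longrightarrow> UNIV \<in> (\<Inter>x\<in>set xs. V x)"
  using UNIV_in_open by (auto simp: cover_def)

lemma F_cover:
  assumes "cover V" "set xs \<subseteq> topspace X"
  shows "F (\<Inter>x\<in>set xs. V x) = {f. \<gamma> * f \<in> sections (\<lambda>v. \<forall>x\<in>set xs. val_ring v \<in> V x)}"
proof -
  have "(\<Inter>x\<in>set xs. V x) \<noteq> {}" using cover_UNIV[OF assms] by blast
  from F[OF this] show ?thesis by simp
qed

lemma cech_cochains_iff: "c \<in> cech_cochains X F q \<longleftrightarrow>
  (\<forall>xs. \<not> (length xs = Suc q \<and> set xs \<subseteq> topspace X) \<longrightarrow> c xs = 0) \<and>
  (\<exists>V. cover V \<and> (\<forall>xs. length xs = Suc q \<longrightarrow> set xs \<subseteq> topspace X \<longrightarrow>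
    \<gamma> * c xs \<in> sections (\<lambda>v. \<forall>x\<in>set xs. val_ring v \<in> V x)))"
  unfolding cech_cochains_def cover_def[symmetric] using F_cover by auto

lemma cech_cochains_obtain:
  assumes "c \<in> cech_cochains X F q"
  obtains V where "cover V" "\<forall>xs. \<not> (length xs = Suc q \<and> set xs \<subseteq> topspace X) \<longrightarrow> c xs = 0"
    "\<forall>xs. length xs = Suc q \<longrightarrow> set xs \<subseteq> topspace X \<longrightarrow> \<gamma> * c xs \<in> sections (\<lambda>v. \<forall>x\<in>set xs. val_ring v \<in> V x)"
  using assms unfolding cech_cochains_iff by blast

lemma scaled_sections_diff: "\<gamma> * f \<in> sections Q \<Longrightarrow> \<gamma> * g \<in> sections Q \<Longrightarrow> \<gamma> * (f - g) \<in> sections Q"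
  using sections_diff by (simp add: right_diff_distrib)

lemma cech_differential_cochains:
  assumes c: "c \<in> cech_cochains X F q"
  shows "cech_differential X q c \<in> cech_cochains X F (Suc q)"
proof -
  obtain V where cover: "cover V" and mem: "\<forall>xs. length xs = Suc q \<longrightarrow> set xs \<subseteq> topspace X \<longrightarrow>
      \<gamma> * c xs \<in> sections (\<lambda>v. \<forall>x\<in>set xs. val_ring v \<in> V x)" using c by (rule cech_cochains_obtain)
  note V = cover mem[rule_format]
  have "coboundary c xs \<in> {f. \<gamma> * f \<in> sections (\<lambda>v. \<forall>x\<in>set xs. val_ring v \<in> V x)}"
    if xs: "length xs = Suc (Suc q)" "set xs \<subseteq> topspace X" for xs
  proof (rule coboundary_mem)
    fix ys assume ys: "set ys \<subseteq> set xs" "Suc (length ys) = length xs"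
    then have "\<gamma> * c ys \<in> sections (\<lambda>v. \<forall>x\<in>set ys. val_ring v \<in> V x)" using xs by (intro V(2)) auto
    also have "\<dots> \<subseteq> sections (\<lambda>v. \<forall>x\<in>set xs. val_ring v \<in> V x)" using ys(1) by (intro sections_mono) blast
    finally show "c ys \<in> {f. \<gamma> * f \<in> sections (\<lambda>v. \<forall>x\<in>set xs. val_ring v \<in> V x)}" by simp
  qed (simp_all add: sections_zero scaled_sections_diff)
  then show ?thesis
    unfolding cech_cochains_iff using V(1) by (auto simp: cech_differential_eq)
qed

lemma cech_differential_twice: "cech_differential X (Suc q) (cech_differential X q c) = 0"
proof
  fix xs
  have "coboundary (cech_differential X q c) xs = coboundary (coboundary c) xs"
    if "length xs = Suc (Suc (Suc q))" "set xs \<subseteq> topspace X"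
    by (rule coboundary_cong) (use that in \<open>auto simp: cech_differential_eq\<close>)
  then show "cech_differential X (Suc q) (cech_differential X q c) xs = 0 xs"
    by (simp add: cech_differential_eq)
qed

text \<open>
  A Cech cocycle for an arbitrary covering is cohomologous to one that is induced from a finite
  covering by principal open sets, because any two refinement maps are homotopic.
\<close>

lemma cech_acyclic:
  assumes c: "c \<in> cech_cochains X F (Suc r)" and dc: "cech_differential X (Suc r) c = 0"
  shows "\<exists>b\<in>cech_cochains X F r. cech_differential X r b = c"
proof -
  let ?T = "topspace X"
  obtain V where V: "cover V" and zero: "\<forall>xs. \<not> (length xs = Suc (Suc r) \<and> set xs \<subseteq> ?T) \<longrightarrow> c xs = 0"
    and mem: "\<forall>xs. length xs = Suc (Suc r) \<longrightarrow> set xs \<subseteq> ?T \<longrightarrow>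
      \<gamma> * c xs \<in> sections (\<lambda>v. \<forall>x\<in>set xs. val_ring v \<in> V x)" using c by (rule cech_cochains_obtain)
  note c0 = zero[rule_format] and cV = mem[rule_format]
  have dc': "coboundary c xs = 0" if "length xs = Suc (Suc (Suc r))" "set xs \<subseteq> ?T" for xs
  proof -
    have "cech_differential X (Suc r) c xs = 0" using dc by simp
    then show ?thesis using that by (simp add: cech_differential_eq)
  qed
  have pT: "points (chart v) \<subseteq> ?T" if "v \<in> verts" for v using that unfolding topspace_X by blast
  \<comment> \<open>For each point of each vertex chart, a principal neighbourhood inside the given
    covering set; quasi-compactness then selects finitely many in each chart.\<close>
  have "\<exists>g. g \<in> chart v \<and> R \<in> principal v g \<and> principal v g \<subseteq> V R" if "v \<in> verts" "R \<in> points (chart v)" for v R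
    using open_contains_principal[of "V R" R v] V pT that unfolding cover_def by blast
  then obtain g where g: "\<And>v R. v \<in> verts \<Longrightarrow> R \<in> points (chart v) \<Longrightarrow>
      g v R \<in> chart v \<and> R \<in> principal v (g v R) \<and> principal v (g v R) \<subseteq> V R" by metis
  define unity where "unity v K h \<longleftrightarrow> finite K \<and> K \<subseteq> points (chart v) \<and> (\<forall>R\<in>K. h R \<in> chart v) \<and>
      (\<Sum>R\<in>K. h R * g v R) = 1" for v K h
  have "\<exists>K h. unity v K h" if v: "v \<in> verts" for v
    unfolding unity_def
  proof (rule partition_of_unity[OF subring_affine_ring])
    fix p assume p: "p \<in> spec (chart v)"
    define R where "R = localization (chart v) p"
    have R: "R \<in> points (chart v)" using p by (auto simp: R_def points_def)
    then have "g v R \<in> units_on R" "g v R \<in> chart v" using g[OF v R] by (auto simp: principal_def)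
    then have "g v R \<notin> p" using unit_localization_iff'[OF subring_affine_ring p] by (simp add: R_def)
    then show "\<exists>R\<in>points (chart v). g v R \<notin> p" using R by blast
  qed (use g v in blast)
  then obtain K h where unity: "\<And>v. v \<in> verts \<Longrightarrow> unity v (K v) (h v)" by metis
  have K: "finite (K v)" "K v \<subseteq> points (chart v)" "R \<in> K v \<Longrightarrow> h v R \<in> chart v"
    "(\<Sum>R\<in>K v. h v R * g v R) = 1" if "v \<in> verts" for v R
    using unity[OF that] by (simp_all add: unity_def)
  \<comment> \<open>An index remembers the chart and the point whose covering set contains the
    principal set; the second component is the refinement map into the given covering.\<close>
  define J where "J = Sigma verts K"
  define gj where "gj j = g (fst j) (snd j)" for j
  define W where "W j = principal (fst j) (gj j)" for j
  have J: "finite J" "fst ` J \<subseteq> verts" using verts(1) K(1) by (auto simp: J_def)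
  have Jg: "gj j \<in> chart (fst j)" "W j \<subseteq> V (snd j)" "snd j \<in> ?T" "openin X (W j)" if "j \<in> J" for j
  proof -
    have j: "fst j \<in> verts" "snd j \<in> points (chart (fst j))" using that K(2)[of "fst j"] by (auto simp: J_def)
    then show *: "gj j \<in> chart (fst j)" "W j \<subseteq> V (snd j)" "snd j \<in> ?T"
      using g[OF j] pT by (auto simp: gj_def W_def)
    show "openin X (W j)" unfolding W_def using openin_principal[OF j(1) *(1)] .
  qed
  define Q where "Q ws u \<longleftrightarrow> (\<forall>j\<in>set ws. u \<in> vals_at (fst j) \<and> gj j \<noteq> 0 \<and> u (gj j) = 0)" for ws u
  have inW: "val_ring u \<in> W j \<longleftrightarrow> u \<in> vals_at (fst j) \<and> gj j \<noteq> 0 \<and> u (gj j) = 0" if "u \<in> vals" "j \<in> J" for u j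
  proof -
    have "fst j \<in> verts" using that J by auto
    then show ?thesis
      using val_ring_in_chart_iff[OF verts_rational(1) verts_rational(2) that(1)] units_on_val_ring[OF vals_discrete[OF that(1)]]
      by (auto simp: W_def principal_def)
  qed
  have unit: "\<exists>h. (\<forall>j. h j \<in> chart v) \<and> (\<Sum>j | j \<in> J \<and> fst j = v. h j * gj j) = 1" if v: "v \<in> verts" for v
  proof -
    define h' where "h' j = (if fst j = v \<and> snd j \<in> K v then h v (snd j) else 0)" for j
    have eq: "{j. j \<in> J \<and> fst j = v} = Pair v ` K v" using v by (auto simp: J_def)
    have "(\<Sum>j | j \<in> J \<and> fst j = v. h' j * gj j) = (\<Sum>R\<in>K v. h v R * g v R)"
      unfolding eq by (subst sum.reindex) (auto simp: inj_on_def h'_def gj_def)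
    moreover have "\<forall>j. h' j \<in> chart v" using K(3)[OF v] subring_onD(1)[OF subring_affine_ring] by (auto simp: h'_def)
    ultimately show ?thesis using K(4)[OF v] by auto
  qed
  have exact: "exact_at J (\<lambda>ws. sections (Q ws)) q" for q
    unfolding Q_def using exact_at_finite_cover[of J fst gj q] J Jg(1) unit by blast
  have sys: "coefficient_system (\<lambda>ws. sections (Q ws))"
    unfolding coefficient_system_def
    by (intro conjI allI ballI impI sections_zero sections_diff sections_mono) (auto simp: Q_def)
  \<comment> \<open>If no \<open>W j\<close> contained \<open>x\<close>, all selected functions of a
    chart through \<open>x\<close> would be nonunits there, and so would their combination
    1.\<close>
  have "\<exists>j. j \<in> J \<and> x \<in> W j" if "x \<in> ?T" for x
  proof (rule ccontr)
    assume no: "\<not> ?thesis"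
    obtain v where v: "v \<in> verts" "x \<in> points (chart v)" using \<open>x \<in> ?T\<close> unfolding topspace_X by blast
    define p where "p = chart v - units_on x"
    have p: "p \<in> spec (chart v)"
      unfolding p_def by (rule contraction_in_spec[OF subring_affine_ring v(2) subring_affine_ring subring_point(2)[OF subring_affine_ring v(2)]])
    have "h v R * g v R \<in> p" if R: "R \<in> K v" for R
    proof -
      have "(v, R) \<in> J" using R v by (simp add: J_def)
      then have "g v R \<notin> units_on x" using no v(2) by (auto simp: W_def gj_def principal_def)
      then have "g v R \<in> p" using g[OF v(1)] K(2)[OF v(1)] R by (auto simp: p_def)
      then show ?thesis using specD(5)[OF subring_affine_ring p] K(3)[OF v(1) R] by blast
    qed
    then have "1 \<in> p" using spec_sum[OF subring_affine_ring p, of "K v" "\<lambda>R. h v R * g v R"] K(4)[OF v(1)] by simp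
    then show False using specD(3)[OF subring_affine_ring p] by blast
  qed
  then obtain s where s: "\<And>x. x \<in> ?T \<Longrightarrow> s x \<in> J \<and> x \<in> W (s x)" by metis
  define t where "t x = snd (s x)" for x
  have t: "t x \<in> ?T" "W (s x) \<subseteq> V (t x)" if "x \<in> ?T" for x using s[OF that] Jg by (auto simp: t_def)

  \<comment> \<open>The cocycle is restricted to the finite covering and multiplied by
    \<open>\<gamma>\<close>, so that it takes values in sections of the torus invariant
    divisor.\<close>
  define c' where "c' js = (if set js \<subseteq> J \<and> length js = Suc (Suc r) then \<gamma> * c (map snd js) else 0)" for js
  have c': "c' \<in> cochains J (\<lambda>ws. sections (Q ws)) (Suc (Suc r))"
  proof (rule cochainsI)
    fix js assume js: "set js \<subseteq> J" "length js = Suc (Suc r)"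
    have "\<gamma> * c (map snd js) \<in> sections (\<lambda>v. \<forall>x\<in>set (map snd js). val_ring v \<in> V x)"
      using js Jg(3) by (intro cV) auto
    also have "\<dots> \<subseteq> sections (Q js)"
    proof (rule sections_mono)
      fix v assume v: "v \<in> vals" "Q js v"
      have "val_ring v \<in> V (snd j)" if "j \<in> set js" for j
      proof -
        have j: "j \<in> J" using js(1) that by blast
        then have "val_ring v \<in> W j" using inW[OF v(1) j] v(2) that by (simp add: Q_def)
        then show ?thesis using Jg(2)[OF j] by blast
      qed
      then show "\<forall>x\<in>set (map snd js). val_ring v \<in> V x" by simp
    qed
    finally show "c' js \<in> sections (Q js)" using js by (simp add: c'_def)
  qed (auto simp: c'_def)
  have dc'': "delta J c' js = 0" for js
  proof (cases "set js \<subseteq> J \<and> length js = Suc (Suc (Suc r))")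
    case True
    have "coboundary c' js = coboundary (\<lambda>ys. \<gamma> * c (map snd ys)) js"
      by (rule coboundary_cong) (use True in \<open>auto simp: c'_def\<close>)
    also have "\<dots> = \<gamma> * coboundary c (map snd js)"
      unfolding coboundary_map by (rule coboundary_hom) (rule right_diff_distrib)
    also have "coboundary c (map snd js) = 0" using True Jg(3) by (intro dc') auto
    finally show ?thesis by (simp add: delta_def)
  next
    case False
    then show ?thesis using cochainsD(2)[OF delta_cochains[OF sys c']] by blast
  qed
  obtain b' where b': "b' \<in> cochains J (\<lambda>ws. sections (Q ws)) (Suc r)" "\<forall>js. delta J b' js = c' js"
    using exact_atD(2)[OF exact c' dc'' refl] by blast

  \<comment> \<open>Pulling back the primitive \<open>b'\<close> along \<open>s\<close> solves the
    problem for the cocycle re-indexed by \<open>t\<close>; the prism term accounts for the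
    difference between \<open>t\<close> and the identity.\<close>
  define b where "b xs = (if length xs = Suc r \<and> set xs \<subseteq> ?T then b' (map s xs) / \<gamma> - prism t c xs else 0)" for xs
  \<comment> \<open>On the intersection with \<open>W (s x)\<close> the pulled back primitive is
    regular, and so is the prism term, since \<open>W (s x)\<close> lies in
    \<open>V (t x)\<close>.\<close>
  define V' where "V' x = V x \<inter> W (s x)" for x
  have V': "cover V'"
    unfolding cover_def V'_def
  proof (intro ballI conjI openin_Int IntI)
    fix x assume x: "x \<in> ?T"
    then show "openin X (V x)" "x \<in> V x" using V by (simp_all add: cover_def)
    show "openin X (W (s x))" "x \<in> W (s x)" using s[OF x] Jg(4)[of "s x"] by simp_all
  qed
  have "\<gamma> * b xs \<in> sections (\<lambda>v. \<forall>x\<in>set xs. val_ring v \<in> V' x)" if xs: "length xs = Suc r" "set xs \<subseteq> ?T" for xs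
  proof -
    have "b' (map s xs) \<in> sections (Q (map s xs))"
      using xs s by (intro cochainsD(1)[OF b'(1)]) auto
    also have "\<dots> \<subseteq> sections (\<lambda>v. \<forall>x\<in>set xs. val_ring v \<in> V' x)"
    proof (rule sections_mono)
      fix v assume v: "v \<in> vals" "\<forall>x\<in>set xs. val_ring v \<in> V' x"
      have "v \<in> vals_at (fst (s x)) \<and> gj (s x) \<noteq> 0 \<and> v (gj (s x)) = 0" if x: "x \<in> set xs" for x
      proof -
        have "s x \<in> J" using s x xs(2) by blast
        moreover have "val_ring v \<in> W (s x)" using v(2) x by (simp add: V'_def)
        ultimately show ?thesis using inW[OF v(1)] by blast
      qed
      then show "Q (map s xs) v" by (simp add: Q_def)
    qed
    finally have 1: "\<gamma> * (b' (map s xs) / \<gamma>) \<in> sections (\<lambda>v. \<forall>x\<in>set xs. val_ring v \<in> V' x)"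
      using \<gamma> by simp
    have "prism t c xs \<in> {f. \<gamma> * f \<in> sections (\<lambda>v. \<forall>x\<in>set xs. val_ring v \<in> V' x)}"
    proof (rule prism_mem)
      fix ys assume ys: "set ys \<subseteq> set xs \<union> t ` set xs" "length ys = Suc (length xs)"
      then have "set ys \<subseteq> ?T" using xs t(1) by blast
      then have "\<gamma> * c ys \<in> sections (\<lambda>v. \<forall>x\<in>set ys. val_ring v \<in> V x)" using ys xs by (intro cV) auto
      also have "\<dots> \<subseteq> sections (\<lambda>v. \<forall>x\<in>set xs. val_ring v \<in> V' x)"
      proof (rule sections_mono, rule ballI)
        fix v y assume v: "\<forall>x\<in>set xs. val_ring v \<in> V' x" and "y \<in> set ys"
        then consider "y \<in> set xs" | x where "x \<in> set xs" "y = t x" using ys by blast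
        then show "val_ring v \<in> V y"
          using v t(2) xs(2) by cases (auto simp: V'_def)
      qed
      finally show "c ys \<in> {f. \<gamma> * f \<in> sections (\<lambda>v. \<forall>x\<in>set xs. val_ring v \<in> V' x)}" by simp
    qed (simp_all add: sections_zero scaled_sections_diff)
    then show ?thesis using scaled_sections_diff[OF 1] xs by (simp add: b_def)
  qed
  then have "b \<in> cech_cochains X F r"
    unfolding cech_cochains_iff using V' by (auto simp: b_def)
  moreover have "cech_differential X r b = c"
  proof
    fix xs
    show "cech_differential X r b xs = c xs"
    proof (cases "length xs = Suc (Suc r) \<and> set xs \<subseteq> ?T")
      case True
      have "coboundary b xs = coboundary (\<lambda>ys. b' (map s ys) / \<gamma> - prism t c ys) xs"
        by (rule coboundary_cong) (use True in \<open>auto simp: b_def\<close>)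
      also have "\<dots> = coboundary (\<lambda>ys. b' (map s ys) / \<gamma>) xs - coboundary (prism t c) xs"
        by (rule coboundary_diff)
      also have "coboundary (\<lambda>ys. b' (map s ys) / \<gamma>) xs = coboundary b' (map s xs) / \<gamma>"
        unfolding coboundary_map by (rule coboundary_hom) (rule diff_divide_distrib)
      also have "coboundary b' (map s xs) = \<gamma> * c (map t xs)"
      proof -
        have "set (map s xs) \<subseteq> J" using True s by auto
        then have "coboundary b' (map s xs) = c' (map s xs)" using b'(2) by (metis delta_def)
        then show ?thesis using True s by (auto simp: c'_def t_def[abs_def] o_def)
      qed
      \<comment> \<open>In the homotopy formula the second term vanishes, because the prism only
        evaluates the coboundary of \<open>c\<close> at tuples of points, where it is 0.\<close>
      also have "coboundary (prism t c) xs = c (map t xs) - c xs"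
      proof -
        have "prism t (coboundary c) xs \<in> {0}"
          by (rule prism_mem) (use True t(1) in \<open>auto intro!: dc'\<close>)
        then show ?thesis using prism_homotopy[of t c xs] by simp
      qed
      finally show ?thesis using True \<gamma> by (simp add: cech_differential_eq)
    next
      case False
      then show ?thesis using c0[OF False] by (auto simp: cech_differential_eq)
    qed
  qed
  ultimately show ?thesis by blast
qed

section \<open>The dimensions of the cohomology groups\<close>

lemma sections_scale: "f \<in> sections Q \<Longrightarrow> scale_ratfun k f \<in> sections Q"
proof (cases "k = 0")
  case False
  assume "f \<in> sections Q"
  then show ?thesis
    unfolding scale_ratfun_eq
  proof (rule sections_mult)
    fix v :: "'a ratfun \<Rightarrow> int" assume "v \<in> vals"
    then show "0 \<le> v (embed_laurent (Poly_Mapping.single 0 k))" using vals_constant[OF _ False] by (metis order_refl)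
  qed
qed (simp add: scale_ratfun_eq sections_zero)

lemma scale_mult_commute: "\<gamma> * scale_ratfun k f = scale_ratfun k (\<gamma> * f)"
  by (simp add: scale_ratfun_eq mult_ac)

abbreviation scale_cochain :: "complex \<Rightarrow> ('a ratfun set list \<Rightarrow> 'a ratfun) \<Rightarrow> 'a ratfun set list \<Rightarrow> 'a ratfun" where
  "scale_cochain \<equiv> \<lambda>k c xs. scale_ratfun k (c xs)"

lemma scale_ratfun_zero: "scale_ratfun k 0 = 0"
  by (simp add: scale_ratfun_eq)

lemma subspace_cocycles: "module.subspace scale_cochain (cech_cocycles X F q)"
proof -
  interpret V: vector_space scale_cochain by (rule vector_space_scale_cochains)
  have add: "c + d \<in> cech_cochains X F q" if c: "c \<in> cech_cochains X F q" and d: "d \<in> cech_cochains X F q" for c d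
  proof -
    obtain V where V0: "cover V" "\<forall>xs. \<not> (length xs = Suc q \<and> set xs \<subseteq> topspace X) \<longrightarrow> c xs = 0"
      "\<forall>xs. length xs = Suc q \<longrightarrow> set xs \<subseteq> topspace X \<longrightarrow> \<gamma> * c xs \<in> sections (\<lambda>v. \<forall>x\<in>set xs. val_ring v \<in> V x)"
      using c by (rule cech_cochains_obtain)
    note V = V0[rule_format]
    obtain W where W0: "cover W" "\<forall>xs. \<not> (length xs = Suc q \<and> set xs \<subseteq> topspace X) \<longrightarrow> d xs = 0"
      "\<forall>xs. length xs = Suc q \<longrightarrow> set xs \<subseteq> topspace X \<longrightarrow> \<gamma> * d xs \<in> sections (\<lambda>v. \<forall>x\<in>set xs. val_ring v \<in> W x)"
      using d by (rule cech_cochains_obtain)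
    note W = W0[rule_format]
    have cov: "cover (\<lambda>x. V x \<inter> W x)" using V(1) W(1) by (auto simp: cover_def)
    have "\<gamma> * (c + d) xs \<in> sections (\<lambda>v. \<forall>x\<in>set xs. val_ring v \<in> V x \<inter> W x)"
      if xs: "length xs = Suc q" "set xs \<subseteq> topspace X" for xs
    proof -
      have 1: "\<gamma> * c xs \<in> sections (\<lambda>v. \<forall>x\<in>set xs. val_ring v \<in> V x \<inter> W x)"
        using V(3)[OF xs] sections_mono[of "\<lambda>v. \<forall>x\<in>set xs. val_ring v \<in> V x \<inter> W x" "\<lambda>v. \<forall>x\<in>set xs. val_ring v \<in> V x"] by blast
      have 2: "\<gamma> * d xs \<in> sections (\<lambda>v. \<forall>x\<in>set xs. val_ring v \<in> V x \<inter> W x)"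
        using W(3)[OF xs] sections_mono[of "\<lambda>v. \<forall>x\<in>set xs. val_ring v \<in> V x \<inter> W x" "\<lambda>v. \<forall>x\<in>set xs. val_ring v \<in> W x"] by blast
      have "0 - \<gamma> * d xs \<in> sections (\<lambda>v. \<forall>x\<in>set xs. val_ring v \<in> V x \<inter> W x)"
        by (rule sections_diff[OF sections_zero 2])
      from sections_diff[OF 1 this] show ?thesis by (simp add: distrib_left)
    qed
    then show ?thesis unfolding cech_cochains_iff using cov V(2) W(2) by auto
  qed
  have scale: "scale_cochain k c \<in> cech_cochains X F q" if c: "c \<in> cech_cochains X F q" for k c
    using c unfolding cech_cochains_iff
    by (auto simp: scale_ratfun_zero scale_mult_commute intro!: sections_scale)
  have zero: "0 \<in> cech_cochains X F q"
    unfolding cech_cochains_iff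
    by (auto simp: sections_zero cover_def intro!: exI[of _ "\<lambda>_. topspace X"])
  have d_add: "cech_differential X q (c + d) = cech_differential X q c + cech_differential X q d" for c d :: "'a ratfun set list \<Rightarrow> 'a ratfun"
    by (intro ext) (simp add: cech_differential_eq coboundary_add plus_fun_def)
  have d_scale: "cech_differential X q (scale_cochain k c) = scale_cochain k (cech_differential X q c)" for k c
  proof
    fix xs
    have "coboundary (scale_cochain k c) xs = scale_ratfun k (coboundary c xs)"
      by (rule coboundary_hom) (simp add: scale_ratfun_eq right_diff_distrib)
    then show "cech_differential X q (scale_cochain k c) xs = scale_cochain k (cech_differential X q c) xs"
      by (simp add: cech_differential_eq scale_ratfun_zero)
  qed
  have d_zero: "cech_differential X q (0 :: 'a ratfun set list \<Rightarrow> 'a ratfun) = 0"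
    using d_add[of 0 0] by simp
  show ?thesis
    unfolding V.subspace_def cech_cocycles_def
    using zero add scale by (auto simp: d_zero d_add d_scale scale_ratfun_zero)
qed

lemma higher_cohomology: "cohomology_dim scale_ratfun X F (Suc r) = 0"
proof -
  have "cech_coboundaries X F (Suc r) = cech_cocycles X F (Suc r)"
  proof (intro equalityI subsetI)
    fix c assume "c \<in> cech_coboundaries X F (Suc r)"
    then obtain b where "b \<in> cech_cochains X F r" "c = cech_differential X r b"
      by (auto simp: cech_coboundaries_def)
    then show "c \<in> cech_cocycles X F (Suc r)"
      using cech_differential_cochains cech_differential_twice by (simp add: cech_cocycles_def)
  next
    fix c assume "c \<in> cech_cocycles X F (Suc r)"
    then obtain b where "b \<in> cech_cochains X F r" "cech_differential X r b = c"
      using cech_acyclic by (auto simp: cech_cocycles_def)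
    then show "c \<in> cech_coboundaries X F (Suc r)" by (auto simp: cech_coboundaries_def)
  qed
  then show ?thesis
    unfolding cohomology_dim_def
    using quotient_dim_self[OF vector_space_scale_cochains subspace_cocycles[of "Suc r"]] by simp
qed

definition constant_cochain :: "'a ratfun \<Rightarrow> 'a ratfun set list \<Rightarrow> 'a ratfun" where
  "constant_cochain f xs = (if length xs = 1 \<and> set xs \<subseteq> topspace X then f else 0)"

lemma constant_cochain_inject: "constant_cochain f = constant_cochain g \<longleftrightarrow> f = g"
proof
  assume "constant_cochain f = constant_cochain g"
  then have "constant_cochain f [UNIV] = constant_cochain g [UNIV]" by simp
  then show "f = g" using UNIV_in_topspace by (simp add: constant_cochain_def)
qed simp

text \<open>The cocycle condition compares every value with that at the generic point, so a cocycle
  is constant. Its regularity along a prime divisor is tested at the generic point of that divisor,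
  which lies in its own covering set.\<close>

lemma cocycles_zero:
  "cech_cocycles X F 0 = constant_cochain ` {f. \<gamma> * f \<in> embed_laurent ` {f. \<forall>m\<in>Poly_Mapping.keys f. graded {} m}}"
proof -
  have all: "sections (\<lambda>v. True) = embed_laurent ` {f. \<forall>m\<in>Poly_Mapping.keys f. graded {} m}"
    using sections_charts[of "{}"] by simp
  have val_T: "val_ring v \<in> topspace X" if "v \<in> vals" for v
    using that prime_divisors_eq by (auto simp: prime_divisors_def)
  show ?thesis
    unfolding all[symmetric]
  proof (intro equalityI subsetI)
    fix c assume "c \<in> cech_cocycles X F 0"
    then have c: "c \<in> cech_cochains X F 0" "cech_differential X 0 c = 0" by (auto simp: cech_cocycles_def)
    obtain V where V0: "cover V" "\<forall>xs. \<not> (length xs = Suc 0 \<and> set xs \<subseteq> topspace X) \<longrightarrow> c xs = 0"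
      "\<forall>xs. length xs = Suc 0 \<longrightarrow> set xs \<subseteq> topspace X \<longrightarrow> \<gamma> * c xs \<in> sections (\<lambda>v. \<forall>x\<in>set xs. val_ring v \<in> V x)"
      using c(1) by (rule cech_cochains_obtain)
    note V = V0[rule_format]
    have eq: "c [x] = c [UNIV]" if "x \<in> topspace X" for x
    proof -
      have "cech_differential X 0 c [UNIV, x] = 0" using c(2) by simp
      then show ?thesis using that UNIV_in_topspace by (simp add: cech_differential_eq coboundary.simps)
    qed
    have "c = constant_cochain (c [UNIV])"
    proof
      fix xs
      show "c xs = constant_cochain (c [UNIV]) xs"
      proof (cases "length xs = Suc 0 \<and> set xs \<subseteq> topspace X")
        case True
        then obtain x where "xs = [x]" "x \<in> topspace X" by (auto simp: length_Suc_conv)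
        then show ?thesis using eq by (simp add: constant_cochain_def)
      qed (use V(2)[of xs] in \<open>auto simp: constant_cochain_def\<close>)
    qed
    moreover have "\<gamma> * c [UNIV] \<in> sections (\<lambda>v. True)"
      unfolding sections_def
    proof (intro CollectI impI ballI)
      fix v assume ne: "\<gamma> * c [UNIV] \<noteq> 0" and v: "v \<in> vals"
      have "\<gamma> * c [val_ring v] \<in> sections (\<lambda>u. \<forall>x\<in>set [val_ring v]. val_ring u \<in> V x)"
        using val_T[OF v] by (intro V(3)) auto
      then show "0 \<le> v (\<gamma> * c [UNIV]) + mult v"
        using ne v V(1) val_T[OF v] eq[OF val_T[OF v]] by (auto simp: sections_def cover_def)
    qed
    ultimately show "c \<in> constant_cochain ` {f. \<gamma> * f \<in> sections (\<lambda>v. True)}" by blast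
  next
    fix c assume "c \<in> constant_cochain ` {f. \<gamma> * f \<in> sections (\<lambda>v. True)}"
    then obtain f where f: "c = constant_cochain f" "\<gamma> * f \<in> sections (\<lambda>v. True)" by blast
    have sub: "sections (\<lambda>v. True) \<subseteq> sections Q" for Q by (rule sections_mono) simp
    have "c \<in> cech_cochains X F 0"
      unfolding cech_cochains_iff f(1) constant_cochain_def using f(2) sub
      by (auto simp: cover_def intro!: exI[of _ "\<lambda>_. topspace X"])
    moreover have "cech_differential X 0 c = 0"
    proof
      fix xs
      have "coboundary c xs = 0" if xs: "length xs = Suc (Suc 0)" "set xs \<subseteq> topspace X"
      proof -
        obtain x y where "xs = [x, y]" using xs(1) by (auto simp: length_Suc_conv)
        then show ?thesis using xs(2) by (simp add: coboundary.simps f(1) constant_cochain_def)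
      qed
      then show "cech_differential X 0 c xs = 0 xs" by (simp add: cech_differential_eq)
    qed
    ultimately show "c \<in> cech_cocycles X F 0" by (simp add: cech_cocycles_def)
  qed
qed

text \<open>The characters without obstruction, divided by \<open>\<gamma>\<close>, give a basis of
  the cocycles: linear independence is read off from the coefficients of Laurent
  polynomials.\<close>

lemma global_sections_dim: "cohomology_dim scale_ratfun X F 0 = card {m. graded {} m}"
proof -
  interpret V: vector_space scale_cochain by (rule vector_space_scale_cochains)
  define e where "e m = constant_cochain (monom m / \<gamma>)" for m
  define M where "M = {m. graded {} m}"
  have comb: "(\<Sum>m\<in>T. scale_cochain (k m) (e m)) =
      constant_cochain (embed_laurent (\<Sum>m\<in>T. Poly_Mapping.single m (k m)) / \<gamma>)" for T k
  proof
    fix xs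
    have scale: "scale_ratfun (k m) (monom m / \<gamma>) = embed_laurent (Poly_Mapping.single m (k m)) / \<gamma>" for m
      by (simp add: scale_ratfun_eq monom_def single_0_mult flip: embed_laurent_mult)
    have "(\<Sum>m\<in>T. scale_cochain (k m) (e m)) xs = (\<Sum>m\<in>T. scale_ratfun (k m) (e m xs))"
      by (induction T rule: infinite_finite_induct) simp_all
    also have "\<dots> = constant_cochain (embed_laurent (\<Sum>m\<in>T. Poly_Mapping.single m (k m)) / \<gamma>) xs"
    proof (cases "length xs = 1 \<and> set xs \<subseteq> topspace X")
      case True
      then have "e m xs = monom m / \<gamma>" for m by (simp add: e_def constant_cochain_def)
      then show ?thesis
        using True by (simp add: constant_cochain_def scale embed_laurent_sum sum_divide_distrib)
    next
      case False
      then have "constant_cochain f xs = 0" for f by (auto simp: constant_cochain_def)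
      then show ?thesis by (simp add: e_def scale_ratfun_zero)
    qed
    finally show "(\<Sum>m\<in>T. scale_cochain (k m) (e m)) xs =
        constant_cochain (embed_laurent (\<Sum>m\<in>T. Poly_Mapping.single m (k m)) / \<gamma>) xs" .
  qed
  have lookup_comb: "Poly_Mapping.lookup (\<Sum>m\<in>T. Poly_Mapping.single m (k m)) n = (if n \<in> T then k n else 0)"
    if "finite T" for T and k :: "'a character \<Rightarrow> complex" and n
    using that by (simp add: lookup_sum lookup_single when_def)
  have inj: "inj e"
  proof (rule injI)
    fix m n assume "e m = e n"
    then have "monom m / \<gamma> = monom n / \<gamma>" by (simp add: e_def constant_cochain_inject)
    then have "Poly_Mapping.single m (1::complex) = Poly_Mapping.single n 1" using \<gamma> by (simp add: monom_def)
    then have "Poly_Mapping.keys (Poly_Mapping.single m (1::complex)) = Poly_Mapping.keys (Poly_Mapping.single n (1::complex))" by simp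
    then show "m = n" by simp
  qed
  have "V.independent (e ` M)"
    unfolding V.independent_explicit_module
  proof (intro allI impI)
    fix S u c assume S: "finite S" "S \<subseteq> e ` M" "(\<Sum>w\<in>S. scale_cochain (u w) w) = 0" "c \<in> S"
    obtain T where T: "S = e ` T" using S(2) by (metis subset_imageE)
    have fT: "finite T" using S(1) inj by (metis T finite_imageD inj_on_subset subset_UNIV)
    have "0 = (\<Sum>m\<in>T. scale_cochain (u (e m)) (e m))"
      unfolding S(3)[symmetric] T using inj by (subst sum.reindex) (auto intro: inj_on_subset)
    also have "\<dots> = constant_cochain (embed_laurent (\<Sum>m\<in>T. Poly_Mapping.single m (u (e m))) / \<gamma>)" by (rule comb)
    finally have "constant_cochain (embed_laurent (\<Sum>m\<in>T. Poly_Mapping.single m (u (e m))) / \<gamma>) = constant_cochain 0"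
      by (simp add: constant_cochain_def[abs_def] zero_fun_def)
    then have "(\<Sum>m\<in>T. Poly_Mapping.single m (u (e m))) = 0" using \<gamma> by (simp add: constant_cochain_inject)
    moreover obtain m where "m \<in> T" "c = e m" using S(4) T by blast
    ultimately show "u c = 0" using lookup_comb[OF fT, of "\<lambda>m. u (e m)" m] by simp
  qed
  moreover have "V.span (e ` M) = cech_cocycles X F 0"
  proof (intro equalityI subsetI)
    have "e ` M \<subseteq> cech_cocycles X F 0"
    proof
      fix c assume "c \<in> e ` M"
      then obtain m where m: "graded {} m" "c = constant_cochain (monom m / \<gamma>)" by (auto simp: e_def M_def)
      have "\<gamma> * (monom m / \<gamma>) = embed_laurent (Poly_Mapping.single m 1)" using \<gamma> by (simp add: monom_def)
      then show "c \<in> cech_cocycles X F 0" unfolding cocycles_zero m(2) using m(1) by (intro imageI CollectI) auto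
    qed
    then show "c \<in> cech_cocycles X F 0" if "c \<in> V.span (e ` M)" for c
      using V.span_minimal[OF _ subspace_cocycles] that by blast
  next
    fix c assume "c \<in> cech_cocycles X F 0"
    then obtain f a where fa: "c = constant_cochain f" "\<gamma> * f = embed_laurent a" "\<forall>m\<in>Poly_Mapping.keys a. graded {} m"
      unfolding cocycles_zero by blast
    have "a = (\<Sum>m\<in>Poly_Mapping.keys a. Poly_Mapping.single m (Poly_Mapping.lookup a m))"
      by (rule poly_mapping_eqI) (simp add: lookup_comb in_keys_iff)
    moreover have "f = embed_laurent a / \<gamma>" using fa(2) \<gamma> by (simp add: field_simps)
    ultimately have "c = (\<Sum>m\<in>Poly_Mapping.keys a. scale_cochain (Poly_Mapping.lookup a m) (e m))"
      unfolding comb fa(1) by simp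
    also have "\<dots> \<in> V.span (e ` M)"
      using fa(3) by (intro V.span_sum V.span_scale V.span_base) (auto simp: M_def)
    finally show "c \<in> V.span (e ` M)" .
  qed
  ultimately have "quotient_dim scale_cochain (cech_cocycles X F 0) {0} = card (e ` M)"
    by (rule quotient_dim_basis[OF vector_space_scale_cochains])
  also have "card (e ` M) = card M" using inj by (intro card_image) (rule inj_on_subset, auto)
  finally show ?thesis by (simp add: cohomology_dim_def cech_coboundaries_def M_def)
qed

theorem euler_characteristic_eq: "euler_characteristic scale_ratfun X F = int (card {m. graded {} m})"
proof -
  have "{q. cohomology_dim scale_ratfun X F q \<noteq> 0} = (if card {m. graded {} m} = 0 then {} else {0})"
  proof (rule Set.set_eqI)
    fix q
    show "q \<in> {q. cohomology_dim scale_ratfun X F q \<noteq> 0} \<longleftrightarrow> q \<in> (if card {m. graded {} m} = 0 then {} else {0})"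
      using higher_cohomology global_sections_dim by (cases q; cases "card {m. graded {} m} = 0") simp_all
  qed
  then show ?thesis
    unfolding euler_characteristic_def by (simp add: global_sections_dim)
qed

end

section \<open>Lattice points\<close>

text \<open>If \<open>D\<close> exceeds the torus invariant divisor by the divisor of
  \<open>\<gamma>\<close>, additivity of valuations moves this excess from the coefficient to the
  function.\<close>

lemma (in acyclic_divisor) divisorial_sheaf_eq:
  assumes "\<gamma> \<noteq> 0" "U \<noteq> {}" and D: "\<And>v. v \<in> vals \<Longrightarrow> D (val_ring v) = mult v + v \<gamma>"
  shows "divisorial_sheaf \<Sigma> D U = {f. \<gamma> * f \<in> sections (\<lambda>v. val_ring v \<in> U)}"
proof (rule Set.set_eqI)
  fix f
  show "f \<in> divisorial_sheaf \<Sigma> D U \<longleftrightarrow> f \<in> {f. \<gamma> * f \<in> sections (\<lambda>v. val_ring v \<in> U)}"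
  proof (cases "f = 0")
    case False
    have eq: "valuation (val_ring v) f + D (val_ring v) = v (\<gamma> * f) + mult v" if "v \<in> vals" for v
      using valuation_val_ring[OF vals_discrete[OF that] False] D[OF that]
        val_mult[OF vals_discrete[OF that] assms(1) False] by simp
    have "f \<in> divisorial_sheaf \<Sigma> D U \<longleftrightarrow>
        (\<forall>v\<in>vals. val_ring v \<in> U \<longrightarrow> 0 \<le> valuation (val_ring v) f + D (val_ring v))"
      using False assms(2) unfolding divisorial_sheaf_def prime_divisors_eq by auto
    also have "\<dots> \<longleftrightarrow> f \<in> {f. \<gamma> * f \<in> sections (\<lambda>v. val_ring v \<in> U)}"
      using False assms(1) by (simp add: sections_def eq)
    finally show ?thesis .
  qed (simp add: divisorial_sheaf_def sections_zero)
qed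

context full_polytope
begin

text \<open>The lattice point belonging to \<open>m\<close> is \<open>- m\<close>, as the fan
  consists of outer normals; division by \<open>n\<close> brings it back to the polytope
  \<open>P\<close> itself.\<close>

definition scaled_point :: "nat \<Rightarrow> 'd character \<Rightarrow> real ^ 'd" where
  "scaled_point n m = (- 1 / real n) *\<^sub>R real_vec (exponent m)"

lemma scaled_point_gen:
  "scaled_point n m \<bullet> gen \<rho> = - real_of_int (weight (primitive_generator \<rho>) m) / real n"
  using pairing_real_vec[of m "primitive_generator \<rho>"] by (simp add: scaled_point_def pairing_def)

lemma card_scaled_points:
  assumes "n \<ge> 1"
  shows "card {m. scaled_point n m \<in> S} = card ((\<lambda>x. real n *\<^sub>R x) ` S \<inter> integer_lattice)"
proof (rule bij_betw_same_card)
  have eq: "real n *\<^sub>R scaled_point n m = real_vec (exponent (- m))" for m :: "'d character"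
    using assms by (simp add: scaled_point_def uminus_character.rep_eq real_vec_def vec_eq_iff)
  show "bij_betw (\<lambda>m. real n *\<^sub>R scaled_point n m) {m. scaled_point n m \<in> S}
      ((\<lambda>x. real n *\<^sub>R x) ` S \<inter> integer_lattice)"
    unfolding bij_betw_def
  proof (intro conjI inj_onI equalityI subsetI)
    fix m m' :: "'d character" assume "real n *\<^sub>R scaled_point n m = real n *\<^sub>R scaled_point n m'"
    then have "exponent (- m) = exponent (- m')" unfolding eq by (simp add: real_vec_def vec_eq_iff)
    then show "m = m'" by (simp add: exponent_inject)
  next
    fix y assume "y \<in> (\<lambda>m. real n *\<^sub>R scaled_point n m) ` {m. scaled_point n m \<in> S}"
    then obtain m where m: "scaled_point n m \<in> S" "y = real n *\<^sub>R scaled_point n m" by blast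
    then have "y \<in> integer_lattice" using eq by (auto simp: integer_lattice_def)
    then show "y \<in> (\<lambda>x. real n *\<^sub>R x) ` S \<inter> integer_lattice" using m by blast
  next
    fix y assume "y \<in> (\<lambda>x. real n *\<^sub>R x) ` S \<inter> integer_lattice"
    then obtain x w where x: "x \<in> S" "y = real n *\<^sub>R x" "y = real_vec w" by (auto simp: integer_lattice_def)
    define m where "m = - Character w"
    have y: "real n *\<^sub>R scaled_point n m = y" unfolding eq x(3) by (simp add: m_def Character_inverse)
    then have "scaled_point n m = x" using x(2) assms by simp
    then show "y \<in> (\<lambda>m. real n *\<^sub>R scaled_point n m) ` {m. scaled_point n m \<in> S}" using y x(1) by force
  qed
qed

lemma convex_functionals:
  "convex {u. \<forall>w\<in>S. w \<bullet> u < x \<bullet> u}" "convex {u. (\<forall>w\<in>S. w \<bullet> u \<le> x \<bullet> u) \<and> y \<bullet> u < x \<bullet> u}"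
proof -
  have "{u. \<forall>w\<in>S. w \<bullet> u < x \<bullet> u} = (\<Inter>w\<in>S. {u. (w - x) \<bullet> u < 0})"
    "{u. (\<forall>w\<in>S. w \<bullet> u \<le> x \<bullet> u) \<and> y \<bullet> u < x \<bullet> u} = (\<Inter>w\<in>S. {u. (w - x) \<bullet> u \<le> 0}) \<inter> {u. (y - x) \<bullet> u < 0}"
    by (auto simp: inner_diff_left)
  then show "convex {u. \<forall>w\<in>S. w \<bullet> u < x \<bullet> u}" "convex {u. (\<forall>w\<in>S. w \<bullet> u \<le> x \<bullet> u) \<and> y \<bullet> u < x \<bullet> u}"
    by (simp_all add: convex_INT convex_Int convex_halfspace_lt convex_halfspace_le)
qed

context
  fixes n :: nat
  assumes n: "n \<ge> 1"
begin

text \<open>The weight is an integer, so rounding the support number down does not change the strict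
  comparison.\<close>

lemma floor_visible:
  "weight (primitive_generator \<rho>) m + \<lfloor>real n * support_number P \<rho>\<rfloor> < 0 \<longleftrightarrow>
    support_number P \<rho> < scaled_point n m \<bullet> gen \<rho>"
proof -
  have "weight (primitive_generator \<rho>) m + \<lfloor>real n * support_number P \<rho>\<rfloor> < 0 \<longleftrightarrow>
      \<lfloor>real n * support_number P \<rho>\<rfloor> < - weight (primitive_generator \<rho>) m" by linarith
  also have "\<dots> \<longleftrightarrow> real n * support_number P \<rho> < - real_of_int (weight (primitive_generator \<rho>) m)"
    by (simp add: floor_less_iff)
  finally show ?thesis using n by (simp add: scaled_point_gen field_simps)
qed

text \<open>The summand \<open>- 1\<close> comes from the canonical divisor. Between integers it
  turns the strict inequality into a weak one, so that the facets themselves become obstructions and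
  interior points remain.\<close>

lemma ceiling_visible:
  "weight (primitive_generator \<rho>) m + (\<lceil>real n * support_number P \<rho>\<rceil> - 1) < 0 \<longleftrightarrow>
    support_number P \<rho> \<le> scaled_point n m \<bullet> gen \<rho>"
proof -
  have "weight (primitive_generator \<rho>) m + (\<lceil>real n * support_number P \<rho>\<rceil> - 1) < 0 \<longleftrightarrow>
      \<lceil>real n * support_number P \<rho>\<rceil> \<le> - weight (primitive_generator \<rho>) m" by linarith
  also have "\<dots> \<longleftrightarrow> real n * support_number P \<rho> \<le> - real_of_int (weight (primitive_generator \<rho>) m)"
    by (simp add: ceiling_le_iff)
  finally show ?thesis using n by (simp add: scaled_point_gen field_simps)
qed

lemma acyclic_floor: "acyclic_divisor P (\<lambda>\<rho>. \<lfloor>real n * support_number P \<rho>\<rfloor>)"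
proof
  fix m
  let ?V = "{u. \<forall>w\<in>verts. w \<bullet> u < scaled_point n m \<bullet> u}"
  have "(\<exists>\<rho>\<in>rays \<Sigma>. (\<forall>s\<in>set ss. gen \<rho> \<in> cone_at s) \<and>
        weight (primitive_generator \<rho>) m + \<lfloor>real n * support_number P \<rho>\<rfloor> < 0) \<longleftrightarrow> in_nerve verts ?V ss"
    if "set ss \<subseteq> verts" for ss
    using visible_facet_iff[of "set ss" "scaled_point n m"] that
    unfolding floor_visible in_nerve_def cone_at_eq_maximizer[symmetric] by simp
  then show "\<exists>V. convex V \<and> (\<forall>ss. set ss \<subseteq> verts \<longrightarrow>
    ((\<exists>\<rho>\<in>rays \<Sigma>. (\<forall>s\<in>set ss. gen \<rho> \<in> cone_at s) \<and>
        weight (primitive_generator \<rho>) m + \<lfloor>real n * support_number P \<rho>\<rfloor> < 0) \<longleftrightarrow> in_nerve verts V ss))"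
    using convex_functionals(1) by blast
qed

lemma acyclic_ceiling: "acyclic_divisor P (\<lambda>\<rho>. \<lceil>real n * support_number P \<rho>\<rceil> - 1)"
proof
  fix m
  obtain x0 where x0: "x0 \<in> interior P" using interior_nonempty by blast
  let ?V = "{u. (\<forall>w\<in>verts. w \<bullet> u \<le> scaled_point n m \<bullet> u) \<and> x0 \<bullet> u < scaled_point n m \<bullet> u}"
  have "(\<exists>\<rho>\<in>rays \<Sigma>. (\<forall>s\<in>set ss. gen \<rho> \<in> cone_at s) \<and>
        weight (primitive_generator \<rho>) m + (\<lceil>real n * support_number P \<rho>\<rceil> - 1) < 0) \<longleftrightarrow> in_nerve verts ?V ss"
    if "set ss \<subseteq> verts" for ss
    using weakly_visible_facet_iff[of "set ss" x0 "scaled_point n m"] that x0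
    unfolding ceiling_visible in_nerve_def cone_at_eq_maximizer[symmetric] by simp
  then show "\<exists>V. convex V \<and> (\<forall>ss. set ss \<subseteq> verts \<longrightarrow>
    ((\<exists>\<rho>\<in>rays \<Sigma>. (\<forall>s\<in>set ss. gen \<rho> \<in> cone_at s) \<and>
        weight (primitive_generator \<rho>) m + (\<lceil>real n * support_number P \<rho>\<rceil> - 1) < 0) \<longleftrightarrow> in_nerve verts V ss))"
    using convex_functionals(2) by blast
qed

lemma chi_floor:
  "int (card ((\<lambda>x. real n *\<^sub>R x) ` P \<inter> integer_lattice)) = chi_divisor P (\<lambda>Z. \<lfloor>real n * polytope_divisor P Z\<rfloor>)"
proof -
  let ?D = "\<lambda>Z. \<lfloor>real n * polytope_divisor P Z\<rfloor>"
  interpret A: acyclic_divisor P "\<lambda>\<rho>. \<lfloor>real n * support_number P \<rho>\<rfloor>" by (rule acyclic_floor)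
  have D: "?D (val_ring v) = A.mult v + v 1" if "v \<in> vals" for v
    using that val_one[OF vals_discrete[OF that]]
    by (auto simp: vals_def polytope_divisor_def A.mult_ray A.mult_torus toric_divisor_ray toric_divisor_torus)
  \<comment> \<open>The rounded-down divisor is itself torus invariant, hence
    \<open>\<gamma> = 1\<close>.\<close>
  interpret acyclic_sheaf P "\<lambda>\<rho>. \<lfloor>real n * support_number P \<rho>\<rfloor>" 1 "divisorial_sheaf \<Sigma> ?D"
    using A.divisorial_sheaf_eq[OF _ _ D] by unfold_locales auto
  have "A.graded {} m \<longleftrightarrow> scaled_point n m \<in> P" for m
  proof -
    have "0 \<le> weight (primitive_generator \<rho>) m + \<lfloor>real n * support_number P \<rho>\<rfloor> \<longleftrightarrow>
        scaled_point n m \<bullet> gen \<rho> \<le> support_number P \<rho>" for \<rho>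
      using floor_visible[of \<rho> m] by linarith
    then show ?thesis by (simp add: A.graded_def mem_polytope_iff)
  qed
  then show ?thesis using euler_characteristic_eq card_scaled_points[OF n, of P] by simp
qed

lemma chi_ceiling:
  assumes K: "canonical_divisor \<Sigma> K"
  shows "int (card (interior ((\<lambda>x. real n *\<^sub>R x) ` P) \<inter> integer_lattice)) =
    chi_divisor P (\<lambda>Z. \<lceil>real n * polytope_divisor P Z\<rceil> + K Z)"
proof -
  let ?D = "\<lambda>Z. \<lceil>real n * polytope_divisor P Z\<rceil> + K Z"
  interpret A: acyclic_divisor P "\<lambda>\<rho>. \<lceil>real n * support_number P \<rho>\<rceil> - 1" by (rule acyclic_ceiling)
  obtain g where g: "g \<noteq> 0" "\<And>Z. Z \<in> prime_divisors \<Sigma> \<Longrightarrow> K Z = toric_divisor \<Sigma> (\<lambda>\<rho>. - 1) Z + valuation Z g"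
    using K by (auto simp: canonical_divisor_def linearly_equivalent_def)
  have D: "?D (val_ring v) = A.mult v + v g" if v: "v \<in> vals" for v
  proof -
    have "K (val_ring v) = toric_divisor \<Sigma> (\<lambda>\<rho>. - 1) (val_ring v) + v g"
      using g v valuation_val_ring[OF vals_discrete[OF v] g(1)] by (simp add: prime_divisors_eq)
    then show ?thesis
      using v
      by (auto simp: vals_def polytope_divisor_def A.mult_ray A.mult_torus toric_divisor_ray toric_divisor_torus)
  qed
  \<comment> \<open>The function \<open>g\<close> of the linear equivalence absorbs the choice of
    the canonical divisor.\<close>
  interpret acyclic_sheaf P "\<lambda>\<rho>. \<lceil>real n * support_number P \<rho>\<rceil> - 1" g "divisorial_sheaf \<Sigma> ?D"
    using A.divisorial_sheaf_eq[OF g(1) _ D] g(1) by unfold_locales auto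
  have "A.graded {} m \<longleftrightarrow> scaled_point n m \<in> interior P" for m
  proof -
    have "0 \<le> weight (primitive_generator \<rho>) m + (\<lceil>real n * support_number P \<rho>\<rceil> - 1) \<longleftrightarrow>
        scaled_point n m \<bullet> gen \<rho> < support_number P \<rho>" for \<rho>
      using ceiling_visible[of \<rho> m] by linarith
    then show ?thesis by (simp only: A.graded_def mem_interior_iff) simp
  qed
  moreover have "interior ((\<lambda>x. real n *\<^sub>R x) ` P) = (\<lambda>x. real n *\<^sub>R x) ` interior P"
    using n by (intro interior_injective_linear_image) (auto simp: inj_on_def intro: linear_scaleR)
  ultimately show ?thesis using euler_characteristic_eq card_scaled_points[OF n, of "interior P"] by simp
qed

end

end

theorem theorem4:
  fixes P :: "(real ^ 'd::finite) set" and n :: nat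
  assumes "rational_polytope P"
    and "aff_dim P = int CARD('d)"
    and "n \<ge> 1"
  shows "int (card ((\<lambda>x. real n *\<^sub>R x) ` P \<inter> integer_lattice)) =
           chi_divisor P (\<lambda>Z. \<lfloor>real n * polytope_divisor P Z\<rfloor>) \<and>
         (\<forall>K. canonical_divisor (normal_fan P) K \<longrightarrow>
           int (card (interior ((\<lambda>x. real n *\<^sub>R x) ` P) \<inter> integer_lattice)) =
             chi_divisor P (\<lambda>Z. \<lceil>real n * polytope_divisor P Z\<rceil> + K Z))"
proof -
  interpret full_polytope P by unfold_locales (fact assms)+
  show ?thesis using chi_floor[OF assms(3)] chi_ceiling[OF assms(3)] by blast
qed

end
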